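(* Let $\Lambda$ be a finite measure on $[0,1]$ with $\Lambda(\{1\})=0$ and let $\rho=(\rho_t,t\ge 0)$ be a càdlàg $\Lambda$-Fleming-Viot process. Then: 1. if $\Lambda$ belongs to regime Discrete, then for all $t>0$, almost surely $\rho_t$ has dust and finitely many atoms; 2. if $\Lambda$ belongs to regime Infinite with dust, then for all $t>0$, almost surely $\rho_t$ has dust and infinitely many atoms; 3. if $\Lambda$ belongs to regime Infinite no dust, then for all $t>0$, almost surely $\rho_t$ has no dust and infinitely many atoms; 4. if $\Lambda$ belongs to regime CDI, then for all $t>0$, almost surely $\rho_t$ has no dust and finitely many atoms.
   Context: **$\Lambda$-Fleming-Viot process.** Let $\mathcal M_1$ be the set of probability measures on $[0,1]$ with the weak topology. For $2\le k\le m$ put $\lambda_{m,k}=\int_{[0,1]}x^{k}(1-x)^{m-k}x^{-2}\Lambda(dx)$ (the integrand being $x^{k-2}(1-x)^{m-k}$, $0^0=1$). For $n\ge1$ and $f$ continuous on $[0,1]^n$ put, for $\mu\in\mathcal M_1$, $G_f(\mu)=\int_{[0,1]^n}\mu(dx_1)\ldots\mu(dx_n)f(x_1,\ldots,x_n)$ and $$LG_f(\mu)=\sum_{K\subset[n],\,k:=\#K\ge2}\lambda_{n,k}\int_{[0,1]^n}\mu(dx_1)\ldots\mu(dx_n)\big(f(R_K(x_1,\ldots,x_{n-k+1}))-f(x_1,\ldots,x_n)\big),$$ where $R_K(x_1,\ldots,x_{n-k+1})=(y_1,\ldots,y_n)$ with $y_i=x_{\min K}$ if $i\in K$, and the $y_i$,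 $i\notin K$, listed by increasing indices, are $x_1,\ldots,x_{\min K-1},x_{\min K+1},\ldots,x_{n-k+1}$. The $\Lambda$-Fleming-Viot process is the $\mathcal M_1$-valued process (unique in law) started from Lebesgue measure such that for all $n$ and $f$, $G_f(\rho_t)-\int_0^tLG_f(\rho_s)ds$ is a martingale. **Regimes.** Let $\nu(dx)=x^{-2}\Lambda(dx)$ (with $\nu(\{0\})=\infty$ and $\int_{\{0\}}x\,\nu(dx)=\infty$ when $\Lambda(\{0\})>0$) and $\Psi(u)=\Lambda(\{0\})u^2+\int_{(0,1)}(e^{-xu}-1+xu)\nu(dx)$, $u\ge0$. Regime Discrete: $\nu([0,1))<\infty$. Regime Infinite with dust: $\nu([0,1))=\infty$ and $\int_{[0,1)}x\,\nu(dx)<\infty$. Regime Infinite no dust: $\int_{[0,1)}x\,\nu(dx)=\infty$ and $\int^\infty\frac{du}{\Psi(u)}=\infty$. Regime CDI: $\int^\infty\frac{du}{\Psi(u)}<\infty$. **Dust.** At a given time $\rho_t$ is almost surely the sum of an atomic component and a component absolutely continuous with respect to Lebesgue measure; $\rho_t$ has dust if the absolutely continuous component is not zero. *)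

theory Defs
  imports "HOL-Probability.Probability"
begin

section \<open>Probability measures on the unit interval\<close>

definition unit_borel :: "real measure" where
  "unit_borel = restrict_space borel {0..1}"

definition unit_lebesgue :: "real measure" where
  "unit_lebesgue = restrict_space lborel {0..1}"

text \<open>The set \<open>\<M>\<^sub>1\<close> of probability measures on \<open>[0,1]\<close>.\<close>

definition M1 :: "real measure set" where
  "M1 = space (prob_algebra unit_borel)"

text \<open>The coarsest topology on \<open>\<M>\<^sub>1\<close> making \<open>\<mu> \<mapsto> \<integral> g d\<mu>\<close> continuous for each continuous \<open>g\<close>.\<close>

definition weak_topology :: "real measure topology" where
  "weak_topology = topology_generated_by
     {{\<mu> \<in> M1. (\<integral>x. g x \<partial>\<mu>) \<in> U} | (g :: real \<Rightarrow> real) U. continuous_on {0..1} g \<and> open U}"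

definition M1_borel :: "real measure measure" where
  "M1_borel = sigma (topspace weak_topology) {U. openin weak_topology U}"


section \<open>Processes indexed by \<open>[0,\<infinity>)\<close>\<close>

text \<open>The time set is \<open>real\<close>; only times \<open>t \<ge> 0\<close> are ever constrained.\<close>

definition cadlag :: "'a measure \<Rightarrow> (real \<Rightarrow> 'a \<Rightarrow> real measure) \<Rightarrow> bool" where
  "cadlag P \<rho> \<longleftrightarrow> (\<forall>\<omega>\<in>space P. \<forall>t\<ge>0.
     limitin weak_topology (\<lambda>s. \<rho> s \<omega>) (\<rho> t \<omega>) (at_right t) \<and>
     (t > 0 \<longrightarrow> (\<exists>l. limitin weak_topology (\<lambda>s. \<rho> s \<omega>) l (at_left t))))"

definition natural_filtration ::
  "'a measure \<Rightarrow> (real \<Rightarrow> 'a \<Rightarrow> real measure) \<Rightarrow> real \<Rightarrow> 'a measure" where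
  "natural_filtration P \<rho> t =
     sigma (space P) {\<rho> s -` A \<inter> space P | s A. 0 \<le> s \<and> s \<le> t \<and> A \<in> sets M1_borel}"

definition is_martingale :: "'a measure \<Rightarrow> (real \<Rightarrow> 'a measure) \<Rightarrow> (real \<Rightarrow> 'a \<Rightarrow> real) \<Rightarrow> bool" where
  "is_martingale P F X \<longleftrightarrow>
     (\<forall>t\<ge>0. subalgebra P (F t) \<and> X t \<in> borel_measurable (F t) \<and> integrable P (X t)) \<and>
     (\<forall>s t. 0 \<le> s \<and> s \<le> t \<longrightarrow> (AE \<omega> in P. real_cond_exp P (F s) (X t) \<omega> = X s \<omega>))"


section \<open>The generator\<close>

text \<open>Points of \<open>[0,1]\<^sup>n\<close> are extensional functions on \<open>[n] = {1..n}\<close>.\<close>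

definition cube :: "nat \<Rightarrow> (nat \<Rightarrow> real) set" where
  "cube n = ({1..n} \<rightarrow>\<^sub>E {0..1})"

definition merge_rate :: "real measure \<Rightarrow> nat \<Rightarrow> nat \<Rightarrow> real" where
  "merge_rate \<Lambda> m k = (\<integral>x. x ^ (k - 2) * (1 - x) ^ (m - k) \<partial>\<Lambda>)"

text \<open>The map \<open>R\<^sub>K\<close>. For \<open>i \<notin> K\<close>, \<open>p\<close> is the rank of \<open>i\<close> in \<open>[n] - K\<close>, and \<open>y\<^sub>i\<close> is the \<open>p\<close>-th term
  of the list \<open>x\<^sub>1, x\<^sub>2, \<dots>\<close> from which the entry with index \<open>min K\<close> has been removed.\<close>

definition R_map :: "nat \<Rightarrow> nat set \<Rightarrow> (nat \<Rightarrow> real) \<Rightarrow> nat \<Rightarrow> real" where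
  "R_map n K x = (\<lambda>i\<in>{1..n}.
     if i \<in> K then x (Min K)
     else let p = card ({1..i} - K) in if p < Min K then x p else x (p + 1))"

definition G_fun :: "nat \<Rightarrow> ((nat \<Rightarrow> real) \<Rightarrow> real) \<Rightarrow> real measure \<Rightarrow> real" where
  "G_fun n f \<mu> = (\<integral>x. f x \<partial>(\<Pi>\<^sub>M i\<in>{1..n}. \<mu>))"

definition LG_fun ::
  "real measure \<Rightarrow> nat \<Rightarrow> ((nat \<Rightarrow> real) \<Rightarrow> real) \<Rightarrow> real measure \<Rightarrow> real" where
  "LG_fun \<Lambda> n f \<mu> = (\<Sum>K | K \<subseteq> {1..n} \<and> 2 \<le> card K.
     merge_rate \<Lambda> n (card K) * (\<integral>x. f (R_map n K x) - f x \<partial>(\<Pi>\<^sub>M i\<in>{1..n}. \<mu>)))"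

text \<open>The martingale property is with respect to the filtration generated by the process.\<close>

definition Lambda_Fleming_Viot ::
  "real measure \<Rightarrow> 'a measure \<Rightarrow> (real \<Rightarrow> 'a \<Rightarrow> real measure) \<Rightarrow> bool" where
  "Lambda_Fleming_Viot \<Lambda> P \<rho> \<longleftrightarrow>
     prob_space P \<and>
     (\<forall>t\<ge>0. \<rho> t \<in> P \<rightarrow>\<^sub>M M1_borel) \<and>
     (AE \<omega> in P. \<rho> 0 \<omega> = unit_lebesgue) \<and>
     (\<forall>n\<ge>1. \<forall>f. continuous_on (cube n) f \<longrightarrow>
        is_martingale P (natural_filtration P \<rho>)
          (\<lambda>t \<omega>. G_fun n f (\<rho> t \<omega>) - (LINT s:{0..t}|lborel. LG_fun \<Lambda> n f (\<rho> s \<omega>))))"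


section \<open>Regimes\<close>

text \<open>As \<open>inverse 0 = \<infinity>\<close> and \<open>\<infinity> * 0 = 0\<close> in \<open>ennreal\<close>, this gives \<open>\<nu> {0} = \<infinity>\<close> exactly when
  \<open>\<Lambda> {0} > 0\<close>.\<close>

definition nu :: "real measure \<Rightarrow> real measure" where
  "nu \<Lambda> = density \<Lambda> (\<lambda>x. inverse (ennreal (x ^ 2)))"

text \<open>\<open>\<integral>\<^bsub>[0,1)\<^esub> x \<nu>(dx)\<close>, with the convention that \<open>{0}\<close> contributes \<open>\<infinity>\<close> when \<open>\<Lambda> {0} > 0\<close>
  (the Lebesgue integral over \<open>{0}\<close> would be \<open>0 * \<infinity> = 0\<close>).\<close>

definition nu_mean :: "real measure \<Rightarrow> ennreal" where
  "nu_mean \<Lambda> = (if emeasure \<Lambda> {0} > 0 then \<infinity> else (\<integral>\<^sup>+x\<in>{0..<1}. ennreal x \<partial>nu \<Lambda>))"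

definition Psi :: "real measure \<Rightarrow> real \<Rightarrow> real" where
  "Psi \<Lambda> u = measure \<Lambda> {0} * u ^ 2 + (LINT x:{0<..<1}|nu \<Lambda>. exp (- (x * u)) - 1 + x * u)"

text \<open>\<open>\<integral>\<^sup>\<infinity> du / \<Psi>(u) < \<infinity>\<close>. For \<open>\<Psi> = 0\<close> the integrand is \<open>\<infinity>\<close>.\<close>

definition Psi_integral_finite :: "real measure \<Rightarrow> bool" where
  "Psi_integral_finite \<Lambda> \<longleftrightarrow>
     (\<exists>a>0. (\<integral>\<^sup>+u\<in>{a..}. inverse (ennreal (Psi \<Lambda> u)) \<partial>lborel) < \<infinity>)"

definition regime_discrete :: "real measure \<Rightarrow> bool" where
  "regime_discrete \<Lambda> \<longleftrightarrow> emeasure (nu \<Lambda>) {0..<1} < \<infinity>"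

definition regime_infinite_dust :: "real measure \<Rightarrow> bool" where
  "regime_infinite_dust \<Lambda> \<longleftrightarrow> emeasure (nu \<Lambda>) {0..<1} = \<infinity> \<and> nu_mean \<Lambda> < \<infinity>"

definition regime_infinite_no_dust :: "real measure \<Rightarrow> bool" where
  "regime_infinite_no_dust \<Lambda> \<longleftrightarrow> nu_mean \<Lambda> = \<infinity> \<and> \<not> Psi_integral_finite \<Lambda>"

definition regime_CDI :: "real measure \<Rightarrow> bool" where
  "regime_CDI \<Lambda> \<longleftrightarrow> Psi_integral_finite \<Lambda>"


section \<open>Atoms and dust\<close>

definition atoms :: "real measure \<Rightarrow> real set" where
  "atoms \<mu> = {x \<in> space \<mu>. emeasure \<mu> {x} > 0}"

definition dust_decomposition :: "real measure \<Rightarrow> real measure \<Rightarrow> real measure \<Rightarrow> bool" where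
  "dust_decomposition \<mu> \<alpha> \<kappa> \<longleftrightarrow>
     sets \<alpha> = sets unit_borel \<and> sets \<kappa> = sets unit_borel \<and>
     (\<forall>B\<in>sets unit_borel. emeasure \<mu> B = emeasure \<alpha> B + emeasure \<kappa> B) \<and>
     (\<exists>A. countable A \<and> (AE x in \<alpha>. x \<in> A)) \<and>
     absolutely_continuous unit_lebesgue \<kappa>"

definition has_dust :: "real measure \<Rightarrow> bool" where
  "has_dust \<mu> \<longleftrightarrow> (\<exists>\<alpha> \<kappa>. dust_decomposition \<mu> \<alpha> \<kappa> \<and> emeasure \<kappa> (space \<kappa>) \<noteq> 0)"

text \<open>Having dust or not is only meaningful for measures with such a decomposition, so the
  decomposition is part of both predicates; in particular a measure with a continuous singular
  part satisfies neither.\<close>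

definition has_no_dust :: "real measure \<Rightarrow> bool" where
  "has_no_dust \<mu> \<longleftrightarrow> (\<exists>\<alpha> \<kappa>. dust_decomposition \<mu> \<alpha> \<kappa>) \<and> \<not> has_dust \<mu>"

end

theory Submission
  imports Defs
begin

text \<open>
  The equality pattern of \<open>n\<close> independent points sampled from \<open>\<rho>\<^sub>t\<close> is a random partition of \<open>[n]\<close>.
  The martingale problem, in expectation and extended from continuous to finitely valued functions,
  yields by induction on \<open>n\<close> that \<open>d/dt E h = E (Q h)\<close> for every function \<open>h\<close> of this partition, \<open>Q\<close> being
  the generator of the \<open>\<Lambda>\<close>-coalescent. As \<open>n \<longlonglongrightarrow> \<infinity>\<close> the non-singleton blocks correspond to the atoms of
  \<open>\<rho>\<^sub>t\<close> and the proportion of singletons tends to the mass of its non-atomic part, so each assertion on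
  atoms or dust reduces to a bound on \<open>Q h\<close> for a suitable \<open>h\<close>: the number of non-singleton blocks,
  the indicator that \<open>{1}\<close> is a block, the indicator that no element of \<open>[j]\<close> is a singleton,
  or a function of the number of blocks built from \<open>\<Sum>1/\<Psi>(j)\<close>, which diverges or converges together with
  \<open>\<integral>du/\<Psi>(u)\<close>. That the non-atomic part is a multiple of Lebesgue measure is a second-moment
  computation with two singletons, whose positions are independent and uniform.
\<close>

section \<open>Measurability of the path\<close>

text \<open>The martingale problem gives the backward equation of the coalescent:
  \<open>R_map\<close> carries out one merger and then reads a sample of
  \<open>n - card K + 1\<close> points, so the equation for \<open>n\<close> points involves smaller
  samples. Drift bounds need the forward equation, where \<open>Q\<close> acts on the current
  partition. \<open>A_fun n h\<close> and \<open>Q h\<close> differ pointwise and agree only in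
  expectation; hence the induction over the sample size, closed by uniqueness for a Volterra
  equation. Total merger rates may tend to infinity with \<open>n\<close>, so \<open>Q h\<close> is
  bounded on one side only, uniformly over all partitions, and \<open>n\<close> goes to infinity
  with the test function fixed. In several cases what survives is a bound for a time integral over
  \<open>{0..t}\<close>; a one-sided Lipschitz or monotonicity bound, again from the drift, leads
  back to the fixed time \<open>t\<close>. For the partitions to converge at all, samples of every
  size are cut from one infinite sequence. The cadlag property supplies the joint measurability in
  time and chance that Fubini's theorem requires.\<close>

lemma space_unit_borel [simp]: "space unit_borel = {0..1}"
  by (simp add: unit_borel_def space_restrict_space)

lemma M1_iff: "\<mu> \<in> M1 \<longleftrightarrow> sets \<mu> = sets unit_borel \<and> prob_space \<mu>"
  by (auto simp: M1_def space_prob_algebra)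

lemma M1_D:
  assumes "\<mu> \<in> M1"
  shows "sets \<mu> = sets unit_borel" "prob_space \<mu>" "space \<mu> = {0..1}"
proof -
  show *: "sets \<mu> = sets unit_borel" "prob_space \<mu>" using assms by (auto simp: M1_iff)
  show "space \<mu> = {0..1}" using sets_eq_imp_space_eq[OF *(1)] by simp
qed

lemma unit_lebesgue_M1: "unit_lebesgue \<in> M1"
proof -
  have "sets unit_lebesgue = sets unit_borel"
    by (simp add: unit_lebesgue_def unit_borel_def sets_restrict_space)
  moreover have "prob_space unit_lebesgue"
    by (rule prob_spaceI)
      (simp add: unit_lebesgue_def space_restrict_space emeasure_restrict_space)
  ultimately show ?thesis by (simp add: M1_iff)
qed

lemma unit_borel_in: "A \<in> sets unit_borel \<longleftrightarrow> A \<in> sets borel \<and> A \<subseteq> {0..1}"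
  by (simp add: unit_borel_def sets_restrict_space_iff conj_commute)

lemma borel_measurable_unit_borel:
  "continuous_on {0..1} g \<Longrightarrow> (g :: real \<Rightarrow> real) \<in> borel_measurable unit_borel"
  unfolding unit_borel_def by (rule borel_measurable_continuous_on_restrict)

lemma sets_unit_borel_sigma: "sets unit_borel = sigma_sets {0..1} (range (\<lambda>a. {0..1} \<inter> {..a}))"
proof -
  have "sets unit_borel = (\<inter>) {0..1} ` sigma_sets UNIV (range (\<lambda>a::real. {..a}))"
    unfolding unit_borel_def sets_restrict_space by (subst borel_eq_atMost) simp
  also have "\<dots> = sigma_sets {0..1} ((\<inter>) {0..1} ` (range (\<lambda>a::real. {..a})))"
    using borel_eq_atMost by (intro sigma_sets_Int)
      (auto simp: borel_eq_atMost[THEN arg_cong[where f=sets], simplified, symmetric])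
  finally show ?thesis by (simp add: image_image)
qed

lemma Int_stable_initial: "Int_stable (range (\<lambda>a::real. {0..1} \<inter> {..a}))"
proof (rule Int_stableI)
  fix A B :: "real set"
  assume "A \<in> range (\<lambda>a. {0..1} \<inter> {..a})" "B \<in> range (\<lambda>a. {0..1} \<inter> {..a})"
  then obtain a b where "A = {0..1} \<inter> {..a}" "B = {0..1} \<inter> {..b}" by blast
  then have "A \<inter> B = {0..1} \<inter> {..min a b}" by auto
  then show "A \<inter> B \<in> range (\<lambda>a. {0..1} \<inter> {..a})" by blast
qed

text \<open>Equals 1 up to and including \<open>a\<close> and, for \<open>n > 0\<close>, vanishes
  from \<open>a + 1/n\<close> on, so the pointwise limit is the indicator of the closed half-line.
  This is how continuous functions reach the generators \<open>{..a}\<close>.\<close>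

definition ramp :: "real \<Rightarrow> nat \<Rightarrow> real \<Rightarrow> real" where
  "ramp a n x = max 0 (min 1 (1 - real n * (x - a)))"

lemma ramp_continuous: "continuous_on S (ramp a n)"
  unfolding ramp_def by (intro continuous_intros)

lemma ramp_bounds: "0 \<le> ramp a n x" "ramp a n x \<le> 1" "\<bar>ramp a n x\<bar> \<le> 1"
  by (auto simp: ramp_def)

lemma ramp_tendsto: "(\<lambda>n. ramp a n x) \<longlonglongrightarrow> indicator {..a} x"
proof (cases "x \<le> a")
  case True
  then have "ramp a n x = 1" for n
    by (simp add: ramp_def mult_nonneg_nonpos min_def)
  then show ?thesis using True by simp
next
  case False
  then have p: "x - a > 0" by simp
  obtain N where N: "real N * (x - a) > 1" using reals_Archimedean3[OF p] by blast
  have "ramp a n x = 0" if "n \<ge> N" for n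
  proof -
    have "real n * (x - a) \<ge> real N * (x - a)" using that p by (intro mult_right_mono) auto
    then show ?thesis using N by (simp add: ramp_def)
  qed
  then have "eventually (\<lambda>n. ramp a n x = 0) sequentially"
    by (auto simp: eventually_sequentially)
  then show ?thesis using False by (simp add: tendsto_eventually)
qed

text \<open>Masses of the sets \<open>{0..1} \<inter> {..a}\<close> are limits of integrals of
  ramps, and these sets form a generator stable under intersection. Hence kernels need checking only
  against continuous functions.\<close>

lemma measurable_kernelI:
  assumes M1: "\<And>w. w \<in> space N \<Longrightarrow> \<kappa> w \<in> M1"
    and m: "\<And>g :: real \<Rightarrow> real. continuous_on {0..1} g \<Longrightarrow> (\<lambda>w. \<integral>x. g x \<partial>\<kappa> w) \<in> borel_measurable N"
  shows "\<kappa> \<in> N \<rightarrow>\<^sub>M prob_algebra unit_borel"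
proof (rule measurable_prob_algebra_generated[OF sets_unit_borel_sigma Int_stable_initial])
  show "range (\<lambda>a. {0..1} \<inter> {..a::real}) \<subseteq> Pow {0..1}" by auto
  show "prob_space (\<kappa> w)" "sets (\<kappa> w) = sets unit_borel" if "w \<in> space N" for w
    using M1_D[OF M1[OF that]] by auto
  fix A assume "A \<in> range (\<lambda>a. {0..1} \<inter> {..a::real})"
  then obtain a where A: "A = {0..1} \<inter> {..a}" by auto
  have lim: "(\<lambda>n. \<integral>x. ramp a n x \<partial>\<kappa> w) \<longlonglongrightarrow> measure (\<kappa> w) A" if w: "w \<in> space N" for w
  proof -
    note D = M1_D[OF M1[OF w]]
    interpret prob_space "\<kappa> w" by (rule D)
    have As: "A \<in> sets (\<kappa> w)" by (auto simp: D A unit_borel_in)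
    have ms: "g \<in> borel_measurable (\<kappa> w)" if "g \<in> borel_measurable unit_borel" for g :: "real \<Rightarrow> real"
      using that measurable_cong_sets[OF D(1) refl] by blast
    have "(\<lambda>n. \<integral>x. ramp a n x \<partial>\<kappa> w) \<longlonglongrightarrow> (\<integral>x. indicator A x \<partial>\<kappa> w)"
    proof (rule integral_dominated_convergence[where w="\<lambda>_. 1"])
      show "(\<lambda>x. indicator A x :: real) \<in> borel_measurable (\<kappa> w)" using As by auto
      show "ramp a i \<in> borel_measurable (\<kappa> w)" for i
        by (intro ms borel_measurable_unit_borel ramp_continuous)
      show "AE x in \<kappa> w. (\<lambda>i. ramp a i x) \<longlonglongrightarrow> indicator A x"
        using ramp_tendsto[of a] by (intro AE_I2) (auto simp: A D indicator_def)
    qed (auto simp: ramp_bounds)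
    then show ?thesis using As by simp
  qed
  have "(\<lambda>w. measure (\<kappa> w) A) \<in> borel_measurable N"
    by (rule borel_measurable_LIMSEQ_real[OF lim]) (use m[OF ramp_continuous] in auto)
  then have "(\<lambda>w. ennreal (measure (\<kappa> w) A)) \<in> borel_measurable N" by measurable
  then show "(\<lambda>w. emeasure (\<kappa> w) A) \<in> borel_measurable N"
    by (subst measurable_cong[where g="\<lambda>w. ennreal (measure (\<kappa> w) A)"])
      (auto dest!: M1 M1_D(2) simp: finite_measure.emeasure_eq_measure prob_space.finite_measure)
qed

text \<open>On a box the product measure is a finite product of measurable functions of
  \<open>w\<close>; boxes are an intersection-stable generator.\<close>

lemma measurable_PiM_kernel:
  assumes k: "\<kappa> \<in> N \<rightarrow>\<^sub>M prob_algebra M" and I: "finite I"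
  shows "(\<lambda>w. PiM I (\<lambda>_. \<kappa> w)) \<in> N \<rightarrow>\<^sub>M prob_algebra (PiM I (\<lambda>_. M))"
proof -
  have D: "prob_space (\<kappa> w)" "sets (\<kappa> w) = sets M" if "w \<in> space N" for w
    using measurable_space[OF k that] by (auto simp: space_prob_algebra)
  show ?thesis
  proof (rule measurable_prob_algebra_generated[OF sets_PiM Int_stable_prod_algebra])
    show "prod_algebra I (\<lambda>_. M) \<subseteq> Pow (Pi\<^sub>E I (\<lambda>_. space M))"
      by (rule prod_algebra_sets_into_space)
    show "prob_space (PiM I (\<lambda>_. \<kappa> w))" if "w \<in> space N" for w
      using D[OF that] by (intro prob_space_PiM)
    show "sets (PiM I (\<lambda>_. \<kappa> w)) = sets (PiM I (\<lambda>_. M))" if "w \<in> space N" for w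
      using D[OF that] by (intro sets_PiM_cong) auto
    fix A assume "A \<in> prod_algebra I (\<lambda>_. M)"
    then obtain X where "A = Pi\<^sub>E I X" "X \<in> I \<rightarrow> sets M"
      using prod_algebra_eq_finite[OF I, of "\<lambda>_. M"] by auto
    then have X: "A = Pi\<^sub>E I X" "\<And>i. i \<in> I \<Longrightarrow> X i \<in> sets M" by auto
    have "emeasure (PiM I (\<lambda>_. \<kappa> w)) A = (\<Prod>i\<in>I. emeasure (\<kappa> w) (X i))" if w: "w \<in> space N" for w
    proof -
      interpret prob_space "\<kappa> w" using D[OF w] by auto
      interpret product_sigma_finite "\<lambda>_. \<kappa> w" ..
      show ?thesis using D[OF w] X I by (simp add: emeasure_PiM)
    qed
    moreover have "(\<lambda>w. \<Prod>i\<in>I. emeasure (\<kappa> w) (X i)) \<in> borel_measurable N"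
    proof (intro borel_measurable_prod_ennreal)
      fix i assume "i \<in> I"
      then show "(\<lambda>w. emeasure (\<kappa> w) (X i)) \<in> borel_measurable N"
        using X measurable_prob_algebraD[OF k] measurable_emeasure_kernel by blast
    qed
    ultimately show "(\<lambda>w. emeasure (PiM I (\<lambda>_. \<kappa> w)) A) \<in> borel_measurable N"
      by (subst measurable_cong) auto
  qed
qed

section \<open>The weak topology and integrals of continuous functions\<close>

lemma topspace_weak_topology: "topspace weak_topology = M1"
proof -
  have "M1 \<in> {{\<mu> \<in> M1. (\<integral>x. g x \<partial>\<mu>) \<in> U} | (g :: real \<Rightarrow> real) U. continuous_on {0..1} g \<and> open U}"
    by (auto intro!: exI[of _ "\<lambda>_. 0"] exI[of _ UNIV])
  then show ?thesis
    unfolding weak_topology_def topology_generated_by_topspace by blast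
qed

lemma openin_weak_topology:
  fixes g :: "real \<Rightarrow> real"
  assumes "continuous_on {0..1} g" "open U"
  shows "openin weak_topology {\<mu> \<in> M1. (\<integral>x. g x \<partial>\<mu>) \<in> U}"
  unfolding weak_topology_def using assms
  by (intro topology_generated_by_Basis CollectI exI[of _ g] exI[of _ U] conjI refl)

lemma space_M1_borel: "space M1_borel = M1"
  unfolding M1_borel_def by (simp add: space_measure_of_conv topspace_weak_topology)

lemma sets_M1_borel: "openin weak_topology U \<Longrightarrow> U \<in> sets M1_borel"
  unfolding M1_borel_def by (subst sets_measure_of) (auto dest: openin_subset)

text \<open>Turns Borel measurability for the weak topology into measurability of a random kernel,
  the form in which integrals against \<open>\<rho> t\<close> are handled.\<close>

lemma M1_borel_kernel: "(\<lambda>\<mu>. \<mu>) \<in> M1_borel \<rightarrow>\<^sub>M prob_algebra unit_borel"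
proof (rule measurable_kernelI)
  fix g :: "real \<Rightarrow> real" assume g: "continuous_on {0..1} g"
  show "(\<lambda>\<mu>. \<integral>x. g x \<partial>\<mu>) \<in> borel_measurable M1_borel"
  proof (rule borel_measurableI)
    fix U :: "real set" assume "open U"
    then have "{\<mu> \<in> M1. (\<integral>x. g x \<partial>\<mu>) \<in> U} \<in> sets M1_borel"
      by (intro sets_M1_borel openin_weak_topology g)
    then show "(\<lambda>\<mu>. \<integral>x. g x \<partial>\<mu>) -` U \<inter> space M1_borel \<in> sets M1_borel"
      by (simp add: space_M1_borel vimage_def Int_def conj_commute)
  qed
qed (auto simp: space_M1_borel)

lemma weak_topology_tendsto:
  fixes g :: "real \<Rightarrow> real"
  assumes "limitin weak_topology f l F" "continuous_on {0..1} g"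
  shows "((\<lambda>s. \<integral>x. g x \<partial>f s) \<longlongrightarrow> (\<integral>x. g x \<partial>l)) F"
proof (rule topological_tendstoI)
  fix U :: "real set" assume U: "open U" "(\<integral>x. g x \<partial>l) \<in> U"
  have l: "l \<in> M1" using assms(1) by (simp add: limitin_def topspace_weak_topology)
  have "eventually (\<lambda>s. f s \<in> {\<mu> \<in> M1. (\<integral>x. g x \<partial>\<mu>) \<in> U}) F"
    using assms(1) openin_weak_topology[OF assms(2) U(1)] l U(2) unfolding limitin_def by blast
  then show "eventually (\<lambda>s. (\<integral>x. g x \<partial>f s) \<in> U) F" by eventually_elim auto
qed

text \<open>The first point strictly right of \<open>t\<close> on the grid of mesh
  \<open>1 / Suc n\<close>. Strictness is what \<open>at_right\<close> demands, and for fixed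
  \<open>n\<close> only countably many values occur as \<open>t\<close> varies. The points are also
  rational, which is used for the non-atomic part.\<close>

lemma dyadic_right_approx:
  fixes t :: real
  shows "filterlim (\<lambda>n. (of_int \<lfloor>real (Suc n) * t\<rfloor> + 1) / real (Suc n)) (at_right t) sequentially"
unfolding filterlim_at
proof (intro conjI)
  let ?s = "\<lambda>n. (of_int \<lfloor>real (Suc n) * t\<rfloor> + 1) / real (Suc n)"
  have gt: "?s n > t" for n
  proof -
    have "t * real (Suc n) < of_int \<lfloor>real (Suc n) * t\<rfloor> + 1"
      using real_of_int_floor_add_one_gt[of "real (Suc n) * t"] by (simp only: mult.commute)
    then show ?thesis by (simp only: pos_less_divide_eq of_nat_0_less_iff zero_less_Suc)
  qed
  have le: "?s n \<le> t + 1 / real (Suc n)" for n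
  proof -
    have "of_int \<lfloor>real (Suc n) * t\<rfloor> + 1 \<le> real (Suc n) * t + 1" by simp
    then have "?s n \<le> (real (Suc n) * t + 1) / real (Suc n)" by (intro divide_right_mono) auto
    then show ?thesis by (simp add: add_divide_distrib)
  qed
  show "eventually (\<lambda>n. ?s n \<in> {t<..} \<and> ?s n \<noteq> t) sequentially"
    using gt by (intro always_eventually allI) (metis greaterThan_iff less_irrefl)
  have "(\<lambda>n. t + 1 / real (Suc n)) \<longlonglongrightarrow> t + 0"
    by (intro tendsto_intros LIMSEQ_Suc[OF lim_1_over_n])
  then have "(\<lambda>n. t + 1 / real (Suc n)) \<longlonglongrightarrow> t" by simp
  moreover have "\<forall>\<^sub>F n in sequentially. t \<le> ?s n"
    using gt by (intro always_eventually allI less_imp_le)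
  moreover have "\<forall>\<^sub>F n in sequentially. ?s n \<le> t + 1 / real (Suc n)"
    using le by (intro always_eventually allI)
  ultimately show "?s \<longlonglongrightarrow> t"
    by (intro real_tendsto_sandwich[of "\<lambda>_. t" ?s sequentially "\<lambda>n. t + 1 / real (Suc n)"] tendsto_const)
qed

section \<open>The process as a jointly measurable kernel\<close>

locale fleming_viot =
  fixes \<Lambda> :: "real measure" and P :: "'a measure" and \<rho> :: "real \<Rightarrow> 'a \<Rightarrow> real measure"
  assumes fin: "finite_measure \<Lambda>" and sets_L: "sets \<Lambda> = sets unit_borel"
    and L1: "emeasure \<Lambda> {1} = 0"
    and FV: "Lambda_Fleming_Viot \<Lambda> P \<rho>" and cadlag: "cadlag P \<rho>"
begin

sublocale P: prob_space P
  using FV by (simp add: Lambda_Fleming_Viot_def)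

sublocale L: finite_measure \<Lambda>
  by (rule fin)

lemma space_L: "space \<Lambda> = {0..1}"
  using sets_eq_imp_space_eq[OF sets_L] by simp

lemma rho_M1: "\<omega> \<in> space P \<Longrightarrow> t \<ge> 0 \<Longrightarrow> \<rho> t \<omega> \<in> M1"
  using FV measurable_space[of "\<rho> t" P M1_borel \<omega>] by (simp add: Lambda_Fleming_Viot_def space_M1_borel)

text \<open>Frozen at negative times, so that it is jointly measurable on \<open>\<real> \<times> \<Omega>\<close>.\<close>

definition path :: "real \<times> 'a \<Rightarrow> real measure" where
  "path = (\<lambda>(s, \<omega>). \<rho> (max 0 s) \<omega>)"

lemma path_M1: "\<omega> \<in> space P \<Longrightarrow> path (s, \<omega>) \<in> M1"
  by (simp add: path_def rho_M1)

text \<open>Replacing the time by the next grid point leaves countably many times, at each of which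
  the integral is measurable in \<open>\<omega>\<close>; right-continuity of the path gives the
  limit.\<close>

lemma path_kernel: "path \<in> (borel :: real measure) \<Otimes>\<^sub>M P \<rightarrow>\<^sub>M prob_algebra unit_borel"
proof (rule measurable_kernelI)
  fix z assume "z \<in> space ((borel :: real measure) \<Otimes>\<^sub>M P)"
  then show "path z \<in> M1" by (cases z) (auto simp: space_pair_measure path_M1)
next
  fix g :: "real \<Rightarrow> real" assume g: "continuous_on {0..1} g"
  define s where "s n t = (of_int \<lfloor>real (Suc n) * t\<rfloor> + 1) / real (Suc n)" for n t
  define F where "F n z = (\<integral>x. g x \<partial>\<rho> (s n (max 0 (fst z))) (snd z))" for n z
  have one: "(\<lambda>\<omega>. \<integral>x. g x \<partial>\<rho> t \<omega>) \<in> borel_measurable P" if "t \<ge> 0" for t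
  proof -
    have "\<rho> t \<in> P \<rightarrow>\<^sub>M M1_borel"
      using FV that by (simp add: Lambda_Fleming_Viot_def)
    from measurable_compose[OF this M1_borel_kernel]
    have "\<rho> t \<in> P \<rightarrow>\<^sub>M subprob_algebra unit_borel" by (rule measurable_prob_algebraD)
    then show ?thesis
      by (rule measurable_compose[OF _ integral_measurable_subprob_algebra[OF borel_measurable_unit_borel[OF g]]])
  qed
  show "(\<lambda>z. \<integral>x. g x \<partial>path z) \<in> borel_measurable ((borel :: real measure) \<Otimes>\<^sub>M P)"
  proof (rule borel_measurable_LIMSEQ_real)
    fix z assume z: "z \<in> space ((borel :: real measure) \<Otimes>\<^sub>M P)"
    let ?t = "max 0 (fst z)"
    have "limitin weak_topology (\<lambda>s. \<rho> s (snd z)) (\<rho> ?t (snd z)) (at_right ?t)"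
      using cadlag[unfolded cadlag_def, rule_format, of "snd z" ?t] z
      by (simp add: space_pair_measure mem_Times_iff)
    from filterlim_compose[OF weak_topology_tendsto[OF this g] dyadic_right_approx]
    show "(\<lambda>n. F n z) \<longlonglongrightarrow> (\<integral>x. g x \<partial>path z)"
      by (simp only: F_def s_def path_def split_beta)
  next
    fix n
    \<comment> \<open>\<open>max 0 i\<close> keeps the time nonnegative for every integer
      \<open>i\<close>, so that all \<open>h i\<close> are measurable; negative \<open>i\<close>
      never occur below.\<close>
    define h where "h i \<omega> = (\<integral>x. g x \<partial>\<rho> ((of_int (max 0 i) + 1) / real (Suc n)) \<omega>)" for i \<omega>
    have h: "h i \<in> borel_measurable P" for i unfolding h_def by (intro one) auto
    have "(\<lambda>z. h \<lfloor>real (Suc n) * max 0 (fst z)\<rfloor> (snd z)) \<in> borel_measurable ((borel :: real measure) \<Otimes>\<^sub>M P)"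
    proof (rule measurable_compose_countable)
      show "(\<lambda>z. h i (snd z)) \<in> borel_measurable ((borel :: real measure) \<Otimes>\<^sub>M P)" for i
        by (rule measurable_compose[OF measurable_snd h])
      show "(\<lambda>z. \<lfloor>real (Suc n) * max 0 (fst z)\<rfloor>) \<in> (borel :: real measure) \<Otimes>\<^sub>M P \<rightarrow>\<^sub>M count_space UNIV"
        by (rule measurable_compose[OF _ measurable_real_floor])
          (intro borel_measurable_times borel_measurable_max borel_measurable_const measurable_fst)
    qed
    moreover have "h \<lfloor>real (Suc n) * max 0 (fst z)\<rfloor> (snd z) = F n z" for z
    proof -
      have "0 \<le> real (Suc n) * max 0 (fst z)" by (intro mult_nonneg_nonneg) auto
      then have "max 0 \<lfloor>real (Suc n) * max 0 (fst z)\<rfloor> = \<lfloor>real (Suc n) * max 0 (fst z)\<rfloor>"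
        by (simp only: max_absorb2 zero_le_floor)
      then show ?thesis unfolding h_def F_def s_def by (simp only:)
    qed
    ultimately show "F n \<in> borel_measurable ((borel :: real measure) \<Otimes>\<^sub>M P)" by (simp only:)
  qed
qed

end

section \<open>Expectations of sampling functionals\<close>

declare One_nat_def [simp del]

section \<open>Uniqueness for a homogeneous Volterra equation\<close>

lemma integral_power_Icc:
  assumes "(0::real) \<le> t"
  shows "integrable lborel (\<lambda>s. s ^ k * indicator {0..t} s)"
    "(LINT s|lborel. s ^ k * indicator {0..t} s) = t ^ Suc k / real (Suc k)"
proof -
  have *: "has_bochner_integral lborel (\<lambda>s. s ^ k * indicator {0..t} s) (t ^ Suc k / real (Suc k) - 0 ^ Suc k / real (Suc k))"
  proof (rule has_bochner_integral_FTC_Icc_nonneg[where F="\<lambda>s. s ^ Suc k / real (Suc k)" and f="\<lambda>s. s ^ k"])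
    show "((\<lambda>s. s ^ Suc k / real (Suc k)) has_real_derivative x ^ k) (at x)" for x
      by (rule derivative_eq_intros refl | simp)+
  qed (use assms in auto)
  then show "integrable lborel (\<lambda>s. s ^ k * indicator {0..t} s)" by (rule has_bochner_integral_iff[THEN iffD1, THEN conjunct1])
  show "(LINT s|lborel. s ^ k * indicator {0..t} s) = t ^ Suc k / real (Suc k)"
    using * by (simp add: has_bochner_integral_iff)
qed

text \<open>Substituting the equation into itself \<open>k\<close> times bounds
  \<open>\<delta> t\<close> by a multiple of the \<open>k\<close>-th term of an exponential series,
  and those terms tend to 0.\<close>

lemma volterra_zero:
  fixes \<delta> :: "real \<Rightarrow> real"
  assumes meas: "\<delta> \<in> borel_measurable borel"
    and bd: "\<And>t. t \<ge> 0 \<Longrightarrow> \<bar>\<delta> t\<bar> \<le> B"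
    and eq: "\<And>t. t \<ge> 0 \<Longrightarrow> \<delta> t = c * (LINT s:{0..t}|lborel. \<delta> s)"
    and t: "t \<ge> 0"
  shows "\<delta> t = 0"
proof -
  have bound: "\<forall>t\<ge>0. \<bar>\<delta> t\<bar> \<le> B * (\<bar>c\<bar> * t) ^ k / fact k" for k
  proof (induction k)
    case 0
    then show ?case using bd by simp
  next
    case (Suc k)
    show ?case
    proof (intro allI impI)
      fix t :: real assume t: "t \<ge> 0"
      define D where "D = B * \<bar>c\<bar> ^ k / fact k"
      have ID: "integrable lborel (\<lambda>s. D * (s ^ k * indicator {0..t} s))"
        by (intro integrable_mult_right integral_power_Icc t)
      have "\<bar>LINT s:{0..t}|lborel. \<delta> s\<bar> \<le> (LINT s|lborel. \<bar>indicator {0..t} s * \<delta> s\<bar>)"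
        unfolding set_lebesgue_integral_def real_scaleR_def by (rule integral_abs_bound)
      also have "\<dots> \<le> (LINT s|lborel. D * (s ^ k * indicator {0..t} s))"
      proof (rule integral_mono'[OF ID])
        fix s
        show "\<bar>indicator {0..t} s * \<delta> s\<bar> \<le> D * (s ^ k * indicator {0..t} s)"
          using Suc[rule_format, of s] by (auto simp: indicator_def D_def power_mult_distrib mult_ac)
        then show "0 \<le> D * (s ^ k * indicator {0..t} s)" by linarith
      qed
      also have "\<dots> = D * (t ^ Suc k / real (Suc k))"
        using integral_power_Icc[OF t] by simp
      finally have "\<bar>\<delta> t\<bar> \<le> \<bar>c\<bar> * (D * (t ^ Suc k / real (Suc k)))"
        unfolding eq[OF t] abs_mult by (intro mult_left_mono) auto
      also have "\<dots> = B * (\<bar>c\<bar> * t) ^ Suc k / fact (Suc k)"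
        by (simp add: D_def power_mult_distrib field_simps)
      finally show "\<bar>\<delta> t\<bar> \<le> B * (\<bar>c\<bar> * t) ^ Suc k / fact (Suc k)" .
    qed
  qed
  have "(\<lambda>k. (\<bar>c\<bar> * t) ^ k / fact k) \<longlonglongrightarrow> 0"
    using summable_exp[of "\<bar>c\<bar> * t"] summable_LIMSEQ_zero by (simp add: divide_inverse mult.commute) blast
  then have "(\<lambda>k. B * ((\<bar>c\<bar> * t) ^ k / fact k)) \<longlonglongrightarrow> B * 0" by (intro tendsto_intros)
  then have "(\<lambda>k. B * (\<bar>c\<bar> * t) ^ k / fact k) \<longlonglongrightarrow> 0" by simp
  then have "\<bar>\<delta> t\<bar> \<le> 0" using bound t by (intro LIMSEQ_le_const) auto
  then show ?thesis by simp
qed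

section \<open>Bounded measurable functions of n sampled points\<close>

definition Cube :: "nat \<Rightarrow> (nat \<Rightarrow> real) measure" where
  "Cube n = (\<Pi>\<^sub>M i\<in>{1..n}. unit_borel)"

lemma space_Cube: "space (Cube n) = cube n"
  by (simp add: Cube_def cube_def space_PiM)

lemma sets_PM: "\<mu> \<in> M1 \<Longrightarrow> sets (\<Pi>\<^sub>M i\<in>{1..n}. \<mu>) = sets (Cube n)"
  unfolding Cube_def by (intro sets_PiM_cong) (auto dest: M1_D)

lemma space_PM: "\<mu> \<in> M1 \<Longrightarrow> space (\<Pi>\<^sub>M i\<in>{1..n}. \<mu>) = cube n"
  using sets_eq_imp_space_eq[OF sets_PM] by (simp add: space_Cube)

lemma prob_PM: "\<mu> \<in> M1 \<Longrightarrow> prob_space (\<Pi>\<^sub>M i\<in>{1..n}. \<mu>)"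
  by (intro prob_space_PiM) (auto dest: M1_D)

text \<open>The class for which the expectations below are linear and continuous along bounded
  pointwise limits. Bounds are asked on \<open>cube n\<close> alone, which carries the product
  measures.\<close>

definition bm :: "nat \<Rightarrow> ((nat \<Rightarrow> real) \<Rightarrow> real) \<Rightarrow> bool" where
  "bm n f \<longleftrightarrow> f \<in> borel_measurable (Cube n) \<and> (\<exists>B. \<forall>x\<in>cube n. \<bar>f x\<bar> \<le> B)"

lemma bmI: "f \<in> borel_measurable (Cube n) \<Longrightarrow> (\<And>x. x \<in> cube n \<Longrightarrow> \<bar>f x\<bar> \<le> B) \<Longrightarrow> bm n f"
  by (auto simp: bm_def)

lemma bm_meas: "bm n f \<Longrightarrow> f \<in> borel_measurable (Cube n)"
  by (simp add: bm_def)

lemma bm_const: "bm n (\<lambda>_. c)"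
  by (rule bmI[where B="\<bar>c\<bar>"]) auto

lemma bm_add:
  assumes "bm n f" "bm n g" shows "bm n (\<lambda>x. f x + g x)"
proof -
  obtain A B where "\<And>x. x \<in> cube n \<Longrightarrow> \<bar>f x\<bar> \<le> A" "\<And>x. x \<in> cube n \<Longrightarrow> \<bar>g x\<bar> \<le> B"
    using assms by (auto simp: bm_def)
  then show ?thesis using assms[THEN bm_meas]
    by (intro bmI[where B="A+B"]) (auto intro: order_trans[OF abs_triangle_ineq] add_mono)
qed

lemma bm_cmult:
  assumes "bm n f" shows "bm n (\<lambda>x. c * f x)"
proof -
  obtain A where "\<And>x. x \<in> cube n \<Longrightarrow> \<bar>f x\<bar> \<le> A"
    using assms by (auto simp: bm_def)
  then show ?thesis using assms[THEN bm_meas]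
    by (intro bmI[where B="\<bar>c\<bar> * A"]) (auto simp: abs_mult intro!: mult_left_mono)
qed

lemma bm_diff: "bm n f \<Longrightarrow> bm n g \<Longrightarrow> bm n (\<lambda>x. f x - g x)"
  using bm_add[OF _ bm_cmult[of n g "-1"], of f] by simp

lemma bm_sum: "(\<And>i. i \<in> I \<Longrightarrow> bm n (f i)) \<Longrightarrow> bm n (\<lambda>x. \<Sum>i\<in>I. f i x)"
  by (induction I rule: infinite_finite_induct) (auto intro: bm_const bm_add)

lemma bm_cong:
  assumes "bm n f" "\<And>x. x \<in> cube n \<Longrightarrow> f x = g x" shows "bm n g"
proof -
  obtain A where "\<And>x. x \<in> cube n \<Longrightarrow> \<bar>f x\<bar> \<le> A"
    using assms by (auto simp: bm_def)
  moreover have "g \<in> borel_measurable (Cube n)"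
    using bm_meas[OF assms(1)] by (subst measurable_cong[where g=f]) (auto simp: space_Cube assms(2))
  ultimately show ?thesis using assms(2) by (intro bmI[where B=A]) auto
qed

lemma bm_integrable:
  assumes "\<mu> \<in> M1" "bm n f" shows "integrable (\<Pi>\<^sub>M i\<in>{1..n}. \<mu>) f"
proof -
  interpret prob_space "\<Pi>\<^sub>M i\<in>{1..n}. \<mu>" by (rule prob_PM[OF assms(1)])
  obtain B where "\<And>x. x \<in> cube n \<Longrightarrow> \<bar>f x\<bar> \<le> B" using assms by (auto simp: bm_def)
  moreover have "f \<in> borel_measurable (\<Pi>\<^sub>M i\<in>{1..n}. \<mu>)"
    using bm_meas[OF assms(2)] measurable_cong_sets[OF sets_PM[OF assms(1)] refl] by blast
  ultimately show ?thesis
    by (intro integrable_const_bound[where B=B]) (auto simp: space_PM[OF assms(1)])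
qed

lemma G_cong: "\<mu> \<in> M1 \<Longrightarrow> (\<And>x. x \<in> cube n \<Longrightarrow> f x = g x) \<Longrightarrow> G_fun n f \<mu> = G_fun n g \<mu>"
  unfolding G_fun_def by (rule Bochner_Integration.integral_cong) (auto simp: space_PM)

lemma G_add: "\<mu> \<in> M1 \<Longrightarrow> bm n f \<Longrightarrow> bm n g \<Longrightarrow> G_fun n (\<lambda>x. f x + g x) \<mu> = G_fun n f \<mu> + G_fun n g \<mu>"
  unfolding G_fun_def by (intro Bochner_Integration.integral_add bm_integrable)

lemma G_cmult: "G_fun n (\<lambda>x. c * f x) \<mu> = c * G_fun n f \<mu>"
  unfolding G_fun_def by simp

lemma G_sum: "\<mu> \<in> M1 \<Longrightarrow> (\<And>i. i \<in> I \<Longrightarrow> bm n (f i)) \<Longrightarrow> G_fun n (\<lambda>x. \<Sum>i\<in>I. f i x) \<mu> = (\<Sum>i\<in>I. G_fun n (f i) \<mu>)"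
  unfolding G_fun_def by (intro Bochner_Integration.integral_sum bm_integrable) auto

lemma G_const: "\<mu> \<in> M1 \<Longrightarrow> G_fun n (\<lambda>_. c) \<mu> = c"
  unfolding G_fun_def using prob_space.prob_space[OF prob_PM[of \<mu> n]] by simp

lemma G_mono:
  assumes "\<mu> \<in> M1" "bm n f" "bm n g" "\<And>x. x \<in> cube n \<Longrightarrow> f x \<le> g x"
  shows "G_fun n f \<mu> \<le> G_fun n g \<mu>"
  unfolding G_fun_def by (rule integral_mono) (use assms bm_integrable space_PM in auto)

lemma G_abs_le:
  assumes m: "\<mu> \<in> M1" and b: "bm n f" "\<And>x. x \<in> cube n \<Longrightarrow> \<bar>f x\<bar> \<le> B"
  shows "\<bar>G_fun n f \<mu>\<bar> \<le> B"
proof -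
  have "f x \<le> B \<and> - B \<le> f x" if "x \<in> cube n" for x
    using b(2)[OF that] by linarith
  then have "G_fun n f \<mu> \<le> G_fun n (\<lambda>_. B) \<mu>" "G_fun n (\<lambda>_. - B) \<mu> \<le> G_fun n f \<mu>"
    using b(1) m by (auto intro!: G_mono bm_const)
  then show ?thesis by (simp add: G_const[OF m] abs_le_iff)
qed

lemma G_lim:
  assumes m: "\<mu> \<in> M1" and b: "\<And>k. bm n (f k)" "bm n g"
    and B: "\<And>k x. x \<in> cube n \<Longrightarrow> \<bar>f k x\<bar> \<le> B"
    and l: "\<And>x. x \<in> cube n \<Longrightarrow> (\<lambda>k. f k x) \<longlonglongrightarrow> g x"
  shows "(\<lambda>k. G_fun n (f k) \<mu>) \<longlonglongrightarrow> G_fun n g \<mu>"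
proof -
  interpret prob_space "\<Pi>\<^sub>M i\<in>{1..n}. \<mu>" by (rule prob_PM[OF m])
  show ?thesis unfolding G_fun_def
    by (rule integral_dominated_convergence[where w="\<lambda>_. B"])
      (use B l b bm_integrable[OF m] in \<open>auto simp: space_PM[OF m] intro!: AE_I2\<close>)
qed

section \<open>Expected sampling functionals and their time integrals\<close>

context fleming_viot
begin

definition V :: "nat \<Rightarrow> ((nat \<Rightarrow> real) \<Rightarrow> real) \<Rightarrow> real \<Rightarrow> real" where
  "V n f s = (\<integral>\<omega>. G_fun n f (path (s, \<omega>)) \<partial>P)"

lemma G_path_meas [measurable]:
  assumes "bm n f"
  shows "(\<lambda>z. G_fun n f (path z)) \<in> borel_measurable (borel \<Otimes>\<^sub>M P)"
proof -
  have "(\<lambda>z. \<Pi>\<^sub>M i\<in>{1..n}. path z) \<in> borel \<Otimes>\<^sub>M P \<rightarrow>\<^sub>M subprob_algebra (Cube n)"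
    unfolding Cube_def by (intro measurable_prob_algebraD measurable_PiM_kernel path_kernel) auto
  from measurable_compose[OF this integral_measurable_subprob_algebra[OF bm_meas[OF assms]]]
  show ?thesis by (simp only: G_fun_def)
qed

lemma G_path_meas1:
  assumes "bm n f"
  shows "(\<lambda>\<omega>. G_fun n f (path (s, \<omega>))) \<in> borel_measurable P"
  using measurable_compose[OF measurable_Pair1' G_path_meas[OF assms], of s] by simp

lemma G_path_integrable:
  assumes "bm n f"
  shows "integrable P (\<lambda>\<omega>. G_fun n f (path (s, \<omega>)))"
proof -
  obtain B where "\<And>x. x \<in> cube n \<Longrightarrow> \<bar>f x\<bar> \<le> B" using assms by (auto simp: bm_def)
  then show ?thesis
    by (intro P.integrable_const_bound[where B=B] G_path_meas1 assms)
      (auto intro!: AE_I2 G_abs_le assms path_M1)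
qed

lemma V_meas: "bm n f \<Longrightarrow> V n f \<in> borel_measurable borel"
  unfolding V_def using P.borel_measurable_lebesgue_integral[of "\<lambda>s \<omega>. G_fun n f (path (s, \<omega>))" borel]
  by (simp add: G_path_meas)

lemma V_cong: "(\<And>x. x \<in> cube n \<Longrightarrow> f x = g x) \<Longrightarrow> V n f = V n g"
  unfolding V_def by (intro ext Bochner_Integration.integral_cong) (auto intro: G_cong path_M1)

lemma V_add:
  assumes "bm n f" "bm n g" shows "V n (\<lambda>x. f x + g x) s = V n f s + V n g s"
proof -
  have "V n (\<lambda>x. f x + g x) s = (\<integral>\<omega>. G_fun n f (path (s, \<omega>)) + G_fun n g (path (s, \<omega>)) \<partial>P)"
    unfolding V_def by (intro Bochner_Integration.integral_cong) (auto intro: G_add path_M1 assms)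
  then show ?thesis using assms by (simp add: V_def G_path_integrable)
qed

lemma V_cmult: "V n (\<lambda>x. c * f x) s = c * V n f s"
  unfolding V_def G_cmult by simp

lemma V_const: "V n (\<lambda>x. c) s = c"
proof -
  have "V n (\<lambda>x. c) s = (\<integral>\<omega>. c \<partial>P)"
    unfolding V_def by (intro Bochner_Integration.integral_cong) (auto intro: G_const path_M1)
  then show ?thesis using P.prob_space by simp
qed

lemma V_sum: "finite I \<Longrightarrow> (\<And>i. i \<in> I \<Longrightarrow> bm n (f i)) \<Longrightarrow> V n (\<lambda>x. \<Sum>i\<in>I. f i x) s = (\<Sum>i\<in>I. V n (f i) s)"
  by (induction I rule: finite_induct) (simp_all add: V_const V_add bm_sum)

lemma V_diff:
  assumes "bm n f" "bm n g" shows "V n (\<lambda>x. f x - g x) s = V n f s - V n g s"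
  using V_add[OF assms(1) bm_cmult[OF assms(2), of "-1"], of s] V_cmult[of n "-1" g s] by simp

lemma V_mono:
  assumes "bm n f" "bm n g" "\<And>x. x \<in> cube n \<Longrightarrow> f x \<le> g x"
  shows "V n f s \<le> V n g s"
  unfolding V_def by (intro integral_mono G_path_integrable assms G_mono path_M1)

lemma V_abs_le:
  assumes b: "bm n f" "\<And>x. x \<in> cube n \<Longrightarrow> \<bar>f x\<bar> \<le> B"
  shows "\<bar>V n f s\<bar> \<le> B"
proof -
  have "f x \<le> B \<and> - B \<le> f x" if "x \<in> cube n" for x
    using b(2)[OF that] by linarith
  then have "V n f s \<le> V n (\<lambda>_. B) s" "V n (\<lambda>_. - B) s \<le> V n f s"
    using b(1) by (auto intro!: V_mono bm_const)
  then show ?thesis by (simp add: V_const abs_le_iff)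
qed

lemma V_lim:
  assumes b: "\<And>k. bm n (f k)" "bm n g"
    and B: "\<And>k x. x \<in> cube n \<Longrightarrow> \<bar>f k x\<bar> \<le> B"
    and l: "\<And>x. x \<in> cube n \<Longrightarrow> (\<lambda>k. f k x) \<longlonglongrightarrow> g x"
  shows "(\<lambda>k. V n (f k) s) \<longlonglongrightarrow> V n g s"
  unfolding V_def
proof (rule integral_dominated_convergence[where w="\<lambda>_. B"])
  show "AE \<omega> in P. (\<lambda>k. G_fun n (f k) (path (s, \<omega>))) \<longlonglongrightarrow> G_fun n g (path (s, \<omega>))"
    by (intro AE_I2 G_lim path_M1 b) (use B l in auto)
  show "AE \<omega> in P. norm (G_fun n (f k) (path (s, \<omega>))) \<le> B" for k
    unfolding real_norm_def by (intro AE_I2 G_abs_le path_M1 b) (use B in auto)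
qed (auto intro: G_path_meas1 b)

definition VI :: "nat \<Rightarrow> ((nat \<Rightarrow> real) \<Rightarrow> real) \<Rightarrow> real \<Rightarrow> real" where
  "VI n f t = (LINT s:{0..t}|lborel. V n f s)"

lemma V_set_integrable:
  assumes "bm n f" shows "set_integrable lborel {a..b} (V n f)"
proof -
  obtain B where B: "\<And>x. x \<in> cube n \<Longrightarrow> \<bar>f x\<bar> \<le> B" using assms by (auto simp: bm_def)
  show ?thesis unfolding set_integrable_def
    using V_meas[OF assms] V_abs_le[OF assms B]
    by (intro integrableI_bounded_set_indicator[where B=B]) (auto simp: emeasure_lborel_Icc_eq)
qed

lemma VI_cong: "(\<And>x. x \<in> cube n \<Longrightarrow> f x = g x) \<Longrightarrow> VI n f = VI n g"
  unfolding VI_def using V_cong[of n f g] by simp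

lemma VI_add:
  assumes "bm n f" "bm n g" shows "VI n (\<lambda>x. f x + g x) t = VI n f t + VI n g t"
proof -
  have "V n (\<lambda>x. f x + g x) = (\<lambda>s. V n f s + V n g s)" by (intro ext V_add assms)
  then show ?thesis unfolding VI_def using assms by (simp only: set_integral_add V_set_integrable)
qed

lemma VI_cmult: "VI n (\<lambda>x. c * f x) t = c * VI n f t"
  unfolding VI_def V_cmult by simp

lemma VI_sum: "finite I \<Longrightarrow> (\<And>i. i \<in> I \<Longrightarrow> bm n (f i)) \<Longrightarrow> VI n (\<lambda>x. \<Sum>i\<in>I. f i x) t = (\<Sum>i\<in>I. VI n (f i) t)"
proof (induction I rule: finite_induct)
  case empty
  then show ?case using VI_cmult[of n 0] by simp
next
  case (insert x F)
  then show ?case by (simp add: VI_add bm_sum)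
qed

lemma VI_diff:
  assumes "bm n f" "bm n g" shows "VI n (\<lambda>x. f x - g x) t = VI n f t - VI n g t"
proof -
  have "V n (\<lambda>x. f x - g x) = (\<lambda>s. V n f s - V n g s)" by (intro ext V_diff assms)
  then show ?thesis unfolding VI_def using assms by (simp only: set_integral_diff V_set_integrable)
qed

lemma VI_mono:
  assumes "bm n f" "bm n g" "\<And>x. x \<in> cube n \<Longrightarrow> f x \<le> g x"
  shows "VI n f t \<le> VI n g t"
  unfolding VI_def by (intro set_integral_mono V_set_integrable V_mono assms)

lemma VI_const: "t \<ge> 0 \<Longrightarrow> VI n (\<lambda>_. c) t = c * t"
  unfolding VI_def V_const by (simp add: set_lebesgue_integral_def mult.commute)

lemma VI_lim:
  assumes b: "\<And>k. bm n (f k)" "bm n g"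
    and B: "\<And>k x. x \<in> cube n \<Longrightarrow> \<bar>f k x\<bar> \<le> B"
    and l: "\<And>x. x \<in> cube n \<Longrightarrow> (\<lambda>k. f k x) \<longlonglongrightarrow> g x"
  shows "(\<lambda>k. VI n (f k) t) \<longlonglongrightarrow> VI n g t"
  unfolding VI_def set_lebesgue_integral_def
proof (rule integral_dominated_convergence[where w="\<lambda>s. indicator {0..t} s * B"])
  show "AE s in lborel. (\<lambda>k. indicat_real {0..t} s *\<^sub>R V n (f k) s) \<longlonglongrightarrow> indicat_real {0..t} s *\<^sub>R V n g s"
    by (intro AE_I2 tendsto_intros V_lim b) (use B l in auto)
  show "AE s in lborel. norm (indicat_real {0..t} s *\<^sub>R V n (f k) s) \<le> indicator {0..t} s * B" for k
    using V_abs_le[OF b(1)[of k] B] by (intro AE_I2) (auto simp: indicator_def)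
  show "integrable lborel (\<lambda>s. indicator {0..t} s * B)"
    by (intro integrable_mult_left integrable_real_indicator) (auto simp: emeasure_lborel_Icc_eq)
qed (use V_meas b in auto)

end

section \<open>The martingale problem in expectation\<close>

definition corner :: "nat \<Rightarrow> (nat \<Rightarrow> real) \<Rightarrow> (nat \<Rightarrow> real) set" where
  "corner n a = {x \<in> cube n. \<forall>i\<in>{1..n}. x i \<le> a i}"

text \<open>Boxes whose sides come from generators generate the product, provided each generator
  covers its space; here the choice \<open>a = 1\<close> is already all of
  \<open>{0..1}\<close>.\<close>

lemma sets_Cube_sigma: "sets (Cube n) = sigma_sets (cube n) (range (corner n))"
proof -
  let ?E = "\<lambda>i::nat. range (\<lambda>a::real. {0..1} \<inter> {..a})"
  let ?P = "{{f\<in>(\<Pi>\<^sub>E i\<in>{1..n}. {0..1}). \<forall>i\<in>j. f i \<in> A i} | A j. j \<in> {{1..n}} \<and> A \<in> Pi j ?E}"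
  have "sets (Cube n) = sets (\<Pi>\<^sub>M i\<in>{1..n}. sigma {0..1} (?E i))"
    unfolding Cube_def
    by (intro sets_PiM_cong refl trans[OF sets_unit_borel_sigma] sets_measure_of[symmetric]) auto
  also have "\<dots> = sets (sigma (\<Pi>\<^sub>E i\<in>{1..n}. {0..1}) ?P)"
  proof (rule sets_PiM_sigma)
    have "{0..1} \<in> ?E i" for i by (intro image_eqI[where x=1]) auto
    then show "\<exists>S\<subseteq>?E i. countable S \<and> {0..1} = \<Union> S" for i
      by (intro exI[of _ "{{0..1}}"]) auto
  qed auto
  also have "?P = range (corner n)"
  proof (intro equalityI subsetI)
    fix X assume "X \<in> ?P"
    then obtain A where A: "X = {f\<in>cube n. \<forall>i\<in>{1..n}. f i \<in> A i}" "A \<in> Pi {1..n} ?E"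
      unfolding cube_def by blast
    then have "\<forall>i\<in>{1..n}. \<exists>a. A i = {0..1} \<inter> {..a}" by blast
    then obtain a where a: "\<And>i. i \<in> {1..n} \<Longrightarrow> A i = {0..1} \<inter> {..a i}" by metis
    have "X = corner n a" unfolding A(1) corner_def cube_def
      using a by (intro Collect_cong) (metis (no_types, lifting) IntI IntD2 PiE_mem atMost_iff)
    then show "X \<in> range (corner n)" by blast
  next
    fix X assume "X \<in> range (corner n)"
    then obtain a where "X = corner n a" by blast
    moreover have "corner n a = {f\<in>(\<Pi>\<^sub>E i\<in>{1..n}. {0..1}). \<forall>i\<in>{1..n}. f i \<in> {0..1} \<inter> {..a i}}"
      unfolding corner_def cube_def by (intro Collect_cong) (meson IntI IntD2 PiE_mem atMost_iff)
    moreover have "(\<lambda>i. {0..1} \<inter> {..a i}) \<in> Pi {1..n} ?E" by auto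
    ultimately show "X \<in> ?P"
      by (intro CollectI exI[of _ "\<lambda>i. {0..1} \<inter> {..a i}"] exI[of _ "{1..n}"]) simp
  qed
  also have "sets (sigma (\<Pi>\<^sub>E i\<in>{1..n}. {0..1}) (range (corner n))) = sigma_sets (cube n) (range (corner n))"
    unfolding cube_def[symmetric] by (rule sets_measure_of) (auto simp: corner_def)
  finally show ?thesis .
qed

lemma Int_stable_corner: "Int_stable (range (corner n))"
proof (rule Int_stableI)
  fix A B assume "A \<in> range (corner n)" "B \<in> range (corner n)"
  then obtain a b where "A = corner n a" "B = corner n b" by blast
  then have "A \<inter> B = corner n (\<lambda>i. min (a i) (b i))" by (auto simp: corner_def)
  then show "A \<inter> B \<in> range (corner n)" by blast
qed

lemma indicator_corner:
  "x \<in> cube n \<Longrightarrow> indicator (corner n a) x = (\<Prod>i\<in>{1..n}. indicator {..a i} (x i) :: real)"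
  by (auto simp: corner_def indicator_def prod_zero_iff intro!: prod.neutral)

lemma coord_measurable: "i \<in> {1..n} \<Longrightarrow> (\<lambda>x. x i) \<in> borel_measurable (Cube n)"
proof -
  assume "i \<in> {1..n}"
  then have "(\<lambda>x. x i) \<in> Cube n \<rightarrow>\<^sub>M unit_borel" unfolding Cube_def by (rule measurable_component_singleton)
  moreover have "(\<lambda>x. x) \<in> unit_borel \<rightarrow>\<^sub>M borel"
    unfolding unit_borel_def by (rule measurable_restrict_space1) simp
  ultimately show ?thesis by (rule measurable_compose)
qed

text \<open>The index whose point coordinate \<open>i\<close> copies under \<open>R_map\<close>.
  Splitting it off reduces the facts about \<open>R_map\<close> to finite combinatorics of
  indices.\<close>

definition rK :: "nat set \<Rightarrow> nat \<Rightarrow> nat" where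
  "rK K i = (if i \<in> K then Min K else let p = card ({1..i} - K) in if p < Min K then p else p + 1)"

lemma R_map_rK: "R_map n K x = (\<lambda>i\<in>{1..n}. x (rK K i))"
  by (auto simp: R_map_def rK_def Let_def fun_eq_iff)

definition Ks :: "nat \<Rightarrow> nat set set" where
  "Ks n = {K. K \<subseteq> {1..n} \<and> 2 \<le> card K}"

lemma finite_Ks: "finite (Ks n)"
  by (rule finite_subset[of _ "Pow {1..n}"]) (auto simp: Ks_def)

lemma KsD:
  assumes "K \<in> Ks n"
  shows "K \<subseteq> {1..n}" "2 \<le> card K" "finite K" "Min K \<in> K" "\<And>i. i \<in> K \<Longrightarrow> Min K \<le> i" "card K \<le> n"
proof -
  show K: "K \<subseteq> {1..n}" "2 \<le> card K" using assms by (auto simp: Ks_def)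
  show f: "finite K" using K by (auto intro: finite_subset)
  have "K \<noteq> {}" using K by auto
  then show "Min K \<in> K" "\<And>i. i \<in> K \<Longrightarrow> Min K \<le> i" using f by auto
  show "card K \<le> n" using card_mono[OF _ K(1)] by simp
qed

lemma rK_rank:
  assumes K: "K \<in> Ks n" and i: "i \<in> {1..n} - K"
  shows "1 \<le> card ({1..i} - K)" "card ({1..i} - K) \<le> n - card K"
proof -
  have "card {i} \<le> card ({1..i} - K)" using i by (intro card_mono) auto
  then show "1 \<le> card ({1..i} - K)" by simp
  have "card ({1..i} - K) \<le> card ({1..n} - K)" using i by (intro card_mono) auto
  also have "\<dots> = n - card K" using KsD[OF K] by (simp add: card_Diff_subset)
  finally show "card ({1..i} - K) \<le> n - card K" .
qed

lemma rK_range: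
  assumes K: "K \<in> Ks n" and i: "i \<in> {1..n}"
  shows "rK K i \<in> {1..n - card K + 1}"
proof (cases "i \<in> K")
  case True
  have "K \<subseteq> {Min K..n}" using KsD[OF K] by auto
  then have "card K \<le> n + 1 - Min K" using card_mono[of "{Min K..n}" K] by simp
  moreover have "1 \<le> Min K" "Min K \<le> n" using KsD[OF K] by auto
  ultimately show ?thesis using True KsD(6)[OF K] by (auto simp: rK_def)
next
  case False
  then show ?thesis using rK_rank[OF K, of i] i by (auto simp: rK_def Let_def)
qed

text \<open>Outside \<open>K\<close> the rank is strictly increasing, and the jump from
  \<open>p\<close> to \<open>p + 1\<close> skips the value \<open>Min K\<close> reserved for
  \<open>K\<close>.\<close>

lemma rK_eq_iff:
  assumes K: "K \<in> Ks n" and ij: "i \<in> {1..n}" "j \<in> {1..n}"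
  shows "rK K i = rK K j \<longleftrightarrow> i = j \<or> i \<in> K \<and> j \<in> K"
proof -
  have out: "rK K i \<noteq> Min K" if "i \<notin> K" for i
    using that by (auto simp: rK_def Let_def)
  have lt: "rK K i < rK K j" if "i < j" "i \<in> {1..n} - K" "j \<in> {1..n} - K" for i j
  proof -
    have "card ({1..i} - K) < card ({1..j} - K)"
    proof (rule psubset_card_mono)
      have "j \<in> {1..j} - K" "j \<notin> {1..i} - K" using that by auto
      moreover have "{1..i} - K \<subseteq> {1..j} - K" using that by auto
      ultimately show "{1..i} - K \<subset> {1..j} - K" by blast
    qed simp
    then show ?thesis using that by (auto simp: rK_def Let_def)
  qed
  show ?thesis
  proof (cases "i \<in> K \<or> j \<in> K")
    case True
    then show ?thesis using out[of i] out[of j] by (auto simp: rK_def)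
  next
    case False
    then show ?thesis using lt[of i j] lt[of j i] ij by (cases i j rule: linorder_cases) auto
  qed
qed

text \<open>By counting: \<open>rK K\<close> is injective on \<open>Min K\<close> together with the
  complement of \<open>K\<close>, a set with as many elements as the target.\<close>

lemma rK_surj:
  assumes K: "K \<in> Ks n"
  shows "rK K ` {1..n} = {1..n - card K + 1}"
proof (rule card_seteq)
  let ?I = "insert (Min K) ({1..n} - K)"
  have "inj_on (rK K) ?I"
    using rK_eq_iff[OF K] KsD[OF K] by (auto simp: inj_on_def)
  then have "card (rK K ` ?I) = card ?I" by (rule card_image)
  also have "\<dots> = n - card K + 1" using KsD[OF K] by (simp add: card_Diff_subset)
  finally have "n - card K + 1 \<le> card (rK K ` {1..n})"
    using KsD[OF K] by (metis card_mono finite_atLeastAtMost finite_imageI image_mono insert_subset subsetD Diff_subset)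
  then show "card {1..n - card K + 1} \<le> card (rK K ` {1..n})" by simp
qed (use rK_range[OF K] in auto)

lemma R_map_measurable:
  assumes K: "K \<in> Ks n" and m: "n - card K + 1 \<le> m"
  shows "R_map n K \<in> Cube m \<rightarrow>\<^sub>M Cube n"
  unfolding Cube_def R_map_rK
proof (rule measurable_restrict)
  fix i assume "i \<in> {1..n}"
  then have "rK K i \<in> {1..m}" using rK_range[OF K, of i] m by auto
  then show "(\<lambda>x. x (rK K i)) \<in> (\<Pi>\<^sub>M i\<in>{1..m}. unit_borel) \<rightarrow>\<^sub>M unit_borel"
    by (rule measurable_component_singleton)
qed

lemma R_map_cube: "K \<in> Ks n \<Longrightarrow> n - card K + 1 \<le> m \<Longrightarrow> x \<in> cube m \<Longrightarrow> R_map n K x \<in> cube n"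
  using measurable_space[OF R_map_measurable] by (metis space_Cube)

lemma R_map_cube': "K \<in> Ks n \<Longrightarrow> x \<in> cube n \<Longrightarrow> R_map n K x \<in> cube n"
  by (rule R_map_cube[of K n n]) (use KsD(2)[of K n] KsD(6)[of K n] in auto)

lemma bm_R_map:
  assumes f: "bm n f" and K: "K \<in> Ks n" and m: "n - card K + 1 \<le> m"
  shows "bm m (\<lambda>x. f (R_map n K x))"
proof -
  obtain B where B: "\<And>x. x \<in> cube n \<Longrightarrow> \<bar>f x\<bar> \<le> B" using f by (auto simp: bm_def)
  show ?thesis
    by (rule bmI[where B=B]) (use measurable_compose[OF R_map_measurable[OF K m] bm_meas[OF f]] B R_map_cube[OF K m] in auto)
qed

lemma bm_R_map': "bm n f \<Longrightarrow> K \<in> Ks n \<Longrightarrow> bm n (\<lambda>x. f (R_map n K x))"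
  by (rule bm_R_map) (use KsD[of K n] in auto)

lemma PM_reindex:
  assumes mu: "\<mu> \<in> M1" and r: "inj_on r {1..n}" "r \<in> {1..n} \<rightarrow> I" and f: "f \<in> borel_measurable (Cube n)"
  shows "(\<integral>x. f (\<lambda>i\<in>{1..n}. x (r i)) \<partial>(\<Pi>\<^sub>M i\<in>I. \<mu>)) = G_fun n f \<mu>"
proof -
  have "distr (\<Pi>\<^sub>M i\<in>I. \<mu>) (\<Pi>\<^sub>M i\<in>{1..n}. \<mu>) (\<lambda>\<omega>. \<lambda>i\<in>{1..n}. \<omega> (r i)) = (\<Pi>\<^sub>M i\<in>{1..n}. \<mu>)"
    using distr_PiM_reindex[of I "\<lambda>_. \<mu>" r "{1..n}"] r M1_D[OF mu] by auto
  then have "G_fun n f \<mu> = (\<integral>x. f x \<partial>distr (\<Pi>\<^sub>M i\<in>I. \<mu>) (\<Pi>\<^sub>M i\<in>{1..n}. \<mu>) (\<lambda>\<omega>. \<lambda>i\<in>{1..n}. \<omega> (r i)))"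
    unfolding G_fun_def by simp
  also have "\<dots> = (\<integral>x. f (\<lambda>i\<in>{1..n}. x (r i)) \<partial>(\<Pi>\<^sub>M i\<in>I. \<mu>))"
  proof (rule integral_distr)
    show "(\<lambda>\<omega>. \<lambda>i\<in>{1..n}. \<omega> (r i)) \<in> (\<Pi>\<^sub>M i\<in>I. \<mu>) \<rightarrow>\<^sub>M (\<Pi>\<^sub>M i\<in>{1..n}. \<mu>)"
      using r by (intro measurable_restrict measurable_component_singleton) auto
    show "f \<in> borel_measurable (\<Pi>\<^sub>M i\<in>{1..n}. \<mu>)"
      using f measurable_cong_sets[OF sets_PM[OF mu] refl] by blast
  qed
  finally show ?thesis by simp
qed

text \<open>Only the coordinates \<open>1..n - card K + 1\<close> are read by
  \<open>R_map n K\<close>, so the others integrate out. This lowers the sample size and feeds the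
  inductions.\<close>

lemma G_R_map_reduce:
  assumes mu: "\<mu> \<in> M1" and K: "K \<in> Ks n" and f: "bm n f"
  shows "G_fun n (\<lambda>x. f (R_map n K x)) \<mu> = G_fun (n - card K + 1) (\<lambda>x. f (R_map n K x)) \<mu>"
proof -
  let ?m = "n - card K + 1"
  have m: "?m \<le> n" using KsD[OF K] by simp
  have "G_fun ?m (\<lambda>x. f (R_map n K x)) \<mu>
      = (\<integral>x. f (R_map n K (\<lambda>i\<in>{1..?m}. x i)) \<partial>(\<Pi>\<^sub>M i\<in>{1..n}. \<mu>))"
    by (rule PM_reindex[symmetric, OF mu]) (use m bm_meas[OF bm_R_map[OF f K order_refl]] in auto)
  also have "\<dots> = G_fun n (\<lambda>x. f (R_map n K x)) \<mu>"
    unfolding G_fun_def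
  proof (rule Bochner_Integration.integral_cong[OF refl])
    fix x
    have "R_map n K (\<lambda>i\<in>{1..?m}. x i) = R_map n K x"
      unfolding R_map_rK using rK_range[OF K] by (auto simp: fun_eq_iff)
    then show "f (R_map n K (\<lambda>i\<in>{1..?m}. x i)) = f (R_map n K x)" by simp
  qed
  finally show ?thesis by simp
qed

section \<open>The generator on functions of n points and Dynkin's formula\<close>

context fleming_viot
begin

abbreviation lam :: "nat \<Rightarrow> nat \<Rightarrow> real" where "lam \<equiv> merge_rate \<Lambda>"

lemma lam_nonneg: "lam n k \<ge> 0"
  unfolding merge_rate_def by (rule integral_nonneg_AE) (auto simp: space_L intro!: AE_I2)

text \<open>The generator as an operator on functions of \<open>n\<close> points:
  \<open>LG_fun\<close> is the sampling functional of \<open>A_fun\<close>, see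
  \<open>LG_eq\<close>, so the drift can be written with \<open>V\<close> and
  \<open>VI\<close>.\<close>

definition A_fun :: "nat \<Rightarrow> ((nat \<Rightarrow> real) \<Rightarrow> real) \<Rightarrow> (nat \<Rightarrow> real) \<Rightarrow> real" where
  "A_fun n f x = (\<Sum>K\<in>Ks n. lam n (card K) * (f (R_map n K x) - f x))"

lemma bm_A: "bm n f \<Longrightarrow> bm n (A_fun n f)"
  unfolding A_fun_def by (intro bm_sum bm_cmult bm_diff bm_R_map')

lemma LG_eq:
  assumes mu: "\<mu> \<in> M1" and f: "bm n f"
  shows "LG_fun \<Lambda> n f \<mu> = G_fun n (A_fun n f) \<mu>"
proof -
  have "G_fun n (A_fun n f) \<mu> = (\<Sum>K\<in>Ks n. G_fun n (\<lambda>x. lam n (card K) * (f (R_map n K x) - f x)) \<mu>)"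
    unfolding A_fun_def by (intro G_sum mu bm_cmult bm_diff bm_R_map' f)
  then show ?thesis unfolding LG_fun_def Ks_def[symmetric] G_cmult by (simp add: G_fun_def)
qed

lemma A_cong: "(\<And>x. x \<in> cube n \<Longrightarrow> f x = g x) \<Longrightarrow> x \<in> cube n \<Longrightarrow> A_fun n f x = A_fun n g x"
  unfolding A_fun_def by (intro sum.cong refl) (simp add: R_map_cube')

lemma VI_A:
  assumes f: "bm n f"
  shows "VI n (A_fun n f) t = (\<Sum>K\<in>Ks n. lam n (card K) * (VI n (\<lambda>x. f (R_map n K x)) t - VI n f t))"
proof -
  have "VI n (A_fun n f) t = (\<Sum>K\<in>Ks n. VI n (\<lambda>x. lam n (card K) * (f (R_map n K x) - f x)) t)"
    unfolding A_fun_def by (intro VI_sum finite_Ks bm_cmult bm_diff bm_R_map' f)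
  also have "\<dots> = (\<Sum>K\<in>Ks n. lam n (card K) * (VI n (\<lambda>x. f (R_map n K x)) t - VI n f t))"
    by (intro sum.cong refl) (simp add: VI_cmult VI_diff bm_R_map' f)
  finally show ?thesis .
qed

text \<open>Dynkin's formula in expectation. Bundled with \<open>bm\<close> it is a property stable
  under linear combinations and bounded limits.\<close>

definition FVeq :: "nat \<Rightarrow> ((nat \<Rightarrow> real) \<Rightarrow> real) \<Rightarrow> bool" where
  "FVeq n f \<longleftrightarrow> bm n f \<and> (\<forall>t\<ge>0. V n f t = G_fun n f unit_lebesgue + VI n (A_fun n f) t)"

text \<open>A martingale has constant expectation, and its value at time 0 is almost surely
  deterministic; Fubini then exchanges expectation and time integral.\<close>

lemma FVeq_continuous:
  assumes n: "1 \<le> n" and c: "continuous_on (cube n) f" and f: "bm n f"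
  shows "FVeq n f"
  unfolding FVeq_def
proof (intro conjI allI impI f)
  fix t :: real assume t: "t \<ge> 0"
  define X where "X t \<omega> = G_fun n f (\<rho> t \<omega>) - (LINT s:{0..t}|lborel. LG_fun \<Lambda> n f (\<rho> s \<omega>))" for t \<omega>
  have "is_martingale P (natural_filtration P \<rho>) X"
    using FV n c unfolding Lambda_Fleming_Viot_def X_def by blast
  then have sub: "subalgebra P (natural_filtration P \<rho> 0)" and Xi: "\<And>t. 0 \<le> t \<Longrightarrow> integrable P (X t)"
    and ce: "AE \<omega> in P. real_cond_exp P (natural_filtration P \<rho> 0) (X t) \<omega> = X 0 \<omega>"
    using t unfolding is_martingale_def by auto
  interpret fs: finite_measure_subalgebra P "natural_filtration P \<rho> 0"
    by unfold_locales (rule sub)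
  have "(\<integral>\<omega>. X t \<omega> \<partial>P) = (\<integral>\<omega>. real_cond_exp P (natural_filtration P \<rho> 0) (X t) \<omega> \<partial>P)"
    using fs.real_cond_exp_int[OF Xi[OF t]] by simp
  also have "\<dots> = (\<integral>\<omega>. X 0 \<omega> \<partial>P)"
    by (rule integral_cong_AE) (use ce fs.real_cond_exp_int[OF Xi[OF t]] Xi[of 0] in auto)
  also have "\<dots> = (\<integral>\<omega>. G_fun n f unit_lebesgue \<partial>P)"
  proof (rule integral_cong_AE)
    \<comment> \<open>At time 0 the integral runs over a single point.\<close>
    have z: "(LINT s:{0}|lborel. h s) = 0" for h :: "real \<Rightarrow> real"
      unfolding set_lebesgue_integral_def
      by (rule integral_eq_zero_AE) (use AE_lborel_singleton[of 0] in \<open>auto elim: eventually_mono\<close>)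
    have "AE \<omega> in P. \<rho> 0 \<omega> = unit_lebesgue" using FV by (simp add: Lambda_Fleming_Viot_def)
    then show "AE \<omega> in P. X 0 \<omega> = G_fun n f unit_lebesgue"
      by eventually_elim (simp add: X_def z)
  qed (use Xi[of 0] in auto)
  also have "\<dots> = G_fun n f unit_lebesgue" using P.prob_space by simp
  finally have EX: "(\<integral>\<omega>. X t \<omega> \<partial>P) = G_fun n f unit_lebesgue" .
  let ?g = "\<lambda>s \<omega>. indicator {0..t} s *\<^sub>R G_fun n (A_fun n f) (path (s, \<omega>))"
  have X: "X t \<omega> = G_fun n f (path (t, \<omega>)) - (LINT s|lborel. ?g s \<omega>)" if w: "\<omega> \<in> space P" for \<omega>
  proof -
    have "(LINT s:{0..t}|lborel. LG_fun \<Lambda> n f (\<rho> s \<omega>)) = (LINT s|lborel. ?g s \<omega>)"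
      unfolding set_lebesgue_integral_def
      by (intro Bochner_Integration.integral_cong refl)
        (auto simp: indicator_def path_def LG_eq[OF rho_M1[OF w] f] max_absorb2)
    then show ?thesis using t by (simp add: X_def path_def)
  qed
  have EX2: "(\<integral>\<omega>. G_fun n f (path (t, \<omega>)) - (LINT s|lborel. ?g s \<omega>) \<partial>P) = G_fun n f unit_lebesgue"
    unfolding EX[symmetric] by (intro Bochner_Integration.integral_cong refl) (simp add: X)
  have "emeasure (lborel \<Otimes>\<^sub>M P) ({0..t} \<times> space P) = emeasure lborel {0..t} * emeasure P (space P)"
    by (rule P.emeasure_pair_measure_Times) auto
  then have fin: "emeasure (lborel \<Otimes>\<^sub>M P) ({0..t} \<times> space P) < \<infinity>"
    by (simp add: P.emeasure_space_1 emeasure_lborel_Icc_eq)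
  interpret pair_sigma_finite lborel P ..
  \<comment> \<open>A bounded integrand on a set of finite product measure; its joint measurability
    is \<open>G_path_meas\<close>.\<close>
  have int: "integrable (lborel \<Otimes>\<^sub>M P) (case_prod ?g)"
  proof -
    obtain B where B: "\<And>x. x \<in> cube n \<Longrightarrow> \<bar>A_fun n f x\<bar> \<le> B" using bm_A[OF f] by (auto simp: bm_def)
    have m: "(\<lambda>z. G_fun n (A_fun n f) (path z)) \<in> borel_measurable (lborel \<Otimes>\<^sub>M P)"
      using G_path_meas[OF bm_A[OF f]] measurable_cong_sets[OF sets_pair_measure_cong[OF sets_lborel refl] refl] by blast
    have "integrable (lborel \<Otimes>\<^sub>M P) (\<lambda>z. indicator ({0..t} \<times> space P) z *\<^sub>R G_fun n (A_fun n f) (path z))"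
    proof (rule integrableI_bounded_set_indicator[where B=B])
      show "{0..t} \<times> space P \<in> sets (lborel \<Otimes>\<^sub>M P)" by (intro pair_measureI) auto
      show "emeasure (lborel \<Otimes>\<^sub>M P) ({0..t} \<times> space P) < \<infinity>" by (rule fin)
      show "AE z in lborel \<Otimes>\<^sub>M P. z \<in> {0..t} \<times> space P \<longrightarrow> norm (G_fun n (A_fun n f) (path z)) \<le> B"
        by (intro AE_I2) (auto intro!: G_abs_le path_M1 bm_A f B)
    qed (rule m)
    then show ?thesis
      by (rule Bochner_Integration.integrable_cong[OF refl, THEN iffD1, rotated])
        (auto simp: space_pair_measure indicator_def)
  qed
  have "integrable P (\<lambda>\<omega>. LINT s|lborel. ?g s \<omega>)" using integrable_snd[OF int] .
  then have "(\<integral>\<omega>. G_fun n f (path (t, \<omega>)) \<partial>P) - (\<integral>\<omega>. (LINT s|lborel. ?g s \<omega>) \<partial>P) = G_fun n f unit_lebesgue"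
    using EX2 G_path_integrable[OF f] by (subst (asm) Bochner_Integration.integral_diff) auto
  also have "(\<integral>\<omega>. (LINT s|lborel. ?g s \<omega>) \<partial>P) = (LINT s|lborel. (\<integral>\<omega>. ?g s \<omega> \<partial>P))"
    by (rule Fubini_integral[OF int])
  also have "\<dots> = VI n (A_fun n f) t"
    unfolding VI_def V_def set_lebesgue_integral_def by simp
  finally show "V n f t = G_fun n f unit_lebesgue + VI n (A_fun n f) t"
    unfolding V_def by simp
qed

lemma FVeq_bm: "FVeq n f \<Longrightarrow> bm n f" by (simp add: FVeq_def)

lemma FVeq_cong: "FVeq n f \<Longrightarrow> (\<And>x. x \<in> cube n \<Longrightarrow> f x = g x) \<Longrightarrow> FVeq n g"
  unfolding FVeq_def using bm_cong[of n f g] V_cong[of n f g] G_cong[OF unit_lebesgue_M1, of n f g]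
    VI_cong[of n "A_fun n f" "A_fun n g"] A_cong[of n f g] by auto

lemma FVeq_add:
  assumes "FVeq n f" "FVeq n g" shows "FVeq n (\<lambda>x. f x + g x)"
proof -
  note b = FVeq_bm[OF assms(1)] FVeq_bm[OF assms(2)]
  have "A_fun n (\<lambda>x. f x + g x) = (\<lambda>x. A_fun n f x + A_fun n g x)"
    by (simp add: A_fun_def fun_eq_iff sum.distrib[symmetric] algebra_simps)
  then show ?thesis using assms b unfolding FVeq_def
    by (simp add: bm_add V_add G_add[OF unit_lebesgue_M1] VI_add bm_A)
qed

lemma FVeq_cmult:
  assumes "FVeq n f" shows "FVeq n (\<lambda>x. c * f x)"
proof -
  have "A_fun n (\<lambda>x. c * f x) = (\<lambda>x. c * A_fun n f x)"
    by (simp add: A_fun_def fun_eq_iff sum_distrib_left algebra_simps)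
  then show ?thesis using assms unfolding FVeq_def
    by (simp add: bm_cmult V_cmult G_cmult VI_cmult distrib_left)
qed

lemma FVeq_const: "1 \<le> n \<Longrightarrow> FVeq n (\<lambda>_. c)"
  by (rule FVeq_continuous) (auto intro: bm_const)

lemma FVeq_sum:
  assumes n: "1 \<le> n" and "finite I" "\<And>i. i \<in> I \<Longrightarrow> FVeq n (f i)"
  shows "FVeq n (\<lambda>x. \<Sum>i\<in>I. f i x)"
  using assms(2,3) by (induction I rule: finite_induct) (simp_all add: FVeq_const[OF n] FVeq_add)

text \<open>Each term is continuous along bounded pointwise limits; for the drift this holds because
  \<open>A_fun\<close> is a finite combination of compositions with \<open>R_map\<close>.\<close>

lemma FVeq_lim:
  assumes f: "\<And>k. FVeq n (f k)" and g: "g \<in> borel_measurable (Cube n)"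
    and B: "\<And>k x. x \<in> cube n \<Longrightarrow> \<bar>f k x\<bar> \<le> B"
    and l: "\<And>x. x \<in> cube n \<Longrightarrow> (\<lambda>k. f k x) \<longlonglongrightarrow> g x"
  shows "FVeq n g"
proof -
  have "\<bar>g x\<bar> \<le> B" if "x \<in> cube n" for x
    using tendsto_rabs[OF l[OF that]] B[OF that] by (intro LIMSEQ_le_const2) auto
  then have g: "bm n g" by (intro bmI[where B=B] g)
  note b = FVeq_bm[OF f] and R = bm_R_map'
  have "V n g t = G_fun n g unit_lebesgue + VI n (A_fun n g) t" if t: "t \<ge> 0" for t
  proof (rule LIMSEQ_unique)
    show "(\<lambda>k. V n (f k) t) \<longlonglongrightarrow> V n g t" by (rule V_lim[OF b g B l])
    have "(\<lambda>k. VI n (\<lambda>x. f k (R_map n K x)) t) \<longlonglongrightarrow> VI n (\<lambda>x. g (R_map n K x)) t" if K: "K \<in> Ks n" for K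
    proof -
      have c: "R_map n K x \<in> cube n" if "x \<in> cube n" for x
        using R_map_cube'[OF K that] .
      show ?thesis using R[OF b K] R[OF g K] c B l by (intro VI_lim) auto
    qed
    then have "(\<lambda>k. VI n (A_fun n (f k)) t) \<longlonglongrightarrow> VI n (A_fun n g) t"
      unfolding VI_A[OF b] VI_A[OF g] by (intro tendsto_intros VI_lim[OF b g B l]) auto
    then show "(\<lambda>k. V n (f k) t) \<longlonglongrightarrow> G_fun n g unit_lebesgue + VI n (A_fun n g) t"
      using f t unfolding FVeq_def by (auto intro!: tendsto_intros G_lim[OF unit_lebesgue_M1 b g B l])
  qed
  then show ?thesis using g by (simp add: FVeq_def)
qed

text \<open>Products of ramps are continuous with values in \<open>{0..1}\<close> and tend to the
  indicator of the corner.\<close>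

lemma FVeq_corner:
  assumes n: "1 \<le> n" shows "FVeq n (indicator (corner n a))"
proof (rule FVeq_lim)
  let ?f = "\<lambda>k x. \<Prod>i\<in>{1..n}. ramp (a i) k (x i)"
  show "indicator (corner n a) \<in> borel_measurable (Cube n)"
    by (intro borel_measurable_indicator) (auto simp: sets_Cube_sigma)
  show B: "\<bar>?f k x\<bar> \<le> 1" for k x
    unfolding abs_prod by (intro prod_le_1) (auto simp: ramp_bounds)
  show "(\<lambda>k. ?f k x) \<longlonglongrightarrow> indicator (corner n a) x" if "x \<in> cube n" for x
    unfolding indicator_corner[OF that] by (intro tendsto_prod ramp_tendsto)
  show "FVeq n (?f k)" for k
  proof (rule FVeq_continuous[OF n])
    have r: "continuous_on UNIV (ramp (a i) k)" for i by (rule ramp_continuous)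
    have "continuous_on (cube n) (\<lambda>x. ramp (a i) k (x i))" for i
      by (rule continuous_on_compose2[OF r continuous_on_subset[OF continuous_on_product_coordinates]]) auto
    then show "continuous_on (cube n) (?f k)"
      by (intro continuous_on_prod)
    have "?f k \<in> borel_measurable (Cube n)"
      by (intro borel_measurable_prod measurable_compose[OF coord_measurable borel_measurable_continuous_onI[OF r]]) auto
    then show "bm n (?f k)" by (rule bmI) (rule B)
  qed
qed

lemma FVeq_indicator:
  assumes n: "1 \<le> n" and A: "A \<in> sets (Cube n)" shows "FVeq n (indicator A)"
proof -
  note Int_stable_corner[of n]
  moreover have "range (corner n) \<subseteq> Pow (cube n)" by (auto simp: corner_def)
  moreover from A have "A \<in> sigma_sets (cube n) (range (corner n))" by (simp add: sets_Cube_sigma)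
  ultimately show ?thesis
  proof (induction rule: sigma_sets_induct_disjoint)
    case (basic A)
    then show ?case using FVeq_corner[OF n] by auto
  next
    case empty
    then show ?case using FVeq_const[OF n, of 0] by (rule FVeq_cong) simp
  next
    case (compl A)
    have "FVeq n (\<lambda>x. 1 + (- 1) * indicator A x)"
      by (intro FVeq_add FVeq_cmult FVeq_const n compl)
    then show ?case by (rule FVeq_cong) (auto simp: indicator_def)
  next
    case (union A)
    have sets: "A i \<in> sets (Cube n)" for i using union(2) by (auto simp: sets_Cube_sigma)
    \<comment> \<open>Disjointness makes the partial sums indicators, hence bounded by 1 as
      \<open>FVeq_lim\<close> requires.\<close>
    have s: "(\<Sum>i<k. indicator (A i) x) = (indicator (\<Union>i<k. A i) x :: real)" for k x
      using union(1) by (subst indicator_UN_disjoint) (auto simp: disjoint_family_on_def)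
    show ?case
    proof (rule FVeq_lim[where f="\<lambda>k x. \<Sum>i<k. indicator (A i) x" and B=1])
      show "FVeq n (\<lambda>x. \<Sum>i<k. indicator (A i) x)" for k by (intro FVeq_sum n union) auto
      show "indicator (\<Union> (range A)) \<in> borel_measurable (Cube n)" using sets by auto
      show "\<bar>\<Sum>i<k. indicator (A i) x\<bar> \<le> (1::real)" for k x unfolding s by (simp add: indicator_def)
      show "(\<lambda>k. \<Sum>i<k. indicator (A i) x) \<longlonglongrightarrow> (indicator (\<Union> (range A)) x :: real)" for x
        unfolding s by (rule LIMSEQ_indicator_UN)
    qed
  qed
qed

text \<open>A measurable function with finitely many values is a finite combination of indicators;
  functions of the sampled partition are of this kind, though discontinuous in general.\<close>

lemma FVeq_finite_range:
  assumes n: "1 \<le> n" and f: "f \<in> borel_measurable (Cube n)" and r: "finite (f ` cube n)"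
  shows "FVeq n f"
proof -
  have "FVeq n (\<lambda>x. \<Sum>y\<in>f ` cube n. y * indicator (f -` {y} \<inter> cube n) x)"
  proof (intro FVeq_sum n r FVeq_cmult FVeq_indicator)
    fix y
    show "f -` {y} \<inter> cube n \<in> sets (Cube n)"
      using measurable_sets[OF f, of "{y}"] by (simp add: space_Cube)
  qed
  then show ?thesis
  proof (rule FVeq_cong)
    fix x assume x: "x \<in> cube n"
    have "(\<Sum>y\<in>f ` cube n. y * indicator (f -` {y} \<inter> cube n) x) = (\<Sum>y\<in>f ` cube n. if y = f x then y else 0)"
      using x by (intro sum.cong) (auto simp: indicator_def)
    also have "\<dots> = f x" using x r by (simp add: sum.delta')
    finally show "(\<Sum>y\<in>f ` cube n. y * indicator (f -` {y} \<inter> cube n) x) = f x" .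
  qed
qed

end

section \<open>Duality with the \<open>\<Lambda>\<close>-coalescent\<close>

definition part :: "nat \<Rightarrow> (nat \<Rightarrow> 'c) \<Rightarrow> nat set set" where
  "part n x = (\<lambda>i. {j\<in>{1..n}. x j = x i}) ` {1..n}"

definition coag :: "'b set set \<Rightarrow> 'b set set \<Rightarrow> 'b set set" where
  "coag J \<pi> = insert (\<Union>J) (\<pi> - J)"

definition Js :: "'b set \<Rightarrow> 'b set set" where
  "Js \<pi> = {J. J \<subseteq> \<pi> \<and> 2 \<le> card J}"

definition singles :: "nat \<Rightarrow> nat set set" where
  "singles n = (\<lambda>i. {i}) ` {1..n}"

text \<open>Pullback along \<open>r\<close>; with \<open>r = rK K\<close> it turns a partition of
  \<open>n - card K + 1\<close> labels into one of \<open>n\<close> labels in which \<open>K\<close>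
  is joined.\<close>

definition pb :: "(nat \<Rightarrow> nat) \<Rightarrow> nat \<Rightarrow> nat set set \<Rightarrow> nat set set" where
  "pb r n \<pi> = (\<lambda>B. {i\<in>{1..n}. r i \<in> B}) ` \<pi>"

lemma finite_Js: "finite \<pi> \<Longrightarrow> finite (Js \<pi>)"
  by (rule finite_subset[of _ "Pow \<pi>"]) (auto simp: Js_def)

lemma finite_part: "finite (part n x)"
  by (simp add: part_def)

lemma part_subset: "B \<in> part n x \<Longrightarrow> B \<subseteq> {1..n}"
  by (auto simp: part_def)

lemma part_cong: "(\<And>i. i \<in> {1..n} \<Longrightarrow> x i = y i) \<Longrightarrow> part n x = part n y"
  unfolding part_def by (intro image_cong refl) auto

lemma part_distinct: "inj_on x {1..n} \<Longrightarrow> part n x = singles n"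
  unfolding part_def singles_def by (intro image_cong refl) (auto dest: inj_onD)

text \<open>The partition depends on \<open>x\<close> only through the finite set of coinciding
  index pairs, and for real points each coincidence is a measurable event; this yields
  \<open>part_measurable\<close>.\<close>

lemma part_kernel: "\<exists>F. \<forall>x. part n x = F {p\<in>{1..n}\<times>{1..n}. x (fst p) = x (snd p)}"
proof -
  have "part n x = (\<lambda>E. (\<lambda>i. {j\<in>{1..n}. (j, i) \<in> E}) ` {1..n}) {p\<in>{1..n}\<times>{1..n}. x (fst p) = x (snd p)}"
    for x :: "nat \<Rightarrow> 'c"
    unfolding part_def by (intro image_cong refl) auto
  then show ?thesis by (intro exI[of _ "\<lambda>E. (\<lambda>i. {j\<in>{1..n}. (j, i) \<in> E}) ` {1..n}"] allI)
qed

lemma part_measurable: "(\<lambda>x. part n x) \<in> Cube n \<rightarrow>\<^sub>M count_space UNIV"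
proof -
  let ?S = "{1..n}\<times>{1..n}"
  let ?k = "\<lambda>x :: nat \<Rightarrow> real. {p\<in>?S. x (fst p) = x (snd p)}"
  have k: "?k \<in> Cube n \<rightarrow>\<^sub>M count_space (Pow ?S)"
  proof (subst measurable_count_space_eq2, simp, intro conjI ballI)
    fix E assume E: "E \<in> Pow ?S"
    have eq: "{x\<in>space (Cube n). x (fst p) = x (snd p)} \<in> sets (Cube n)" if "p \<in> ?S" for p
      using that by (intro borel_measurable_eq coord_measurable) auto
    have "{x\<in>space (Cube n). \<forall>p\<in>?S. (x (fst p) = x (snd p)) = (p \<in> E)} \<in> sets (Cube n)"
    proof (rule sets.sets_Collect_finite_All)
      fix p assume p: "p \<in> ?S"
      show "{x\<in>space (Cube n). (x (fst p) = x (snd p)) = (p \<in> E)} \<in> sets (Cube n)"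
        using eq[OF p] sets.sets_Collect_neg[OF eq[OF p]] by (cases "p \<in> E") auto
    qed simp
    also have "{x\<in>space (Cube n). \<forall>p\<in>?S. (x (fst p) = x (snd p)) = (p \<in> E)} = ?k -` {E} \<inter> space (Cube n)"
      using E by (intro set_eqI) (auto 0 4 simp only: vimage_def Int_iff mem_Collect_eq Pow_iff singleton_iff)
    finally show "?k -` {E} \<inter> space (Cube n) \<in> sets (Cube n)" .
  qed auto
  obtain F where F: "\<And>x :: nat \<Rightarrow> real. part n x = F (?k x)" using part_kernel[of n] by metis
  show ?thesis unfolding F by (rule measurable_compose[OF k]) simp
qed

lemma finite_range_part: "finite (range (part n))"
proof -
  have "range (part n) \<subseteq> Pow (Pow {1..n})" by (auto simp: part_def)
  then show ?thesis by (rule finite_subset) simp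
qed

lemma part_fun_meas: "(\<lambda>x. h (part n x) :: real) \<in> borel_measurable (Cube n)"
  by (rule measurable_compose[OF part_measurable]) simp

lemma part_fun_finite: "finite ((\<lambda>x. h (part n x)) ` S)"
  using finite_subset[OF _ finite_imageI[OF finite_range_part[of n], of h], of "(\<lambda>x. h (part n x)) ` S"] by auto

lemma bm_part: "bm n (\<lambda>x. h (part n x))"
proof -
  have "finite ((\<lambda>x. \<bar>h (part n x)\<bar>) ` cube n)" by (rule part_fun_finite)
  then have "\<forall>x\<in>cube n. \<bar>h (part n x)\<bar> \<le> Max ((\<lambda>x. \<bar>h (part n x)\<bar>) ` cube n)" by auto
  then show ?thesis by (intro bmI part_fun_meas) auto
qed

text \<open>Copied points coincide exactly when the points they are copied from do; surjectivity of
  \<open>rK K\<close> ensures that no block is lost and none is empty.\<close>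

lemma part_R_map:
  assumes K: "K \<in> Ks n"
  shows "part n (R_map n K x) = pb (rK K) n (part (n - card K + 1) x)"
proof -
  have "part n (R_map n K x) = (\<lambda>i. {j\<in>{1..n}. x (rK K j) = x (rK K i)}) ` {1..n}"
    unfolding part_def R_map_rK by (intro image_cong refl) auto
  also have "\<dots> = (\<lambda>i'. {j\<in>{1..n}. x (rK K j) = x i'}) ` rK K ` {1..n}"
    by (simp add: image_image)
  also have "\<dots> = (\<lambda>i'. {j\<in>{1..n}. rK K j \<in> {j'\<in>{1..n - card K + 1}. x j' = x i'}}) ` {1..n - card K + 1}"
    unfolding rK_surj[OF K] by (intro image_cong refl) (use rK_range[OF K] in auto)
  finally show ?thesis by (simp add: pb_def part_def image_image)
qed

lemma pb_singles:
  assumes K: "K \<in> Ks n"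
  shows "pb (rK K) n (singles (n - card K + 1)) = coag ((\<lambda>i. {i}) ` K) (singles n)"
proof -
  have "pb (rK K) n (singles (n - card K + 1)) = (\<lambda>i'. {j\<in>{1..n}. rK K j = i'}) ` rK K ` {1..n}"
    unfolding rK_surj[OF K] by (simp add: pb_def singles_def image_image)
  also have "\<dots> = (\<lambda>i. {j\<in>{1..n}. rK K j = rK K i}) ` {1..n}" by (simp add: image_image)
  also have "\<dots> = (\<lambda>i. if i \<in> K then K else {i}) ` {1..n}"
    by (intro image_cong refl) (use rK_eq_iff[OF K] KsD(1)[OF K] in auto)
  also have "\<dots> = insert K ((\<lambda>i. {i}) ` ({1..n} - K))"
    using KsD(1,4)[OF K] by (auto simp: image_iff)
  also have "\<dots> = coag ((\<lambda>i. {i}) ` K) (singles n)"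
    unfolding coag_def singles_def by auto
  finally show ?thesis .
qed

lemma Js_image:
  assumes f: "inj_on f \<pi>"
  shows "Js (f ` \<pi>) = (\<lambda>J. f ` J) ` Js \<pi>"
proof (intro equalityI subsetI)
  fix J assume "J \<in> Js (f ` \<pi>)"
  then have J: "J \<subseteq> f ` \<pi>" "2 \<le> card J" by (auto simp: Js_def)
  then obtain J' where J': "J' \<subseteq> \<pi>" "J = f ` J'" by (meson subset_image_iff)
  then have "card J = card J'" using card_image[OF inj_on_subset[OF f J'(1)]] by simp
  then show "J \<in> (\<lambda>J. f ` J) ` Js \<pi>" using J J' by (auto simp: Js_def)
next
  fix J assume "J \<in> (\<lambda>J. f ` J) ` Js \<pi>"
  then obtain J' where J': "J' \<subseteq> \<pi>" "2 \<le> card J'" "J = f ` J'" by (auto simp: Js_def)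
  then show "J \<in> Js (f ` \<pi>)" using card_image[OF inj_on_subset[OF f J'(1)]] by (auto simp: Js_def)
qed

lemma inj_on_image_Js: "inj_on f \<pi> \<Longrightarrow> inj_on (\<lambda>J. f ` J) (Js \<pi>)"
  by (rule inj_on_subset[OF inj_on_image_Pow]) (auto simp: Js_def)

text \<open>Given \<open>x j\<close>, the coordinate \<open>x i\<close> equals it with probability
  \<open>emeasure \<mu> {x j}\<close>; integrating over \<open>x j\<close>, coincidences away from
  atoms have probability 0.\<close>

lemma repeated_coordinate_atom:
  assumes mu: "\<mu> \<in> M1" and ij: "i \<in> I" "j \<in> I" "i \<noteq> j"
  shows "AE x in (\<Pi>\<^sub>M i\<in>I. \<mu>). x i = x j \<longrightarrow> emeasure \<mu> {x j} > 0"
proof -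
  interpret prob_space \<mu> by (rule M1_D[OF mu])
  interpret product_sigma_finite "\<lambda>_. \<mu>" ..
  have sing: "{y} \<in> sets \<mu>" if "y \<in> {0..1}" for y using that by (simp add: M1_D[OF mu] unit_borel_in)
  let ?M = "\<Pi>\<^sub>M i\<in>{i,j}. \<mu>"
  let ?A = "{x \<in> space ?M. x i = x j \<and> emeasure \<mu> {x j} = 0}"
  have c: "(\<lambda>x. x k) \<in> borel_measurable ?M" if "k \<in> {i, j}" for k
  proof -
    have "(\<lambda>x. x k) \<in> ?M \<rightarrow>\<^sub>M \<mu>" using that by (rule measurable_component_singleton)
    moreover have "(\<lambda>x. x) \<in> \<mu> \<rightarrow>\<^sub>M borel"
      unfolding measurable_cong_sets[OF M1_D(1)[OF mu] refl] unit_borel_def by (rule measurable_restrict_space1) simp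
    ultimately show ?thesis by (rule measurable_compose)
  qed
  \<comment> \<open>There are countably many atoms, so being one is a Borel condition.\<close>
  have "countable {y. measure \<mu> {y} \<noteq> 0}" by (rule countable_support)
  then have "{y. measure \<mu> {y} \<noteq> 0} \<in> sets borel" by (rule sets.countable[rotated]) auto
  then have at: "- {y. measure \<mu> {y} \<noteq> 0} \<in> sets borel" by (rule borel_comp)
  have "{x \<in> space ?M. x i = x j} \<inter> ((\<lambda>x. x j) -` (- {y. measure \<mu> {y} \<noteq> 0}) \<inter> space ?M) \<in> sets ?M"
    by (intro sets.Int borel_measurable_eq c measurable_sets[OF c at]) auto
  also have "{x \<in> space ?M. x i = x j} \<inter> ((\<lambda>x. x j) -` (- {y. measure \<mu> {y} \<noteq> 0}) \<inter> space ?M) = ?A"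
    by (auto simp: emeasure_eq_measure)
  finally have A: "?A \<in> sets ?M" .
  have "emeasure ?M ?A = (\<integral>\<^sup>+x. indicator ?A x \<partial>?M)" using A by simp
  also have "\<dots> = (\<integral>\<^sup>+x. (\<integral>\<^sup>+y. indicator ?A (x(i := y)) \<partial>\<mu>) \<partial>(\<Pi>\<^sub>M i\<in>{j}. \<mu>))"
    using A ij by (intro product_nn_integral_insert) auto
  also have "\<dots> = (\<integral>\<^sup>+x. 0 \<partial>(\<Pi>\<^sub>M i\<in>{j}. \<mu>))"
  proof (rule nn_integral_cong)
    fix x assume "x \<in> space (\<Pi>\<^sub>M i\<in>{j}. \<mu>)"
    then have xj: "x j \<in> {0..1}" by (auto simp: space_PiM M1_D[OF mu] PiE_iff)
    show "(\<integral>\<^sup>+y. indicator ?A (x(i := y)) \<partial>\<mu>) = 0"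
    proof (cases "emeasure \<mu> {x j} = 0")
      case True
      have "(\<integral>\<^sup>+y. indicator ?A (x(i := y)) \<partial>\<mu>) \<le> (\<integral>\<^sup>+y. indicator {x j} y \<partial>\<mu>)"
        using ij by (intro nn_integral_mono) (auto simp: indicator_def)
      then show ?thesis using True sing[OF xj] by simp
    next
      case False
      then have "indicator ?A (x(i := y)) = (0 :: ennreal)" for y using ij by (simp add: indicator_def)
      then show ?thesis by simp
    qed
  qed
  finally have z: "emeasure ?M ?A = 0" by simp
  have "AE x in ?M. x i = x j \<longrightarrow> emeasure \<mu> {x j} > 0"
    by (rule AE_I[OF _ z A]) (auto simp: zero_less_iff_neq_zero)
  \<comment> \<open>Fubini was applied to the marginal on \<open>{i, j}\<close>; \<open>I\<close>
    itself may be infinite.\<close>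
  also have "?M = distr (\<Pi>\<^sub>M i\<in>I. \<mu>) ?M (\<lambda>\<omega>. \<lambda>n\<in>{i,j}. \<omega> n)"
    using distr_PiM_reindex[of I "\<lambda>_. \<mu>" "\<lambda>i. i" "{i,j}"] ij prob_space_axioms by auto
  finally have "AE x in distr (\<Pi>\<^sub>M i\<in>I. \<mu>) ?M (\<lambda>\<omega>. \<lambda>n\<in>{i,j}. \<omega> n). x i = x j \<longrightarrow> emeasure \<mu> {x j} > 0" .
  moreover have "(\<lambda>\<omega>. \<lambda>n\<in>{i,j}. \<omega> n) \<in> (\<Pi>\<^sub>M i\<in>I. \<mu>) \<rightarrow>\<^sub>M ?M"
    using ij by (intro measurable_restrict measurable_component_singleton) auto
  ultimately have "AE \<omega> in (\<Pi>\<^sub>M i\<in>I. \<mu>). (\<lambda>n\<in>{i,j}. \<omega> n) i = (\<lambda>n\<in>{i,j}. \<omega> n) j \<longrightarrow> emeasure \<mu> {(\<lambda>n\<in>{i,j}. \<omega> n) j} > 0"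
    by (rule AE_distrD[rotated])
  then show ?thesis by simp
qed

lemma unit_lebesgue_atomless: "emeasure unit_lebesgue {y} = 0"
proof (cases "y \<in> {0..1}")
  case True
  then show ?thesis by (simp add: unit_lebesgue_def emeasure_restrict_space)
next
  case False
  then have "{y} \<notin> sets unit_lebesgue"
    by (auto simp: M1_D[OF unit_lebesgue_M1] unit_borel_in)
  then show ?thesis by (rule emeasure_notin_sets)
qed

lemma unit_lebesgue_distinct:
  fixes n :: nat
  shows "AE x in (\<Pi>\<^sub>M i\<in>{1..n}. unit_lebesgue). inj_on x {1..n}"
proof -
  have "AE x in (\<Pi>\<^sub>M i\<in>{1..n}. unit_lebesgue). \<forall>i\<in>{1..n}. \<forall>j\<in>{1..n}. i \<noteq> j \<longrightarrow> x i \<noteq> x j"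
  proof (intro AE_finite_allI)
    fix i j assume ij: "i \<in> {1..n}" "j \<in> {1..n}"
    show "AE x in (\<Pi>\<^sub>M i\<in>{1..n}. unit_lebesgue). i \<noteq> j \<longrightarrow> x i \<noteq> x j"
    proof (cases "i = j")
      case False
      from repeated_coordinate_atom[OF unit_lebesgue_M1 ij False] show ?thesis
        by (simp add: unit_lebesgue_atomless)
    qed simp
  qed auto
  then show ?thesis by (rule eventually_mono) (auto simp: inj_on_def)
qed

lemma G_unit_lebesgue_part: "G_fun n (\<lambda>x. h (part n x)) unit_lebesgue = h (singles n)"
proof -
  have "G_fun n (\<lambda>x. h (part n x)) unit_lebesgue = (\<integral>x. h (singles n) \<partial>(\<Pi>\<^sub>M i\<in>{1..n}. unit_lebesgue))"
    unfolding G_fun_def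
  proof (rule integral_cong_AE)
    show "(\<lambda>x. h (part n x)) \<in> borel_measurable (\<Pi>\<^sub>M i\<in>{1..n}. unit_lebesgue)"
      unfolding measurable_cong_sets[OF sets_PM[OF unit_lebesgue_M1] refl] by (rule part_fun_meas)
    show "AE x in \<Pi>\<^sub>M i\<in>{1..n}. unit_lebesgue. h (part n x) = h (singles n)"
      using unit_lebesgue_distinct[of n] by eventually_elim (simp add: part_distinct)
  qed auto
  then show ?thesis using G_const[OF unit_lebesgue_M1, of n "h (singles n)"] by (simp add: G_fun_def)
qed

section \<open>Forward equation for the sampled partition\<close>

context fleming_viot
begin

text \<open>The generator of the \<open>\<Lambda>\<close>-coalescent.\<close>

definition Q :: "(nat set set \<Rightarrow> real) \<Rightarrow> nat set set \<Rightarrow> real" where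
  "Q h \<pi> = (\<Sum>J\<in>Js \<pi>. lam (card \<pi>) (card J) * (h (coag J \<pi>) - h \<pi>))"

text \<open>Pullback along the surjection \<open>rK K\<close> is injective on blocks and commutes
  with unions, so it preserves block counts, hence rates, and carries mergers to mergers.\<close>

lemma Q_pb:
  assumes K: "K \<in> Ks n" and pi: "\<And>B. B \<in> \<pi> \<Longrightarrow> B \<subseteq> {1..n - card K + 1}"
  shows "Q h (pb (rK K) n \<pi>) = Q (\<lambda>\<pi>. h (pb (rK K) n \<pi>)) \<pi>"
proof -
  let ?f = "\<lambda>B. {i\<in>{1..n}. rK K i \<in> B}"
  have inj: "inj_on ?f \<pi>"
  proof (rule inj_onI)
    fix B C assume B: "B \<in> \<pi>" "C \<in> \<pi>" "?f B = ?f C"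
    have *: "D = rK K ` ?f D" if "D \<subseteq> {1..n - card K + 1}" for D
      using that unfolding rK_surj[OF K, symmetric] by blast
    show "B = C" using *[OF pi[OF B(1)]] *[OF pi[OF B(2)]] B(3) by simp
  qed
  have coag: "coag (?f ` J) (?f ` \<pi>) = ?f ` coag J \<pi>" if "J \<in> Js \<pi>" for J
  proof -
    have J: "J \<subseteq> \<pi>" using that by (auto simp: Js_def)
    have "?f ` (\<pi> - J) = ?f ` \<pi> - ?f ` J"
      using inj_on_image_set_diff[OF inj, of \<pi> J] J by auto
    moreover have "\<Union> (?f ` J) = ?f (\<Union>J)" by auto
    ultimately show ?thesis unfolding coag_def by simp
  qed
  have cJ: "card (?f ` J) = card J" if "J \<in> Js \<pi>" for J
    using that by (intro card_image inj_on_subset[OF inj]) (auto simp: Js_def)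
  have cp: "card (?f ` \<pi>) = card \<pi>" by (rule card_image[OF inj])
  have "Q h (pb (rK K) n \<pi>) = (\<Sum>J\<in>Js (?f ` \<pi>). lam (card (?f ` \<pi>)) (card J) * (h (coag J (?f ` \<pi>)) - h (?f ` \<pi>)))"
    by (simp add: Q_def pb_def)
  also have "\<dots> = (\<Sum>J\<in>Js \<pi>. lam (card \<pi>) (card (?f ` J)) * (h (coag (?f ` J) (?f ` \<pi>)) - h (?f ` \<pi>)))"
    unfolding Js_image[OF inj] cp by (subst sum.reindex[OF inj_on_image_Js[OF inj]]) simp
  also have "\<dots> = (\<Sum>J\<in>Js \<pi>. lam (card \<pi>) (card J) * (h (?f ` coag J \<pi>) - h (?f ` \<pi>)))"
    by (intro sum.cong refl) (simp only: coag cJ)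
  finally show ?thesis by (simp only: Q_def pb_def)
qed

text \<open>At the partition into singletons the mergers of blocks are the sets \<open>K\<close>
  themselves, so \<open>Q\<close> takes the shape that \<open>A_fun\<close> produces.\<close>

lemma Q_singles:
  "Q h (singles n) = (\<Sum>K\<in>Ks n. lam n (card K) * (h (pb (rK K) n (singles (n - card K + 1))) - h (singles n)))"
proof -
  let ?f = "\<lambda>i::nat. {i}"
  have inj: "inj_on ?f {1..n}" by auto
  have KJ: "Ks n = Js {1..n}" by (simp add: Ks_def Js_def)
  have cp: "card (singles n) = n" unfolding singles_def by (subst card_image) auto
  have "Q h (singles n) = (\<Sum>J\<in>Js (?f ` {1..n}). lam n (card J) * (h (coag J (singles n)) - h (singles n)))"
    unfolding Q_def cp by (simp add: singles_def)
  also have "\<dots> = (\<Sum>K\<in>Ks n. lam n (card (?f ` K)) * (h (coag (?f ` K) (singles n)) - h (singles n)))"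
    unfolding Js_image[OF inj] KJ by (subst sum.reindex[OF inj_on_image_Js[OF inj]]) simp
  also have "\<dots> = (\<Sum>K\<in>Ks n. lam n (card K) * (h (pb (rK K) n (singles (n - card K + 1))) - h (singles n)))"
    by (intro sum.cong refl) (simp add: pb_singles card_image)
  finally show ?thesis .
qed

lemma V_part_R_map:
  assumes K: "K \<in> Ks n"
  shows "V n (\<lambda>x. h (part n (R_map n K x))) = V (n - card K + 1) (\<lambda>x. h (pb (rK K) n (part (n - card K + 1) x)))"
proof -
  have "G_fun n (\<lambda>x. h (part n (R_map n K x))) \<mu> = G_fun (n - card K + 1) (\<lambda>x. h (pb (rK K) n (part (n - card K + 1) x))) \<mu>"
    if "\<mu> \<in> M1" for \<mu>
    using G_R_map_reduce[OF that K bm_part[of n h]] by (simp add: part_R_map[OF K])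
  then show ?thesis unfolding V_def
    by (intro ext Bochner_Integration.integral_cong refl) (simp add: path_M1)
qed

lemma FVeq_part:
  assumes n: "1 \<le> n" and t: "t \<ge> 0"
  shows "V n (\<lambda>x. h (part n x)) t = h (singles n) + VI n (A_fun n (\<lambda>x. h (part n x))) t"
  using FVeq_finite_range[OF n part_fun_meas part_fun_finite, of h] t
  by (simp add: FVeq_def G_unit_lebesgue_part)

text \<open>With \<open>U = V n (Q h)\<close> and \<open>W = V n (A h)\<close>, the derivative of \<open>V n h\<close>: both \<open>U\<close> and \<open>W\<close> solve the
  equation obtained from the generator by inserting the induction hypothesis for fewer points, so
  their difference solves a homogeneous Volterra equation.\<close>

theorem duality:
  assumes "1 \<le> n" "t \<ge> 0"
  shows "V n (\<lambda>x. h (part n x)) t = h (singles n) + VI n (\<lambda>x. Q h (part n x)) t"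
  using assms
proof (induction n arbitrary: h t rule: less_induct)
  case (less n)
  note n = less.prems(1)
  let ?m = "\<lambda>K. n - card K + 1"
  let ?h = "\<lambda>x. h (part n x)" and ?q = "\<lambda>x. Q h (part n x)"
  let ?hp = "\<lambda>K \<pi>. h (pb (rK K) n \<pi>)"
  define c where "c = (\<Sum>K\<in>Ks n. lam n (card K))"
  define g where "g x = ?q x - A_fun n ?h x" for x
  have bh: "bm n ?h" "bm n ?q" and bA: "bm n (A_fun n ?h)" by (auto intro: bm_part bm_A)
  have bg: "bm n g" unfolding g_def by (intro bm_diff bh bA)
  have m: "?m K < n" "1 \<le> ?m K" if "K \<in> Ks n" for K using KsD(2,6)[OF that] by auto
  have VA: "V n (A_fun n ?h) s = (\<Sum>K\<in>Ks n. lam n (card K) * V (?m K) (\<lambda>x. ?hp K (part (?m K) x)) s) - c * V n ?h s" for s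
  proof -
    have "V n (A_fun n ?h) s = (\<Sum>K\<in>Ks n. V n (\<lambda>x. lam n (card K) * (?h (R_map n K x) - ?h x)) s)"
      unfolding A_fun_def by (intro V_sum finite_Ks bm_cmult bm_diff bm_R_map' bh)
    also have "\<dots> = (\<Sum>K\<in>Ks n. lam n (card K) * (V (?m K) (\<lambda>x. ?hp K (part (?m K) x)) s - V n ?h s))"
      by (intro sum.cong refl) (simp add: V_cmult V_diff bm_R_map'[OF bh(1)] bh V_part_R_map)
    finally show ?thesis by (simp add: right_diff_distrib sum_subtractf c_def sum_distrib_right)
  qed
  have U: "V n ?q s = Q h (singles n) + (\<Sum>K\<in>Ks n. lam n (card K) *
      (V (?m K) (\<lambda>x. ?hp K (part (?m K) x)) s - ?hp K (singles (?m K)))) - c * VI n ?q s" if s: "s \<ge> 0" for s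
  proof -
    \<comment> \<open>By \<open>Q_pb\<close> the integrand is \<open>Q\<close> of a pulled-back
      function on a smaller sample, where the induction hypothesis evaluates the time
      integral.\<close>
    have "VI n (\<lambda>x. ?q (R_map n K x)) s = V (?m K) (\<lambda>x. ?hp K (part (?m K) x)) s - ?hp K (singles (?m K))"
      if K: "K \<in> Ks n" for K
    proof -
      have "VI n (\<lambda>x. ?q (R_map n K x)) s = VI (?m K) (\<lambda>x. Q h (pb (rK K) n (part (?m K) x))) s"
        unfolding VI_def by (simp add: V_part_R_map[OF K])
      also have "\<dots> = VI (?m K) (\<lambda>x. Q (?hp K) (part (?m K) x)) s"
        by (rule arg_cong[where f="\<lambda>f. f s"], rule VI_cong, rule Q_pb[OF K part_subset])
      also have "\<dots> = V (?m K) (\<lambda>x. ?hp K (part (?m K) x)) s - ?hp K (singles (?m K))"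
        using less.IH[OF m[OF K] s, of "?hp K"] by simp
      finally show ?thesis .
    qed
    then have "VI n (A_fun n ?q) s = (\<Sum>K\<in>Ks n. lam n (card K) *
      (V (?m K) (\<lambda>x. ?hp K (part (?m K) x)) s - ?hp K (singles (?m K)) - VI n ?q s))"
      unfolding VI_A[OF bh(2)] by (intro sum.cong refl) simp
    then show ?thesis unfolding FVeq_part[OF n s, of "Q h"]
      by (simp add: right_diff_distrib sum_subtractf c_def sum_distrib_right)
  qed
  have vg: "V n g s = - c * (LINT r:{0..s}|lborel. V n g r)" if s: "s \<ge> 0" for s
  proof -
    have "V n g s = V n ?q s - V n (A_fun n ?h) s" unfolding g_def by (intro V_diff bh bA)
    \<comment> \<open>The terms for smaller samples cancel, and so do the initial values by
      \<open>Q_singles\<close>.\<close>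
    also have "\<dots> = - c * (VI n ?q s - VI n (A_fun n ?h) s)"
      unfolding U[OF s] VA FVeq_part[OF n s, of h] Q_singles
      by (simp add: algebra_simps sum_subtractf sum.distrib c_def sum_distrib_right sum_distrib_left)
    also have "VI n ?q s - VI n (A_fun n ?h) s = VI n g s"
      unfolding g_def by (intro VI_diff[symmetric] bh bA)
    finally show ?thesis by (simp add: VI_def)
  qed
  obtain B where B: "\<And>x. x \<in> cube n \<Longrightarrow> \<bar>g x\<bar> \<le> B" using bg by (auto simp: bm_def)
  have "V n g s = 0" if "s \<ge> 0" for s
    by (rule volterra_zero[OF V_meas[OF bg] V_abs_le[OF bg B] vg that])
  moreover have "V n g s = V n ?q s - V n (A_fun n ?h) s" for s unfolding g_def by (intro V_diff bh bA)
  ultimately have "V n ?q s = V n (A_fun n ?h) s" if "s \<ge> 0" for s using that by auto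
  then have "VI n ?q t = VI n (A_fun n ?h) t"
    unfolding VI_def by (intro set_lebesgue_integral_cong) auto
  then show ?case using FVeq_part[OF n less.prems(2), of h] by simp
qed

end

section \<open>Infinite samples\<close>

definition seqs :: "real measure \<Rightarrow> (nat \<Rightarrow> real) measure" where
  "seqs \<mu> = (\<Pi>\<^sub>M i\<in>(UNIV :: nat set). \<mu>)"

definition dustmass :: "real measure \<Rightarrow> real" where
  "dustmass \<mu> = measure \<mu> ({0..1} - atoms \<mu>)"

text \<open>Collects the almost sure properties of a sample from which the later limits are deduced
  sequence by sequence. Hits are required beyond every \<open>n\<close>, in particular at indices
  from 1 on, where \<open>part\<close> begins.\<close>

definition typical :: "real measure \<Rightarrow> (nat \<Rightarrow> real) \<Rightarrow> bool" where
  "typical \<mu> X \<longleftrightarrow> (\<forall>i j. i \<noteq> j \<longrightarrow> X i = X j \<longrightarrow> X i \<in> atoms \<mu>) \<and>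
     (\<forall>a\<in>atoms \<mu>. \<forall>n. \<exists>i>n. X i = a) \<and>
     (if dustmass \<mu> > 0 then \<forall>n. \<exists>i>n. X i \<notin> atoms \<mu> else \<forall>i. X i \<in> atoms \<mu>)"

lemma atoms_unit: "\<mu> \<in> M1 \<Longrightarrow> atoms \<mu> = {x\<in>{0..1}. emeasure \<mu> {x} > 0}"
  by (simp add: atoms_def M1_D)

lemma countable_atoms:
  assumes "\<mu> \<in> M1" shows "countable (atoms \<mu>)"
proof -
  interpret prob_space \<mu> by (rule M1_D[OF assms])
  have "countable {x. measure \<mu> {x} \<noteq> 0}" by (rule countable_support)
  then show ?thesis by (rule countable_subset[rotated]) (auto simp: atoms_def emeasure_eq_measure)
qed

lemma sets_atoms: "\<mu> \<in> M1 \<Longrightarrow> A \<subseteq> atoms \<mu> \<Longrightarrow> A \<in> sets unit_borel"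
  using countable_subset[OF _ countable_atoms] sets.countable[of A borel]
  by (auto simp: unit_borel_in atoms_unit)

lemma sets_nonatoms: "\<mu> \<in> M1 \<Longrightarrow> {0..1} - atoms \<mu> \<in> sets \<mu>"
  using sets_atoms[of \<mu> "atoms \<mu>"] by (auto simp: M1_D unit_borel_in intro!: sets.Diff)

lemma dustmass_nonneg: "dustmass \<mu> \<ge> 0"
  by (simp add: dustmass_def)

lemma prob_seqs: "\<mu> \<in> M1 \<Longrightarrow> prob_space (seqs \<mu>)"
  unfolding seqs_def by (intro prob_space_PiM) (auto dest: M1_D)

lemma seqs_component: "(\<lambda>X. X i) \<in> seqs \<mu> \<rightarrow>\<^sub>M \<mu>"
  unfolding seqs_def by (rule measurable_component_singleton) simp

lemma space_seqs: "\<mu> \<in> M1 \<Longrightarrow> X \<in> space (seqs \<mu>) \<Longrightarrow> X i \<in> {0..1}"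
  by (auto simp: seqs_def space_PiM M1_D PiE_iff)

text \<open>The first \<open>k\<close> points after index \<open>n\<close> all miss \<open>B\<close>
  with probability \<open>q ^ k\<close>, where \<open>q < 1\<close>.\<close>

lemma hits_infinitely_often:
  assumes mu: "\<mu> \<in> M1" and B: "B \<in> sets \<mu>" "emeasure \<mu> B > 0"
  shows "AE X in seqs \<mu>. \<exists>i>n. X i \<in> B"
proof -
  interpret prob_space \<mu> by (rule M1_D[OF mu])
  interpret S: product_prob_space "\<lambda>_. \<mu>" "UNIV :: nat set" by unfold_locales
  define q where "q = measure \<mu> (space \<mu> - B)"
  have q: "0 \<le> q" "q < 1"
    using B prob_compl[OF B(1)] by (auto simp: q_def emeasure_eq_measure)
  define N where "N k = {X\<in>space (seqs \<mu>). \<forall>i\<in>{n<..n+k}. X i \<in> space \<mu> - B}" for k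
  have N: "N k \<in> sets (seqs \<mu>)" "emeasure (seqs \<mu>) (N k) = ennreal (q ^ k)" for k
  proof -
    show "N k \<in> sets (seqs \<mu>)" unfolding N_def
    proof (rule sets.sets_Collect_finite_All)
      fix i
      show "{X\<in>space (seqs \<mu>). X i \<in> space \<mu> - B} \<in> sets (seqs \<mu>)"
        using measurable_sets[OF seqs_component[of i \<mu>], of "space \<mu> - B"] B(1)
        by (simp add: vimage_def Int_def conj_commute)
    qed simp
    have "emeasure (seqs \<mu>) (N k) = (\<Prod>i\<in>{n<..n+k}. emeasure \<mu> (space \<mu> - B))"
      unfolding N_def seqs_def using B by (intro S.emeasure_PiM_Collect) auto
    also have "\<dots> = ennreal (q ^ k)" using q by (simp add: emeasure_eq_measure q_def ennreal_power)
    finally show "emeasure (seqs \<mu>) (N k) = ennreal (q ^ k)" .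
  qed
  have I: "(\<Inter>k. N k) \<in> sets (seqs \<mu>)" using N by auto
  have "emeasure (seqs \<mu>) (\<Inter>k. N k) \<le> ennreal (q ^ k)" for k
    unfolding N(2)[symmetric] by (intro emeasure_mono N) auto
  moreover have "(\<lambda>k. ennreal (q ^ k)) \<longlonglongrightarrow> ennreal 0"
    using q by (intro tendsto_ennrealI LIMSEQ_realpow_zero)
  ultimately have "emeasure (seqs \<mu>) (\<Inter>k. N k) \<le> ennreal 0"
    by (intro LIMSEQ_le_const) auto
  then have z: "emeasure (seqs \<mu>) (\<Inter>k. N k) = 0" by simp
  show ?thesis
  proof (rule AE_I[OF _ z I], safe)
    fix X k assume X: "X \<in> space (seqs \<mu>)" "\<not> (\<exists>i>n. X i \<in> B)"
    then have "X i \<in> space \<mu> - B" if "i > n" for i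
      using that measurable_space[OF seqs_component X(1)] by auto
    then show "X \<in> N k" using X by (auto simp: N_def)
  qed
qed

lemma AE_typical:
  assumes mu: "\<mu> \<in> M1"
  shows "AE X in seqs \<mu>. typical \<mu> X"
proof -
  have mem: "AE X in seqs \<mu>. \<forall>i. X i \<in> {0..1}"
    using space_seqs[OF mu] by (intro AE_I2) auto
  have rep: "AE X in seqs \<mu>. \<forall>i j. i \<noteq> j \<longrightarrow> X i = X j \<longrightarrow> emeasure \<mu> {X j} > 0"
    unfolding AE_all_countable
  proof (intro allI)
    fix i j :: nat
    show "AE X in seqs \<mu>. i \<noteq> j \<longrightarrow> X i = X j \<longrightarrow> emeasure \<mu> {X j} > 0"
      unfolding seqs_def by (cases "i = j") (auto intro!: repeated_coordinate_atom[OF mu])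
  qed
  have at: "AE X in seqs \<mu>. \<forall>a\<in>atoms \<mu>. \<forall>n. \<exists>i>n. X i = a"
    unfolding AE_ball_countable[OF countable_atoms[OF mu]] AE_all_countable
  proof (intro ballI allI)
    fix a n assume a: "a \<in> atoms \<mu>"
    then have "{a} \<in> sets \<mu>" using sets_atoms[OF mu, of "{a}"] by (simp add: M1_D[OF mu])
    then show "AE X in seqs \<mu>. \<exists>i>n. X i = a"
      using hits_infinitely_often[OF mu, of "{a}" n] a by (simp add: atoms_def)
  qed
  have dust: "AE X in seqs \<mu>. if dustmass \<mu> > 0 then \<forall>n. \<exists>i>n. X i \<notin> atoms \<mu> else \<forall>i. X i \<in> atoms \<mu>"
  proof (cases "dustmass \<mu> > 0")
    case True
    interpret prob_space \<mu> by (rule M1_D[OF mu])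
    have "AE X in seqs \<mu>. \<forall>n. \<exists>i>n. X i \<in> {0..1} - atoms \<mu>"
      unfolding AE_all_countable
      using True by (intro allI hits_infinitely_often[OF mu] sets_nonatoms[OF mu])
        (simp add: dustmass_def emeasure_eq_measure)
    then show ?thesis using True by simp (auto elim: eventually_mono)
  next
    case False
    interpret prob_space \<mu> by (rule M1_D[OF mu])
    interpret S: product_prob_space "\<lambda>_. \<mu>" "UNIV :: nat set" by unfold_locales
    have "measure \<mu> ({0..1} - atoms \<mu>) = 0" using False dustmass_nonneg[of \<mu>] unfolding dustmass_def by linarith
    then have "AE x in \<mu>. x \<in> atoms \<mu>"
      by (intro AE_I[where N="{0..1} - atoms \<mu>"] sets_nonatoms[OF mu]) (auto simp: M1_D[OF mu] emeasure_eq_measure)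
    then have "AE X in seqs \<mu>. X i \<in> atoms \<mu>" for i
      unfolding seqs_def using AE_PiM_component[of UNIV "\<lambda>_. \<mu>" i "\<lambda>x. x \<in> atoms \<mu>"] prob_space_axioms by auto
    then show ?thesis using False by (simp add: AE_all_countable)
  qed
  from mem rep at dust show ?thesis
  proof eventually_elim
    case (elim X)
    have "X i \<in> atoms \<mu>" if "i \<noteq> j" "X i = X j" for i j
      using elim(1,2) that by (auto simp: atoms_unit[OF mu])
    with elim(3,4) show ?case by (auto simp: typical_def)
  qed
qed

text \<open>Puts all sample sizes on one sequence space; only then can the behaviour of
  \<open>part n X\<close> for growing \<open>n\<close> be studied pointwise.\<close>

lemma G_seqs:
  assumes mu: "\<mu> \<in> M1"
  shows "G_fun n (\<lambda>x. h (part n x)) \<mu> = (\<integral>X. h (part n X) \<partial>seqs \<mu>)"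
proof -
  have "G_fun n (\<lambda>x. h (part n x)) \<mu> = (\<integral>X. h (part n (\<lambda>i\<in>{1..n}. X i)) \<partial>seqs \<mu>)"
    unfolding seqs_def by (rule PM_reindex[OF mu, symmetric]) (auto intro: part_fun_meas)
  also have "\<dots> = (\<integral>X. h (part n X) \<partial>seqs \<mu>)"
    by (intro Bochner_Integration.integral_cong refl arg_cong[where f=h] part_cong) auto
  finally show ?thesis .
qed

lemma part_seqs_meas:
  assumes mu: "\<mu> \<in> M1"
  shows "(\<lambda>X. h (part n X) :: real) \<in> borel_measurable (seqs \<mu>)"
proof -
  have "(\<lambda>X. \<lambda>i\<in>{1..n}. X i) \<in> seqs \<mu> \<rightarrow>\<^sub>M (\<Pi>\<^sub>M i\<in>{1..n}. \<mu>)"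
    by (intro measurable_restrict seqs_component)
  then have "(\<lambda>X. \<lambda>i\<in>{1..n}. X i) \<in> seqs \<mu> \<rightarrow>\<^sub>M Cube n"
    using measurable_cong_sets[OF refl sets_PM[OF mu]] by blast
  from measurable_compose[OF this part_fun_meas[of h n]]
  have "(\<lambda>X. h (part n (\<lambda>i\<in>{1..n}. X i))) \<in> borel_measurable (seqs \<mu>)" .
  moreover have "part n (\<lambda>i\<in>{1..n}. X i) = part n X" for X :: "nat \<Rightarrow> real" by (intro part_cong) auto
  ultimately show ?thesis by simp
qed

lemma G_seqs_lim:
  assumes mu: "\<mu> \<in> M1" and B: "\<And>n \<pi>. \<bar>h n \<pi>\<bar> \<le> (B::real)"
    and L: "L \<in> borel_measurable (seqs \<mu>)"
    and lim: "\<And>X. typical \<mu> X \<Longrightarrow> (\<lambda>n. h n (part n X)) \<longlonglongrightarrow> L X"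
  shows "(\<lambda>n. G_fun n (\<lambda>x. h n (part n x)) \<mu>) \<longlonglongrightarrow> (\<integral>X. L X \<partial>seqs \<mu>)"
  unfolding G_seqs[OF mu]
proof (rule integral_dominated_convergence[where w="\<lambda>_. B"])
  interpret prob_space "seqs \<mu>" by (rule prob_seqs[OF mu])
  show "integrable (seqs \<mu>) (\<lambda>_. B)" by simp
  show "AE X in seqs \<mu>. (\<lambda>n. h n (part n X)) \<longlonglongrightarrow> L X"
    using AE_typical[OF mu] by eventually_elim (rule lim)
qed (auto intro: L part_seqs_meas[OF mu] simp: B)

lemma G_seqs_lim_const:
  assumes mu: "\<mu> \<in> M1" and B: "\<And>n \<pi>. \<bar>h n \<pi>\<bar> \<le> (B::real)"
    and lim: "\<And>X. typical \<mu> X \<Longrightarrow> (\<lambda>n. h n (part n X)) \<longlonglongrightarrow> c"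
  shows "(\<lambda>n. G_fun n (\<lambda>x. h n (part n x)) \<mu>) \<longlonglongrightarrow> c"
proof -
  interpret prob_space "seqs \<mu>" by (rule prob_seqs[OF mu])
  show ?thesis using G_seqs_lim[OF mu, of h B "\<lambda>_. c"] B lim prob_space by simp
qed

section \<open>Block counts of a typical sample\<close>

definition num_nonsingles :: "'b set set \<Rightarrow> nat" where "num_nonsingles \<pi> = card {B\<in>\<pi>. 2 \<le> card B}"

definition num_singles :: "'b set set \<Rightarrow> nat" where "num_singles \<pi> = card {B\<in>\<pi>. card B = 1}"

lemma card_part: "card (part n X) = card (X ` {1..n})"
proof -
  have "part n X = (\<lambda>a. {j\<in>{1..n}. X j = a}) ` X ` {1..n}" by (simp add: part_def image_image)
  moreover have "inj_on (\<lambda>a. {j\<in>{1..n}. X j = a}) (X ` {1..n})"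
  proof (rule inj_onI)
    fix a b assume ab: "a \<in> X ` {1..n}" "{j\<in>{1..n}. X j = a} = {j\<in>{1..n}. X j = b}"
    then obtain i where i: "i \<in> {1..n}" "X i = a" by blast
    then have "i \<in> {j\<in>{1..n}. X j = b}" unfolding ab(2)[symmetric] by blast
    then show "a = b" using i by simp
  qed
  ultimately show ?thesis by (simp add: card_image)
qed

lemma singleton_in_part: "{i} \<in> part n X \<longleftrightarrow> i \<in> {1..n} \<and> (\<forall>j\<in>{1..n}. X j = X i \<longrightarrow> j = i)"
proof
  assume "{i} \<in> part n X"
  then obtain k where k: "{i} = {j\<in>{1..n}. X j = X k}" "k \<in> {1..n}" unfolding part_def by (rule imageE)
  then have "k \<in> {i}" unfolding k(1) by simp
  then have ki: "k = i" by simp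
  have "j = i" if "j \<in> {1..n}" "X j = X i" for j
  proof -
    have "j \<in> {i}" unfolding k(1) using that ki by simp
    then show ?thesis by simp
  qed
  then show "i \<in> {1..n} \<and> (\<forall>j\<in>{1..n}. X j = X i \<longrightarrow> j = i)" using k(2) ki by blast
next
  assume *: "i \<in> {1..n} \<and> (\<forall>j\<in>{1..n}. X j = X i \<longrightarrow> j = i)"
  then have "{j\<in>{1..n}. X j = X i} = {i}" by auto
  then show "{i} \<in> part n X" unfolding part_def using * by (intro image_eqI[where x=i]) simp_all
qed

text \<open>A block with two elements sits at a repeated value, hence is the set of labels of some
  atom.\<close>

lemma num_nonsingles_le:
  assumes "typical \<mu> X" "finite (atoms \<mu>)"
  shows "num_nonsingles (part n X) \<le> card (atoms \<mu>)"
proof -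
  have "{B\<in>part n X. 2 \<le> card B} \<subseteq> (\<lambda>a. {j\<in>{1..n}. X j = a}) ` atoms \<mu>"
  proof safe
    fix B assume B: "B \<in> part n X" "2 \<le> card B"
    then obtain i where i: "B = {j\<in>{1..n}. X j = X i}" "i \<in> {1..n}" unfolding part_def by (elim imageE)
    have "\<not> B \<subseteq> {i}" using B(2) card_mono[of "{i}" B] by auto
    then obtain j where "j \<noteq> i" "X j = X i" using i by auto
    then have "X i \<in> atoms \<mu>" using assms(1) unfolding typical_def by metis
    then show "B \<in> (\<lambda>a. {j\<in>{1..n}. X j = a}) ` atoms \<mu>" using i(1) by (rule rev_image_eqI)
  qed
  then have "num_nonsingles (part n X) \<le> card ((\<lambda>a. {j\<in>{1..n}. X j = a}) ` atoms \<mu>)"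
    unfolding num_nonsingles_def by (intro card_mono finite_imageI assms)
  also have "\<dots> \<le> card (atoms \<mu>)" by (rule card_image_le[OF assms(2)])
  finally show ?thesis .
qed

text \<open>From some \<open>n\<close> on every atom of the finite set \<open>A\<close> has been
  sampled twice.\<close>

lemma num_nonsingles_ge:
  assumes X: "typical \<mu> X" and A: "finite A" "A \<subseteq> atoms \<mu>"
  shows "eventually (\<lambda>n. card A \<le> num_nonsingles (part n X)) sequentially"
proof -
  have "eventually (\<lambda>n. \<exists>i\<in>{1..n}. \<exists>j\<in>{1..n}. i \<noteq> j \<and> X i = a \<and> X j = a) sequentially" if "a \<in> A" for a
  proof -
    have a: "\<forall>n. \<exists>i>n. X i = a" using X that A by (auto simp: typical_def)
    then obtain i where i: "i > 0" "X i = a" by blast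
    from a obtain j where j: "j > i" "X j = a" by blast
    show ?thesis using i j
      by (intro eventually_sequentiallyI[of j] bexI[of _ i] bexI[of _ j]) auto
  qed
  then have "eventually (\<lambda>n. \<forall>a\<in>A. \<exists>i\<in>{1..n}. \<exists>j\<in>{1..n}. i \<noteq> j \<and> X i = a \<and> X j = a) sequentially"
    using A by (intro eventually_ball_finite) auto
  then show ?thesis
  proof eventually_elim
    case (elim n)
    let ?f = "\<lambda>a. {j\<in>{1..n}. X j = a}"
    have "inj_on ?f A"
    proof (rule inj_onI)
      fix a b assume "a \<in> A" "b \<in> A" "?f a = ?f b"
      moreover obtain i where i: "i \<in> {1..n}" "X i = a" using elim \<open>a \<in> A\<close> by blast
      ultimately have "i \<in> ?f b" by blast
      then show "a = b" using i by simp
    qed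
    then have "card A = card (?f ` A)" by (simp add: card_image)
    also have "\<dots> \<le> card {B\<in>part n X. 2 \<le> card B}"
    proof (intro card_mono)
      show "?f ` A \<subseteq> {B\<in>part n X. 2 \<le> card B}"
      proof safe
        fix a assume "a \<in> A"
        then obtain i j where ij: "i \<in> {1..n}" "j \<in> {1..n}" "i \<noteq> j" "X i = a" "X j = a" using elim by blast
        show "?f a \<in> part n X" unfolding part_def by (rule image_eqI[where x=i]) (use ij in simp_all)
        have "card {i, j} \<le> card (?f a)" using ij by (intro card_mono) auto
        then show "2 \<le> card (?f a)" using ij by simp
      qed
    qed (simp add: finite_part)
    finally show ?case by (simp add: num_nonsingles_def)
  qed
qed

lemma num_nonsingles_infinite:
  assumes "typical \<mu> X" "infinite (atoms \<mu>)"
  shows "eventually (\<lambda>n. M \<le> num_nonsingles (part n X)) sequentially"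
proof -
  obtain A where "finite A" "card A = M" "A \<subseteq> atoms \<mu>"
    using infinite_arbitrarily_large[OF assms(2)] by blast
  then show ?thesis using num_nonsingles_ge[OF assms(1), of A] by simp
qed

lemma num_nonsingles_finite:
  assumes "typical \<mu> X" "finite (atoms \<mu>)"
  shows "eventually (\<lambda>n. num_nonsingles (part n X) = card (atoms \<mu>)) sequentially"
  using num_nonsingles_ge[OF assms(1,2) order_refl] by eventually_elim (use num_nonsingles_le[OF assms] in \<open>auto intro: antisym\<close>)

text \<open>Points outside the atoms are never repeated, so their labels remain singletons for all
  larger \<open>n\<close>.\<close>

lemma num_singles_dust:
  assumes X: "typical \<mu> X" and d: "dustmass \<mu> > 0"
  shows "eventually (\<lambda>n. M \<le> num_singles (part n X)) sequentially"
proof -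
  let ?I = "{i. 0 < i \<and> X i \<notin> atoms \<mu>}"
  have "infinite ?I"
    unfolding infinite_nat_iff_unbounded
  proof
    fix m
    have "\<forall>n. \<exists>i>n. X i \<notin> atoms \<mu>" using X d by (simp add: typical_def)
    then obtain i where "i > m" "X i \<notin> atoms \<mu>" by blast
    then show "\<exists>i>m. i \<in> ?I" by auto
  qed
  then obtain I where I: "finite I" "card I = M" "I \<subseteq> ?I"
    using infinite_arbitrarily_large by blast
  show ?thesis
  proof (rule eventually_sequentiallyI[of "Max (insert 0 I)"])
    fix n assume n: "Max (insert 0 I) \<le> n"
    have "card ((\<lambda>i. {i}) ` I) \<le> card {B\<in>part n X. card B = 1}"
    proof (intro card_mono)
      show "(\<lambda>i. {i}) ` I \<subseteq> {B\<in>part n X. card B = 1}"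
      proof safe
        fix i assume i: "i \<in> I"
        then have "i \<in> {1..n}" using n I by auto
        moreover have "j = i" if "X j = X i" for j
          using that X i I unfolding typical_def by auto
        ultimately show "{i} \<in> part n X" unfolding singleton_in_part by blast
      qed simp
    qed (simp add: finite_part)
    also have "card ((\<lambda>i. {i}) ` I) = M" using I by (simp add: card_image)
    finally show "M \<le> num_singles (part n X)" by (simp add: num_singles_def)
  qed
qed

lemma num_singles_le_card: "finite \<pi> \<Longrightarrow> num_singles \<pi> \<le> card \<pi>"
  unfolding num_singles_def by (intro card_mono) auto

lemma num_nonsingles_le_card: "finite \<pi> \<Longrightarrow> num_nonsingles \<pi> \<le> card \<pi>"
  unfolding num_nonsingles_def by (intro card_mono) auto

lemma card_part_infinite:
  assumes X: "typical \<mu> X" and d: "dustmass \<mu> > 0 \<or> infinite (atoms \<mu>)"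
  shows "eventually (\<lambda>n. M \<le> card (part n X)) sequentially"
  using d
proof
  assume "dustmass \<mu> > 0"
  from num_singles_dust[OF X this, of M] show ?thesis
    by eventually_elim (use num_singles_le_card[OF finite_part] order_trans in blast)
next
  assume "infinite (atoms \<mu>)"
  from num_nonsingles_infinite[OF X this, of M] show ?thesis
    by eventually_elim (use num_nonsingles_le_card[OF finite_part] order_trans in blast)
qed

lemma card_part_finite:
  assumes X: "typical \<mu> X" and d: "\<not> dustmass \<mu> > 0" and f: "finite (atoms \<mu>)"
  shows "card (part n X) \<le> card (atoms \<mu>)"
  unfolding card_part using X d by (intro card_mono f) (auto simp: typical_def)

lemma singleton_dust:
  assumes X: "typical \<mu> X" and i: "X i \<notin> atoms \<mu>" "1 \<le> i" "i \<le> n"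
  shows "{i} \<in> part n X"
  unfolding singleton_in_part using assms unfolding typical_def by auto

lemma singleton_atom:
  assumes X: "typical \<mu> X" and i: "X i \<in> atoms \<mu>"
  shows "eventually (\<lambda>n. {i} \<notin> part n X) sequentially"
proof -
  obtain j where j: "j > i" "X j = X i" using X i unfolding typical_def by blast
  show ?thesis
    by (rule eventually_sequentiallyI[of j]) (use j in \<open>auto simp: singleton_in_part\<close>)
qed

section \<open>Passage from n points to functionals of the random measure\<close>

context fleming_viot
begin

definition E_fun :: "(real measure \<Rightarrow> real) \<Rightarrow> real \<Rightarrow> real" where
  "E_fun l s = (\<integral>\<omega>. l (path (s, \<omega>)) \<partial>P)"

text \<open>Two dominated convergences, in chance and in time. Measurability of the limit functional
  along the path comes out of the convergence.\<close>

lemma V_seqs_lim: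
  assumes lim: "\<And>\<mu>. \<mu> \<in> M1 \<Longrightarrow> (\<lambda>n. G_fun n (\<lambda>x. h n (part n x)) \<mu>) \<longlonglongrightarrow> l \<mu>"
    and B: "\<And>n \<pi>. \<bar>h n \<pi>\<bar> \<le> B"
  shows "integrable P (\<lambda>\<omega>. l (path (s, \<omega>)))"
    and "(\<lambda>n. V n (\<lambda>x. h n (part n x)) s) \<longlonglongrightarrow> E_fun l s"
    and "(\<lambda>n. VI n (\<lambda>x. h n (part n x)) t) \<longlonglongrightarrow> (LINT s:{0..t}|lborel. E_fun l s)"
    and "set_integrable lborel {0..t} (E_fun l)"
proof -
  have bG: "\<bar>G_fun n (\<lambda>x. h n (part n x)) \<mu>\<bar> \<le> B" if "\<mu> \<in> M1" for n \<mu>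
    by (rule G_abs_le[OF that bm_part]) (rule B)
  have m: "(\<lambda>\<omega>. l (path (s, \<omega>))) \<in> borel_measurable P" for s
    by (rule borel_measurable_LIMSEQ_real[OF lim[OF path_M1] G_path_meas1[OF bm_part]])
  have b: "\<bar>l \<mu>\<bar> \<le> B" if "\<mu> \<in> M1" for \<mu>
    using bG[OF that] tendsto_rabs[OF lim[OF that]] by (intro LIMSEQ_le_const2) auto
  show "integrable P (\<lambda>\<omega>. l (path (s, \<omega>)))"
    by (intro P.integrable_const_bound[where B=B] m AE_I2) (simp add: b path_M1)
  have c: "(\<lambda>n. V n (\<lambda>x. h n (part n x)) s) \<longlonglongrightarrow> E_fun l s" for s
    unfolding V_def E_fun_def
  proof (rule integral_dominated_convergence[where w="\<lambda>_. B"])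
    show "AE \<omega> in P. (\<lambda>n. G_fun n (\<lambda>x. h n (part n x)) (path (s, \<omega>))) \<longlonglongrightarrow> l (path (s, \<omega>))"
      by (intro AE_I2 lim path_M1)
    show "AE \<omega> in P. norm (G_fun n (\<lambda>x. h n (part n x)) (path (s, \<omega>))) \<le> B" for n
      unfolding real_norm_def by (intro AE_I2 bG path_M1)
  qed (auto intro: m G_path_meas1 bm_part)
  then show "(\<lambda>n. V n (\<lambda>x. h n (part n x)) s) \<longlonglongrightarrow> E_fun l s" .
  have bV: "\<bar>V n (\<lambda>x. h n (part n x)) s\<bar> \<le> B" for n s by (rule V_abs_le[OF bm_part]) (rule B)
  have Em: "E_fun l \<in> borel_measurable borel"
    by (rule borel_measurable_LIMSEQ_real[OF c V_meas[OF bm_part]])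
  have bE: "\<bar>E_fun l s\<bar> \<le> B" for s
    by (rule LIMSEQ_le_const2[OF tendsto_rabs[OF c]]) (use bV in blast)
  show "(\<lambda>n. VI n (\<lambda>x. h n (part n x)) t) \<longlonglongrightarrow> (LINT s:{0..t}|lborel. E_fun l s)"
    unfolding VI_def set_lebesgue_integral_def
  proof (rule integral_dominated_convergence[where w="\<lambda>s. indicator {0..t} s * B"])
    show "AE s in lborel. (\<lambda>n. indicat_real {0..t} s *\<^sub>R V n (\<lambda>x. h n (part n x)) s) \<longlonglongrightarrow> indicat_real {0..t} s *\<^sub>R E_fun l s"
      by (intro AE_I2 tendsto_intros c)
    show "AE s in lborel. norm (indicat_real {0..t} s *\<^sub>R V n (\<lambda>x. h n (part n x)) s) \<le> indicator {0..t} s * B" for n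
      using bV[of n] by (intro AE_I2) (auto simp: indicator_def)
    show "integrable lborel (\<lambda>s. indicator {0..t} s * B)"
      by (intro integrable_mult_left integrable_real_indicator) (auto simp: emeasure_lborel_Icc_eq)
    show "(\<lambda>s. indicat_real {0..t} s *\<^sub>R E_fun l s) \<in> borel_measurable lborel" using Em by simp
    show "(\<lambda>s. indicat_real {0..t} s *\<^sub>R V n (\<lambda>x. h n (part n x)) s) \<in> borel_measurable lborel" for n
      using V_meas[OF bm_part, of n "h n"] by simp
  qed
  show "set_integrable lborel {0..t} (E_fun l)" unfolding set_integrable_def
    using Em bE by (intro integrableI_bounded_set_indicator[where B=B]) (auto simp: emeasure_lborel_Icc_eq)
qed

end

section \<open>Merger rates\<close>

text \<open>Identities for \<open>ow\<close> are derived after multiplication by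
  \<open>x\<^sup>2\<close>, which says nothing at 0; continuity supplies that point, where \<Lambda>
  may have mass.\<close>

lemma eq_at_zero:
  fixes f g :: "real \<Rightarrow> real"
  assumes "continuous_on UNIV f" "continuous_on UNIV g" and eq: "\<And>x. x \<noteq> 0 \<Longrightarrow> f x = g x"
  shows "f x = g x"
proof (cases "x = 0")
  case True
  have "isCont f 0" "isCont g 0" using assms(1,2) by (simp_all add: continuous_on_eq_continuous_at)
  then have "(f \<longlongrightarrow> f 0) (at 0)" "(g \<longlongrightarrow> g 0) (at 0)" by (simp_all add: isCont_def)
  moreover have "(f \<longlongrightarrow> g 0) (at 0)"
    using \<open>(g \<longlongrightarrow> g 0) (at 0)\<close> by (rule Lim_transform_eventually) (auto simp: eventually_at_filter eq)
  ultimately show ?thesis using True tendsto_unique[of "at (0::real)"] by auto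
qed (rule eq)

lemma sum_Pow_card:
  assumes "finite V"
  shows "(\<Sum>J\<in>Pow V. \<phi> (card J)) = (\<Sum>k\<le>card V. real (card V choose k) * \<phi> k)"
proof -
  have "(\<Sum>J\<in>Pow V. \<phi> (card J)) = (\<Sum>k\<le>card V. \<Sum>J | J \<in> Pow V \<and> card J = k. \<phi> (card J))"
    by (rule sum.group[symmetric]) (use assms in \<open>auto intro: card_mono\<close>)
  also have "\<dots> = (\<Sum>k\<le>card V. real (card V choose k) * \<phi> k)"
  proof (intro sum.cong refl)
    fix k
    have "(\<Sum>J | J \<in> Pow V \<and> card J = k. \<phi> (card J)) = (\<Sum>J | J \<in> Pow V \<and> card J = k. \<phi> k)"
      by (intro sum.cong) auto
    also have "\<dots> = real (card V choose k) * \<phi> k" using n_subsets[OF assms, of k] by (simp add: Pow_def)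
    finally show "(\<Sum>J | J \<in> Pow V \<and> card J = k. \<phi> (card J)) = real (card V choose k) * \<phi> k" .
  qed
  finally show ?thesis .
qed

lemma JsD: "J \<in> Js V \<Longrightarrow> J \<subseteq> V \<and> 2 \<le> card J"
  by (simp add: Js_def)

lemma Js_card_le: "finite V \<Longrightarrow> J \<in> Js V \<Longrightarrow> card J \<le> card V"
  by (auto dest: JsD intro: card_mono)

lemma sum_Js_Pow:
  fixes f :: "'b set \<Rightarrow> real"
  assumes "finite V"
  shows "(\<Sum>J\<in>Js V. f J) = (\<Sum>J\<in>Pow V. f J) - f {} - (\<Sum>v\<in>V. f {v})"
proof -
  let ?S = "insert {} ((\<lambda>v. {v}) ` V)"
  have eq: "Pow V = Js V \<union> ?S"
  proof (intro equalityI subsetI)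
    fix J assume J: "J \<in> Pow V"
    then have "finite J" using assms finite_subset by auto
    then have "J = {} \<or> (\<exists>v. J = {v}) \<or> 2 \<le> card J"
      using card_0_eq[of J] card_1_singletonE[of J] by (metis One_nat_def Suc_1 Suc_leI le_neq_implies_less less_one not_less_eq_eq linorder_not_le)
    then show "J \<in> Js V \<union> ?S" using J by (auto simp: Js_def)
  qed (auto simp: Js_def)
  have disj: "Js V \<inter> ?S = {}" by (auto simp: Js_def)
  have "(\<Sum>J\<in>Pow V. f J) = (\<Sum>J\<in>Js V. f J) + (\<Sum>J\<in>?S. f J)"
    unfolding eq using assms disj by (intro sum.union_disjoint finite_Js) auto
  also have "(\<Sum>J\<in>?S. f J) = f {} + (\<Sum>v\<in>V. f {v})"
    using assms by (subst sum.insert) (auto simp: sum.reindex)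
  finally show ?thesis by simp
qed

lemma sum_Js_card:
  assumes "finite V"
  shows "(\<Sum>J\<in>Js V. \<phi> (card J)) = (\<Sum>k\<in>{2..card V}. real (card V choose k) * \<phi> k)"
proof -
  have "(\<Sum>J\<in>Js V. \<phi> (card J)) = (\<Sum>J\<in>Pow V. if 2 \<le> card J then \<phi> (card J) else 0)"
    unfolding Js_def using assms by (intro sum.mono_neutral_cong_left) auto
  also have "\<dots> = (\<Sum>k\<le>card V. real (card V choose k) * (if 2 \<le> k then \<phi> k else 0))"
    by (rule sum_Pow_card[OF assms])
  also have "\<dots> = (\<Sum>k\<in>{2..card V}. real (card V choose k) * \<phi> k)"
    by (intro sum.mono_neutral_cong_right) auto
  finally show ?thesis .
qed

text \<open>If each element of \<open>V\<close> is marked with probability \<open>x\<close>, then \<open>bw V x J\<close> is the probability that \<open>J\<close> is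
  the set of marked elements; \<open>ow\<close> is \<open>bw / x\<^sup>2\<close>, extended to \<open>x = 0\<close>, and its \<open>\<Lambda>\<close>-integral is the rate
  at which the subset \<open>J\<close> of \<open>V\<close> merges.\<close>

definition bw :: "'b set \<Rightarrow> real \<Rightarrow> 'b set \<Rightarrow> real" where
  "bw V x J = x ^ card J * (1 - x) ^ (card V - card J)"

definition ow :: "'b set \<Rightarrow> real \<Rightarrow> 'b set \<Rightarrow> real" where
  "ow V x J = x ^ (card J - 2) * (1 - x) ^ (card V - card J)"

lemma ow_bw: "J \<in> Js V \<Longrightarrow> x\<^sup>2 * ow V x J = bw V x J"
proof -
  assume "J \<in> Js V"
  then obtain m where "card J = 2 + m" by (auto simp: Js_def dest: le_Suc_ex)
  then have "x\<^sup>2 * x ^ (card J - 2) = x ^ card J" by (simp only: power_add add_diff_cancel_left')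
  then show ?thesis by (simp add: ow_def bw_def mult.assoc[symmetric])
qed

lemma sum_ow_bw: "S \<subseteq> Js V \<Longrightarrow> x\<^sup>2 * (\<Sum>J\<in>S. ow V x J * c J) = (\<Sum>J\<in>S. bw V x J * c J)"
  unfolding sum_distrib_left by (intro sum.cong refl) (auto simp: ow_bw mult.assoc[symmetric])

lemma ow_nonneg: "0 \<le> x \<Longrightarrow> x \<le> 1 \<Longrightarrow> 0 \<le> ow V x J"
  by (simp add: ow_def)

lemma bw_nonneg: "0 \<le> x \<Longrightarrow> x \<le> 1 \<Longrightarrow> 0 \<le> bw V x J"
  by (simp add: bw_def)

lemma ow_continuous: "continuous_on S (\<lambda>x. ow V x J)"
  unfolding ow_def by (intro continuous_intros)

lemma bw_total: "finite V \<Longrightarrow> (\<Sum>J\<in>Pow V. bw V x J) = 1"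
  unfolding bw_def by (subst sum_Pow_card) (simp_all add: Bernstein_def[symmetric] mult.assoc[symmetric])

lemma bw_mean: "finite V \<Longrightarrow> (\<Sum>J\<in>Pow V. bw V x J * real (card J)) = real (card V) * x"
proof -
  assume V: "finite V"
  have "(\<Sum>J\<in>Pow V. bw V x J * real (card J)) = (\<Sum>k\<le>card V. real k * Bernstein (card V) k x)"
    unfolding bw_def by (subst sum_Pow_card[OF V]) (simp add: Bernstein_def mult_ac)
  then show ?thesis by (simp add: sum_k_Bernstein)
qed

text \<open>Sum over the marks outside \<open>I\<close>: all elements of \<open>I\<close> are marked
  with probability \<open>x ^ card I\<close>.\<close>

lemma bw_superset:
  assumes V: "finite V" and I: "I \<subseteq> V"
  shows "(\<Sum>J | I \<subseteq> J \<and> J \<subseteq> V. bw V x J) = x ^ card I"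
proof -
  have fI: "finite I" using I V finite_subset by auto
  have "{J. I \<subseteq> J \<and> J \<subseteq> V} = (\<lambda>J. I \<union> J) ` Pow (V - I)"
  proof (intro equalityI subsetI)
    fix J assume "J \<in> {J. I \<subseteq> J \<and> J \<subseteq> V}"
    then have "J = I \<union> (J - I)" "J - I \<in> Pow (V - I)" by auto
    then show "J \<in> (\<lambda>J. I \<union> J) ` Pow (V - I)" by (rule image_eqI)
  qed (use I in auto)
  moreover have "inj_on (\<lambda>J. I \<union> J) (Pow (V - I))" by (rule inj_onI) blast
  ultimately have "(\<Sum>J | I \<subseteq> J \<and> J \<subseteq> V. bw V x J) = (\<Sum>J\<in>Pow (V - I). bw V x (I \<union> J))"
    by (simp add: sum.reindex)
  also have "\<dots> = (\<Sum>J\<in>Pow (V - I). x ^ card I * bw (V - I) x J)"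
  proof (intro sum.cong refl)
    fix J assume J: "J \<in> Pow (V - I)"
    then have "card (I \<union> J) = card I + card J" using fI V by (intro card_Un_disjoint) (auto intro: finite_subset)
    then show "bw V x (I \<union> J) = x ^ card I * bw (V - I) x J"
      using I fI by (simp add: bw_def power_add card_Diff_subset)
  qed
  also have "\<dots> = x ^ card I" using V by (simp add: sum_distrib_left[symmetric] bw_total)
  finally show ?thesis .
qed

lemma ow_superset_le:
  assumes V: "finite V" and I: "I \<subseteq> V" and x: "0 < x" "x \<le> 1"
  shows "(\<Sum>J | J \<in> Js V \<and> I \<subseteq> J. ow V x J) \<le> x ^ card I / x\<^sup>2"
proof -
  have "x\<^sup>2 * (\<Sum>J | J \<in> Js V \<and> I \<subseteq> J. ow V x J) = (\<Sum>J | J \<in> Js V \<and> I \<subseteq> J. bw V x J)"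
    using sum_ow_bw[of "{J. J \<in> Js V \<and> I \<subseteq> J}" V x "\<lambda>_. 1"] by auto
  also have "\<dots> \<le> (\<Sum>J | I \<subseteq> J \<and> J \<subseteq> V. bw V x J)"
    using V x by (intro sum_mono2) (auto intro: bw_nonneg dest: JsD)
  also have "\<dots> = x ^ card I" by (rule bw_superset[OF V I])
  finally show ?thesis using x by (simp add: field_simps)
qed

text \<open>The element \<open>v\<close> is marked together with another one with probability
  \<open>x - x * (1 - x) ^ (card V - 1)\<close>; divided by \<open>x\<^sup>2\<close> this is a
  geometric sum.\<close>

lemma ow_member:
  assumes V: "finite V" and v: "v \<in> V"
  shows "(\<Sum>J | J \<in> Js V \<and> v \<in> J. ow V x J) = (\<Sum>i<card V - 1. (1 - x) ^ i)"
proof (rule eq_at_zero[where f="\<lambda>x. \<Sum>J | J \<in> Js V \<and> v \<in> J. ow V x J" and g="\<lambda>x. \<Sum>i<card V - 1. (1 - x) ^ i"])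
  fix x :: real assume x: "x \<noteq> 0"
  have fin: "finite {J. {v} \<subseteq> J \<and> J \<subseteq> V}" using V by simp
  have "{J. J \<in> Js V \<and> v \<in> J} = {J. {v} \<subseteq> J \<and> J \<subseteq> V} - {{v}}"
  proof (intro equalityI subsetI)
    fix J assume J: "J \<in> {J. {v} \<subseteq> J \<and> J \<subseteq> V} - {{v}}"
    then obtain u where "u \<in> J" "u \<noteq> v" by auto
    then have "card {u, v} \<le> card J" using J V by (intro card_mono) (auto intro: finite_subset)
    then show "J \<in> {J. J \<in> Js V \<and> v \<in> J}" using J \<open>u \<noteq> v\<close> by (auto simp: Js_def)
  qed (auto simp: Js_def)
  then have "x\<^sup>2 * (\<Sum>J | J \<in> Js V \<and> v \<in> J. ow V x J) = (\<Sum>J\<in>{J. {v} \<subseteq> J \<and> J \<subseteq> V} - {{v}}. bw V x J)"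
    using sum_ow_bw[of "{J. J \<in> Js V \<and> v \<in> J}" V x "\<lambda>_. 1"] by auto
  also have "\<dots> = x - x * (1 - x) ^ (card V - 1)"
    using v fin bw_superset[OF V, of "{v}" x] by (subst sum_diff) (auto simp: bw_def One_nat_def)
  also have "\<dots> = x * (1 - (1 - x) ^ (card V - 1))" by (simp add: algebra_simps)
  also have "\<dots> = x\<^sup>2 * (\<Sum>i<card V - 1. (1 - x) ^ i)"
    unfolding one_diff_power_eq by (simp add: power2_eq_square)
  finally show "(\<Sum>J | J \<in> Js V \<and> v \<in> J. ow V x J) = (\<Sum>i<card V - 1. (1 - x) ^ i)" using x by simp
qed (intro continuous_intros ow_continuous)+

text \<open>The right-hand side is the probability that at least two of \<open>a\<close> elements
  are marked.\<close>

lemma pair_sum_closed_form: "x\<^sup>2 * (\<Sum>j<a. real j * (1 - x) ^ (j - 1)) = 1 - (1 - x) ^ a - real a * x * (1 - x) ^ (a - 1)"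
proof (induction a)
  case (Suc a)
  then show ?case
    by (cases a) (simp_all add: distrib_left algebra_simps power2_eq_square)
qed simp

text \<open>The elements outside \<open>A\<close> stay unmarked and at least two inside are
  marked.\<close>

lemma ow_inside:
  assumes V: "finite V" and A: "A \<subseteq> V" and x: "x \<noteq> 0"
  shows "(\<Sum>J\<in>Js A. ow V x J) = (1 - x) ^ (card V - card A) * (\<Sum>j<card A. real j * (1 - x) ^ (j - 1))"
proof -
  have fA: "finite A" and cA: "card A \<le> card V" using V A by (auto intro: finite_subset card_mono)
  have "ow V x J = (1 - x) ^ (card V - card A) * ow A x J" if "J \<in> Js A" for J
    using Js_card_le[OF fA that] cA by (simp add: ow_def power_add[symmetric])
  then have "(\<Sum>J\<in>Js A. ow V x J) = (1 - x) ^ (card V - card A) * (\<Sum>J\<in>Js A. ow A x J)"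
    by (simp add: sum_distrib_left)
  moreover have "x\<^sup>2 * (\<Sum>J\<in>Js A. ow A x J) = x\<^sup>2 * (\<Sum>j<card A. real j * (1 - x) ^ (j - 1))"
  proof -
    have "x\<^sup>2 * (\<Sum>J\<in>Js A. ow A x J) = (\<Sum>J\<in>Js A. bw A x J)"
      using sum_ow_bw[of "Js A" A x "\<lambda>_. 1"] by simp
    also have "\<dots> = 1 - (1 - x) ^ card A - real (card A) * x * (1 - x) ^ (card A - 1)"
      by (simp add: sum_Js_Pow[OF fA] bw_total[OF fA]) (simp add: bw_def One_nat_def)
    finally show ?thesis by (simp only: pair_sum_closed_form)
  qed
  ultimately show ?thesis using x by simp
qed

text \<open>The integral of \<open>gam b\<close> with respect to \<open>\<Lambda>\<close> is the rate at which \<open>b\<close> blocks are lost.\<close>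

definition gam :: "nat \<Rightarrow> real \<Rightarrow> real" where
  "gam b x = (\<Sum>i<b. \<Sum>j<i. (1 - x) ^ j)"

text \<open>Discrete analogue of the integrand of \<Psi>, with \<open>(1 - x) ^ b\<close> in place
  of \<open>exp (- (x * b))\<close>.\<close>

lemma gam_closed_form: "x\<^sup>2 * gam b x = real b * x - 1 + (1 - x) ^ b"
proof -
  have "x\<^sup>2 * gam b x = x * (\<Sum>i<b. x * (\<Sum>j<i. (1 - x) ^ j))"
    by (simp add: gam_def power2_eq_square sum_distrib_left mult.assoc)
  also have "(\<Sum>i<b. x * (\<Sum>j<i. (1 - x) ^ j)) = (\<Sum>i<b. 1 - (1 - x) ^ i)"
    using one_diff_power_eq[of "1 - x"] by (intro sum.cong) simp_all
  also have "x * \<dots> = real b * x - x * (\<Sum>i<b. (1 - x) ^ i)"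
    by (simp add: sum_subtractf algebra_simps)
  also have "x * (\<Sum>i<b. (1 - x) ^ i) = 1 - (1 - x) ^ b"
    using one_diff_power_eq[of "1 - x" b] by simp
  finally show ?thesis by simp
qed

lemma gam_continuous: "continuous_on S (gam b)"
  unfolding gam_def by (intro continuous_intros)

text \<open>With \<open>N\<close> marked elements this is the mean of
  \<open>(N - 1)\<^sup>+\<close>, that is \<open>E N - 1 + P (N = 0)\<close>, divided by
  \<open>x\<^sup>2\<close>.\<close>

lemma sum_ow_gam:
  assumes V: "finite V"
  shows "(\<Sum>J\<in>Js V. ow V x J * (real (card J) - 1)) = gam (card V) x"
proof (rule eq_at_zero[where f="\<lambda>x. \<Sum>J\<in>Js V. ow V x J * (real (card J) - 1)" and g="gam (card V)"])
  fix x :: real assume x: "x \<noteq> 0"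
  have "x\<^sup>2 * (\<Sum>J\<in>Js V. ow V x J * (real (card J) - 1)) = (\<Sum>J\<in>Js V. bw V x J * (real (card J) - 1))"
    by (rule sum_ow_bw) simp
  also have "\<dots> = (\<Sum>J\<in>Pow V. bw V x J * real (card J)) - (\<Sum>J\<in>Pow V. bw V x J) + (1 - x) ^ card V"
    by (simp add: sum_Js_Pow[OF V] right_diff_distrib sum_subtractf) (simp add: bw_def)
  also have "\<dots> = x\<^sup>2 * gam (card V) x"
    by (simp add: bw_mean[OF V] bw_total[OF V] gam_closed_form)
  finally show "(\<Sum>J\<in>Js V. ow V x J * (real (card J) - 1)) = gam (card V) x" using x by simp
qed (intro continuous_intros ow_continuous gam_continuous)+

lemma gam_binomial:
  "gam b x = (\<Sum>k\<in>{2..b}. real (b choose k) * (x ^ (k - 2) * (1 - x) ^ (b - k) * (real k - 1)))"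
  using sum_ow_gam[of "{1..b}" x] sum_Js_card[of "{1..b}" "\<lambda>k. x ^ (k - 2) * (1 - x) ^ (b - k) * (real k - 1)"]
  by (simp add: ow_def)

text \<open>The denominator is absorbed by
  \<open>(b choose k) / (b - k + 1) = (b + 1 choose k) / (b + 1)\<close>, and the additional factor
  \<open>1 - x\<close> completes the weights for \<open>b + 1\<close> elements.\<close>

lemma sum_ow_ratio_le:
  assumes V: "finite V" and x: "0 \<le> x" "x < 1"
  shows "(\<Sum>J\<in>Js V. ow V x J * ((real (card J) - 1) / (real (card V) - real (card J) + 1)))
    \<le> gam (card V + 1) x / ((1 - x) * (real (card V) + 1))"
proof -
  let ?b = "card V"
  let ?t = "\<lambda>k. x ^ (k - 2) * (1 - x) ^ (?b + 1 - k) * (real k - 1)"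
  have "(1 - x) * (real ?b + 1) * (\<Sum>J\<in>Js V. ow V x J * ((real (card J) - 1) / (real ?b - real (card J) + 1)))
    = (1 - x) * (real ?b + 1) * (\<Sum>k\<in>{2..?b}. real (?b choose k) * (x ^ (k - 2) * (1 - x) ^ (?b - k) * ((real k - 1) / (real ?b - real k + 1))))"
    unfolding ow_def using sum_Js_card[OF V, of "\<lambda>k. x ^ (k - 2) * (1 - x) ^ (?b - k) * ((real k - 1) / (real ?b - real k + 1))"]
    by simp
  also have "\<dots> = (\<Sum>k\<in>{2..?b}. real (?b + 1 choose k) * ?t k)"
    unfolding sum_distrib_left
  proof (intro sum.cong refl)
    fix k assume k: "k \<in> {2..?b}"
    then have p: "real ?b - real k + 1 > 0" by simp
    have "(?b + 1 - k) * (?b + 1 choose k) = (?b + 1) * (?b choose k)"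
      using binomial_absorb_comp[of "?b + 1" k] by simp
    then have "real (?b + 1 - k) * real (?b + 1 choose k) = real (?b + 1) * real (?b choose k)"
      by (metis of_nat_mult)
    moreover have "real (?b + 1 - k) = real ?b - real k + 1" using k by (simp add: of_nat_diff)
    ultimately have c: "(real ?b + 1) * real (?b choose k) / (real ?b - real k + 1) = real (?b + 1 choose k)"
      using p by (simp add: field_simps)
    have "?b + 1 - k = Suc (?b - k)" using k by auto
    then have e: "(1 - x) ^ (?b + 1 - k) = (1 - x) * (1 - x) ^ (?b - k)" by simp
    show "(1 - x) * (real ?b + 1) * (real (?b choose k) * (x ^ (k - 2) * (1 - x) ^ (?b - k) * ((real k - 1) / (real ?b - real k + 1))))
        = real (?b + 1 choose k) * ?t k"
      unfolding c[symmetric] e times_divide_eq_left times_divide_eq_right by (simp only: mult_ac)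
  qed
  also have "\<dots> \<le> (\<Sum>k\<in>{2..?b + 1}. real (?b + 1 choose k) * ?t k)"
    using x by (intro sum_mono2) auto
  also have "\<dots> = gam (?b + 1) x" by (simp only: gam_binomial)
  finally show ?thesis using x by (subst pos_le_divide_eq) (simp_all add: mult.commute)
qed

text \<open>The integrand of \<open>\<Psi>\<close>: \<open>\<Psi>(u) = \<integral> psi x u \<Lambda>(dx)\<close>.\<close>

definition psi :: "real \<Rightarrow> real \<Rightarrow> real" where
  "psi x u = (if x = 0 then u\<^sup>2 else (exp (- (x * u)) - 1 + x * u) / x\<^sup>2)"

section \<open>Comparison of the block loss rate with the integrand of \<Psi>\<close>

lemma exp_remainder_nonneg: "0 \<le> exp (- y) - 1 + (y::real)"
  using exp_ge_add_one_self[of "- y"] by simp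

lemma exp_remainder_le_sq: "0 \<le> y \<Longrightarrow> exp (- y) - 1 + (y::real) \<le> y\<^sup>2"
proof -
  assume y: "0 \<le> y"
  have "exp (- y) * (1 + y) \<le> exp (- y) * exp y" using exp_ge_add_one_self[of y] by (intro mult_left_mono) auto
  also have "\<dots> = 1" by (simp add: exp_minus)
  also have "1 \<le> (1 - y + y\<^sup>2) * (1 + y)"
    using y by (simp add: algebra_simps power2_eq_square power3_eq_cube)
  finally have "exp (- y) \<le> 1 - y + y\<^sup>2" using y by (simp add: mult_le_cancel_right)
  then show ?thesis by simp
qed

lemma exp_remainder_mono: "0 \<le> y \<Longrightarrow> y \<le> z \<Longrightarrow> exp (- y) - 1 + y \<le> exp (- z) - 1 + (z::real)"
proof -
  assume yz: "0 \<le> y" "y \<le> z"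
  have "exp (- y) - exp (- z) = exp (- y) * (1 - exp (- (z - y)))"
    by (simp add: right_diff_distrib exp_add[symmetric])
  also have "\<dots> \<le> 1 * (1 - exp (- (z - y)))" using yz by (intro mult_right_mono) auto
  also have "\<dots> \<le> z - y" using exp_ge_add_one_self[of "y - z"] by (simp only: minus_diff_eq mult_1_left)
  finally show ?thesis by simp
qed

text \<open>Both sides vanish at 0, and the derivative of their difference is nonnegative by
  convexity of \<open>exp\<close>. This is the source of \<open>Psi_scale\<close>, the at most
  quadratic growth of \<Psi>.\<close>

lemma exp_remainder_scale:
  assumes \<theta>: "0 \<le> \<theta>" "\<theta> \<le> 1" and y: "0 \<le> y"
  shows "\<theta>\<^sup>2 * (exp (- y) - 1 + y) \<le> exp (- (\<theta> * y)) - 1 + \<theta> * (y::real)"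
proof -
  let ?f = "\<lambda>y. exp (- (\<theta> * y)) - 1 + \<theta> * y - \<theta>\<^sup>2 * (exp (- y) - 1 + y)"
  have "?f 0 \<le> ?f y"
  proof (rule DERIV_nonneg_imp_nondecreasing[OF y])
    fix z
    let ?d = "\<theta> * (1 - exp (- (\<theta> * z)) - \<theta> * (1 - exp (- z)))"
    have "(?f has_real_derivative ?d) (at z)"
      by (auto intro!: derivative_eq_intros simp: algebra_simps power2_eq_square)
    moreover have "exp (- (\<theta> * z)) \<le> (1 - \<theta>) * exp 0 + \<theta> * exp (- z)"
      using convex_onD[OF exp_convex, of \<theta> 0 "- z"] \<theta> by simp
    then have "0 \<le> ?d" using \<theta> by (intro mult_nonneg_nonneg) (auto simp: algebra_simps)
    ultimately show "\<exists>d. (?f has_real_derivative d) (at z) \<and> 0 \<le> d" by blast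
  qed
  then show ?thesis by simp
qed

lemma psi_nonneg: "0 \<le> psi x u"
  by (simp add: psi_def exp_remainder_nonneg)

lemma psi_le_sq: "0 \<le> x \<Longrightarrow> 0 \<le> u \<Longrightarrow> psi x u \<le> u\<^sup>2"
  using exp_remainder_le_sq[of "x * u"] by (auto simp: psi_def field_simps power_mult_distrib)

lemma psi_pos:
  assumes "0 \<le> x" "0 < u" shows "0 < psi x u"
proof (cases "x = 0")
  case False
  then have y: "0 < x * u" using assms by auto
  have "0 < exp (- (x * u)) - 1 + x * u"
  proof (cases "x * u \<le> 2")
    case True
    \<comment> \<open>The bound \<open>1 - y \<le> exp (- y)\<close>, taken at half the argument and
      squared, becomes strict; squaring needs \<open>x * u \<le> 2\<close>.\<close>
    have "1 - x * u < (1 - x * u / 2)\<^sup>2" using zero_less_power[OF y, of 2] by (simp add: power2_eq_square algebra_simps)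
    also have "\<dots> \<le> (exp (- (x * u / 2)))\<^sup>2"
      using True exp_ge_add_one_self[of "- (x * u / 2)"] by (intro power_mono) auto
    also have "\<dots> = exp (- (x * u))" by (simp flip: exp_double)
    finally show ?thesis by simp
  next
    case False
    then show ?thesis using exp_gt_zero[of "- (x * u)"] by linarith
  qed
  then show ?thesis using False by (simp add: psi_def)
qed (use assms in \<open>simp add: psi_def\<close>)

lemma psi_mono: "0 \<le> x \<Longrightarrow> 0 \<le> u \<Longrightarrow> u \<le> v \<Longrightarrow> psi x u \<le> psi x v"
  using exp_remainder_mono[of "x * u" "x * v"]
  by (auto simp: psi_def intro!: divide_right_mono mult_left_mono power_mono)

lemma psi_scale: "0 \<le> x \<Longrightarrow> 0 \<le> u \<Longrightarrow> 0 \<le> \<theta> \<Longrightarrow> \<theta> \<le> 1 \<Longrightarrow> \<theta>\<^sup>2 * psi x u \<le> psi x (\<theta> * u)"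
proof (cases "x = 0")
  case False
  assume "0 \<le> x" "0 \<le> u" "0 \<le> \<theta>" "\<theta> \<le> 1"
  then have "\<theta>\<^sup>2 * (exp (- (x * u)) - 1 + x * u) \<le> exp (- (x * (\<theta> * u))) - 1 + x * (\<theta> * u)"
    using exp_remainder_scale[of \<theta> "x * u"] by (simp only: mult.left_commute[of x \<theta>] mult_nonneg_nonneg)
  then have "\<theta>\<^sup>2 * (exp (- (x * u)) - 1 + x * u) / x\<^sup>2 \<le> (exp (- (x * (\<theta> * u))) - 1 + x * (\<theta> * u)) / x\<^sup>2"
    by (intro divide_right_mono) auto
  then show ?thesis using False by (simp add: psi_def)
qed (simp add: psi_def power_mult_distrib)

lemma gam_le_psi:
  assumes "0 \<le> x" "x \<le> 1" shows "gam b x \<le> psi x (real b)"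
proof (cases "x = 0")
  case True
  have "gam b 0 = (\<Sum>i<b. real i)" by (simp add: gam_def)
  also have "\<dots> \<le> (\<Sum>i<b. real b)" by (intro sum_mono) simp
  finally show ?thesis using True by (simp add: psi_def power2_eq_square)
next
  case False
  have "(1 - x) ^ b \<le> exp (- x) ^ b" using assms exp_ge_add_one_self[of "- x"] by (intro power_mono) auto
  also have "\<dots> = exp (- (x * real b))" by (simp add: exp_of_nat_mult[symmetric] mult.commute)
  finally have "x\<^sup>2 * gam b x \<le> exp (- (x * real b)) - 1 + x * real b"
    unfolding gam_closed_form by (simp add: mult.commute)
  then show ?thesis using False by (simp add: psi_def field_simps)
qed

text \<open>Up to \<open>x = 1 / b\<close> Bernoulli's inequality gives
  \<open>gam b x \<ge> b\<^sup>2 / 8\<close>, against \<open>psi x b \<le> b\<^sup>2\<close>.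
  Beyond, \<open>x * gam b x\<close> is nondecreasing in \<open>x\<close>, hence at least
  \<open>b / 8\<close>, against \<open>x * psi x b \<le> b\<close>.\<close>

lemma psi_le_gam:
  assumes x: "0 \<le> x" "x \<le> 1" and b: "2 \<le> b" shows "psi x (real b) / 8 \<le> gam b x"
proof -
  have small: "(real b)\<^sup>2 / 8 \<le> gam b x" if x: "0 \<le> x" "x \<le> 1 / real b" for x
  proof -
    have "1 / real b \<le> 1" using b by simp
    then have x1: "x \<le> 1" using that by linarith
    have bern: "1 - real j / real b \<le> (1 - x) ^ j" for j
    proof -
      have "1 - real j / real b \<le> 1 + real j * (- x)" using x(2) b mult_left_mono[of x "1 / real b" "real j"] by simp
      also have "\<dots> \<le> (1 + - x) ^ j" using x1 by (intro Bernoulli_inequality) simp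
      finally show ?thesis by simp
    qed
    have tri: "(\<Sum>j<i. real j) = real i * (real i - 1) / 2" for i by (induction i) (auto simp: field_simps)
    have "real i / 2 \<le> (\<Sum>j<i. (1 - x) ^ j)" if i: "i < b" for i
    proof -
      have "real i / 2 \<le> real i - (real i * (real i - 1) / 2) / real b"
      proof -
        have "(real i * (real i - 1) / 2) / real b \<le> (real i * real b / 2) / real b"
          using i by (intro divide_right_mono mult_left_mono) auto
        then show ?thesis using b by simp
      qed
      also have "\<dots> = (\<Sum>j<i. 1 - real j / real b)"
        by (simp add: sum_subtractf sum_divide_distrib[symmetric] tri)
      also have "\<dots> \<le> (\<Sum>j<i. (1 - x) ^ j)" by (intro sum_mono bern)
      finally show ?thesis .
    qed
    then have "(\<Sum>i<b. real i / 2) \<le> gam b x" unfolding gam_def by (intro sum_mono) auto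
    moreover have "(\<Sum>i<b. real i / 2) = real b * (real b - 1) / 4" by (simp add: sum_divide_distrib[symmetric] tri)
    moreover have "(real b)\<^sup>2 / 8 \<le> real b * (real b - 1) / 4"
    proof -
      have "real b * 2 \<le> real b * real b" using b by (intro mult_left_mono) auto
      then show ?thesis by (simp add: power2_eq_square algebra_simps)
    qed
    ultimately show ?thesis by linarith
  qed
  show ?thesis
  proof (cases "x \<le> 1 / real b")
    case True
    then show ?thesis using small[OF x(1) True] psi_le_sq[OF x(1), of "real b"] by simp
  next
    case False
    have "0 < 1 / real b" using b by simp
    then have xp: "x > 0" using False by linarith
    define y where "y = 1 / real b"
    have y: "0 < y" "y \<le> x" "y \<le> 1" using False b by (auto simp: y_def)
    have eq: "z * gam b z = (\<Sum>i<b. 1 - (1 - z) ^ i)" for z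
      using one_diff_power_eq[of "1 - z"] by (simp add: gam_def sum_distrib_left)
    have "real b / 8 = y * ((real b)\<^sup>2 / 8)" using b by (simp add: y_def power2_eq_square)
    also have "\<dots> \<le> y * gam b y" using small[of y] y by (intro mult_left_mono) (auto simp: y_def)
    also have "\<dots> \<le> x * gam b x" unfolding eq
      using y x by (intro sum_mono diff_left_mono power_mono) auto
    finally have "real b / 8 \<le> x * gam b x" .
    then have "x * (real b / 8) \<le> x\<^sup>2 * gam b x" using xp by (simp add: power2_eq_square mult.assoc)
    then have "(x * real b) / 8 \<le> x\<^sup>2 * gam b x" by simp
    moreover have "exp (- (x * real b)) \<le> 1" using xp by simp
    then have "(exp (- (x * real b)) - 1 + x * real b) / 8 \<le> x * real b / 8" by (intro divide_right_mono) simp_all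
    ultimately have "(exp (- (x * real b)) - 1 + x * real b) / 8 \<le> x\<^sup>2 * gam b x" by linarith
    then show ?thesis using xp by (simp add: psi_def field_simps)
  qed
qed

section \<open>Integrated rates and their meaning in each regime\<close>

context fleming_viot
begin

lemma L_meas: "f \<in> borel_measurable borel \<Longrightarrow> f \<in> borel_measurable \<Lambda>"
  unfolding measurable_cong_sets[OF sets_L refl] unit_borel_def by (rule measurable_restrict_space1)

lemma L_sets: "A \<in> sets borel \<Longrightarrow> A \<subseteq> {0..1} \<Longrightarrow> A \<in> sets \<Lambda>"
  by (simp add: sets_L unit_borel_in)

lemma L_AE_unit: "AE x in \<Lambda>. 0 \<le> x \<and> x < 1"
proof -
  have "AE x in \<Lambda>. x \<noteq> 1"
    using L1 by (intro AE_I[where N="{1}"] L_sets) auto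
  moreover have "AE x in \<Lambda>. 0 \<le> x \<and> x \<le> 1" by (intro AE_I2) (simp add: space_L)
  ultimately show ?thesis by eventually_elim auto
qed

lemma L_AE_pos: "emeasure \<Lambda> {0} = 0 \<Longrightarrow> AE x in \<Lambda>. 0 < x \<and> x < 1"
proof -
  assume "emeasure \<Lambda> {0} = 0"
  then have "AE x in \<Lambda>. x \<noteq> 0" by (intro AE_I[where N="{0}"] L_sets) auto
  with L_AE_unit show ?thesis by eventually_elim auto
qed

lemma L_integrable:
  fixes f :: "real \<Rightarrow> real"
  shows "f \<in> borel_measurable borel \<Longrightarrow> (\<And>x. 0 \<le> x \<Longrightarrow> x \<le> 1 \<Longrightarrow> \<bar>f x\<bar> \<le> B) \<Longrightarrow> integrable \<Lambda> f"
  by (intro L.integrable_const_bound[where B=B] L_meas AE_I2) (auto simp: space_L)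

lemma ow_meas: "(\<lambda>x. ow S x J) \<in> borel_measurable borel"
  by (intro borel_measurable_continuous_onI ow_continuous)

lemma ow_le_1: "0 \<le> x \<Longrightarrow> x \<le> 1 \<Longrightarrow> ow S x J \<le> 1"
  unfolding ow_def by (intro mult_le_one power_le_one) auto

lemma ow_integrable: "integrable \<Lambda> (\<lambda>x. ow S x J)"
  by (rule L_integrable[where B=1]) (auto simp: ow_meas ow_nonneg ow_le_1)

lemma lam_ow: "lam (card S) (card J) = (\<integral>x. ow S x J \<partial>\<Lambda>)"
  by (simp add: merge_rate_def ow_def)

lemma lam_sum: "(\<Sum>J\<in>T. lam (card S) (card J) * c J) = (\<integral>x. (\<Sum>J\<in>T. ow S x J * c J) \<partial>\<Lambda>)"
  by (simp add: lam_ow ow_integrable)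

lemma lam_sum_integrable: "integrable \<Lambda> (\<lambda>x. \<Sum>J\<in>T. ow S x J * c J)"
  by (intro Bochner_Integration.integrable_sum integrable_mult_left ow_integrable)

text \<open>All of \<open>I\<close> is marked with probability \<open>x ^ card I\<close>, so moments
  of \<nu> control these rates. Used with \<open>I\<close> empty, with a single block, and with all
  singletons in \<open>[j]\<close>.\<close>

lemma superset_rate_le:
  assumes L0: "emeasure \<Lambda> {0} = 0" and int: "integrable \<Lambda> (\<lambda>x. x ^ card I / x\<^sup>2)"
    and S: "finite S" "I \<subseteq> S"
  shows "(\<Sum>J | J \<in> Js S \<and> I \<subseteq> J. lam (card S) (card J)) \<le> (\<integral>x. x ^ card I / x\<^sup>2 \<partial>\<Lambda>)"
proof -
  have "(\<Sum>J | J \<in> Js S \<and> I \<subseteq> J. lam (card S) (card J)) = (\<integral>x. (\<Sum>J | J \<in> Js S \<and> I \<subseteq> J. ow S x J * 1) \<partial>\<Lambda>)"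
    unfolding lam_sum[symmetric] by simp
  also have "\<dots> \<le> (\<integral>x. x ^ card I / x\<^sup>2 \<partial>\<Lambda>)"
  proof (rule integral_mono_AE[OF lam_sum_integrable int])
    show "AE x in \<Lambda>. (\<Sum>J | J \<in> Js S \<and> I \<subseteq> J. ow S x J * 1) \<le> x ^ card I / x\<^sup>2"
      using L_AE_pos[OF L0] by eventually_elim (use ow_superset_le[OF S] in simp)
  qed
  finally show ?thesis .
qed

text \<open>The \<open>i\<close>-th moment of \<nu> when \<Lambda> does not charge 0. At
  \<open>x = 0\<close> the quotient is 0 by convention.\<close>

definition moment :: "nat \<Rightarrow> real" where
  "moment i = (\<integral>x. x ^ i / x\<^sup>2 \<partial>\<Lambda>)"

lemma moment_nonneg: "moment i \<ge> 0"
  unfolding moment_def by (intro integral_nonneg_AE) (use L_AE_unit in \<open>auto elim: eventually_mono\<close>)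

lemma moment_integrable:
  assumes L0: "emeasure \<Lambda> {0} = 0" and int: "integrable \<Lambda> (\<lambda>x. x ^ j / x\<^sup>2)" and ij: "j \<le> i"
  shows "integrable \<Lambda> (\<lambda>x. x ^ i / x\<^sup>2)" "moment i \<le> moment j"
proof -
  have le: "AE x in \<Lambda>. x ^ i / x\<^sup>2 \<le> x ^ j / x\<^sup>2 \<and> 0 \<le> x ^ i / x\<^sup>2"
    using L_AE_unit by eventually_elim (use ij in \<open>auto intro!: divide_right_mono power_decreasing\<close>)
  show i: "integrable \<Lambda> (\<lambda>x. x ^ i / x\<^sup>2)"
  proof (rule Bochner_Integration.integrable_bound[OF int])
    show "(\<lambda>x. x ^ i / x\<^sup>2) \<in> borel_measurable \<Lambda>" by (rule L_meas) measurable
    show "AE x in \<Lambda>. norm (x ^ i / x\<^sup>2) \<le> norm (x ^ j / x\<^sup>2)"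
      unfolding real_norm_def using le by eventually_elim linarith
  qed
  show "moment i \<le> moment j" unfolding moment_def
    by (rule integral_mono_AE[OF i int]) (use le in \<open>auto elim: eventually_mono\<close>)
qed

text \<open>Dominated convergence by the first moment: powers of \<open>x\<close> tend to 0 because
  \<Lambda> does not charge 1.\<close>

lemma moment_tendsto:
  assumes L0: "emeasure \<Lambda> {0} = 0" and int: "integrable \<Lambda> (\<lambda>x. x ^ 1 / x\<^sup>2)"
  shows "moment \<longlonglongrightarrow> 0"
proof -
  have "(\<lambda>i. moment (Suc i)) \<longlonglongrightarrow> (\<integral>x. 0 \<partial>\<Lambda>)"
    unfolding moment_def
  proof (rule integral_dominated_convergence[where w="\<lambda>x. x ^ 1 / x\<^sup>2"])
    show "AE x in \<Lambda>. (\<lambda>i. x ^ Suc i / x\<^sup>2) \<longlonglongrightarrow> 0"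
      using L_AE_unit
    proof eventually_elim
      case (elim x)
      have "(\<lambda>i. x ^ Suc i / x\<^sup>2) \<longlonglongrightarrow> 0 / x\<^sup>2" if "x \<noteq> 0"
        using elim that by (intro tendsto_divide tendsto_const LIMSEQ_Suc LIMSEQ_realpow_zero) auto
      then show ?case by (cases "x = 0") auto
    qed
    show "AE x in \<Lambda>. norm (x ^ Suc i / x\<^sup>2) \<le> x ^ 1 / x\<^sup>2" for i
      using L_AE_unit by eventually_elim
        (auto intro!: divide_right_mono power_le_one mult_left_le)
    show "(\<lambda>x. x ^ Suc i / x\<^sup>2) \<in> borel_measurable \<Lambda>" for i by (rule L_meas) measurable
  qed (use int in auto)
  then show ?thesis by (intro LIMSEQ_imp_Suc[of moment]) simp
qed

text \<open>Count pairs of a merger and a participating block of \<open>B\<close>, and bound the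
  participation rate of each block by the first moment.\<close>

lemma intersection_rate_le:
  assumes L0: "emeasure \<Lambda> {0} = 0" and int: "integrable \<Lambda> (\<lambda>x. x ^ 1 / x\<^sup>2)"
    and S: "finite S" "B \<subseteq> S"
  shows "(\<Sum>J\<in>Js S. lam (card S) (card J) * real (card (J \<inter> B))) \<le> real (card B) * moment 1"
proof -
  have fB: "finite B" using S finite_subset by auto
  have "(\<Sum>J\<in>Js S. lam (card S) (card J) * real (card (J \<inter> B)))
      = (\<Sum>J\<in>Js S. \<Sum>v\<in>B. if v \<in> J then lam (card S) (card J) else 0)"
  proof (intro sum.cong refl)
    fix J
    have "real (card (J \<inter> B)) = (\<Sum>v\<in>B. if v \<in> J then 1 else 0)"
      using fB by (simp add: sum.If_cases Int_commute)
    then show "lam (card S) (card J) * real (card (J \<inter> B)) = (\<Sum>v\<in>B. if v \<in> J then lam (card S) (card J) else 0)"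
      by (simp add: sum_distrib_left if_distrib cong: if_cong)
  qed
  also have "\<dots> = (\<Sum>v\<in>B. \<Sum>J\<in>Js S. if v \<in> J then lam (card S) (card J) else 0)" by (rule sum.swap)
  also have "\<dots> \<le> (\<Sum>v\<in>B. moment 1)"
  proof (rule sum_mono)
    fix v assume v: "v \<in> B"
    have "(\<Sum>J\<in>Js S. if v \<in> J then lam (card S) (card J) else 0) = (\<Sum>J | J \<in> Js S \<and> {v} \<subseteq> J. lam (card S) (card J))"
      using finite_Js[OF S(1)] by (simp add: sum.inter_filter[symmetric])
    also have "\<dots> \<le> moment 1"
      using superset_rate_le[OF L0, of "{v}" S] int S v by (auto simp: moment_def)
    finally show "(\<Sum>J\<in>Js S. if v \<in> J then lam (card S) (card J) else 0) \<le> moment 1" .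
  qed
  finally show ?thesis by simp
qed

lemma nn_inverse_sq: "x \<noteq> 0 \<Longrightarrow> inverse (ennreal (x\<^sup>2)) = ennreal (1 / x\<^sup>2)"
  by (simp add: inverse_ennreal inverse_eq_divide)

lemma nu_meas: "(\<lambda>x. inverse (ennreal (x\<^sup>2))) \<in> borel_measurable \<Lambda>"
proof -
  have "(\<lambda>x. ennreal (x\<^sup>2)) \<in> borel_measurable \<Lambda>" by (intro measurable_compose[OF L_meas measurable_ennreal]) measurable
  then show ?thesis by (rule borel_measurable_inverse_ennreal)
qed

lemma unit_half_open: "{0..<1} \<in> sets \<Lambda>"
  by (rule L_sets) auto

lemma emeasure_nu: "emeasure (nu \<Lambda>) {0..<1} = (\<integral>\<^sup>+x. inverse (ennreal (x\<^sup>2)) \<partial>\<Lambda>)"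
proof -
  have "emeasure (nu \<Lambda>) {0..<1} = (\<integral>\<^sup>+x. inverse (ennreal (x\<^sup>2)) * indicator {0..<1} x \<partial>\<Lambda>)"
    unfolding nu_def by (rule emeasure_density[OF nu_meas unit_half_open])
  also have "\<dots> = (\<integral>\<^sup>+x. inverse (ennreal (x\<^sup>2)) \<partial>\<Lambda>)"
    by (rule nn_integral_cong_AE) (use L_AE_unit in \<open>auto elim: eventually_mono\<close>)
  finally show ?thesis .
qed

lemma nn_mean_nu: "(\<integral>\<^sup>+x\<in>{0..<1}. ennreal x \<partial>nu \<Lambda>) = (\<integral>\<^sup>+x. inverse (ennreal (x\<^sup>2)) * ennreal x \<partial>\<Lambda>)"
proof -
  have m: "(\<lambda>x. ennreal x * indicator {0..<1} x) \<in> borel_measurable \<Lambda>"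
    using unit_half_open by (intro borel_measurable_times_ennreal measurable_compose[OF L_meas measurable_ennreal]) auto
  have "(\<integral>\<^sup>+x\<in>{0..<1}. ennreal x \<partial>nu \<Lambda>) = (\<integral>\<^sup>+x. inverse (ennreal (x\<^sup>2)) * (ennreal x * indicator {0..<1} x) \<partial>\<Lambda>)"
    unfolding nu_def by (rule nn_integral_density[OF nu_meas m])
  also have "\<dots> = (\<integral>\<^sup>+x. inverse (ennreal (x\<^sup>2)) * ennreal x \<partial>\<Lambda>)"
    by (rule nn_integral_cong_AE) (use L_AE_unit in \<open>auto elim: eventually_mono\<close>)
  finally show ?thesis .
qed

lemma atom_zero_infinite:
  assumes "emeasure \<Lambda> {0} \<noteq> 0" "f 0 = (\<infinity> :: ennreal)" "f \<in> borel_measurable \<Lambda>"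
  shows "(\<integral>\<^sup>+x. f x \<partial>\<Lambda>) = \<infinity>"
proof -
  have "(\<integral>\<^sup>+x. \<infinity> * indicator {0} x \<partial>\<Lambda>) \<le> (\<integral>\<^sup>+x. f x \<partial>\<Lambda>)"
    by (intro nn_integral_mono) (auto simp: indicator_def assms(2))
  moreover have "(\<integral>\<^sup>+x. \<infinity> * indicator {0} x \<partial>\<Lambda>) = \<infinity> * emeasure \<Lambda> {0}"
    by (intro nn_integral_cmult_indicator L_sets) auto
  ultimately show ?thesis using assms(1) by (simp add: ennreal_top_mult top_unique)
qed

lemma discreteD:
  assumes "regime_discrete \<Lambda>"
  shows "emeasure \<Lambda> {0} = 0" "integrable \<Lambda> (\<lambda>x. x ^ 0 / x\<^sup>2)"
proof -
  have f: "(\<integral>\<^sup>+x. inverse (ennreal (x\<^sup>2)) \<partial>\<Lambda>) < \<infinity>"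
    using assms by (simp add: regime_discrete_def emeasure_nu)
  show L0: "emeasure \<Lambda> {0} = 0"
  proof (rule ccontr)
    assume "emeasure \<Lambda> {0} \<noteq> 0"
    from atom_zero_infinite[OF this _ nu_meas] f show False by simp
  qed
  have "(\<integral>\<^sup>+x. ennreal (x ^ 0 / x\<^sup>2) \<partial>\<Lambda>) = (\<integral>\<^sup>+x. inverse (ennreal (x\<^sup>2)) \<partial>\<Lambda>)"
    by (rule nn_integral_cong_AE) (use L_AE_pos[OF L0] in \<open>auto elim!: eventually_mono simp: nn_inverse_sq\<close>)
  with f show "integrable \<Lambda> (\<lambda>x. x ^ 0 / x\<^sup>2)"
    by (intro integrableI_nonneg L_meas) auto
qed

lemma mean_finiteD:
  assumes "nu_mean \<Lambda> < \<infinity>"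
  shows "emeasure \<Lambda> {0} = 0" "integrable \<Lambda> (\<lambda>x. x ^ 1 / x\<^sup>2)"
proof -
  show L0: "emeasure \<Lambda> {0} = 0"
    using assms by (auto simp: nu_mean_def zero_less_iff_neq_zero split: if_splits)
  then have f: "(\<integral>\<^sup>+x. inverse (ennreal (x\<^sup>2)) * ennreal x \<partial>\<Lambda>) < \<infinity>"
    using assms by (simp add: nu_mean_def nn_mean_nu)
  have "(\<integral>\<^sup>+x. ennreal (x ^ 1 / x\<^sup>2) \<partial>\<Lambda>) = (\<integral>\<^sup>+x. inverse (ennreal (x\<^sup>2)) * ennreal x \<partial>\<Lambda>)"
    by (rule nn_integral_cong_AE)
      (use L_AE_pos[OF L0] in \<open>auto elim!: eventually_mono simp: nn_inverse_sq ennreal_mult[symmetric]\<close>)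
  moreover have "AE x in \<Lambda>. 0 \<le> x ^ 1 / x\<^sup>2" using L_AE_unit by eventually_elim auto
  ultimately show "integrable \<Lambda> (\<lambda>x. x ^ 1 / x\<^sup>2)"
    using f by (intro integrableI_nonneg L_meas) auto
qed

text \<open>By monotone convergence the integrals of the \<open>f i\<close> form a divergent series
  of nonnegative terms.\<close>

lemma unbounded_of_suminf:
  fixes f :: "nat \<Rightarrow> real \<Rightarrow> real"
  assumes f: "\<And>i. f i \<in> borel_measurable borel" "\<And>i x. 0 \<le> x \<Longrightarrow> x \<le> 1 \<Longrightarrow> 0 \<le> f i x"
    and int: "\<And>i. integrable \<Lambda> (f i)"
    and inf: "(\<integral>\<^sup>+x. (\<Sum>i. ennreal (f i x)) \<partial>\<Lambda>) = \<infinity>"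
  shows "\<exists>n0. \<forall>n\<ge>n0. L \<le> (\<integral>x. (\<Sum>i<n. f i x) \<partial>\<Lambda>)"
proof -
  define c where "c i = (\<integral>x. f i x \<partial>\<Lambda>)" for i
  have nn: "AE x in \<Lambda>. 0 \<le> f i x" for i using L_AE_unit by eventually_elim (use f in auto)
  have c0: "c i \<ge> 0" for i unfolding c_def by (rule integral_nonneg_AE[OF nn])
  have "(\<Sum>i. ennreal (c i)) = (\<Sum>i. \<integral>\<^sup>+x. ennreal (f i x) \<partial>\<Lambda>)"
    unfolding c_def by (intro suminf_cong nn_integral_eq_integral[symmetric] int nn)
  also have "\<dots> = (\<integral>\<^sup>+x. (\<Sum>i. ennreal (f i x)) \<partial>\<Lambda>)"
    by (rule nn_integral_suminf[symmetric]) (intro measurable_compose[OF L_meas measurable_ennreal] f)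
  finally have "(\<Sum>i. ennreal (c i)) = \<infinity>" using inf by simp
  then have ns: "\<not> summable c" using c0 suminf_ennreal2[of c] by (auto simp: ennreal_neq_top)
  have "\<exists>n. L < (\<Sum>i<n. c i)"
  proof (rule ccontr)
    assume "\<not> (\<exists>n. L < (\<Sum>i<n. c i))"
    then have "summable c" by (intro bounded_imp_summable[of c L] c0) (simp only: not_less not_ex lessThan_Suc_atMost[symmetric])
    then show False using ns by simp
  qed
  then obtain n0 where n0: "L < (\<Sum>i<n0. c i)" by blast
  show ?thesis
  proof (intro exI[of _ n0] allI impI)
    fix n assume "n0 \<le> n"
    then have "(\<Sum>i<n0. c i) \<le> (\<Sum>i<n. c i)" by (intro sum_mono2) (auto simp: c0)
    then show "L \<le> (\<integral>x. (\<Sum>i<n. f i x) \<partial>\<Lambda>)" using n0 int by (simp add: c_def)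
  qed
qed

text \<open>By \<open>ow_member\<close> the participation rate integrates a partial geometric sum,
  whose limit is \<open>1 / x\<close>; the \<Lambda>-integral of that limit is the mean of \<nu>.
  The threshold \<open>b0\<close> is uniform in \<open>S\<close> and \<open>v\<close>.\<close>

lemma member_rate_unbounded:
  assumes "nu_mean \<Lambda> = \<infinity>"
  shows "\<exists>b0. \<forall>S v. finite S \<longrightarrow> (v :: 'c) \<in> S \<longrightarrow> b0 \<le> card S \<longrightarrow> L \<le> (\<Sum>J | J \<in> Js S \<and> v \<in> J. lam (card S) (card J))"
proof -
  have inf: "(\<integral>\<^sup>+x. (\<Sum>i. ennreal ((1 - x) ^ i)) \<partial>\<Lambda>) = \<infinity>"
  proof (cases "emeasure \<Lambda> {0} = 0")
    case True
    then have "\<infinity> = (\<integral>\<^sup>+x. inverse (ennreal (x\<^sup>2)) * ennreal x \<partial>\<Lambda>)"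
      using assms by (simp add: nu_mean_def nn_mean_nu)
    also have "\<dots> = (\<integral>\<^sup>+x. (\<Sum>i. ennreal ((1 - x) ^ i)) \<partial>\<Lambda>)"
    proof (rule nn_integral_cong_AE)
      show "AE x in \<Lambda>. inverse (ennreal (x\<^sup>2)) * ennreal x = (\<Sum>i. ennreal ((1 - x) ^ i))"
        using L_AE_pos[OF True]
      proof eventually_elim
        case (elim x)
        have "(\<lambda>i. (1 - x) ^ i) sums (1 / (1 - (1 - x)))" using elim by (intro geometric_sums) auto
        then have "(\<Sum>i. ennreal ((1 - x) ^ i)) = ennreal (1 / x)"
          using elim by (subst suminf_ennreal_eq) auto
        moreover have "inverse (ennreal (x\<^sup>2)) * ennreal x = ennreal (1 / x\<^sup>2) * ennreal x"
          using elim by (simp add: nn_inverse_sq)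
        moreover have "ennreal (1 / x\<^sup>2) * ennreal x = ennreal (1 / x\<^sup>2 * x)"
          using elim by (intro ennreal_mult'[symmetric]) auto
        ultimately show ?case using elim by (simp add: power2_eq_square)
      qed
    qed
    finally show ?thesis by simp
  next
    case False
    show ?thesis
    proof (rule atom_zero_infinite[OF False])
      show "(\<lambda>x. \<Sum>i. ennreal ((1 - x) ^ i)) \<in> borel_measurable \<Lambda>"
        by (intro borel_measurable_suminf_order measurable_compose[OF L_meas measurable_ennreal]) measurable
      \<comment> \<open>At \<open>x = 0\<close> the geometric series is a divergent sum of
        ones.\<close>
      have "\<not> summable (\<lambda>i::nat. 1::real)" using summable_LIMSEQ_zero[of "\<lambda>i::nat. 1::real"] LIMSEQ_unique[of "\<lambda>i::nat. 1::real" 1 0] by auto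
      then have "(\<Sum>i::nat. (1::ennreal)) = top"
        using summable_suminf_not_top[of "\<lambda>i::nat. 1::real"] by auto
      then show "(\<Sum>i. ennreal ((1 - 0) ^ i)) = \<infinity>" by simp
    qed
  qed
  have int: "integrable \<Lambda> (\<lambda>x. (1 - x) ^ i)" for i
    by (rule L_integrable[where B=1]) (auto simp: power_le_one power_abs)
  have "\<exists>n0. \<forall>n\<ge>n0. L \<le> (\<integral>x. (\<Sum>i<n. (1 - x) ^ i) \<partial>\<Lambda>)"
    by (rule unbounded_of_suminf[OF _ _ int inf]) auto
  then obtain n0 where n0: "\<And>n. n \<ge> n0 \<Longrightarrow> L \<le> (\<integral>x. (\<Sum>i<n. (1 - x) ^ i) \<partial>\<Lambda>)" by blast
  show ?thesis
  proof (intro exI[of _ "Suc n0"] allI impI)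
    fix S and v :: 'c assume S: "finite S" "v \<in> S" "Suc n0 \<le> card S"
    have "L \<le> (\<integral>x. (\<Sum>i<card S - 1. (1 - x) ^ i) \<partial>\<Lambda>)" using n0[of "card S - 1"] S(3) by (simp add: One_nat_def)
    also have "\<dots> = (\<Sum>J | J \<in> Js S \<and> v \<in> J. lam (card S) (card J) * 1)"
      unfolding lam_sum by (simp add: ow_member[OF S(1,2)])
    finally show "L \<le> (\<Sum>J | J \<in> Js S \<and> v \<in> J. lam (card S) (card J))" by simp
  qed
qed

text \<open>At most \<open>M\<close> blocks lie outside \<open>A\<close>; that they stay out leaves
  at least the fraction \<open>(1 - x) ^ M\<close>, and the remaining sum tends to
  \<open>1 / x\<^sup>2\<close>, the density of \<nu>. The fraction is harmless because the infinite
  mass of \<nu> sits near 0.\<close>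

lemma inside_rate_unbounded:
  assumes L0: "emeasure \<Lambda> {0} = 0" and inf: "emeasure (nu \<Lambda>) {0..<1} = \<infinity>"
  shows "\<exists>a0. \<forall>S A. finite S \<longrightarrow> (A :: 'c set) \<subseteq> S \<longrightarrow> card S - card A \<le> M \<longrightarrow> a0 \<le> card A \<longrightarrow>
    L \<le> (\<Sum>J\<in>Js A. lam (card S) (card J))"
proof -
  let ?f = "\<lambda>j x. (1 - x) ^ M * (real j * (1 - x) ^ (j - 1))"
  have bd: "?f j x \<le> real j" "0 \<le> ?f j x" if "0 \<le> x" "x \<le> 1" for j x
  proof -
    have "(1 - x) ^ M * (real j * (1 - x) ^ (j - 1)) \<le> 1 * (real j * 1)"
      using that by (intro mult_mono power_le_one) auto
    then show "?f j x \<le> real j" by simp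
  qed (use that in simp)
  have inf': "(\<integral>\<^sup>+x. (\<Sum>j. ennreal (?f j x)) \<partial>\<Lambda>) = \<infinity>"
  proof -
    have sums: "(\<Sum>j. ennreal (?f j x)) = ennreal ((1 - x) ^ M / x\<^sup>2)" if x: "0 < x" "x < 1" for x
    proof -
      have "(\<lambda>j. diffs (\<lambda>_. 1::real) j * (1 - x) ^ j) sums (1 / (1 - (1 - x))\<^sup>2)"
      proof -
        have "(\<lambda>n. real (Suc n) * (1 - x) ^ n) sums (1 / (1 - (1 - x))\<^sup>2)"
          using geometric_deriv_sums[of "1 - x"] x by simp
        then show ?thesis by (simp add: diffs_def)
      qed
      then have "(\<lambda>n. real (Suc n) * (1 - x) ^ (Suc n - 1)) sums (1 / x\<^sup>2)" by (simp add: diffs_def One_nat_def)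
      then have "(\<lambda>n. real n * (1 - x) ^ (n - 1)) sums (1 / x\<^sup>2)" by (subst (asm) sums_Suc_iff) simp
      then have "(\<lambda>n. ?f n x) sums ((1 - x) ^ M * (1 / x\<^sup>2))" by (rule sums_mult)
      then show ?thesis using x by (subst suminf_ennreal_eq) auto
    qed
    have "(\<integral>\<^sup>+x. (\<Sum>j. ennreal (?f j x)) \<partial>\<Lambda>) = (\<integral>\<^sup>+x. ennreal ((1 - x) ^ M / x\<^sup>2) \<partial>\<Lambda>)"
      using L_AE_pos[OF L0] by (intro nn_integral_cong_AE, eventually_elim) (use sums in blast)
    moreover have "\<infinity> \<le> ennreal (2 ^ M) * (\<integral>\<^sup>+x. ennreal ((1 - x) ^ M / x\<^sup>2) \<partial>\<Lambda>) + 4 * emeasure \<Lambda> (space \<Lambda>)"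
    proof -
      have "\<infinity> = (\<integral>\<^sup>+x. inverse (ennreal (x\<^sup>2)) \<partial>\<Lambda>)" using inf by (simp add: emeasure_nu)
      also have "\<dots> \<le> (\<integral>\<^sup>+x. ennreal (2 ^ M) * ennreal ((1 - x) ^ M / x\<^sup>2) + 4 \<partial>\<Lambda>)"
      proof (rule nn_integral_mono_AE)
        show "AE x in \<Lambda>. inverse (ennreal (x\<^sup>2)) \<le> ennreal (2 ^ M) * ennreal ((1 - x) ^ M / x\<^sup>2) + 4"
          using L_AE_pos[OF L0]
        proof eventually_elim
          case (elim x)
          \<comment> \<open>For \<open>x \<le> 1/2\<close> the factor
            \<open>(2 * (1 - x)) ^ M\<close> is at least 1; for larger \<open>x\<close> the left
            side is at most 4.\<close>
          have "1 / x\<^sup>2 \<le> 2 ^ M * ((1 - x) ^ M / x\<^sup>2) + 4"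
          proof (cases "x \<le> 1 / 2")
            case True
            then have "1 \<le> (2 * (1 - x)) ^ M" by (intro one_le_power) simp
            then have "1 / x\<^sup>2 \<le> (2 * (1 - x)) ^ M / x\<^sup>2" by (intro divide_right_mono) auto
            also have "\<dots> = 2 ^ M * ((1 - x) ^ M / x\<^sup>2)" unfolding power_mult_distrib by simp
            finally show ?thesis by simp
          next
            case False
            then have "(1 / 2)\<^sup>2 \<le> x\<^sup>2" by (intro power_mono) auto
            then have "1 / x\<^sup>2 \<le> 4" using elim by (simp add: field_simps)
            moreover have "0 \<le> 2 ^ M * ((1 - x) ^ M / x\<^sup>2)" using elim by simp
            ultimately show ?thesis by linarith
          qed
          then have "ennreal (1 / x\<^sup>2) \<le> ennreal (2 ^ M * ((1 - x) ^ M / x\<^sup>2) + 4)" by (rule ennreal_leI)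
          also have "\<dots> = ennreal (2 ^ M * ((1 - x) ^ M / x\<^sup>2)) + ennreal 4"
            using elim by (intro ennreal_plus) auto
          also have "ennreal (2 ^ M * ((1 - x) ^ M / x\<^sup>2)) = ennreal (2 ^ M) * ennreal ((1 - x) ^ M / x\<^sup>2)"
            by (rule ennreal_mult') simp
          finally have "ennreal (1 / x\<^sup>2) \<le> ennreal (2 ^ M) * ennreal ((1 - x) ^ M / x\<^sup>2) + 4"
            by (simp only: ennreal_numeral)
          moreover have "inverse (ennreal (x\<^sup>2)) = ennreal (1 / x\<^sup>2)" using elim by (simp add: nn_inverse_sq)
          ultimately show ?case by (simp only:)
        qed
      qed
      also have "\<dots> = ennreal (2 ^ M) * (\<integral>\<^sup>+x. ennreal ((1 - x) ^ M / x\<^sup>2) \<partial>\<Lambda>) + 4 * emeasure \<Lambda> (space \<Lambda>)"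
      proof -
        have m: "(\<lambda>x. ennreal ((1 - x) ^ M / x\<^sup>2)) \<in> borel_measurable \<Lambda>"
          by (intro measurable_compose[OF L_meas measurable_ennreal]) measurable
        show ?thesis using m by (subst nn_integral_add) (auto simp: nn_integral_cmult)
      qed
      finally show ?thesis .
    qed
    ultimately show ?thesis
      using L.emeasure_finite[of "space \<Lambda>"]
      by (auto simp: top_unique ennreal_mult_eq_top_iff ennreal_add_eq_top)
  qed
  have int: "integrable \<Lambda> (?f j)" for j
  proof (rule L_integrable)
    fix x :: real assume "0 \<le> x" "x \<le> 1"
    then show "\<bar>?f j x\<bar> \<le> real j" using bd[of x j] by linarith
  qed simp
  have "\<exists>a0. \<forall>n\<ge>a0. L \<le> (\<integral>x. (\<Sum>j<n. ?f j x) \<partial>\<Lambda>)"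
    by (rule unbounded_of_suminf[OF _ bd(2) int inf']) auto
  then obtain a0 where a0: "\<And>n. n \<ge> a0 \<Longrightarrow> L \<le> (\<integral>x. (\<Sum>j<n. ?f j x) \<partial>\<Lambda>)" by blast
  show ?thesis
  proof (intro exI[of _ a0] allI impI)
    fix S and A :: "'c set" assume S: "finite S" "A \<subseteq> S" "card S - card A \<le> M" "a0 \<le> card A"
    have "L \<le> (\<integral>x. (\<Sum>j<card A. ?f j x) \<partial>\<Lambda>)" by (rule a0[OF S(4)])
    also have "\<dots> \<le> (\<integral>x. (\<Sum>J\<in>Js A. ow S x J * 1) \<partial>\<Lambda>)"
    proof (rule integral_mono_AE[OF _ lam_sum_integrable])
      show "integrable \<Lambda> (\<lambda>x. \<Sum>j<card A. ?f j x)"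
        by (intro Bochner_Integration.integrable_sum int)
      show "AE x in \<Lambda>. (\<Sum>j<card A. ?f j x) \<le> (\<Sum>J\<in>Js A. ow S x J * 1)"
        using L_AE_pos[OF L0]
      proof eventually_elim
        case (elim x)
        have "(\<Sum>j<card A. ?f j x) = (1 - x) ^ M * (\<Sum>j<card A. real j * (1 - x) ^ (j - 1))"
          by (simp add: sum_distrib_left)
        also have "\<dots> \<le> (1 - x) ^ (card S - card A) * (\<Sum>j<card A. real j * (1 - x) ^ (j - 1))"
          using elim S(3) by (intro mult_right_mono power_decreasing sum_nonneg) auto
        also have "\<dots> = (\<Sum>J\<in>Js A. ow S x J)" using ow_inside[OF S(1,2)] elim by simp
        finally show ?case by simp
      qed
    qed
    also have "\<dots> = (\<Sum>J\<in>Js A. lam (card S) (card J))" unfolding lam_sum[symmetric] by simp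
    finally show "L \<le> (\<Sum>J\<in>Js A. lam (card S) (card J))" .
  qed
qed

lemma psi_meas: "0 \<le> u \<Longrightarrow> (\<lambda>x. psi x u) \<in> borel_measurable borel"
  unfolding psi_def by measurable

lemma psi_integrable: "0 \<le> u \<Longrightarrow> integrable \<Lambda> (\<lambda>x. psi x u)"
  by (rule L_integrable[where B="u\<^sup>2"]) (auto simp: psi_meas psi_nonneg psi_le_sq)

text \<open>An atom at 0 contributes \<open>psi 0 u = u\<^sup>2\<close>, in agreement with the
  separate term of \<open>Psi\<close>; elsewhere the density of \<nu> supplies
  \<open>1 / x\<^sup>2\<close>.\<close>

lemma Psi_eq:
  assumes u: "0 \<le> u" shows "Psi \<Lambda> u = (\<integral>x. psi x u \<partial>\<Lambda>)"
proof -
  let ?e = "\<lambda>x. indicator {0<..<1} x *\<^sub>R (exp (- (x * u)) - 1 + x * u)"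
  have enn: "0 \<le> ?e x" for x by (simp add: exp_remainder_nonneg)
  have em: "?e \<in> borel_measurable \<Lambda>" by (rule L_meas) measurable
  have "(LINT x:{0<..<1}|nu \<Lambda>. exp (- (x * u)) - 1 + x * u) = enn2real (\<integral>\<^sup>+x. ennreal (?e x) \<partial>nu \<Lambda>)"
    unfolding set_lebesgue_integral_def using em by (intro integral_eq_nn_integral) (auto simp: nu_def exp_remainder_nonneg)
  also have "(\<integral>\<^sup>+x. ennreal (?e x) \<partial>nu \<Lambda>) = (\<integral>\<^sup>+x. inverse (ennreal (x\<^sup>2)) * ennreal (?e x) \<partial>\<Lambda>)"
    unfolding nu_def using em by (intro nn_integral_density nu_meas) auto
  also have "\<dots> = (\<integral>\<^sup>+x. ennreal (indicator {0<..<1} x * psi x u) \<partial>\<Lambda>)"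
  proof (intro nn_integral_cong)
    fix x
    show "inverse (ennreal (x\<^sup>2)) * ennreal (?e x) = ennreal (indicator {0<..<1} x * psi x u)"
    proof (cases "x \<in> {0<..<1}")
      case True
      then have "inverse (ennreal (x\<^sup>2)) * ennreal (?e x) = ennreal (1 / x\<^sup>2) * ennreal (?e x)"
        by (simp add: nn_inverse_sq)
      also have "\<dots> = ennreal (1 / x\<^sup>2 * ?e x)" by (intro ennreal_mult'[symmetric]) auto
      finally show ?thesis using True by (simp add: psi_def)
    qed simp
  qed
  also have "enn2real \<dots> = (\<integral>x. indicator {0<..<1} x * psi x u \<partial>\<Lambda>)"
    by (intro integral_eq_nn_integral[symmetric] L_meas) (auto simp: psi_nonneg intro!: borel_measurable_times psi_meas u)
  finally have "Psi \<Lambda> u = measure \<Lambda> {0} * u\<^sup>2 + (\<integral>x. indicator {0<..<1} x * psi x u \<partial>\<Lambda>)"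
    by (simp add: Psi_def)
  also have "measure \<Lambda> {0} * u\<^sup>2 = (\<integral>x. indicator {0} x * u\<^sup>2 \<partial>\<Lambda>)"
    using L_sets[of "{0}"] by simp
  also have "(\<integral>x. indicator {0} x * u\<^sup>2 \<partial>\<Lambda>) + (\<integral>x. indicator {0<..<1} x * psi x u \<partial>\<Lambda>)
      = (\<integral>x. indicator {0} x * u\<^sup>2 + indicator {0<..<1} x * psi x u \<partial>\<Lambda>)"
    by (intro Bochner_Integration.integral_add[symmetric] L_integrable[where B="u\<^sup>2"])
      (auto simp: indicator_def psi_nonneg psi_le_sq u intro!: borel_measurable_times psi_meas u)
  also have "\<dots> = (\<integral>x. psi x u \<partial>\<Lambda>)"
  proof (rule integral_cong_AE)
    show "AE x in \<Lambda>. indicator {0} x * u\<^sup>2 + indicator {0<..<1} x * psi x u = psi x u"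
      using L_AE_unit by eventually_elim (auto simp: indicator_def psi_def)
  qed (auto intro!: L_meas borel_measurable_add borel_measurable_times psi_meas u)
  finally show ?thesis .
qed

lemma Psi_nonneg: "0 \<le> u \<Longrightarrow> 0 \<le> Psi \<Lambda> u"
  by (simp add: Psi_eq psi_nonneg)

lemma Psi_mono: "0 \<le> u \<Longrightarrow> u \<le> v \<Longrightarrow> Psi \<Lambda> u \<le> Psi \<Lambda> v"
  unfolding Psi_eq[of u] using Psi_eq[of v]
  by (auto intro!: integral_mono psi_integrable psi_mono simp: space_L)

lemma Psi_scale: "0 \<le> u \<Longrightarrow> 0 \<le> \<theta> \<Longrightarrow> \<theta> \<le> 1 \<Longrightarrow> \<theta>\<^sup>2 * Psi \<Lambda> u \<le> Psi \<Lambda> (\<theta> * u)"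
proof -
  assume a: "0 \<le> u" "0 \<le> \<theta>" "\<theta> \<le> 1"
  have "(\<integral>x. \<theta>\<^sup>2 * psi x u \<partial>\<Lambda>) \<le> (\<integral>x. psi x (\<theta> * u) \<partial>\<Lambda>)"
    using a by (intro integral_mono integrable_mult_right psi_integrable psi_scale) (auto simp: space_L)
  then show ?thesis using a by (simp add: Psi_eq)
qed

lemma Psi_pos:
  assumes "emeasure \<Lambda> (space \<Lambda>) \<noteq> 0" "0 < u"
  shows "0 < Psi \<Lambda> u"
proof (rule ccontr)
  assume "\<not> 0 < Psi \<Lambda> u"
  then have "(\<integral>x. psi x u \<partial>\<Lambda>) = 0" using Psi_nonneg[of u] Psi_eq[of u] assms by simp
  then have "AE x in \<Lambda>. psi x u = 0"
    using assms by (subst (asm) integral_nonneg_eq_0_iff_AE) (auto simp: psi_nonneg intro!: psi_integrable)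
  with L_AE_unit have "AE x in \<Lambda>. False"
  proof eventually_elim
    case (elim x)
    then show ?case using psi_pos[of x u] assms by auto
  qed
  then have "emeasure \<Lambda> (space \<Lambda>) = 0" by (rule AE_E) (use emeasure_eq_0 in auto)
  then show False using assms by simp
qed

lemma gam_integrable: "integrable \<Lambda> (gam b)"
proof (rule L_integrable[where B="psi 0 (real b)"])
  show "gam b \<in> borel_measurable borel" by (intro borel_measurable_continuous_onI gam_continuous)
  fix x :: real assume "0 \<le> x" "x \<le> 1"
  moreover have "0 \<le> gam b x" using calculation unfolding gam_def by (intro sum_nonneg) auto
  ultimately show "\<bar>gam b x\<bar> \<le> psi 0 (real b)"
    using gam_le_psi[of x b] psi_le_sq[of x "real b"] by (simp add: psi_def)
qed

lemma Psi_le_gam: "2 \<le> b \<Longrightarrow> Psi \<Lambda> (real b) / 8 \<le> (\<integral>x. gam b x \<partial>\<Lambda>)"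
proof -
  assume b: "2 \<le> b"
  have "(\<integral>x. psi x (real b) / 8 \<partial>\<Lambda>) \<le> (\<integral>x. gam b x \<partial>\<Lambda>)"
    using b by (intro integral_mono gam_integrable integrable_divide psi_integrable psi_le_gam) (auto simp: space_L)
  then show ?thesis by (simp add: Psi_eq)
qed

text \<open>If each merger of \<open>k\<close> blocks gains at least \<open>(k - 1) * c\<close>, the
  total gain is at least \<open>c\<close> times the rate of block loss, which is no less than
  \<open>\<Psi>(b) / 8\<close>.\<close>

lemma weighted_merge_rate_ge:
  assumes S: "finite S" "2 \<le> card S"
    and \<phi>: "\<And>J. J \<in> Js S \<Longrightarrow> (real (card J) - 1) * c \<le> \<phi> J" and c: "0 \<le> c"
  shows "Psi \<Lambda> (real (card S)) * c / 8 \<le> (\<Sum>J\<in>Js S. lam (card S) (card J) * \<phi> J)"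
proof -
  have "Psi \<Lambda> (real (card S)) * c / 8 = Psi \<Lambda> (real (card S)) / 8 * c" by simp
  also have "\<dots> \<le> (\<integral>x. gam (card S) x \<partial>\<Lambda>) * c" by (intro mult_right_mono Psi_le_gam S c)
  also have "\<dots> = (\<Sum>J\<in>Js S. lam (card S) (card J) * (real (card J) - 1)) * c"
    unfolding lam_sum by (simp only: sum_ow_gam[OF S(1)])
  also have "\<dots> = (\<Sum>J\<in>Js S. lam (card S) (card J) * ((real (card J) - 1) * c))"
    by (simp add: sum_distrib_right mult.assoc)
  also have "\<dots> \<le> (\<Sum>J\<in>Js S. lam (card S) (card J) * \<phi> J)"
    by (intro sum_mono mult_left_mono \<phi> lam_nonneg)
  finally show ?thesis .
qed

text \<open>The ratio bound degenerates like \<open>1 / (1 - x)\<close> as \<open>x\<close> tends to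
  1, so the integral is cut at \<open>1 - \<delta>\<close>. Above the cut
  \<open>\<phi> J \<le> 1\<close> is used, with total weight at most
  \<open>1 / x\<^sup>2 \<le> 4\<close> since \<open>x \<ge> 1/2\<close>.\<close>

lemma weighted_merge_rate_le:
  assumes S: "finite S" "2 \<le> card S" and \<delta>: "0 < \<delta>" "\<delta> \<le> 1 / 2" and \<epsilon>: "0 \<le> \<epsilon>"
    and pos: "0 < Psi \<Lambda> (real (card S))"
    and \<phi>1: "\<And>J. J \<in> Js S \<Longrightarrow> \<phi> J \<le> 1"
    and \<phi>2: "\<And>J. J \<in> Js S \<Longrightarrow> \<phi> J \<le> \<epsilon> * (real (card S) / Psi \<Lambda> (real (card S))) * ((real (card J) - 1) / (real (card S) - real (card J) + 1))"
  shows "(\<Sum>J\<in>Js S. lam (card S) (card J) * \<phi> J) \<le> 4 * \<epsilon> / \<delta> + 4 * measure \<Lambda> {1 - \<delta><..1}"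
proof -
  let ?b = "card S"
  define p where "p = Psi \<Lambda> (real ?b)"
  have p: "p > 0" using pos by (simp add: p_def)
  have b: "real ?b \<ge> 2" using S(2) by simp
  have bound: "(\<Sum>J\<in>Js S. ow S x J * \<phi> J) \<le> \<epsilon> / (p * \<delta>) * psi x (real (?b + 1)) + 4 * indicator {1 - \<delta><..1} x"
    if x: "0 \<le> x" "x < 1" for x
  proof (cases "x \<le> 1 - \<delta>")
    case True
    have "(\<Sum>J\<in>Js S. ow S x J * \<phi> J) \<le> (\<Sum>J\<in>Js S. ow S x J * (\<epsilon> * (real ?b / p) * ((real (card J) - 1) / (real ?b - real (card J) + 1))))"
      unfolding p_def using x by (intro sum_mono mult_left_mono \<phi>2 ow_nonneg) auto
    also have "\<dots> = \<epsilon> * (real ?b / p) * (\<Sum>J\<in>Js S. ow S x J * ((real (card J) - 1) / (real ?b - real (card J) + 1)))"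
      by (simp add: sum_distrib_left mult_ac)
    also have "\<dots> \<le> \<epsilon> * (real ?b / p) * (gam (?b + 1) x / ((1 - x) * (real ?b + 1)))"
      using \<epsilon> p x by (intro mult_left_mono sum_ow_ratio_le S) auto
    also have "\<dots> \<le> \<epsilon> * (real ?b / p) * (psi x (real (?b + 1)) / (\<delta> * real ?b))"
    proof (intro mult_left_mono frac_le)
      show "\<delta> * real ?b \<le> (1 - x) * (real ?b + 1)" using True \<delta> b by (intro mult_mono) auto
    qed (use \<epsilon> p x \<delta> b gam_le_psi[of x "?b + 1"] psi_nonneg in auto)
    also have "\<dots> = \<epsilon> / (p * \<delta>) * psi x (real (?b + 1))" using b \<delta> p by (simp add: field_simps)
    finally show ?thesis by (simp add: indicator_def add_increasing2)
  next
    case False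
    have xp: "x \<ge> 1 / 2" using False \<delta> by simp
    have "(\<Sum>J\<in>Js S. ow S x J * \<phi> J) \<le> (\<Sum>J\<in>Js S. ow S x J * 1)"
      using x by (intro sum_mono mult_left_mono \<phi>1 ow_nonneg) auto
    also have "\<dots> \<le> 1 / x\<^sup>2"
      using ow_superset_le[OF S(1), of "{}" x] x xp by simp
    also have "\<dots> \<le> 4"
    proof -
      have "(1 / 2)\<^sup>2 \<le> x\<^sup>2" using xp by (intro power_mono) auto
      then show ?thesis using xp by (simp add: field_simps)
    qed
    moreover have "0 \<le> \<epsilon> / (p * \<delta>) * psi x (real (?b + 1))"
      using \<epsilon> p \<delta> psi_nonneg by (intro mult_nonneg_nonneg divide_nonneg_nonneg) auto
    ultimately show ?thesis using False x by (simp add: indicator_def)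
  qed
  have sub: "{1 - \<delta><..1} \<inter> {0..1} = {1 - \<delta><..1}" using \<delta> by auto
  have ind: "integrable \<Lambda> (\<lambda>x. 4 * indicator {1 - \<delta><..1} x :: real)"
    by (rule L_integrable[where B=4]) (auto simp: indicator_def)
  have pin: "integrable \<Lambda> (\<lambda>x. \<epsilon> / (p * \<delta>) * psi x (real (?b + 1)))"
    by (intro integrable_mult_right psi_integrable) simp
  have "(\<Sum>J\<in>Js S. lam ?b (card J) * \<phi> J) \<le> (\<integral>x. \<epsilon> / (p * \<delta>) * psi x (real (?b + 1)) + 4 * indicator {1 - \<delta><..1} x \<partial>\<Lambda>)"
    unfolding lam_sum
    by (rule integral_mono_AE[OF lam_sum_integrable Bochner_Integration.integrable_add[OF pin ind]])
      (use L_AE_unit in \<open>eventually_elim, use bound in blast\<close>)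
  also have "\<dots> = \<epsilon> / (p * \<delta>) * Psi \<Lambda> (real (?b + 1)) + 4 * measure \<Lambda> {1 - \<delta><..1}"
    using pin ind \<delta> by (simp add: Psi_eq Bochner_Integration.integral_add space_L sub)
  \<comment> \<open>Scaling by \<open>b / (b + 1) \<ge> 1/2\<close> pays for the shift from
    \<open>b\<close> to \<open>b + 1\<close>.\<close>
  also have "Psi \<Lambda> (real (?b + 1)) \<le> 4 * p"
  proof -
    let ?t = "real ?b / real (?b + 1)"
    have "(1 / 2)\<^sup>2 \<le> ?t\<^sup>2" using b by (intro power_mono) (auto simp: field_simps)
    then have "(1 / 2)\<^sup>2 * Psi \<Lambda> (real (?b + 1)) \<le> ?t\<^sup>2 * Psi \<Lambda> (real (?b + 1))"
      by (intro mult_right_mono Psi_nonneg) auto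
    also have "\<dots> \<le> Psi \<Lambda> (?t * real (?b + 1))" by (intro Psi_scale) auto
    also have "?t * real (?b + 1) = real ?b" by simp
    finally show ?thesis by (simp add: p_def power2_eq_square)
  qed
  then have "\<epsilon> / (p * \<delta>) * Psi \<Lambda> (real (?b + 1)) \<le> \<epsilon> / (p * \<delta>) * (4 * p)"
    using \<epsilon> p \<delta> by (intro mult_left_mono divide_nonneg_nonneg) auto
  also have "\<epsilon> / (p * \<delta>) * (4 * p) = 4 * \<epsilon> / \<delta>" using p by simp
  finally show ?thesis by simp
qed

text \<open>Continuity from above at the null set \<open>{1}\<close>; it makes the second term of
  \<open>weighted_merge_rate_le\<close> small.\<close>

lemma small_mass_near_one:
  assumes "0 < \<eta>" obtains \<delta> where "0 < \<delta>" "\<delta> \<le> 1 / 2" "measure \<Lambda> {1 - \<delta><..1} < \<eta>"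
proof -
  let ?A = "\<lambda>n. {1 - 1 / real (n + 2)<..(1::real)}"
  have "(\<lambda>n. measure \<Lambda> (?A n)) \<longlonglongrightarrow> measure \<Lambda> (\<Inter>n. ?A n)"
  proof (rule L.finite_Lim_measure_decseq)
    show "range ?A \<subseteq> sets \<Lambda>"
    proof safe
      fix n
      have "1 / real (n + 2) \<le> 1" by simp
      moreover have "1 - 1 / real (n + 2) < x" if "x \<in> ?A n" for x using that by (simp only: greaterThanAtMost_iff)
      ultimately have "0 \<le> x" if "x \<in> ?A n" for x using that by (meson diff_ge_0_iff_ge less_imp_le order_trans)
      then show "?A n \<in> sets \<Lambda>" by (intro L_sets) auto
    qed
    show "decseq ?A"
    proof (rule decseq_SucI, rule subsetI)
      fix n x assume "x \<in> ?A (Suc n)"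
      moreover have "1 / real (Suc n + 2) \<le> 1 / real (n + 2)" by (intro divide_left_mono) auto
      ultimately show "x \<in> ?A n" by auto
    qed
  qed
  also have "(\<Inter>n. ?A n) = {1}"
  proof (intro equalityI subsetI)
    fix x assume x: "x \<in> (\<Inter>n. ?A n)"
    have "x \<ge> 1"
    proof (rule ccontr)
      assume "\<not> x \<ge> 1"
      then obtain n where "1 / real (Suc n) < 1 - x" using reals_Archimedean[of "1 - x"] by (auto simp: inverse_eq_divide)
      moreover have "1 / real (n + 2) \<le> 1 / real (Suc n)" by (intro divide_left_mono) auto
      moreover have "1 - 1 / real (n + 2) < x" using x by auto
      ultimately show False by linarith
    qed
    moreover have "x \<le> 1" using x by auto
    ultimately show "x \<in> {1}" by simp
  qed auto
  also have "measure \<Lambda> {1} = 0" using L1 by (simp add: measure_def)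
  finally have "eventually (\<lambda>n. measure \<Lambda> (?A n) < \<eta>) sequentially" using assms by (rule order_tendstoD)
  then obtain n where "measure \<Lambda> (?A n) < \<eta>" by (auto simp: eventually_sequentially)
  then show ?thesis by (intro that[of "1 / real (n + 2)"]) (auto simp: field_simps)
qed

end

section \<open>Regime Discrete and absence of dust\<close>

text \<open>A partition of an unspecified finite set: drift bounds are proved for all of these,
  hence uniformly in the sample size.\<close>

definition blocks :: "'b set set \<Rightarrow> bool" where
  "blocks \<pi> \<longleftrightarrow> finite \<pi> \<and> (\<forall>B\<in>\<pi>. finite B \<and> B \<noteq> {}) \<and> (\<forall>B\<in>\<pi>. \<forall>C\<in>\<pi>. B \<noteq> C \<longrightarrow> B \<inter> C = {})"

lemma blocks_part: "blocks (part n x)"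
  unfolding blocks_def
proof (intro conjI ballI impI)
  fix B C assume "B \<in> part n x" "C \<in> part n x" "B \<noteq> C"
  then show "B \<inter> C = {}" by (auto simp: part_def)
qed (auto simp: part_def)

text \<open>Distinct blocks are disjoint and nonempty. A merger therefore creates a new block that
  is not a singleton, which determines how the block counts change.\<close>

lemma blocks_Union:
  assumes b: "blocks \<pi>" and J: "J \<in> Js \<pi>"
  shows "\<Union>J \<notin> \<pi>" "2 \<le> card (\<Union>J)"
proof -
  have J': "J \<subseteq> \<pi>" "2 \<le> card J" using JsD[OF J] by auto
  have fJ: "finite J" using J' b finite_subset by (auto simp: blocks_def)
  obtain B C where BC: "B \<in> J" "C \<in> J" "B \<noteq> C"
  proof -
    have "J \<noteq> {}" using J' by auto
    then obtain B where B: "B \<in> J" by blast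
    have "\<not> J \<subseteq> {B}" using J' card_mono[of "{B}" J] by auto
    then show ?thesis using that B by blast
  qed
  have pi: "B \<in> \<pi>" "C \<in> \<pi>" using BC J' by auto
  then have ne: "B \<noteq> {}" "C \<noteq> {}" "B \<inter> C = {}" using b BC(3) unfolding blocks_def by blast+
  show "\<Union>J \<notin> \<pi>"
  proof
    assume U: "\<Union>J \<in> \<pi>"
    have "D = \<Union>J" if D: "D \<in> J" for D
    proof (rule ccontr)
      assume ne: "D \<noteq> \<Union>J"
      have D\<pi>: "D \<in> \<pi>" using D J' by auto
      from b have "\<forall>B\<in>\<pi>. \<forall>C\<in>\<pi>. B \<noteq> C \<longrightarrow> B \<inter> C = {}" by (simp add: blocks_def)
      from this[rule_format, OF D\<pi> U ne] have "D \<inter> \<Union>J = {}" .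
      moreover have "D \<inter> \<Union>J = D" using D by (rule Int_absorb2[OF Union_upper])
      moreover have "D \<noteq> {}" using b D\<pi> by (simp add: blocks_def)
      ultimately show False by simp
    qed
    from this[OF BC(1)] this[OF BC(2)] BC(3) show False by simp
  qed
  have "finite (\<Union>J)" using b J' fJ by (auto simp: blocks_def)
  moreover obtain u v where "u \<in> B" "v \<in> C" using ne by blast
  moreover have "u \<noteq> v" using ne \<open>u \<in> B\<close> \<open>v \<in> C\<close> by blast
  ultimately have "card {u, v} \<le> card (\<Union>J)" using BC by (intro card_mono) auto
  then show "2 \<le> card (\<Union>J)" using \<open>u \<noteq> v\<close> by simp
qed

lemma card_coag:
  assumes b: "blocks \<pi>" and J: "J \<in> Js \<pi>"
  shows "card (coag J \<pi>) = card \<pi> - card J + 1"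
proof -
  have f: "finite \<pi>" using b by (simp add: blocks_def)
  have "\<Union>J \<notin> \<pi> - J" using blocks_Union[OF b J] by auto
  then show ?thesis unfolding coag_def using f JsD[OF J] finite_subset[of J \<pi>]
    by (simp add: card_Diff_subset)
qed

text \<open>The merged block is gained and the non-singletons in \<open>J\<close> are lost; the
  additive form avoids subtraction of natural numbers.\<close>

lemma num_nonsingles_coag:
  assumes b: "blocks \<pi>" and J: "J \<in> Js \<pi>"
  shows "num_nonsingles (coag J \<pi>) + card (J \<inter> {B\<in>\<pi>. 2 \<le> card B}) = num_nonsingles \<pi> + 1"
proof -
  let ?N = "{B\<in>\<pi>. 2 \<le> card B}"
  have f: "finite ?N" using b by (simp add: blocks_def)
  have "{B\<in>coag J \<pi>. 2 \<le> card B} = insert (\<Union>J) (?N - J)"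
    using blocks_Union[OF b J] by (auto simp: coag_def)
  then have "num_nonsingles (coag J \<pi>) = Suc (card (?N - J))"
    unfolding num_nonsingles_def using blocks_Union[OF b J] f by simp
  moreover have "card ?N = card (?N - J) + card (J \<inter> ?N)"
    using card_Diff_subset_Int[of ?N J] f card_mono[OF f, of "?N \<inter> J"] by (simp add: Int_commute)
  ultimately show ?thesis by (simp add: num_nonsingles_def)
qed

text \<open>Singletons are never created, so the indicator of a given singleton has nonpositive
  drift.\<close>

lemma singleton_coag:
  assumes b: "blocks \<pi>" and J: "J \<in> Js \<pi>"
  shows "{i} \<in> coag J \<pi> \<longleftrightarrow> {i} \<in> \<pi> \<and> {i} \<notin> J"
proof -
  have "\<Union>J \<noteq> {i}" using blocks_Union(2)[OF b J] by auto
  then show ?thesis by (auto simp: coag_def)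
qed

lemma card_singles: "card (singles n) = n"
  unfolding singles_def by (subst card_image) auto

lemma num_nonsingles_singles: "num_nonsingles (singles n) = 0"
proof -
  have "{B\<in>singles n. 2 \<le> card B} = {}" by (auto simp: singles_def)
  then show ?thesis unfolding num_nonsingles_def by (simp only: card.empty)
qed

lemma card_part_eventually:
  assumes X: "typical \<mu> X" and d: "\<not> dustmass \<mu> > 0" "finite (atoms \<mu>)"
  shows "eventually (\<lambda>n. card (part n X) = card (atoms \<mu>)) sequentially"
  using num_nonsingles_finite[OF X d(2)]
proof eventually_elim
  case (elim n)
  then show ?case using card_part_finite[OF X d, of n] num_nonsingles_le_card[OF finite_part, of n X] by simp
qed

text \<open>If \<open>f t\<close> were positive, the one-sided Lipschitz bound would keep
  \<open>f\<close> at least \<open>f t / 2\<close> on an interval ending at \<open>t\<close>, and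
  the integral would be positive.\<close>

lemma zero_from_integral:
  fixes f :: "real \<Rightarrow> real"
  assumes int: "set_integrable lborel {0..t} f" and z: "(LINT s:{0..t}|lborel. f s) \<le> 0"
    and nn: "\<And>s. 0 \<le> s \<Longrightarrow> s \<le> t \<Longrightarrow> 0 \<le> f s"
    and lip: "\<And>s. 0 \<le> s \<Longrightarrow> s \<le> t \<Longrightarrow> f t \<le> f s + C * (t - s)" and C: "0 \<le> C" and t: "0 < t"
  shows "f t \<le> 0"
proof (rule ccontr)
  assume "\<not> f t \<le> 0"
  then have e: "f t > 0" by simp
  \<comment> \<open>The denominator \<open>2 * C + 1\<close> gives
    \<open>C * \<eta> \<le> f t / 2\<close> and stays positive for \<open>C = 0\<close>.\<close>
  define \<eta> where "\<eta> = min t (f t / (2 * C + 1))"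
  have \<eta>: "0 < \<eta>" "\<eta> \<le> t" using e t C by (auto simp: \<eta>_def)
  have C\<eta>: "C * \<eta> \<le> f t / 2"
  proof -
    have "C * \<eta> \<le> C * (f t / (2 * C + 1))" unfolding \<eta>_def by (intro mult_left_mono C) simp
    also have "\<dots> \<le> f t / 2" using C e by (simp add: field_simps)
    finally show ?thesis .
  qed
  have ind: "integrable lborel (\<lambda>s. f t / 2 * indicator {t - \<eta>..t} s)"
    by (intro integrable_mult_right integrable_real_indicator) (auto simp: emeasure_lborel_Icc_eq)
  have "f t / 2 * \<eta> = (LINT s|lborel. f t / 2 * indicator {t - \<eta>..t} s)"
    using \<eta> by simp
  also have "\<dots> \<le> (LINT s|lborel. indicator {0..t} s *\<^sub>R f s)"
  proof (rule integral_mono[OF ind])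
    show "integrable lborel (\<lambda>s. indicator {0..t} s *\<^sub>R f s)" using int by (simp add: set_integrable_def)
    fix s :: real
    show "f t / 2 * indicator {t - \<eta>..t} s \<le> indicator {0..t} s *\<^sub>R f s"
    proof (cases "s \<in> {t - \<eta>..t}")
      case True
      then have s: "0 \<le> s" "s \<le> t" "t - s \<le> \<eta>" using \<eta> by auto
      have "C * (t - s) \<le> C * \<eta>" using s C by (intro mult_left_mono)
      then show ?thesis using lip[OF s(1,2)] C\<eta> s True by (simp add: indicator_def)
    qed (use nn in \<open>auto simp: indicator_def\<close>)
  qed
  also have "\<dots> \<le> 0" using z by (simp add: set_lebesgue_integral_def)
  finally show False using \<eta> e by (simp add: mult_le_0_iff)
qed

text \<open>Telescoping with \<open>1 / j\<^sup>2 \<le> 1 / (j - 1) - 1 / j\<close>.\<close>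

lemma sum_inverse_squares_le:
  assumes m: "1 \<le> m" and "m \<le> b"
  shows "(\<Sum>j\<in>{m<..b}. 1 / (real j)\<^sup>2) \<le> 1 / real m - 1 / real b"
  using assms(2)
proof (induction b rule: dec_induct)
  case (step b)
  have "{m<..Suc b} = insert (Suc b) {m<..b}" using step by auto
  then have "(\<Sum>j\<in>{m<..Suc b}. 1 / (real j)\<^sup>2) = 1 / (real (Suc b))\<^sup>2 + (\<Sum>j\<in>{m<..b}. 1 / (real j)\<^sup>2)" by simp
  also have "\<dots> \<le> 1 / (real (Suc b))\<^sup>2 + (1 / real m - 1 / real b)" using step by simp
  also have "1 / (real (Suc b))\<^sup>2 \<le> 1 / (real b * real (Suc b))"
    using step m by (intro divide_left_mono) (auto simp: power2_eq_square)
  also have "1 / (real b * real (Suc b)) = 1 / real b - 1 / real (Suc b)"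
    using step m by (simp add: field_simps)
  finally show ?case by simp
qed simp

section \<open>From drift bounds to almost sure statements\<close>

context fleming_viot
begin

lemma duality_le:
  assumes "1 \<le> n" "0 \<le> t" "\<And>\<pi>. blocks \<pi> \<Longrightarrow> Q h \<pi> \<le> g \<pi>"
  shows "V n (\<lambda>x. h (part n x)) t \<le> h (singles n) + VI n (\<lambda>x. g (part n x)) t"
  unfolding duality[OF assms(1,2)]
  by (intro add_left_mono VI_mono bm_part assms(3) blocks_part)

text \<open>After subtracting \<open>C\<close> the drift is nonpositive, so its time integral
  decreases with the endpoint.\<close>

lemma duality_lipschitz:
  assumes n: "1 \<le> n" and st: "0 \<le> s" "s \<le> t" and C: "\<And>\<pi>. blocks \<pi> \<Longrightarrow> Q h \<pi> \<le> C"
  shows "V n (\<lambda>x. h (part n x)) t \<le> V n (\<lambda>x. h (part n x)) s + C * (t - s)"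
proof -
  let ?q = "\<lambda>x. Q h (part n x)" and ?d = "\<lambda>x. Q h (part n x) - C"
  have d: "VI n ?d r = VI n ?q r - C * r" if "r \<ge> 0" for r
    using VI_diff[OF bm_part[of n "Q h"] bm_const[of n C], of r] VI_const[OF that, of n C] by simp
  have bd: "bm n ?d" by (intro bm_diff bm_part bm_const)
  have "V n ?d r \<le> V n (\<lambda>_. 0) r" for r
    by (intro V_mono bd bm_const) (simp add: C blocks_part)
  then have neg: "V n ?d r \<le> 0" for r by (simp add: V_const)
  have "VI n ?d t \<le> VI n ?d s"
    unfolding VI_def set_lebesgue_integral_def
    using V_set_integrable[OF bd] neg st
    by (intro integral_mono) (auto simp: set_integrable_def indicator_def)
  then have "VI n ?q t - C * t \<le> VI n ?q s - C * s" using d st by simp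
  then show ?thesis using duality[OF n, of t h] duality[OF n, of s h] st by (simp add: algebra_simps)
qed

text \<open>Markov's inequality bounds the probability that every \<open>X k\<close> is at least
  \<open>c\<close> by the mean of any one of them divided by \<open>c\<close>.\<close>

lemma AE_not_bounded_below:
  fixes X :: "nat \<Rightarrow> 'a \<Rightarrow> real"
  assumes X: "\<And>k. integrable P (X k)" "\<And>k \<omega>. \<omega> \<in> space P \<Longrightarrow> 0 \<le> X k \<omega>"
    and lim: "(\<lambda>k. \<integral>\<omega>. X k \<omega> \<partial>P) \<longlonglongrightarrow> 0" and c: "0 < c"
  shows "AE \<omega> in P. \<exists>k. X k \<omega> < c"
proof -
  define N where "N k = {\<omega>\<in>space P. c \<le> X k \<omega>}" for k
  have N: "N k \<in> sets P" for k
    unfolding N_def using borel_measurable_integrable[OF X(1), of k] by measurable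
  have "measure P (\<Inter>k. N k) \<le> (\<integral>\<omega>. X k \<omega> \<partial>P) / c" for k
  proof -
    have "measure P (\<Inter>k. N k) \<le> measure P (N k)" using N by (intro P.finite_measure_mono) auto
    also have "\<dots> \<le> (\<integral>\<omega>. X k \<omega> \<partial>P) / c"
      unfolding N_def using X c by (intro integral_Markov_inequality_measure[where A="{}"]) (auto intro!: AE_I2)
    finally show ?thesis .
  qed
  moreover have "(\<lambda>k. (\<integral>\<omega>. X k \<omega> \<partial>P) / c) \<longlonglongrightarrow> 0 / c" by (intro tendsto_divide lim tendsto_const) (use c in auto)
  ultimately have "measure P (\<Inter>k. N k) \<le> 0" by (intro LIMSEQ_le_const) auto
  then have "emeasure P (\<Inter>k. N k) = 0" by (simp add: P.emeasure_eq_measure measure_nonneg antisym)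
  moreover have "(\<Inter>k. N k) \<in> sets P" using N by auto
  ultimately show ?thesis
    by (intro AE_I[where N="\<Inter>k. N k"]) (auto simp: N_def not_less)
qed

lemma AE_zero_of_E:
  assumes "integrable P (\<lambda>\<omega>. l (path (t, \<omega>)))" "\<And>\<mu>. \<mu> \<in> M1 \<Longrightarrow> 0 \<le> l \<mu>" "E_fun l t \<le> 0"
  shows "AE \<omega> in P. l (path (t, \<omega>)) = 0"
proof -
  have nn: "AE \<omega> in P. 0 \<le> l (path (t, \<omega>))" by (intro AE_I2 assms(2) path_M1)
  then have "E_fun l t = 0" using assms(3) integral_nonneg_AE[OF nn] by (simp add: E_fun_def)
  then show ?thesis using integral_nonneg_eq_0_iff_AE[OF assms(1) nn] by (simp add: E_fun_def)
qed

lemma E_nonneg: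
  assumes "\<And>\<mu>. \<mu> \<in> M1 \<Longrightarrow> 0 \<le> l \<mu>" shows "0 \<le> E_fun l t"
  unfolding E_fun_def by (intro integral_nonneg_AE AE_I2 assms path_M1)

text \<open>A merger adds at most one non-singleton block, and the total merger rate is at most the
  mass of \<nu>. So the mean number of such blocks is bounded uniformly in \<open>n\<close>.\<close>

lemma discrete_finite_atoms:
  assumes reg: "regime_discrete \<Lambda>" and t: "0 \<le> t"
  shows "AE \<omega> in P. finite (atoms (path (t, \<omega>)))"
proof -
  note L0 = discreteD[OF reg]
  have Q: "Q (\<lambda>\<pi>. real (num_nonsingles \<pi>)) \<pi> \<le> moment 0" if b: "blocks \<pi>" for \<pi>
  proof -
    have "Q (\<lambda>\<pi>. real (num_nonsingles \<pi>)) \<pi> \<le> (\<Sum>J\<in>Js \<pi>. lam (card \<pi>) (card J) * 1)"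
      unfolding Q_def
    proof (intro sum_mono mult_left_mono lam_nonneg)
      fix J assume "J \<in> Js \<pi>"
      from num_nonsingles_coag[OF b this] show "real (num_nonsingles (coag J \<pi>)) - real (num_nonsingles \<pi>) \<le> 1" by linarith
    qed
    also have "\<dots> \<le> moment 0"
      using superset_rate_le[OF L0(1), of "{}" \<pi>] L0(2) b by (simp add: moment_def blocks_def)
    finally show ?thesis .
  qed
  have V: "V n (\<lambda>x. real (num_nonsingles (part n x))) t \<le> moment 0 * t" if "1 \<le> n" for n
    using duality_le[OF that t Q] VI_const[OF t, of n "moment 0"] by (simp add: num_nonsingles_singles)
  \<comment> \<open>\<open>card\<close> of an infinite set is 0, so the case of infinitely many
    atoms is listed separately.\<close>
  define l where "l M \<mu> = (if infinite (atoms \<mu>) \<or> M \<le> card (atoms \<mu>) then 1 else 0 :: real)" for M and \<mu> :: "real measure"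
  define h where "h M (n::nat) \<pi> = (if M \<le> num_nonsingles \<pi> then 1 else 0 :: real)" for M n and \<pi> :: "nat set set"
  have lim: "(\<lambda>n. G_fun n (\<lambda>x. h M n (part n x)) \<mu>) \<longlonglongrightarrow> l M \<mu>" if "\<mu> \<in> M1" for M \<mu>
  proof (rule G_seqs_lim_const[OF that, where B=1])
    fix X assume X: "typical \<mu> X"
    show "(\<lambda>n. h M n (part n X)) \<longlonglongrightarrow> l M \<mu>"
    proof (cases "finite (atoms \<mu>)")
      case True
      from num_nonsingles_finite[OF X True] have "eventually (\<lambda>n. h M n (part n X) = l M \<mu>) sequentially"
        by eventually_elim (use True in \<open>simp add: h_def l_def\<close>)
      then show ?thesis by (rule tendsto_eventually)
    next
      case False
      from num_nonsingles_infinite[OF X False, of M] have "eventually (\<lambda>n. h M n (part n X) = l M \<mu>) sequentially"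
        by eventually_elim (use False in \<open>simp add: h_def l_def\<close>)
      then show ?thesis by (rule tendsto_eventually)
    qed
  qed (simp add: h_def)
  have hB: "\<bar>h M n \<pi>\<bar> \<le> 1" for M n \<pi> by (simp add: h_def)
  have S1: "integrable P (\<lambda>\<omega>. l M (path (t, \<omega>)))" for M
    by (rule V_seqs_lim(1)[where h="h M" and l="l M" and B=1]) (use lim hB in auto)
  have S2: "(\<lambda>n. V n (\<lambda>x. h M n (part n x)) t) \<longlonglongrightarrow> E_fun (l M) t" for M
    by (rule V_seqs_lim(2)[where h="h M" and l="l M" and B=1]) (use lim hB in auto)
  have E: "E_fun (l M) t \<le> moment 0 * t / real M" if M: "M \<ge> 1" for M
  proof (rule LIMSEQ_le_const2[OF S2], intro exI[of _ 1] allI impI)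
    fix n :: nat assume n: "1 \<le> n"
    \<comment> \<open>Markov's inequality for the number of non-singleton blocks.\<close>
    have "V n (\<lambda>x. h M n (part n x)) t \<le> V n (\<lambda>x. 1 / real M * real (num_nonsingles (part n x))) t"
      using M by (intro V_mono bm_part bm_cmult) (auto simp: h_def field_simps)
    also have "\<dots> = 1 / real M * V n (\<lambda>x. real (num_nonsingles (part n x))) t" by (rule V_cmult)
    also have "\<dots> \<le> 1 / real M * (moment 0 * t)" using V[OF n] by (intro mult_left_mono) auto
    finally show "V n (\<lambda>x. h M n (part n x)) t \<le> moment 0 * t / real M" by simp
  qed
  have "AE \<omega> in P. \<exists>k. l (Suc k) (path (t, \<omega>)) < 1"
  proof (rule AE_not_bounded_below)
    have "(\<lambda>k. moment 0 * t / real (Suc k)) \<longlonglongrightarrow> 0"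
      by (intro LIMSEQ_Suc lim_const_over_n)
    then show "(\<lambda>k. \<integral>\<omega>. l (Suc k) (path (t, \<omega>)) \<partial>P) \<longlonglongrightarrow> 0"
    proof (rule real_tendsto_sandwich[rotated 2, OF tendsto_const])
      show "eventually (\<lambda>k. 0 \<le> (\<integral>\<omega>. l (Suc k) (path (t, \<omega>)) \<partial>P)) sequentially"
        by (intro always_eventually allI integral_nonneg_AE AE_I2) (simp add: l_def)
      show "eventually (\<lambda>k. (\<integral>\<omega>. l (Suc k) (path (t, \<omega>)) \<partial>P) \<le> moment 0 * t / real (Suc k)) sequentially"
        using E[of "Suc _"] by (intro always_eventually allI) (simp add: E_fun_def)
    qed
    show "integrable P (\<lambda>\<omega>. l (Suc k) (path (t, \<omega>)))" for k by (rule S1)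
  qed (simp_all add: l_def)
  then show ?thesis by eventually_elim (auto simp: l_def split: if_splits)
qed

text \<open>For a typical sample the block \<open>{1}\<close> persists as \<open>n\<close> grows
  exactly when the first point avoids the atoms.\<close>

lemma singleton_tendsto_dustmass:
  assumes mu: "\<mu> \<in> M1"
  shows "(\<lambda>n. G_fun n (\<lambda>x. of_bool ({1} \<in> part n x)) \<mu>) \<longlonglongrightarrow> dustmass \<mu>"
proof -
  interpret prob_space \<mu> by (rule M1_D[OF mu])
  interpret S: product_prob_space "\<lambda>_. \<mu>" "UNIV :: nat set" by unfold_locales
  let ?D = "{0..1} - atoms \<mu>"
  let ?L = "\<lambda>X :: nat \<Rightarrow> real. indicator ?D (X 1) :: real"
  have L: "?L \<in> borel_measurable (seqs \<mu>)"
    by (rule measurable_compose[OF seqs_component]) (use sets_nonatoms[OF mu] in simp)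
  have ty: "(\<lambda>n. of_bool ({1} \<in> part n X) :: real) \<longlonglongrightarrow> of_bool (X 1 \<notin> atoms \<mu>)" if X: "typical \<mu> X" for X
  proof (cases "X 1 \<in> atoms \<mu>")
    case True
    from singleton_atom[OF X True] show ?thesis using True
      by (intro tendsto_eventually) (auto elim: eventually_mono)
  next
    case False
    have "eventually (\<lambda>n. {1} \<in> part n X) sequentially"
      by (rule eventually_sequentiallyI[of 1]) (rule singleton_dust[OF X False], auto)
    then show ?thesis using False
      by (intro tendsto_eventually) (auto elim: eventually_mono)
  qed
  have at: "{X \<in> space (seqs \<mu>). X 1 \<notin> atoms \<mu>} = (\<lambda>X. X 1) -` ?D \<inter> space (seqs \<mu>)"
    using space_seqs[OF mu] by auto
  have m: "(\<lambda>X. of_bool (X 1 \<notin> atoms \<mu>) :: real) \<in> borel_measurable (seqs \<mu>)"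
    using L by (subst measurable_cong[where g="?L"]) (auto simp: indicator_def dest: space_seqs[OF mu, of _ 1])
  have "(\<lambda>n. G_fun n (\<lambda>x. of_bool ({1} \<in> part n x)) \<mu>) \<longlonglongrightarrow> (\<integral>X. of_bool (X 1 \<notin> atoms \<mu>) \<partial>seqs \<mu>)"
    by (rule G_seqs_lim[OF mu, where B=1]) (use m ty in auto)
  also have "(\<integral>X. of_bool (X 1 \<notin> atoms \<mu>) \<partial>seqs \<mu>) = (\<integral>X. ?L X \<partial>seqs \<mu>)"
    by (intro Bochner_Integration.integral_cong refl) (auto simp: indicator_def dest: space_seqs[OF mu, of _ 1])
  also have "\<dots> = (\<integral>x. indicator ?D x \<partial>distr (seqs \<mu>) \<mu> (\<lambda>X. X 1))"
    by (rule integral_distr[symmetric]) (use seqs_component sets_nonatoms[OF mu] in auto)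
  also have "distr (seqs \<mu>) \<mu> (\<lambda>X. X 1) = \<mu>"
    unfolding seqs_def using S.PiM_component[of 1] by simp
  also have "(\<integral>x. indicator ?D x \<partial>\<mu>) = dustmass \<mu>"
  proof -
    have "?D \<inter> {0..1} = ?D" by auto
    then show ?thesis using sets_nonatoms[OF mu] by (simp add: dustmass_def M1_D[OF mu])
  qed
  finally show ?thesis .
qed

text \<open>The singleton \<open>{1}\<close> is lost at a rate that grows without bound with the
  number of blocks, and this number tends to infinity when there is dust. Hence the time integral of
  the mean dust mass is at most \<open>1 / L\<close> for every \<open>L\<close>.\<close>

lemma no_dust:
  assumes reg: "nu_mean \<Lambda> = \<infinity>" and t: "0 < t"
  shows "AE \<omega> in P. dustmass (path (t, \<omega>)) = 0"
proof -
  define h :: "nat set set \<Rightarrow> real" where "h \<pi> = of_bool ({1} \<in> \<pi>)" for \<pi>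
  have Qh: "Q h \<pi> = - h \<pi> * (\<Sum>J | J \<in> Js \<pi> \<and> {1} \<in> J. lam (card \<pi>) (card J))" if b: "blocks \<pi>" for \<pi>
  proof (cases "{1} \<in> \<pi>")
    case True
    have "Q h \<pi> = (\<Sum>J\<in>Js \<pi>. if {1} \<in> J then - lam (card \<pi>) (card J) else 0)"
      unfolding Q_def by (intro sum.cong refl) (use True in \<open>auto simp: h_def singleton_coag[OF b]\<close>)
    also have "\<dots> = (\<Sum>J | J \<in> Js \<pi> \<and> {1} \<in> J. - lam (card \<pi>) (card J))"
      using finite_Js[of \<pi>] b by (intro sum.inter_filter[symmetric]) (simp add: blocks_def)
    finally show ?thesis using True by (simp add: h_def sum_negf)
  next
    case False
    then show ?thesis unfolding Q_def by (simp add: h_def singleton_coag[OF b])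
  qed
  have h01: "0 \<le> h \<pi>" "h \<pi> \<le> 1" "\<bar>h \<pi>\<bar> \<le> 1" for \<pi> by (auto simp: h_def)
  have Q0: "Q h \<pi> \<le> 0" if "blocks \<pi>" for \<pi>
    unfolding Qh[OF that] using h01 by (simp add: sum_nonneg lam_nonneg)
  have lim: "(\<lambda>n. G_fun n (\<lambda>x. h (part n x)) \<mu>) \<longlonglongrightarrow> dustmass \<mu>" if "\<mu> \<in> M1" for \<mu>
    unfolding h_def by (rule singleton_tendsto_dustmass[OF that])
  note S = V_seqs_lim[where h="\<lambda>_. h" and l=dustmass and B=1, OF lim h01(3)]
  have bound: "(LINT s:{0..t}|lborel. E_fun dustmass s) \<le> 1 / L" if L: "L > 0" for L
  proof -
    from member_rate_unbounded[OF reg, of L, where 'c="nat set"]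
    obtain b0 where b0': "\<forall>\<pi> v. finite \<pi> \<longrightarrow> (v::nat set) \<in> \<pi> \<longrightarrow> b0 \<le> card \<pi> \<longrightarrow>
        L \<le> (\<Sum>J | J \<in> Js \<pi> \<and> v \<in> J. lam (card \<pi>) (card J))" by (rule exE)
    note b0 = b0'[rule_format]
    \<comment> \<open>Partitions with fewer than \<open>b0\<close> blocks escape the rate bound.
      Their contribution vanishes in the limit: eventually there are \<open>b0\<close> blocks or
      \<open>{1}\<close> is no longer a block.\<close>
    define g where "g \<pi> = (if card \<pi> < b0 then h \<pi> else 0)" for \<pi>
    have "Q h \<pi> \<le> - L * (h \<pi> - g \<pi>)" if b: "blocks \<pi>" for \<pi>
    proof (cases "card \<pi> < b0 \<or> {1} \<notin> \<pi>")
      case True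
      then show ?thesis using Q0[OF b] by (auto simp: g_def h_def)
    next
      case False
      then show ?thesis using b0[of \<pi> "{1}"] b by (auto simp: Qh[OF b] g_def h_def blocks_def)
    qed
    note D = duality_le[OF _ less_imp_le[OF t] this]
    have le: "VI n (\<lambda>x. h (part n x)) t \<le> 1 / L + VI n (\<lambda>x. g (part n x)) t" if n: "1 \<le> n" for n
    proof -
      have "0 \<le> V n (\<lambda>x. h (part n x)) t"
        using V_mono[OF bm_const[of n 0] bm_part[of n h], of t] h01 by (simp add: V_const)
      also have "\<dots> \<le> 1 + VI n (\<lambda>x. - L * (h (part n x) - g (part n x))) t"
        using D[OF n] h01(2)[of "singles n"] by simp
      also have "VI n (\<lambda>x. - L * (h (part n x) - g (part n x))) t = - L * (VI n (\<lambda>x. h (part n x)) t - VI n (\<lambda>x. g (part n x)) t)"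
        unfolding VI_cmult by (simp add: VI_diff bm_part)
      finally show ?thesis using L by (simp add: field_simps)
    qed
    have gl: "(\<lambda>n. G_fun n (\<lambda>x. g (part n x)) \<mu>) \<longlonglongrightarrow> 0" if mu: "\<mu> \<in> M1" for \<mu>
    proof (rule G_seqs_lim_const[OF mu, of "\<lambda>_. g" 1])
      fix X assume X: "typical \<mu> X"
      have "eventually (\<lambda>n. g (part n X) = 0) sequentially"
      proof (cases "dustmass \<mu> > 0")
        case True
        then have "eventually (\<lambda>n. b0 \<le> card (part n X)) sequentially" by (intro card_part_infinite[OF X]) simp
        then show ?thesis by eventually_elim (simp add: g_def)
      next
        case False
        then have "X 1 \<in> atoms \<mu>" using X by (simp add: typical_def)
        from singleton_atom[OF X this] show ?thesis by eventually_elim (simp add: g_def h_def)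
      qed
      then show "(\<lambda>n. g (part n X)) \<longlonglongrightarrow> 0" by (rule tendsto_eventually)
    qed (auto simp: g_def h_def)
    have "(\<lambda>n. VI n (\<lambda>x. g (part n x)) t) \<longlonglongrightarrow> (LINT s:{0..t}|lborel. E_fun (\<lambda>_. 0) s)"
      by (rule V_seqs_lim(3)[where h="\<lambda>_. g" and l="\<lambda>_. 0" and B=1, OF gl]) (auto simp: g_def h_def)
    then have "(\<lambda>n. 1 / L + VI n (\<lambda>x. g (part n x)) t) \<longlonglongrightarrow> 1 / L + 0"
      by (intro tendsto_intros) (simp add: E_fun_def)
    then show ?thesis
      by (intro LIMSEQ_le[OF S(3)]) (use le in auto)
  qed
  have z: "(LINT s:{0..t}|lborel. E_fun dustmass s) \<le> 0"
  proof (rule field_le_epsilon)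
    fix e :: real assume "0 < e"
    then show "(LINT s:{0..t}|lborel. E_fun dustmass s) \<le> 0 + e" using bound[of "1 / e"] by simp
  qed
  \<comment> \<open>The drift is nonpositive, so the mean dust mass is nonincreasing in time and the
    Lipschitz constant is 0.\<close>
  have "E_fun dustmass t \<le> 0"
  proof (rule zero_from_integral[OF S(4) z _ _ order_refl t])
    show "0 \<le> E_fun dustmass s" for s by (intro E_nonneg dustmass_nonneg)
    show "E_fun dustmass t \<le> E_fun dustmass s + 0 * (t - s)" if "0 \<le> s" "s \<le> t" for s
      using duality_lipschitz[OF _ that Q0]
      by (intro LIMSEQ_le[OF S(2)[of t] tendsto_add[OF S(2)[of s] tendsto_const]]) auto
  qed
  then show ?thesis by (intro AE_zero_of_E S(1) dustmass_nonneg)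
qed

end

section \<open>Presence of dust\<close>

definition dust_count :: "real measure \<Rightarrow> nat \<Rightarrow> (nat \<Rightarrow> real) \<Rightarrow> nat" where
  "dust_count \<mu> j X = card {i\<in>{1..j}. X i \<notin> atoms \<mu>}"

text \<open>Singletons among the first \<open>j\<close> labels. For fixed \<open>j\<close> and
  growing \<open>n\<close> their number becomes the number of dust points among the first
  \<open>j\<close> points.\<close>

definition sg :: "nat \<Rightarrow> nat set set \<Rightarrow> nat set set" where
  "sg j \<pi> = {B\<in>\<pi>. \<exists>i\<in>{1..j}. B = {i}}"

lemma dust_count_measurable:
  fixes F :: "nat \<Rightarrow> real"
  assumes mu: "\<mu> \<in> M1"
  shows "(\<lambda>X. F (dust_count \<mu> j X)) \<in> borel_measurable (seqs \<mu>)"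
proof -
  let ?s = "\<lambda>X :: nat \<Rightarrow> real. \<Sum>i\<in>{1..j}. indicator ({0..1} - atoms \<mu>) (X i) :: real"
  have "?s \<in> borel_measurable (seqs \<mu>)"
    by (intro borel_measurable_sum measurable_compose[OF seqs_component])
      (use sets_nonatoms[OF mu] in simp)
  from measurable_compose[OF this measurable_real_floor]
  have "(\<lambda>X. \<lfloor>?s X\<rfloor>) \<in> seqs \<mu> \<rightarrow>\<^sub>M count_space UNIV" .
  then have "(\<lambda>X. F (nat \<lfloor>?s X\<rfloor>)) \<in> borel_measurable (seqs \<mu>)"
    by (rule measurable_compose) simp
  moreover have "F (nat \<lfloor>?s X\<rfloor>) = F (dust_count \<mu> j X)" if "X \<in> space (seqs \<mu>)" for X
  proof -
    have "?s X = (\<Sum>i\<in>{1..j}. if X i \<notin> atoms \<mu> then 1 else 0)"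
      using space_seqs[OF mu that] by (intro sum.cong) (auto simp: indicator_def)
    also have "\<dots> = real (dust_count \<mu> j X)"
      by (simp add: dust_count_def sum.If_cases Int_def)
    finally show ?thesis by simp
  qed
  ultimately show ?thesis by (subst measurable_cong[where g="\<lambda>X. F (nat \<lfloor>?s X\<rfloor>)"]) simp_all
qed

lemma sg_part_eventually:
  assumes X: "typical \<mu> X"
  shows "eventually (\<lambda>n. card (sg j (part n X)) = dust_count \<mu> j X) sequentially"
proof -
  have "eventually (\<lambda>n. ({i} \<in> part n X) = (X i \<notin> atoms \<mu>)) sequentially" if i: "i \<in> {1..j}" for i
  proof (cases "X i \<in> atoms \<mu>")
    case True
    from singleton_atom[OF X True] show ?thesis by eventually_elim (simp add: True)
  next
    case False
    then show ?thesis using i by (intro eventually_sequentiallyI[of i]) (simp add: singleton_dust[OF X])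
  qed
  then have "eventually (\<lambda>n. \<forall>i\<in>{1..j}. ({i} \<in> part n X) = (X i \<notin> atoms \<mu>)) sequentially"
    by (intro eventually_ball_finite) auto
  then show ?thesis
  proof eventually_elim
    case (elim n)
    have "sg j (part n X) = (\<lambda>i. {i}) ` {i\<in>{1..j}. X i \<notin> atoms \<mu>}" using elim by (auto simp: sg_def)
    then show ?case by (simp add: dust_count_def card_image)
  qed
qed

lemma dust_count_unbounded:
  assumes X: "typical \<mu> X" and d: "dustmass \<mu> > 0"
  shows "filterlim (\<lambda>j. dust_count \<mu> j X) at_top sequentially"
  unfolding filterlim_at_top
proof
  fix M
  have ex: "\<exists>j. M \<le> dust_count \<mu> j X"
  proof (induction M)
    case (Suc M)
    then obtain j where j: "M \<le> dust_count \<mu> j X" by blast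
    have "\<forall>n. \<exists>i>n. X i \<notin> atoms \<mu>" using X d by (simp add: typical_def)
    then obtain i where i: "i > j" "X i \<notin> atoms \<mu>" by blast
    have "insert i {i\<in>{1..j}. X i \<notin> atoms \<mu>} \<subseteq> {k\<in>{1..i}. X k \<notin> atoms \<mu>}" using i by auto
    then have "card (insert i {i\<in>{1..j}. X i \<notin> atoms \<mu>}) \<le> dust_count \<mu> i X"
      unfolding dust_count_def by (intro card_mono) auto
    then show ?case using j i by (intro exI[of _ i]) (simp add: dust_count_def)
  qed simp
  then obtain j where "M \<le> dust_count \<mu> j X" by blast
  moreover have "dust_count \<mu> j X \<le> dust_count \<mu> j' X" if "j \<le> j'" for j'
    unfolding dust_count_def using that by (intro card_mono) auto
  ultimately show "eventually (\<lambda>j. M \<le> dust_count \<mu> j X) sequentially"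
    by (intro eventually_sequentiallyI[of j]) (meson order_trans)
qed

lemma sg_coag:
  assumes b: "blocks \<pi>" and J: "J \<in> Js \<pi>"
  shows "sg j (coag J \<pi>) = sg j \<pi> - J"
  using singleton_coag[OF b J] by (auto simp: sg_def)

lemma card_le_tendsto:
  assumes mu: "\<mu> \<in> M1"
  shows "(\<lambda>n. G_fun n (\<lambda>x. of_bool (card (part n x) \<le> M)) \<mu>)
    \<longlonglongrightarrow> of_bool (\<not> dustmass \<mu> > 0 \<and> finite (atoms \<mu>) \<and> card (atoms \<mu>) \<le> M)"
proof (rule G_seqs_lim_const[OF mu, of "\<lambda>_ \<pi>. of_bool (card \<pi> \<le> M)" 1])
  fix X assume X: "typical \<mu> X"
  show "(\<lambda>n. of_bool (card (part n X) \<le> M) :: real)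
    \<longlonglongrightarrow> of_bool (\<not> dustmass \<mu> > 0 \<and> finite (atoms \<mu>) \<and> card (atoms \<mu>) \<le> M)"
  proof (cases "\<not> dustmass \<mu> > 0 \<and> finite (atoms \<mu>)")
    case True
    then have "eventually (\<lambda>n. card (part n X) = card (atoms \<mu>)) sequentially"
      using card_part_eventually[OF X] by blast
    then show ?thesis using True by (intro tendsto_eventually) (auto elim: eventually_mono)
  next
    case False
    then have "eventually (\<lambda>n. Suc M \<le> card (part n X)) sequentially"
      using card_part_infinite[OF X] by blast
    then show ?thesis using False by (intro tendsto_eventually) (auto elim: eventually_mono)
  qed
qed simp

context fleming_viot
begin

lemma E_abs_le:
  assumes "integrable P (\<lambda>\<omega>. l (path (s, \<omega>)))" "\<And>\<mu>. \<mu> \<in> M1 \<Longrightarrow> \<bar>l \<mu>\<bar> \<le> B"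
  shows "\<bar>E_fun l s\<bar> \<le> B"
proof -
  have "\<bar>E_fun l s\<bar> \<le> (\<integral>\<omega>. \<bar>l (path (s, \<omega>))\<bar> \<partial>P)" unfolding E_fun_def by (rule integral_abs_bound)
  also have "\<dots> \<le> (\<integral>\<omega>. B \<partial>P)" by (intro integral_mono integrable_abs assms path_M1) auto
  finally show ?thesis using P.prob_space by simp
qed

lemma E_integral_lim_zero:
  assumes int: "\<And>j s. integrable P (\<lambda>\<omega>. l j (path (s, \<omega>)))" "\<And>j. set_integrable lborel {0..t} (E_fun (l j))"
    and B: "\<And>j \<mu>. \<mu> \<in> M1 \<Longrightarrow> \<bar>l j \<mu>\<bar> \<le> B"
    and lim: "\<And>\<mu>. \<mu> \<in> M1 \<Longrightarrow> (\<lambda>j. l j \<mu>) \<longlonglongrightarrow> 0"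
  shows "(\<lambda>j. LINT s:{0..t}|lborel. E_fun (l j) s) \<longlonglongrightarrow> 0"
proof -
  have "(\<lambda>j. E_fun (l j) s) \<longlonglongrightarrow> (\<integral>\<omega>. 0 \<partial>P)" for s
    unfolding E_fun_def
  proof (rule integral_dominated_convergence[where w="\<lambda>_. B"])
    show "AE \<omega> in P. (\<lambda>j. l j (path (s, \<omega>))) \<longlonglongrightarrow> 0" by (intro AE_I2 lim path_M1)
    show "AE \<omega> in P. norm (l j (path (s, \<omega>))) \<le> B" for j unfolding real_norm_def by (intro AE_I2 B path_M1)
  qed (use int in auto)
  then have l0: "(\<lambda>j. E_fun (l j) s) \<longlonglongrightarrow> 0" for s by simp
  have "(\<lambda>j. LINT s|lborel. indicator {0..t} s *\<^sub>R E_fun (l j) s) \<longlonglongrightarrow> (LINT s|(lborel :: real measure). 0)"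
  proof (rule integral_dominated_convergence[where w="\<lambda>s. indicator {0..t} s * B"])
    show "AE s in lborel. (\<lambda>j. indicat_real {0..t} s *\<^sub>R E_fun (l j) s) \<longlonglongrightarrow> 0"
      using l0 by (intro AE_I2) (auto intro: tendsto_mult_right_zero)
    show "AE s in lborel. norm (indicat_real {0..t} s *\<^sub>R E_fun (l j) s) \<le> indicator {0..t} s * B" for j
      using E_abs_le[OF int(1) B, of j] by (intro AE_I2) (auto simp: indicator_def)
    show "integrable lborel (\<lambda>s. indicator {0..t} s * B)"
      by (intro integrable_mult_left integrable_real_indicator) (auto simp: emeasure_lborel_Icc_eq)
    show "(\<lambda>s. indicat_real {0..t} s *\<^sub>R E_fun (l j) s) \<in> borel_measurable lborel" for j
      using int(2)[of j] unfolding set_integrable_def by (rule borel_measurable_integrable)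
  qed simp
  then show ?thesis by (simp add: set_lebesgue_integral_def)
qed

text \<open>Test function: no element of \<open>[j]\<close> is a singleton. From \<open>k \<ge> 1\<close> singletons in \<open>[j]\<close> this is
  reached at rate at most \<open>\<integral> x\<^sup>k \<nu>(dx)\<close>, and \<open>k\<close> is large with \<open>j\<close> as long as there is dust.\<close>

lemma dust_positive:
  assumes reg: "nu_mean \<Lambda> < \<infinity>" and t: "0 \<le> t"
  shows "AE \<omega> in P. dustmass (path (t, \<omega>)) > 0"
proof -
  note L0 = mean_finiteD[OF reg]
  have mom: "integrable \<Lambda> (\<lambda>x. x ^ i / x\<^sup>2)" "moment i \<le> moment 1" if "1 \<le> i" for i
    using moment_integrable[OF L0 that] by auto
  define H where "H (k::nat) = (of_bool (k = 0) :: real)" for k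
  \<comment> \<open>Zero at \<open>k = 0\<close>: there the test function is already 1 and remains
    so, since singletons are never created.\<close>
  define R where "R k = (if k = 0 then 0 else moment k)" for k
  have HB: "\<bar>H k\<bar> \<le> 1" "0 \<le> H k" for k by (auto simp: H_def)
  have RB: "\<bar>R k\<bar> \<le> moment 1" "0 \<le> R k" for k using mom(2)[of k] moment_nonneg by (auto simp: R_def)
  let ?h = "\<lambda>j \<pi>. H (card (sg j \<pi>))" and ?g = "\<lambda>j \<pi>. R (card (sg j \<pi>))"
  have Q: "Q (?h j) \<pi> \<le> ?g j \<pi>" if b: "blocks \<pi>" for j \<pi>
  proof -
    have fin: "finite (sg j \<pi>)" using b by (simp add: blocks_def sg_def)
    show ?thesis
    proof (cases "sg j \<pi> = {}")
      case True
      then show ?thesis unfolding Q_def by (simp add: sg_coag[OF b] R_def)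
    next
      case False
      have "Q (?h j) \<pi> = (\<Sum>J\<in>Js \<pi>. if sg j \<pi> \<subseteq> J then lam (card \<pi>) (card J) else 0)"
        unfolding Q_def
      proof (intro sum.cong refl)
        fix J assume J: "J \<in> Js \<pi>"
        have "finite (sg j \<pi> - J)" using fin by simp
        then show "lam (card \<pi>) (card J) * (?h j (coag J \<pi>) - ?h j \<pi>) = (if sg j \<pi> \<subseteq> J then lam (card \<pi>) (card J) else 0)"
          using False fin by (auto simp: sg_coag[OF b J] H_def)
      qed
      also have "\<dots> = (\<Sum>J | J \<in> Js \<pi> \<and> sg j \<pi> \<subseteq> J. lam (card \<pi>) (card J))"
        using finite_Js[of \<pi>] b by (intro sum.inter_filter[symmetric]) (simp add: blocks_def)
      also have "\<dots> \<le> moment (card (sg j \<pi>))"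
      proof -
        have "1 \<le> card (sg j \<pi>)" using False fin by (simp add: Suc_le_eq card_gt_0_iff One_nat_def)
        then show ?thesis unfolding moment_def
          using b by (intro superset_rate_le L0 mom(1)) (auto simp: blocks_def sg_def)
      qed
      also have "\<dots> = ?g j \<pi>" using False fin by (simp add: R_def)
      finally show ?thesis .
    qed
  qed
  define l where "l j \<mu> = (\<integral>X. H (dust_count \<mu> j X) \<partial>seqs \<mu>)" for j \<mu>
  define r where "r j \<mu> = (\<integral>X. R (dust_count \<mu> j X) \<partial>seqs \<mu>)" for j \<mu>
  have lim_gen: "(\<lambda>n. G_fun n (\<lambda>x. F (card (sg j (part n x)))) \<mu>) \<longlonglongrightarrow> (\<integral>X. F (dust_count \<mu> j X) \<partial>seqs \<mu>)"
    if mu: "\<mu> \<in> M1" and B: "\<And>k. \<bar>F k\<bar> \<le> B" for F :: "nat \<Rightarrow> real" and B j \<mu>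
  proof (rule G_seqs_lim[OF mu, where B=B and h="\<lambda>n \<pi>. F (card (sg j \<pi>))"])
    fix X assume "typical \<mu> X"
    from sg_part_eventually[OF this, of j]
    show "(\<lambda>n. F (card (sg j (part n X)))) \<longlonglongrightarrow> F (dust_count \<mu> j X)"
      by (intro tendsto_eventually) (auto elim: eventually_mono)
  qed (use B dust_count_measurable[OF mu] in auto)
  have limH: "(\<lambda>n. G_fun n (\<lambda>x. ?h j (part n x)) \<mu>) \<longlonglongrightarrow> l j \<mu>" if "\<mu> \<in> M1" for j \<mu>
    unfolding l_def by (rule lim_gen[OF that HB(1)])
  have limR: "(\<lambda>n. G_fun n (\<lambda>x. ?g j (part n x)) \<mu>) \<longlonglongrightarrow> r j \<mu>" if "\<mu> \<in> M1" for j \<mu>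
    unfolding r_def by (rule lim_gen[OF that RB(1)])
  have SH1: "integrable P (\<lambda>\<omega>. l j (path (s, \<omega>)))" for j s
    by (rule V_seqs_lim(1)[where h="\<lambda>_. ?h j" and l="l j" and B=1, OF limH HB(1)])
  have SH2: "(\<lambda>n. V n (\<lambda>x. ?h j (part n x)) s) \<longlonglongrightarrow> E_fun (l j) s" for j s
    by (rule V_seqs_lim(2)[where h="\<lambda>_. ?h j" and l="l j" and B=1, OF limH HB(1)])
  have SR1: "integrable P (\<lambda>\<omega>. r j (path (s, \<omega>)))" for j s
    by (rule V_seqs_lim(1)[where h="\<lambda>_. ?g j" and l="r j" and B="moment 1", OF limR RB(1)])
  have SR3: "(\<lambda>n. VI n (\<lambda>x. ?g j (part n x)) t) \<longlonglongrightarrow> (LINT s:{0..t}|lborel. E_fun (r j) s)" for j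
    by (rule V_seqs_lim(3)[where h="\<lambda>_. ?g j" and l="r j" and B="moment 1", OF limR RB(1)])
  have SR4: "set_integrable lborel {0..t} (E_fun (r j))" for j
    by (rule V_seqs_lim(4)[where h="\<lambda>_. ?g j" and l="r j" and B="moment 1", OF limR RB(1)])
  have le: "E_fun (l j) t \<le> (LINT s:{0..t}|lborel. E_fun (r j) s)" if j: "1 \<le> j" for j
  proof (rule LIMSEQ_le[OF SH2 SR3], intro exI[of _ j] allI impI)
    fix n assume n: "j \<le> n"
    \<comment> \<open>All labels are singletons initially, so the test function starts from
      0.\<close>
    have "{1} \<in> sg j (singles n)" using j n by (auto simp: sg_def singles_def)
    moreover have "finite (sg j (singles n))" by (simp add: sg_def singles_def)
    ultimately have "?h j (singles n) = 0" by (auto simp: H_def)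
    then show "V n (\<lambda>x. ?h j (part n x)) t \<le> VI n (\<lambda>x. ?g j (part n x)) t"
      using duality_le[OF _ t Q, of n j] j n by simp
  qed
  have prob_r: "\<bar>r j \<mu>\<bar> \<le> moment 1" if mu: "\<mu> \<in> M1" for j \<mu>
  proof -
    have "\<bar>G_fun n (\<lambda>x. ?g j (part n x)) \<mu>\<bar> \<le> moment 1" for n by (rule G_abs_le[OF mu bm_part RB(1)])
    then show ?thesis by (intro LIMSEQ_le_const2[OF tendsto_rabs[OF limR[OF mu]]]) blast
  qed
  have r0: "(\<lambda>j. r j \<mu>) \<longlonglongrightarrow> 0" if mu: "\<mu> \<in> M1" for \<mu>
  proof -
    interpret prob_space "seqs \<mu>" by (rule prob_seqs[OF mu])
    have "(\<lambda>j. r j \<mu>) \<longlonglongrightarrow> (\<integral>X. 0 \<partial>seqs \<mu>)" unfolding r_def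
    proof (rule integral_dominated_convergence[where w="\<lambda>_. moment 1"])
      show "AE X in seqs \<mu>. (\<lambda>j. R (dust_count \<mu> j X)) \<longlonglongrightarrow> 0"
        using AE_typical[OF mu]
      proof eventually_elim
        case (elim X)
        show ?case
        proof (cases "dustmass \<mu> > 0")
          case True
          have "R \<longlonglongrightarrow> 0"
            using moment_tendsto[OF L0] by (rule Lim_transform_eventually)
              (auto simp: R_def eventually_sequentially intro!: exI[of _ 1])
          then show ?thesis by (rule filterlim_compose[OF _ dust_count_unbounded[OF elim True]])
        next
          case False
          then have "dust_count \<mu> j X = 0" for j using elim by (simp add: dust_count_def typical_def)
          then show ?thesis by (simp add: R_def)
        qed
      qed
    qed (use RB dust_count_measurable[OF mu] in auto)
    then show ?thesis by simp
  qed
  have "(\<lambda>j. LINT s:{0..t}|lborel. E_fun (r j) s) \<longlonglongrightarrow> 0"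
    by (rule E_integral_lim_zero[OF SR1 SR4 prob_r r0])
  then have up: "(\<lambda>j. LINT s:{0..t}|lborel. E_fun (r (Suc j)) s) \<longlonglongrightarrow> 0" by (rule LIMSEQ_Suc)
  have l0: "0 \<le> l j \<mu>" for j \<mu> unfolding l_def by (rule integral_nonneg_AE) (simp add: HB)
  have "AE \<omega> in P. \<exists>j. l (Suc j) (path (t, \<omega>)) < 1"
  proof (rule AE_not_bounded_below)
    show "(\<lambda>j. \<integral>\<omega>. l (Suc j) (path (t, \<omega>)) \<partial>P) \<longlonglongrightarrow> 0"
    proof (rule real_tendsto_sandwich[OF _ _ tendsto_const up])
      show "eventually (\<lambda>j. 0 \<le> (\<integral>\<omega>. l (Suc j) (path (t, \<omega>)) \<partial>P)) sequentially"
        by (intro always_eventually allI integral_nonneg_AE AE_I2 l0)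
      show "eventually (\<lambda>j. (\<integral>\<omega>. l (Suc j) (path (t, \<omega>)) \<partial>P) \<le> (LINT s:{0..t}|lborel. E_fun (r (Suc j)) s)) sequentially"
        using le[of "Suc _"] by (intro always_eventually allI) (simp add: E_fun_def)
    qed
  qed (auto intro: SH1 l0)
  moreover have "AE \<omega> in P. path (t, \<omega>) \<in> M1" by (intro AE_I2 path_M1)
  ultimately show ?thesis
  proof eventually_elim
    case (elim \<omega>)
    let ?m = "path (t, \<omega>)"
    show ?case
    proof (rule ccontr)
      assume d: "\<not> dustmass ?m > 0"
      interpret prob_space "seqs ?m" by (rule prob_seqs[OF elim(2)])
      \<comment> \<open>Without dust every sampled point is an atom, so the limiting test function
        equals 1 for every \<open>j\<close>.\<close>
      have "l j ?m = (\<integral>X. 1 \<partial>seqs ?m)" for j unfolding l_def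
      proof (rule integral_cong_AE)
        show "AE X in seqs ?m. H (dust_count ?m j X) = 1"
          using AE_typical[OF elim(2)] by eventually_elim (use d in \<open>simp add: dust_count_def typical_def H_def\<close>)
      qed (use dust_count_measurable[OF elim(2)] in auto)
      then show False using elim(1) prob_space by simp
    qed
  qed
qed

text \<open>Serves limits that hold only almost surely at each time, such as those relying on
  \<open>dust_positive\<close>.\<close>

lemma VI_AE_lim_zero:
  assumes lim: "\<And>s. s \<ge> 0 \<Longrightarrow> AE \<omega> in P. (\<lambda>n. G_fun n (\<lambda>x. h (part n x)) (path (s, \<omega>))) \<longlonglongrightarrow> 0"
    and B: "\<And>\<pi>. \<bar>h \<pi>\<bar> \<le> B"
  shows "(\<lambda>n. VI n (\<lambda>x. h (part n x)) t) \<longlonglongrightarrow> 0"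
proof -
  have "(\<lambda>n. V n (\<lambda>x. h (part n x)) s) \<longlonglongrightarrow> (\<integral>\<omega>. 0 \<partial>P)" if "s \<ge> 0" for s
    unfolding V_def
  proof (rule integral_dominated_convergence[where w="\<lambda>_. B"])
    show "AE \<omega> in P. norm (G_fun n (\<lambda>x. h (part n x)) (path (s, \<omega>))) \<le> B" for n
      unfolding real_norm_def by (intro AE_I2 G_abs_le[OF path_M1 bm_part B])
  qed (auto intro: G_path_meas1 bm_part lim[OF that])
  then have l0: "(\<lambda>n. V n (\<lambda>x. h (part n x)) s) \<longlonglongrightarrow> 0" if "s \<ge> 0" for s using that by simp
  have bV: "\<bar>V n (\<lambda>x. h (part n x)) s\<bar> \<le> B" for n s by (rule V_abs_le[OF bm_part B])
  have "(\<lambda>n. VI n (\<lambda>x. h (part n x)) t) \<longlonglongrightarrow> (LINT s|(lborel :: real measure). 0)"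
    unfolding VI_def set_lebesgue_integral_def
  proof (rule integral_dominated_convergence[where w="\<lambda>s. indicator {0..t} s * B"])
    show "AE s in lborel. (\<lambda>n. indicat_real {0..t} s *\<^sub>R V n (\<lambda>x. h (part n x)) s) \<longlonglongrightarrow> 0"
      using l0 by (intro AE_I2) (auto simp: indicator_def)
    show "AE s in lborel. norm (indicat_real {0..t} s *\<^sub>R V n (\<lambda>x. h (part n x)) s) \<le> indicator {0..t} s * B" for n
      using bV[of n] by (intro AE_I2) (auto simp: indicator_def)
    show "integrable lborel (\<lambda>s. indicator {0..t} s * B)"
      by (intro integrable_mult_left integrable_real_indicator) (auto simp: emeasure_lborel_Icc_eq)
    show "(\<lambda>s. indicat_real {0..t} s *\<^sub>R V n (\<lambda>x. h (part n x)) s) \<in> borel_measurable lborel" for n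
      using V_meas[OF bm_part, of n h] by simp
  qed simp
  then show ?thesis by simp
qed

text \<open>A merger absorbing \<open>k\<close> of the \<open>N\<close> non-singleton blocks
  replaces \<open>N\<close> by \<open>N + 1 - k\<close>. For \<open>N \<le> M\<close> the function
  gains at most \<open>k\<close>, and loses 1 when \<open>k = 0\<close>; for \<open>N > M\<close> it
  gains at most \<open>k * M / N\<close>. The rate-weighted sum of \<open>k\<close> is at most
  \<open>N * moment 1\<close>, so \<open>M * moment 1\<close> bounds the gain in both cases.\<close>

lemma Q_excess_blocks_le:
  assumes L0: "emeasure \<Lambda> {0} = 0" "integrable \<Lambda> (\<lambda>x. x ^ 1 / x\<^sup>2)"
    and b: "blocks \<pi>"
  shows "Q (\<lambda>\<pi>. real (M + 1 - num_nonsingles \<pi>)) \<pi> \<le> real M * moment 1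
    - (if num_nonsingles \<pi> \<le> M then \<Sum>J\<in>Js {B\<in>\<pi>. card B = 1}. lam (card \<pi>) (card J) else 0)"
proof -
  let ?h = "\<lambda>\<pi>. real (M + 1 - num_nonsingles \<pi>)"
  let ?N = "{B\<in>\<pi>. 2 \<le> card B}" and ?A = "{B\<in>\<pi>. card B = 1}"
  have f: "finite \<pi>" using b by (simp add: blocks_def)
  define c where "c = (if num_nonsingles \<pi> \<le> M then 1 else real M / real (num_nonsingles \<pi>))"
  have c: "0 \<le> c" "c * real (num_nonsingles \<pi>) \<le> real M" by (auto simp: c_def)
  have step: "?h (coag J \<pi>) - ?h \<pi> \<le> c * real (card (J \<inter> ?N)) - (if num_nonsingles \<pi> \<le> M \<and> J \<inter> ?N = {} then 1 else 0)"
    if J: "J \<in> Js \<pi>" for J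
  proof -
    let ?k = "card (J \<inter> ?N)" and ?b' = "num_nonsingles (coag J \<pi>)"
    have e: "?b' + ?k = num_nonsingles \<pi> + 1" by (rule num_nonsingles_coag[OF b J])
    have kN: "?k \<le> num_nonsingles \<pi>" unfolding num_nonsingles_def using f by (intro card_mono) auto
    have k0: "?k = 0 \<longleftrightarrow> J \<inter> ?N = {}" using f by simp
    show ?thesis
    proof (cases "num_nonsingles \<pi> \<le> M")
      case True
      show ?thesis
      proof (cases "?k = 0")
        case True
        then have "?b' = num_nonsingles \<pi> + 1" using e by simp
        then have "?h (coag J \<pi>) = ?h \<pi> - 1" using \<open>num_nonsingles \<pi> \<le> M\<close> by (simp add: of_nat_diff)
        then show ?thesis using True k0 \<open>num_nonsingles \<pi> \<le> M\<close> by simp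
      next
        case False
        then have "?b' \<le> num_nonsingles \<pi>" using e by simp
        then have "?h (coag J \<pi>) - ?h \<pi> = real (num_nonsingles \<pi>) - real ?b'" using \<open>num_nonsingles \<pi> \<le> M\<close> by (simp add: of_nat_diff)
        also have "\<dots> \<le> real ?k" using e by linarith
        finally show ?thesis using False k0 \<open>num_nonsingles \<pi> \<le> M\<close> by (simp add: c_def)
      qed
    next
      case False
      then have bp: "real (num_nonsingles \<pi>) > 0" "?h \<pi> = 0" "c = real M / real (num_nonsingles \<pi>)" by (auto simp: c_def)
      have "?h (coag J \<pi>) \<le> real M * real ?k / real (num_nonsingles \<pi>)"
      proof (cases "?b' \<le> M")
        case True
        then have "?h (coag J \<pi>) = real M + 1 - real ?b'" by (simp add: of_nat_diff)
        also have "\<dots> = real M + real ?k - real (num_nonsingles \<pi>)" using e by linarith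
        also have "\<dots> \<le> real M * real ?k / real (num_nonsingles \<pi>)"
        proof -
          \<comment> \<open>In the notation \<open>N\<close>, \<open>k\<close>, \<open>M\<close>
            this rearranges to \<open>(M + k - N) * N \<le> M * k\<close>.\<close>
          have "0 \<le> (real (num_nonsingles \<pi>) - real ?k) * (real (num_nonsingles \<pi>) - real M)"
            using kN False by (intro mult_nonneg_nonneg) auto
          then have "(real M + real ?k - real (num_nonsingles \<pi>)) * real (num_nonsingles \<pi>) \<le> real M * real ?k" by (simp add: algebra_simps)
          then show ?thesis using bp by (simp add: pos_le_divide_eq)
        qed
        finally show ?thesis .
      next
        case f: False
        then show ?thesis by simp
      qed
      then show ?thesis using bp False by simp
    qed
  qed
  have "Q ?h \<pi> \<le> (\<Sum>J\<in>Js \<pi>. lam (card \<pi>) (card J) * (c * real (card (J \<inter> ?N)) - (if num_nonsingles \<pi> \<le> M \<and> J \<inter> ?N = {} then 1 else 0)))"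
    unfolding Q_def by (intro sum_mono mult_left_mono step lam_nonneg)
  also have "\<dots> = c * (\<Sum>J\<in>Js \<pi>. lam (card \<pi>) (card J) * real (card (J \<inter> ?N)))
      - (\<Sum>J\<in>Js \<pi>. if num_nonsingles \<pi> \<le> M \<and> J \<inter> ?N = {} then lam (card \<pi>) (card J) else 0)"
    unfolding sum_distrib_left sum_subtractf[symmetric] by (intro sum.cong refl) (simp add: algebra_simps)
  also have "c * (\<Sum>J\<in>Js \<pi>. lam (card \<pi>) (card J) * real (card (J \<inter> ?N))) \<le> c * (real (num_nonsingles \<pi>) * moment 1)"
    unfolding num_nonsingles_def using f by (intro mult_left_mono intersection_rate_le L0 c) auto
  also have "c * (real (num_nonsingles \<pi>) * moment 1) \<le> real M * moment 1"
    using mult_right_mono[OF c(2) moment_nonneg[of 1]] by (simp add: mult.assoc)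
  also have "(\<Sum>J\<in>Js \<pi>. if num_nonsingles \<pi> \<le> M \<and> J \<inter> ?N = {} then lam (card \<pi>) (card J) else 0)
      = (if num_nonsingles \<pi> \<le> M then \<Sum>J\<in>Js ?A. lam (card \<pi>) (card J) else 0)"
  proof -
    have c12: "card B = 1 \<or> 2 \<le> card B" if "B \<in> \<pi>" for B
    proof -
      have "card B \<noteq> 0" using b that by (auto simp: blocks_def)
      then show ?thesis by linarith
    qed
    have "Js ?A = {J\<in>Js \<pi>. J \<inter> ?N = {}}"
    proof (intro equalityI subsetI)
      fix J assume J: "J \<in> {J\<in>Js \<pi>. J \<inter> ?N = {}}"
      have "card B = 1" if "B \<in> J" for B
      proof -
        have "B \<in> \<pi>" using J that by (auto simp: Js_def)
        then show ?thesis using c12[of B] J that by auto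
      qed
      then show "J \<in> Js ?A" using J by (auto simp: Js_def)
    qed (auto simp: Js_def)
    then show ?thesis using finite_Js[OF f] by (simp add: sum.inter_filter)
  qed
  finally show ?thesis by simp
qed

end

section \<open>Number of atoms outside regime Discrete\<close>

lemma num_singles_plus_nonsingles:
  assumes "blocks \<pi>" shows "card \<pi> = num_singles \<pi> + num_nonsingles \<pi>"
proof -
  have c12: "card B = 1 \<or> 2 \<le> card B" if "B \<in> \<pi>" for B
  proof -
    have "card B \<noteq> 0" using assms that by (auto simp: blocks_def)
    then show ?thesis by linarith
  qed
  have "\<pi> = {B\<in>\<pi>. card B = 1} \<union> {B\<in>\<pi>. 2 \<le> card B}" using c12 by auto
  then have "card \<pi> = card ({B\<in>\<pi>. card B = 1} \<union> {B\<in>\<pi>. 2 \<le> card B})" by simp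
  also have "\<dots> = num_singles \<pi> + num_nonsingles \<pi>"
    unfolding num_singles_def num_nonsingles_def using assms by (intro card_Un_disjoint) (auto simp: blocks_def)
  finally show ?thesis .
qed

lemma unit_interval_family:
  fixes m :: nat
  shows "disjoint_family (\<lambda>j. {real (m + j)..<real (m + j) + 1})"
  unfolding disjoint_family_on_def
proof (intro ballI impI)
  fix i j :: nat assume "i \<noteq> j"
  then have "i < j \<or> j < i" by linarith
  then have "real (m + i) + 1 \<le> real (m + j) \<or> real (m + j) + 1 \<le> real (m + i)" by linarith
  then show "{real (m + i)..<real (m + i) + 1} \<inter> {real (m + j)..<real (m + j) + 1} = {}" by auto
qed

lemma nn_integral_step:
  "(\<integral>\<^sup>+u. (\<Sum>j. ennreal (c j) * indicator {real (m + j)..<real (m + j) + 1} u) \<partial>lborel) = (\<Sum>j. ennreal (c j))"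
proof -
  have "(\<integral>\<^sup>+u. (\<Sum>j. ennreal (c j) * indicator {real (m + j)..<real (m + j) + 1} u) \<partial>lborel)
      = (\<Sum>j. \<integral>\<^sup>+u. ennreal (c j) * indicator {real (m + j)..<real (m + j) + 1} u \<partial>lborel)"
    by (rule nn_integral_suminf) simp
  also have "\<dots> = (\<Sum>j. ennreal (c j))"
    by (intro suminf_cong) (simp add: nn_integral_cmult_indicator)
  finally show ?thesis .
qed

lemma summable_tail_tendsto:
  fixes c :: "nat \<Rightarrow> real"
  assumes "summable c" shows "(\<lambda>M. \<Sum>i. c (i + M)) \<longlonglongrightarrow> 0"
proof -
  have "(\<lambda>M. suminf c - (\<Sum>i<M. c i)) \<longlonglongrightarrow> suminf c - suminf c"
    by (intro tendsto_diff tendsto_const summable_LIMSEQ assms)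
  then show ?thesis by (simp add: suminf_minus_initial_segment[OF assms])
qed

context fleming_viot
begin

text \<open>Test function: \<open>(M + 1 - b)\<^sup>+\<close>, \<open>b\<close> the number of non-singleton blocks. Mergers of singletons alone
  decrease it, at a rate that is unbounded in the number of singletons, while the other mergers
  increase it at a bounded rate.\<close>

lemma infinite_atoms_dust:
  assumes reg: "regime_infinite_dust \<Lambda>" and t: "0 < t"
  shows "AE \<omega> in P. infinite (atoms (path (t, \<omega>)))"
proof -
  have mean: "nu_mean \<Lambda> < \<infinity>" and inf: "emeasure (nu \<Lambda>) {0..<1} = \<infinity>"
    using reg by (auto simp: regime_infinite_dust_def)
  note L0 = mean_finiteD[OF mean]
  define lh where "lh M \<mu> = (if finite (atoms \<mu>) then real (M + 1 - card (atoms \<mu>)) else 0)" for M and \<mu> :: "real measure"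
  have "AE \<omega> in P. lh M (path (t, \<omega>)) = 0" for M
  proof -
    let ?h = "\<lambda>\<pi> :: nat set set. real (M + 1 - num_nonsingles \<pi>)"
    let ?u = "\<lambda>\<pi> :: nat set set. of_bool (num_nonsingles \<pi> \<le> M) :: real"
    define lu where "lu \<mu> = (of_bool (finite (atoms \<mu>) \<and> card (atoms \<mu>) \<le> M) :: real)" for \<mu> :: "real measure"
    define C where "C = real M * moment 1"
    have C: "0 \<le> C" by (simp add: C_def moment_nonneg)
    have hB: "\<bar>?h \<pi>\<bar> \<le> real M + 1" and uB: "\<bar>?u \<pi>\<bar> \<le> 1" for \<pi> by simp_all
    have ev: "eventually (\<lambda>n. ?h (part n X) = lh M \<mu> \<and> ?u (part n X) = lu \<mu>) sequentially"
      if X: "typical \<mu> X" for \<mu> X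
    proof (cases "finite (atoms \<mu>)")
      case True
      from num_nonsingles_finite[OF X True] show ?thesis
        by eventually_elim (use True in \<open>simp add: lh_def lu_def\<close>)
    next
      case False
      from num_nonsingles_infinite[OF X False, of "M + 1"] show ?thesis
        by eventually_elim (use False in \<open>simp add: lh_def lu_def\<close>)
    qed
    have limh: "(\<lambda>n. G_fun n (\<lambda>x. ?h (part n x)) \<mu>) \<longlonglongrightarrow> lh M \<mu>" if "\<mu> \<in> M1" for \<mu>
    proof (rule G_seqs_lim_const[OF that, where B="real M + 1" and h="\<lambda>_. ?h"])
      fix X assume "typical \<mu> X"
      from ev[OF this] show "(\<lambda>n. ?h (part n X)) \<longlonglongrightarrow> lh M \<mu>"
        by (intro tendsto_eventually) (auto elim: eventually_mono)
    qed (rule hB)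
    have limu: "(\<lambda>n. G_fun n (\<lambda>x. ?u (part n x)) \<mu>) \<longlonglongrightarrow> lu \<mu>" if "\<mu> \<in> M1" for \<mu>
    proof (rule G_seqs_lim_const[OF that, where B=1 and h="\<lambda>_. ?u"])
      fix X assume "typical \<mu> X"
      from ev[OF this] show "(\<lambda>n. ?u (part n X)) \<longlonglongrightarrow> lu \<mu>"
        by (intro tendsto_eventually) (auto elim: eventually_mono)
    qed (rule uB)
    note Sh = V_seqs_lim[where h="\<lambda>_. ?h" and l="lh M" and B="real M + 1", OF limh hB]
    note Su = V_seqs_lim[where h="\<lambda>_. ?u" and l=lu and B=1, OF limu uB]
    have QC: "Q ?h \<pi> \<le> C" if "blocks \<pi>" for \<pi>
    proof -
      have "0 \<le> (if num_nonsingles \<pi> \<le> M then \<Sum>J\<in>Js {B\<in>\<pi>. card B = 1}. lam (card \<pi>) (card J) else 0)"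
        by (simp add: sum_nonneg lam_nonneg)
      then show ?thesis using Q_excess_blocks_le[OF L0 that, of M] unfolding C_def by linarith
    qed
    have bound: "(LINT s:{0..t}|lborel. E_fun lu s) \<le> (real M + 1 + C * t) / L" if L: "L > 0" for L
    proof -
      from inside_rate_unbounded[OF L0(1) inf, of M L, where 'c="nat set"]
      obtain a0 where a0': "\<forall>S A. finite S \<longrightarrow> (A :: nat set set) \<subseteq> S \<longrightarrow> card S - card A \<le> M \<longrightarrow> a0 \<le> card A \<longrightarrow>
        L \<le> (\<Sum>J\<in>Js A. lam (card S) (card J))" by (rule exE)
      note a0 = a0'[rule_format]
      \<comment> \<open>Partitions with too few singletons for \<open>inside_rate_unbounded\<close>;
        they disappear in the limit because dust is almost surely present.\<close>
      let ?g = "\<lambda>\<pi> :: nat set set. of_bool (num_nonsingles \<pi> \<le> M \<and> num_singles \<pi> < a0) :: real"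
      have Qb: "Q ?h \<pi> \<le> C - L * (?u \<pi> - ?g \<pi>)" if b: "blocks \<pi>" for \<pi>
      proof (cases "num_nonsingles \<pi> \<le> M \<and> a0 \<le> num_singles \<pi>")
        case True
        have "L \<le> (\<Sum>J\<in>Js {B\<in>\<pi>. card B = 1}. lam (card \<pi>) (card J))"
          using True num_singles_plus_nonsingles[OF b] b by (intro a0) (auto simp: num_singles_def blocks_def)
        then show ?thesis using Q_excess_blocks_le[OF L0 b, of M] True by (simp add: C_def)
      next
        case False
        then have "?u \<pi> - ?g \<pi> = 0" by auto
        then show ?thesis using QC[OF b] by simp
      qed
      have le: "VI n (\<lambda>x. ?u (part n x)) t \<le> (real M + 1 + C * t) / L + VI n (\<lambda>x. ?g (part n x)) t" if n: "1 \<le> n" for n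
      proof -
        have "0 \<le> V n (\<lambda>x. ?h (part n x)) t"
          using V_mono[OF bm_const[of n 0] bm_part[of n ?h], of t] by (simp add: V_const)
        also have "\<dots> \<le> real M + 1 + VI n (\<lambda>x. C - L * (?u (part n x) - ?g (part n x))) t"
          using duality_le[OF n less_imp_le[OF t] Qb] by (simp add: num_nonsingles_singles add.commute)
        also have "VI n (\<lambda>x. C - L * (?u (part n x) - ?g (part n x))) t
            = C * t - L * (VI n (\<lambda>x. ?u (part n x)) t - VI n (\<lambda>x. ?g (part n x)) t)"
          using VI_diff[OF bm_const[of n C] bm_cmult[OF bm_diff[OF bm_part[of n ?u] bm_part[of n ?g]], of L], of t]
            VI_diff[OF bm_part[of n ?u] bm_part[of n ?g], of t] VI_const[of t n C] t
          by (simp only: VI_cmult less_imp_le)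
        finally show ?thesis using L by (simp add: field_simps)
      qed
      have "(\<lambda>n. VI n (\<lambda>x. ?g (part n x)) t) \<longlonglongrightarrow> 0"
      proof (rule VI_AE_lim_zero[where h="?g" and B=1])
        fix s :: real assume s: "0 \<le> s"
        have "AE \<omega> in P. path (s, \<omega>) \<in> M1" by (intro AE_I2 path_M1)
        with dust_positive[OF mean s]
        show "AE \<omega> in P. (\<lambda>n. G_fun n (\<lambda>x. ?g (part n x)) (path (s, \<omega>))) \<longlonglongrightarrow> 0"
        proof eventually_elim
          case (elim \<omega>)
          show ?case
          proof (rule G_seqs_lim_const[OF elim(2), where B=1 and h="\<lambda>_. ?g"])
            fix X assume "typical (path (s, \<omega>)) X"
            from num_singles_dust[OF this elim(1), of a0]
            have "eventually (\<lambda>n. ?g (part n X) = 0) sequentially" by eventually_elim simp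
            then show "(\<lambda>n. ?g (part n X)) \<longlonglongrightarrow> 0" by (rule tendsto_eventually)
          qed simp
        qed
      qed simp
      then have "(\<lambda>n. (real M + 1 + C * t) / L + VI n (\<lambda>x. ?g (part n x)) t) \<longlonglongrightarrow> (real M + 1 + C * t) / L + 0"
        by (intro tendsto_add tendsto_const)
      then show ?thesis by (intro LIMSEQ_le[OF Su(3)]) (use le in auto)
    qed
    have zu: "(LINT s:{0..t}|lborel. E_fun lu s) \<le> 0"
    proof (rule field_le_epsilon)
      fix e :: real assume e: "0 < e"
      define K where "K = real M + 1 + C * t"
      have K: "K > 0" using C t by (simp add: K_def add_nonneg_pos add_pos_nonneg)
      show "(LINT s:{0..t}|lborel. E_fun lu s) \<le> 0 + e"
        using bound[of "K / e"] K e unfolding K_def[symmetric] by simp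
    qed
    \<comment> \<open>\<open>lh M\<close> vanishes where \<open>lu\<close> does and never exceeds
      \<open>M + 1\<close>.\<close>
    have zh: "(LINT s:{0..t}|lborel. E_fun (lh M) s) \<le> 0"
    proof -
      have "E_fun (lh M) s \<le> (real M + 1) * E_fun lu s" for s
      proof -
        have "E_fun (lh M) s \<le> (\<integral>\<omega>. (real M + 1) * lu (path (s, \<omega>)) \<partial>P)"
          unfolding E_fun_def
          by (intro integral_mono integrable_mult_right Sh(1) Su(1)) (auto simp: lh_def lu_def)
        then show ?thesis by (simp add: E_fun_def)
      qed
      then have "(LINT s:{0..t}|lborel. E_fun (lh M) s) \<le> (LINT s:{0..t}|lborel. (real M + 1) * E_fun lu s)"
        by (intro set_integral_mono Sh(4) set_integrable_mult_right Su(4))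
      also have "\<dots> = (real M + 1) * (LINT s:{0..t}|lborel. E_fun lu s)" by (rule set_integral_mult_right)
      also have "\<dots> \<le> 0" using zu by (intro mult_nonneg_nonpos) auto
      finally show ?thesis .
    qed
    have lh0: "0 \<le> lh M \<mu>" for \<mu> by (simp add: lh_def)
    have "E_fun (lh M) t \<le> 0"
    proof (rule zero_from_integral[OF Sh(4) zh _ _ C t])
      show "0 \<le> E_fun (lh M) s" for s by (intro E_nonneg lh0)
      show "E_fun (lh M) t \<le> E_fun (lh M) s + C * (t - s)" if "0 \<le> s" "s \<le> t" for s
        using duality_lipschitz[OF _ that QC]
        by (intro LIMSEQ_le[OF Sh(2)[of t] tendsto_add[OF Sh(2)[of s] tendsto_const]]) auto
    qed
    then show ?thesis by (intro AE_zero_of_E[of "lh M"] Sh(1) lh0)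
  qed
  then have "AE \<omega> in P. \<forall>M. lh M (path (t, \<omega>)) = 0" by (simp add: AE_all_countable)
  then show ?thesis
  proof eventually_elim
    case (elim \<omega>)
    show ?case
    proof
      assume "finite (atoms (path (t, \<omega>)))"
      \<comment> \<open>At \<open>M\<close> equal to the number of atoms, \<open>lh M\<close> would
        be 1.\<close>
      then show False using elim[rule_format, of "card (atoms (path (t, \<omega>)))"] by (simp add: lh_def)
    qed
  qed
qed

section \<open>The series of 1/\<Psi>(j) and the integral criterion\<close>

definition c_seq :: "nat \<Rightarrow> real" where
  "c_seq j = 1 / Psi \<Lambda> (real j)"

lemma c_seq_nonneg: "0 \<le> c_seq j"
  by (simp add: c_seq_def Psi_nonneg)

lemma inverse_Psi_antimono:
  assumes nz: "emeasure \<Lambda> (space \<Lambda>) \<noteq> 0" and uv: "0 < u" "u \<le> v"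
  shows "inverse (ennreal (Psi \<Lambda> v)) \<le> inverse (ennreal (Psi \<Lambda> u))"
proof -
  have p: "0 < Psi \<Lambda> u" "Psi \<Lambda> u \<le> Psi \<Lambda> v" using Psi_pos[OF nz uv(1)] Psi_mono[of u v] uv by auto
  then have "ennreal (inverse (Psi \<Lambda> v)) \<le> ennreal (inverse (Psi \<Lambda> u))"
    by (intro ennreal_leI le_imp_inverse_le)
  then show ?thesis using p by (simp add: inverse_ennreal)
qed

lemma inverse_Psi_nat:
  assumes nz: "emeasure \<Lambda> (space \<Lambda>) \<noteq> 0" and j: "0 < j"
  shows "inverse (ennreal (Psi \<Lambda> (real j))) = ennreal (c_seq j)"
  using Psi_pos[OF nz, of "real j"] j by (simp add: inverse_ennreal c_seq_def inverse_eq_divide)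

text \<open>Integral test: on each unit interval the integrand is at most its value at the left end.
  For \<Lambda> = 0 the convention \<open>1 / 0 = 0\<close> would make the series converge although
  the integral is infinite, hence the first hypothesis.\<close>

lemma summable_imp_Psi_integral:
  assumes nz: "emeasure \<Lambda> (space \<Lambda>) \<noteq> 0" and s: "summable c_seq"
  shows "Psi_integral_finite \<Lambda>"
proof -
  let ?F = "\<lambda>u. inverse (ennreal (Psi \<Lambda> u))"
  let ?A = "\<lambda>j. {real (1 + j)..<real (1 + j) + 1}"
  have "(\<integral>\<^sup>+u\<in>{1..}. ?F u \<partial>lborel) \<le> (\<integral>\<^sup>+u. (\<Sum>j. ennreal (c_seq (1 + j)) * indicator (?A j) u) \<partial>lborel)"
  proof (rule nn_integral_mono)
    fix u :: real
    show "?F u * indicator {1..} u \<le> (\<Sum>j. ennreal (c_seq (1 + j)) * indicator (?A j) u)"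
    proof (cases "1 \<le> u")
      case True
      define j where "j = nat \<lfloor>u\<rfloor> - 1"
      have fl: "1 \<le> \<lfloor>u\<rfloor>" using True by (simp add: le_floor_iff)
      then have "1 \<le> nat \<lfloor>u\<rfloor>" using nat_mono[OF fl] by (simp only: nat_one_as_int)
      then have "1 + j = nat \<lfloor>u\<rfloor>" unfolding j_def by (rule le_add_diff_inverse)
      then have rj: "real (1 + j) = of_int \<lfloor>u\<rfloor>" using fl by simp
      have uj: "u \<in> ?A j" unfolding rj by simp
      have "(\<Sum>j. ennreal (c_seq (1 + j)) * indicator (?A j) u) = ennreal (c_seq (1 + j))"
        by (rule suminf_cmult_indicator[OF unit_interval_family uj])
      also have "\<dots> = ?F (real (1 + j))" by (rule inverse_Psi_nat[OF nz, symmetric]) simp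
      also have "\<dots> \<ge> ?F u" using uj by (intro inverse_Psi_antimono nz) auto
      finally show ?thesis using True by simp
    qed simp
  qed
  also have "\<dots> = (\<Sum>j. ennreal (c_seq (1 + j)))" by (rule nn_integral_step)
  also have "(\<Sum>j. ennreal (c_seq (1 + j))) = ennreal (\<Sum>j. c_seq (1 + j))"
  proof (rule suminf_ennreal2[OF c_seq_nonneg])
    show "summable (\<lambda>j. c_seq (1 + j))"
      using summable_ignore_initial_segment[OF s, of 1] by (simp only: add.commute[of 1])
  qed
  also have "\<dots> < \<infinity>" by simp
  finally show ?thesis unfolding Psi_integral_finite_def by (intro exI[of _ 1]) simp
qed

text \<open>Integral test with values at the right ends, hence the shift \<open>m + j + 1\<close>.
  For \<Lambda> = 0 the integrand is infinite, so a finite integral forces positive mass.\<close>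

lemma Psi_integral_imp_summable:
  assumes "Psi_integral_finite \<Lambda>"
  shows "emeasure \<Lambda> (space \<Lambda>) \<noteq> 0" "summable c_seq"
proof -
  let ?F = "\<lambda>u. inverse (ennreal (Psi \<Lambda> u))"
  obtain a where a: "a > 0" "(\<integral>\<^sup>+u\<in>{a..}. ?F u \<partial>lborel) < \<infinity>" using assms by (auto simp: Psi_integral_finite_def)
  show nz: "emeasure \<Lambda> (space \<Lambda>) \<noteq> 0"
  proof
    assume z: "emeasure \<Lambda> (space \<Lambda>) = 0"
    have "AE x in \<Lambda>. psi x u = 0" for u by (rule AE_I[where N="space \<Lambda>"]) (use z in auto)
    then have "Psi \<Lambda> u = 0" if "0 \<le> u" for u
      unfolding Psi_eq[OF that] by (rule integral_eq_zero_AE)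
    then have "(\<integral>\<^sup>+u\<in>{a..}. ?F u \<partial>lborel) = (\<integral>\<^sup>+u. \<infinity> * indicator {a..a + 1} u + ?F u * indicator {a + 1<..} u \<partial>lborel)"
      using a(1) by (intro nn_integral_cong) (auto simp: indicator_def)
    also have "\<dots> \<ge> (\<integral>\<^sup>+u. \<infinity> * indicator {a..a + 1} u \<partial>lborel)" by (intro nn_integral_mono) simp
    moreover have "(\<integral>\<^sup>+u. \<infinity> * indicator {a..a + 1} u \<partial>lborel) = \<infinity>"
      by (subst nn_integral_cmult_indicator) (auto simp: ennreal_top_mult)
    ultimately show False using a(2) by (simp add: top_unique)
  qed
  define m where "m = nat \<lceil>a\<rceil>"
  have m: "a \<le> real m" by (simp add: m_def) linarith
  let ?A = "\<lambda>j. {real (m + j)..<real (m + j) + 1}"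
  have "(\<Sum>j. ennreal (c_seq (m + j + 1))) = (\<integral>\<^sup>+u. (\<Sum>j. ennreal (c_seq (m + j + 1)) * indicator (?A j) u) \<partial>lborel)"
    by (rule nn_integral_step[symmetric])
  also have "\<dots> \<le> (\<integral>\<^sup>+u\<in>{a..}. ?F u \<partial>lborel)"
  proof (rule nn_integral_mono)
    fix u :: real
    show "(\<Sum>j. ennreal (c_seq (m + j + 1)) * indicator (?A j) u) \<le> ?F u * indicator {a..} u"
    proof (cases "\<exists>j. u \<in> ?A j")
      case True
      then obtain j where uj: "u \<in> ?A j" by blast
      have "(\<Sum>j. ennreal (c_seq (m + j + 1)) * indicator (?A j) u) = ennreal (c_seq (m + j + 1))"
        by (rule suminf_cmult_indicator[OF unit_interval_family uj])
      also have "\<dots> = ?F (real (m + j + 1))" by (rule inverse_Psi_nat[OF nz, symmetric]) simp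
      also have "\<dots> \<le> ?F u" using uj a(1) m by (intro inverse_Psi_antimono nz) auto
      finally show ?thesis using uj m by simp
    next
      case False
      then have "indicator (?A j) u = (0 :: ennreal)" for j by (auto simp: indicator_def)
      then show ?thesis by simp
    qed
  qed
  also have "\<dots> < \<infinity>" by (rule a(2))
  finally have "summable (\<lambda>j. c_seq (m + j + 1))"
    using c_seq_nonneg by (intro summable_suminf_not_top) auto
  then have "summable (\<lambda>j. c_seq (j + (m + 1)))" by (simp add: ac_simps)
  then show "summable c_seq" by (rule summable_iff_shift[THEN iffD1])
qed

text \<open>\<open>Psi_scale\<close> gives
  \<open>\<Psi>(j) \<ge> (j / b)\<^sup>2 * \<Psi>(b)\<close>, and inverse squares telescope. At
  \<open>m = b - k + 1\<close>, after a merger of \<open>k\<close> blocks, the bound has the form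
  that \<open>weighted_merge_rate_le\<close> asks for.\<close>

lemma c_seq_sum_le:
  assumes nz: "emeasure \<Lambda> (space \<Lambda>) \<noteq> 0" and m: "1 \<le> m" "m \<le> b"
  shows "(\<Sum>j\<in>{m<..b}. c_seq j) \<le> real b / Psi \<Lambda> (real b) * ((real b - real m) / real m)"
proof -
  have pb: "Psi \<Lambda> (real b) > 0" using m by (intro Psi_pos nz) auto
  have "(\<Sum>j\<in>{m<..b}. c_seq j) \<le> (\<Sum>j\<in>{m<..b}. (real b)\<^sup>2 / Psi \<Lambda> (real b) * (1 / (real j)\<^sup>2))"
  proof (rule sum_mono)
    fix j assume j: "j \<in> {m<..b}"
    then have jp: "real j > 0" by simp
    have "(real j / real b)\<^sup>2 * Psi \<Lambda> (real b) \<le> Psi \<Lambda> (real j / real b * real b)"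
      using j by (intro Psi_scale) auto
    also have "real j / real b * real b = real j" using m by simp
    finally have le: "(real j / real b)\<^sup>2 * Psi \<Lambda> (real b) \<le> Psi \<Lambda> (real j)" .
    have pos: "0 < (real j / real b)\<^sup>2 * Psi \<Lambda> (real b)" using jp pb m by simp
    have "c_seq j \<le> 1 / ((real j / real b)\<^sup>2 * Psi \<Lambda> (real b))"
      unfolding c_seq_def by (intro divide_left_mono le mult_pos_pos pos less_le_trans[OF pos le]) simp
    also have "\<dots> = (real b)\<^sup>2 / Psi \<Lambda> (real b) * (1 / (real j)\<^sup>2)" by (simp add: power_divide)
    finally show "c_seq j \<le> (real b)\<^sup>2 / Psi \<Lambda> (real b) * (1 / (real j)\<^sup>2)" .
  qed
  also have "\<dots> = (real b)\<^sup>2 / Psi \<Lambda> (real b) * (\<Sum>j\<in>{m<..b}. 1 / (real j)\<^sup>2)" by (simp add: sum_distrib_left)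
  also have "\<dots> \<le> (real b)\<^sup>2 / Psi \<Lambda> (real b) * (1 / real m - 1 / real b)"
    using pb by (intro mult_left_mono sum_inverse_squares_le m) auto
  also have "\<dots> = real b / Psi \<Lambda> (real b) * ((real b - real m) / real m)"
  proof -
    have "real m > 0" "real b > 0" using m by auto
    then show ?thesis using pb by (simp add: field_simps power2_eq_square)
  qed
  finally show ?thesis .
qed

text \<open>Test function: \<open>(1 - \<epsilon> H b)\<^sup>+\<close> with \<open>H b = \<Sum>j\<in>{1..b}. 1/\<Psi>(j)\<close>, \<open>b\<close> the number of blocks. It vanishes for
  large \<open>b\<close> as the series diverges, and its drift is small because \<open>b\<close> decreases at a rate
  of order \<open>\<Psi>(b)\<close>, except for mergers of almost all blocks.\<close>

lemma infinite_support_no_dust: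
  assumes mean: "nu_mean \<Lambda> = \<infinity>" and np: "\<not> Psi_integral_finite \<Lambda>" and t: "0 \<le> t"
  shows "AE \<omega> in P. dustmass (path (t, \<omega>)) > 0 \<or> infinite (atoms (path (t, \<omega>)))"
proof -
  have nz: "emeasure \<Lambda> (space \<Lambda>) \<noteq> 0"
  proof
    assume z: "emeasure \<Lambda> (space \<Lambda>) = 0"
    then have "emeasure \<Lambda> {0} = 0" using emeasure_space[of \<Lambda> "{0}"] by simp
    moreover have "AE x in \<Lambda>. inverse (ennreal (x\<^sup>2)) * ennreal x = 0"
      by (rule AE_I[where N="space \<Lambda>"]) (use z in auto)
    then have "(\<integral>\<^sup>+x. inverse (ennreal (x\<^sup>2)) * ennreal x \<partial>\<Lambda>) = (\<integral>\<^sup>+x. 0 \<partial>\<Lambda>)" by (rule nn_integral_cong_AE)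
    ultimately show False using mean by (simp add: nu_mean_def nn_mean_nu)
  qed
  have ns: "\<not> summable c_seq" using summable_imp_Psi_integral[OF nz] np by blast
  define H where "H b = (\<Sum>j\<in>{1..b}. c_seq j)" for b
  have Hmono: "H m \<le> H b" if "m \<le> b" for m b
    unfolding H_def using that by (intro sum_mono2) (auto simp: c_seq_nonneg)
  have Hdiff: "H b - H m = (\<Sum>j\<in>{m<..b}. c_seq j)" if "m \<le> b" for m b
  proof -
    have "{1..b} = {1..m} \<union> {m<..b}" using that by auto
    then have "H b = H m + (\<Sum>j\<in>{m<..b}. c_seq j)" unfolding H_def
      by (simp add: sum.union_disjoint ivl_disj_int)
    then show ?thesis by simp
  qed
  have Hinf: "\<exists>n. \<forall>b\<ge>n. L \<le> H b" for L
  proof -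
    have "\<exists>n. L < (\<Sum>j<n. c_seq (Suc j))"
    proof (rule ccontr)
      assume "\<not> (\<exists>n. L < (\<Sum>j<n. c_seq (Suc j)))"
      then have "summable (\<lambda>j. c_seq (Suc j))"
        by (intro bounded_imp_summable[of _ L] c_seq_nonneg) (simp only: not_less not_ex lessThan_Suc_atMost[symmetric])
      then show False using ns by (simp add: summable_Suc_iff)
    qed
    then obtain n where n: "L < (\<Sum>j<n. c_seq (Suc j))" by blast
    have "(\<Sum>j<n. c_seq (Suc j)) = H n"
      unfolding H_def by (rule sum.reindex_bij_witness[of _ "\<lambda>i. i - 1" Suc]) auto
    then show ?thesis using n Hmono by (intro exI[of _ n]) (auto intro: order_trans less_imp_le)
  qed
  have zero: "AE \<omega> in P. of_bool (\<not> dustmass (path (t, \<omega>)) > 0 \<and> finite (atoms (path (t, \<omega>))) \<and> card (atoms (path (t, \<omega>))) \<le> M) = (0::real)" for M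
  proof -
    define l where "l \<mu> = (of_bool (\<not> dustmass \<mu> > 0 \<and> finite (atoms \<mu>) \<and> card (atoms \<mu>) \<le> M) :: real)" for \<mu>
    let ?u = "\<lambda>\<pi> :: nat set set. of_bool (card \<pi> \<le> M) :: real"
    have uB: "\<bar>?u \<pi>\<bar> \<le> 1" for \<pi> by simp
    have limu: "(\<lambda>n. G_fun n (\<lambda>x. ?u (part n x)) \<mu>) \<longlonglongrightarrow> l \<mu>" if "\<mu> \<in> M1" for \<mu>
      unfolding l_def by (rule card_le_tendsto[OF that])
    note S = V_seqs_lim[where h="\<lambda>_. ?u" and l=l and B=1, OF limu uB]
    \<comment> \<open>On partitions with at most \<open>M\<close> blocks the test function is at
      least \<open>1 - \<epsilon> * H M\<close>, so its mean controls their probability.\<close>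
    have bound: "E_fun l t * (1 - \<epsilon> * H M) \<le> (4 * \<epsilon> / \<delta> + 4 * measure \<Lambda> {1 - \<delta><..1}) * t"
      if \<epsilon>: "0 < \<epsilon>" and \<delta>: "0 < \<delta>" "\<delta> \<le> 1 / 2" for \<epsilon> \<delta>
    proof -
      let ?h = "\<lambda>\<pi> :: nat set set. max 0 (1 - \<epsilon> * H (card \<pi>))"
      let ?R = "4 * \<epsilon> / \<delta> + 4 * measure \<Lambda> {1 - \<delta><..1}"
      have R: "0 \<le> ?R" using \<epsilon> \<delta> by simp
      have H0: "0 \<le> H b" for b unfolding H_def by (intro sum_nonneg c_seq_nonneg)
      have h01: "0 \<le> ?h \<pi>" "?h \<pi> \<le> 1" for \<pi> using H0 \<epsilon> by auto
      have Qh: "Q ?h \<pi> \<le> ?R" if b: "blocks \<pi>" for \<pi>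
      proof (cases "2 \<le> card \<pi>")
        case True
        have f: "finite \<pi>" using b by (simp add: blocks_def)
        show ?thesis unfolding Q_def
        proof (rule weighted_merge_rate_le[OF f True \<delta> less_imp_le[OF \<epsilon>]])
          show "0 < Psi \<Lambda> (real (card \<pi>))" using True by (intro Psi_pos nz) auto
          fix J assume J: "J \<in> Js \<pi>"
          show "?h (coag J \<pi>) - ?h \<pi> \<le> 1" using h01[of "coag J \<pi>"] h01[of \<pi>] by linarith
          have cJ: "card J \<le> card \<pi>" "2 \<le> card J" using Js_card_le[OF f J] JsD[OF J] by auto
          let ?m = "card \<pi> - card J + 1"
          have m: "1 \<le> ?m" "?m \<le> card \<pi>" "real ?m = real (card \<pi>) - real (card J) + 1" using cJ by (auto simp: of_nat_diff)
          have "?h (coag J \<pi>) - ?h \<pi> \<le> \<epsilon> * (H (card \<pi>) - H ?m)"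
          proof -
            have "\<epsilon> * H ?m \<le> \<epsilon> * H (card \<pi>)" using Hmono[OF m(2)] \<epsilon> by simp
            then show ?thesis unfolding card_coag[OF b J] by (simp add: right_diff_distrib)
          qed
          also have "\<dots> \<le> \<epsilon> * (real (card \<pi>) / Psi \<Lambda> (real (card \<pi>)) * ((real (card \<pi>) - real ?m) / real ?m))"
            unfolding Hdiff[OF m(2)] using \<epsilon> by (intro mult_left_mono c_seq_sum_le[OF nz m(1,2)]) auto
          also have "\<dots> = \<epsilon> * (real (card \<pi>) / Psi \<Lambda> (real (card \<pi>))) * ((real (card J) - 1) / (real (card \<pi>) - real (card J) + 1))"
            unfolding m(3) by simp
          finally show "?h (coag J \<pi>) - ?h \<pi> \<le> \<epsilon> * (real (card \<pi>) / Psi \<Lambda> (real (card \<pi>))) * ((real (card J) - 1) / (real (card \<pi>) - real (card J) + 1))" .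
        qed
      next
        case False
        have "finite \<pi>" using b by (simp add: blocks_def)
        then have "Js \<pi> = {}" using False Js_card_le[of \<pi>] JsD[of _ \<pi>] by (metis all_not_in_conv order_trans)
        then show ?thesis using R by (simp add: Q_def)
      qed
      \<comment> \<open>By divergence of the series the test function vanishes at the initial
        partition once \<open>n\<close> is large.\<close>
      obtain n0 where n0: "\<And>n. n0 \<le> n \<Longrightarrow> 1 / \<epsilon> \<le> H n" using Hinf[of "1 / \<epsilon>"] by blast
      have "V n (\<lambda>x. ?u (part n x)) t * (1 - \<epsilon> * H M) \<le> ?R * t" if n: "max 1 n0 \<le> n" for n
      proof -
        have "?h (singles n) = 0" using n0[of n] n \<epsilon> by (simp add: card_singles field_simps)
        then have "V n (\<lambda>x. ?h (part n x)) t \<le> ?R * t"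
          using duality_le[of n t ?h "\<lambda>_. ?R", OF _ t Qh] VI_const[OF t, of n ?R] n by simp
        moreover have "V n (\<lambda>x. (1 - \<epsilon> * H M) * ?u (part n x)) t \<le> V n (\<lambda>x. ?h (part n x)) t"
        proof (intro V_mono bm_cmult bm_part)
          fix x :: "nat \<Rightarrow> real"
          show "(1 - \<epsilon> * H M) * ?u (part n x) \<le> ?h (part n x)"
          proof (cases "card (part n x) \<le> M")
            case True
            then have "\<epsilon> * H (card (part n x)) \<le> \<epsilon> * H M" using Hmono[OF True] \<epsilon> by simp
            then show ?thesis using True by simp
          qed simp
        qed
        ultimately show ?thesis unfolding V_cmult by (simp add: mult.commute)
      qed
      then show ?thesis
        by (intro LIMSEQ_le_const2[OF tendsto_mult_right[OF S(2)]] exI[of _ "max 1 n0"] allI impI)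
    qed
    \<comment> \<open>Here \<epsilon> tends to 0 with \<delta> fixed, which removes
      \<open>4 * \<epsilon> / \<delta>\<close>; \<delta> is chosen afterwards.\<close>
    have small: "E_fun l t \<le> 4 * measure \<Lambda> {1 - \<delta><..1} * t" if \<delta>: "0 < \<delta>" "\<delta> \<le> 1 / 2" for \<delta>
    proof (rule LIMSEQ_le)
      have e: "(\<lambda>k. 1 / real (Suc k)) \<longlonglongrightarrow> 0" by (rule LIMSEQ_Suc[OF lim_1_over_n])
      have "(\<lambda>k. E_fun l t * (1 - 1 / real (Suc k) * H M)) \<longlonglongrightarrow> E_fun l t * (1 - 0 * H M)"
        by (intro tendsto_intros e)
      then show "(\<lambda>k. E_fun l t * (1 - 1 / real (Suc k) * H M)) \<longlonglongrightarrow> E_fun l t" by simp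
      have "(\<lambda>k. (4 * (1 / real (Suc k)) / \<delta> + 4 * measure \<Lambda> {1 - \<delta><..1}) * t) \<longlonglongrightarrow> (4 * 0 / \<delta> + 4 * measure \<Lambda> {1 - \<delta><..1}) * t"
        using \<delta> by (intro tendsto_intros e) auto
      then show "(\<lambda>k. (4 * (1 / real (Suc k)) / \<delta> + 4 * measure \<Lambda> {1 - \<delta><..1}) * t) \<longlonglongrightarrow> 4 * measure \<Lambda> {1 - \<delta><..1} * t" by simp
      show "\<exists>N. \<forall>k\<ge>N. E_fun l t * (1 - 1 / real (Suc k) * H M) \<le> (4 * (1 / real (Suc k)) / \<delta> + 4 * measure \<Lambda> {1 - \<delta><..1}) * t"
        by (intro exI allI impI bound \<delta>) simp
    qed
    have "E_fun l t \<le> 0"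
    proof (rule field_le_epsilon)
      fix e :: real assume e: "0 < e"
      obtain \<delta> where \<delta>: "0 < \<delta>" "\<delta> \<le> 1 / 2" "measure \<Lambda> {1 - \<delta><..1} < e / (4 * (t + 1))"
        by (rule small_mass_near_one[of "e / (4 * (t + 1))"]) (use e t in auto)
      have "4 * measure \<Lambda> {1 - \<delta><..1} * t \<le> 4 * (e / (4 * (t + 1))) * (t + 1)"
        using \<delta>(3) t e by (intro mult_mono) auto
      also have "\<dots> = e" using t by (simp add: field_simps)
      finally show "E_fun l t \<le> 0 + e" using small[OF \<delta>(1,2)] by simp
    qed
    moreover have "0 \<le> l \<mu>" for \<mu> by (simp add: l_def)
    ultimately have "AE \<omega> in P. l (path (t, \<omega>)) = 0" by (intro AE_zero_of_E[of l] S(1))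
    then show ?thesis by (simp add: l_def)
  qed
  then have "AE \<omega> in P. \<forall>M. of_bool (\<not> dustmass (path (t, \<omega>)) > 0 \<and> finite (atoms (path (t, \<omega>))) \<and> card (atoms (path (t, \<omega>))) \<le> M) = (0::real)"
    unfolding AE_all_countable by blast
  then show ?thesis by eventually_elim (auto split: if_splits)
qed

text \<open>Test function: \<open>f b = \<Sum>j\<in>{M<..b}. 1/\<Psi>(j)\<close>, \<open>b\<close> the number of blocks. It is bounded by a tail of a
  convergent series, and has drift at most a negative constant as long as \<open>b > 2 M\<close>.\<close>

lemma CDI_finite_support:
  assumes reg: "Psi_integral_finite \<Lambda>" and t: "0 < t"
  shows "AE \<omega> in P. \<not> dustmass (path (t, \<omega>)) > 0 \<and> finite (atoms (path (t, \<omega>)))"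
proof -
  note nz = Psi_integral_imp_summable(1)[OF reg] and sc = Psi_integral_imp_summable(2)[OF reg]
  define l where "l M \<mu> = (of_bool (\<not> (\<not> dustmass \<mu> > 0 \<and> finite (atoms \<mu>) \<and> card (atoms \<mu>) \<le> 2 * M)) :: real)" for M \<mu>
  let ?w = "\<lambda>M \<pi>. of_bool (2 * M < card \<pi>) :: real"
  have wB: "\<bar>?w M \<pi>\<bar> \<le> 1" for M and \<pi> :: "nat set set" by simp
  have limw: "(\<lambda>n. G_fun n (\<lambda>x. ?w M (part n x)) \<mu>) \<longlonglongrightarrow> l M \<mu>" if mu: "\<mu> \<in> M1" for M \<mu>
  proof -
    have "G_fun n (\<lambda>x. ?w M (part n x)) \<mu> = 1 - G_fun n (\<lambda>x. of_bool (card (part n x) \<le> 2 * M)) \<mu>" for n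
    proof -
      have "G_fun n (\<lambda>x. ?w M (part n x) + of_bool (card (part n x) \<le> 2 * M)) \<mu> = G_fun n (\<lambda>x. 1) \<mu>"
        by (intro G_cong mu) auto
      then show ?thesis
        using G_add[OF mu bm_part[of n "?w M"] bm_part[of n "\<lambda>\<pi>. of_bool (card \<pi> \<le> 2 * M)"]] G_const[OF mu, of n 1] by simp
    qed
    moreover have "(\<lambda>n. 1 - G_fun n (\<lambda>x. of_bool (card (part n x) \<le> 2 * M)) \<mu>) \<longlonglongrightarrow> l M \<mu>"
      unfolding l_def of_bool_not_iff by (intro tendsto_diff tendsto_const card_le_tendsto mu)
    ultimately show ?thesis by simp
  qed
  have S1: "integrable P (\<lambda>\<omega>. l M (path (t, \<omega>)))" for M
    by (rule V_seqs_lim(1)[where h="\<lambda>_. ?w M" and l="l M" and B=1, OF limw wB])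
  have S2: "(\<lambda>n. V n (\<lambda>x. ?w M (part n x)) t) \<longlonglongrightarrow> E_fun (l M) t" for M
    by (rule V_seqs_lim(2)[where h="\<lambda>_. ?w M" and l="l M" and B=1, OF limw wB])
  define \<tau> where "\<tau> M = (\<Sum>i. c_seq (i + (M + 1)))" for M
  have "(\<lambda>M. \<Sum>i. c_seq (i + M)) \<longlonglongrightarrow> 0" by (rule summable_tail_tendsto[OF sc])
  then have \<tau>0: "\<tau> \<longlonglongrightarrow> 0" unfolding \<tau>_def by (intro LIMSEQ_ignore_initial_segment)
  have bound: "E_fun (l M) t \<le> 16 * \<tau> M / t" if M: "1 \<le> M" for M
  proof -
    define f where "f b = (\<Sum>j\<in>{M<..b}. c_seq j)" for b
    have f0: "0 \<le> f b" for b unfolding f_def by (intro sum_nonneg c_seq_nonneg)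
    have f\<tau>: "f b \<le> \<tau> M" for b
    proof -
      have "f b = (\<Sum>i<b - M. c_seq (i + (M + 1)))"
        unfolding f_def by (rule sum.reindex_bij_witness[of _ "\<lambda>i. i + (M + 1)" "\<lambda>j. j - (M + 1)"]) auto
      also have "\<dots> \<le> \<tau> M" unfolding \<tau>_def
        by (intro sum_le_suminf summable_ignore_initial_segment sc c_seq_nonneg) auto
      finally show ?thesis .
    qed
    let ?h = "\<lambda>\<pi> :: nat set set. f (card \<pi>)"
    have mono: "f m \<le> f b" if "m \<le> b" for m b
      unfolding f_def using that by (intro sum_mono2) (auto simp: c_seq_nonneg)
    \<comment> \<open>The constant is the \<open>1/8\<close> of
      \<open>weighted_merge_rate_ge\<close> times the \<open>1/2\<close> in the gain
      \<open>1 / (2 * \<Psi>(b))\<close> per lost block.\<close>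
    have Qh: "Q ?h \<pi> \<le> - (1 / 16) * ?w M \<pi>" if b: "blocks \<pi>" for \<pi>
    proof -
      have fin: "finite \<pi>" using b by (simp add: blocks_def)
      have m: "card (coag J \<pi>) \<le> card \<pi>" if "J \<in> Js \<pi>" for J
        using card_coag[OF b that] Js_card_le[OF fin that] conjunct2[OF JsD[OF that]] by linarith
      have Qeq: "Q ?h \<pi> = - (\<Sum>J\<in>Js \<pi>. lam (card \<pi>) (card J) * (?h \<pi> - ?h (coag J \<pi>)))"
        unfolding Q_def sum_negf[symmetric] by (intro sum.cong refl) (simp add: algebra_simps)
      show ?thesis
      proof (cases "2 * M < card \<pi>")
        case True
        let ?b = "card \<pi>" and ?p = "Psi \<Lambda> (real (card \<pi>))"
        have b2: "2 \<le> ?b" using True M by linarith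
        have p: "0 < ?p" using b2 by (intro Psi_pos nz) auto
        have "?p * (1 / (2 * ?p)) / 8 \<le> (\<Sum>J\<in>Js \<pi>. lam ?b (card J) * (?h \<pi> - ?h (coag J \<pi>)))"
        proof (rule weighted_merge_rate_ge[OF fin b2])
          show "0 \<le> 1 / (2 * ?p)" using p by simp
          fix J assume J: "J \<in> Js \<pi>"
          have cJ: "card J \<le> ?b" "2 \<le> card J" using Js_card_le[OF fin J] JsD[OF J] by auto
          \<comment> \<open>\<open>f\<close> vanishes up to \<open>M\<close>, so only the part of
            the jump above \<open>M\<close> counts.\<close>
          define m' where "m' = max M (?b - card J + 1)"
          have m': "m' \<le> ?b" "M \<le> m'" "?b - card J + 1 \<le> m'" using cJ True by (auto simp: m'_def)
          have fm: "f (?b - card J + 1) = f m' \<or> f (?b - card J + 1) \<le> f m'" using mono m' by blast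
          have "f ?b - f m' = (\<Sum>j\<in>{m'<..?b}. c_seq j)"
          proof -
            have "{M<..?b} = {M<..m'} \<union> {m'<..?b}" using m' by auto
            then have "f ?b = f m' + (\<Sum>j\<in>{m'<..?b}. c_seq j)" unfolding f_def
              by (simp add: sum.union_disjoint ivl_disj_int)
            then show ?thesis by simp
          qed
          also have "\<dots> \<ge> (\<Sum>j\<in>{m'<..?b}. 1 / ?p)"
          proof (rule sum_mono)
            fix j assume "j \<in> {m'<..?b}"
            then show "1 / ?p \<le> c_seq j" unfolding c_seq_def
              by (intro divide_left_mono Psi_mono mult_pos_pos p Psi_pos nz) auto
          qed
          also have "(\<Sum>j\<in>{m'<..?b}. 1 / ?p) = real (?b - m') / ?p" by simp
          finally have "real (?b - m') / ?p \<le> f ?b - f (?b - card J + 1)" using fm by linarith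
          moreover have "(real (card J) - 1) * (1 / (2 * ?p)) \<le> real (?b - m') / ?p"
          proof -
            \<comment> \<open>A jump ending below \<open>M\<close> still covers
              \<open>b - M > b / 2\<close> steps, because \<open>b > 2 * M\<close>; hence the factor
              2.\<close>
            have "real (card J) - 1 \<le> 2 * real (?b - m')"
            proof (cases "M \<le> ?b - card J + 1")
              case True
              then have "?b - m' = card J - 1" using cJ by (simp add: m'_def max_def)
              then show ?thesis using cJ by (simp add: of_nat_diff)
            next
              case False
              then have "?b - m' = ?b - M" by (simp add: m'_def)
              moreover have "real (?b - M) = real ?b - real M" using \<open>2 * M < ?b\<close> by (simp add: of_nat_diff)
              moreover have "2 * real M < real ?b" using \<open>2 * M < ?b\<close> by linarith
              moreover have "real (card J) \<le> real ?b" using cJ by simp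
              ultimately show ?thesis by simp
            qed
            then have "(real (card J) - 1) * (1 / (2 * ?p)) \<le> 2 * real (?b - m') * (1 / (2 * ?p))"
              using p by (intro mult_right_mono) auto
            then show ?thesis by simp
          qed
          ultimately show "(real (card J) - 1) * (1 / (2 * ?p)) \<le> ?h \<pi> - ?h (coag J \<pi>)"
            unfolding card_coag[OF b J] by linarith
        qed
        then show ?thesis unfolding Qeq using True p by simp
      next
        case False
        have "0 \<le> (\<Sum>J\<in>Js \<pi>. lam (card \<pi>) (card J) * (?h \<pi> - ?h (coag J \<pi>)))"
          using mono[OF m] by (intro sum_nonneg mult_nonneg_nonneg lam_nonneg) auto
        then show ?thesis unfolding Qeq using False by simp
      qed
    qed
    have Qw: "Q (?w M) \<pi> \<le> 0" if b: "blocks \<pi>" for \<pi>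
      unfolding Q_def
    proof (intro sum_nonpos mult_nonneg_nonpos lam_nonneg)
      fix J assume J: "J \<in> Js \<pi>"
      have "card (coag J \<pi>) \<le> card \<pi>"
        using card_coag[OF b J] Js_card_le[OF _ J] conjunct2[OF JsD[OF J]] b unfolding blocks_def by linarith
      then show "?w M (coag J \<pi>) - ?w M \<pi> \<le> 0" by auto
    qed
    show ?thesis
    proof (rule LIMSEQ_le_const2[OF S2], intro exI[of _ 1] allI impI)
      fix n :: nat assume n: "1 \<le> n"
      let ?W = "\<lambda>x. ?w M (part n x)"
      have "0 \<le> V n (\<lambda>x. ?h (part n x)) t"
        using V_mono[OF bm_const[of n 0] bm_part[of n ?h], of t] f0 by (simp add: V_const)
      also have "\<dots> \<le> ?h (singles n) + VI n (\<lambda>x. - (1 / 16) * ?W x) t"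
        by (rule duality_le[OF n less_imp_le[OF t] Qh])
      also have "\<dots> \<le> \<tau> M - 1 / 16 * VI n ?W t"
        using f\<tau> VI_cmult[of n "- (1 / 16)" ?W t] by simp
      finally have VIw: "VI n ?W t \<le> 16 * \<tau> M" by simp
      \<comment> \<open>The indicator has nonpositive drift, so its mean is nonincreasing in time
        and \<open>t\<close> times the final mean is at most the time integral.\<close>
      have "V n ?W t * t = (LINT s:{0..t}|lborel. V n ?W t)"
        using VI_const[OF less_imp_le[OF t], of n "V n ?W t"] unfolding VI_def V_const by simp
      also have "\<dots> \<le> VI n ?W t"
        unfolding VI_def set_lebesgue_integral_def
      proof (rule integral_mono)
        show "integrable lborel (\<lambda>s. indicator {0..t} s *\<^sub>R V n ?W s)"
          using V_set_integrable[OF bm_part, of 0 t n "?w M"] by (simp add: set_integrable_def)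
        show "integrable lborel (\<lambda>s. indicator {0..t} s *\<^sub>R V n ?W t)"
          by (intro integrable_scaleR_left integrable_real_indicator) (auto simp: emeasure_lborel_Icc_eq)
        fix s :: real
        show "indicator {0..t} s *\<^sub>R V n ?W t \<le> indicator {0..t} s *\<^sub>R V n ?W s"
        proof (cases "s \<in> {0..t}")
          case True
          then have "V n ?W t \<le> V n ?W s + 0 * (t - s)" by (intro duality_lipschitz n Qw) auto
          then show ?thesis using True by simp
        qed simp
      qed
      also note VIw
      finally show "V n ?W t \<le> 16 * \<tau> M / t" using t by (simp add: pos_le_divide_eq)
    qed
  qed
  have "AE \<omega> in P. \<exists>k. l (Suc k) (path (t, \<omega>)) < 1"
  proof (rule AE_not_bounded_below)
    have "(\<lambda>k. 16 * \<tau> (Suc k) / t) \<longlonglongrightarrow> 16 * 0 / t"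
      using t by (intro tendsto_intros LIMSEQ_Suc[OF \<tau>0]) auto
    then have up: "(\<lambda>k. 16 * \<tau> (Suc k) / t) \<longlonglongrightarrow> 0" by simp
    show "(\<lambda>k. \<integral>\<omega>. l (Suc k) (path (t, \<omega>)) \<partial>P) \<longlonglongrightarrow> 0"
    proof (rule real_tendsto_sandwich[OF _ _ tendsto_const up])
      show "eventually (\<lambda>k. 0 \<le> (\<integral>\<omega>. l (Suc k) (path (t, \<omega>)) \<partial>P)) sequentially"
        by (intro always_eventually allI integral_nonneg_AE AE_I2) (simp add: l_def)
      show "eventually (\<lambda>k. (\<integral>\<omega>. l (Suc k) (path (t, \<omega>)) \<partial>P) \<le> 16 * \<tau> (Suc k) / t) sequentially"
        using bound[of "Suc _"] by (intro always_eventually allI) (simp add: E_fun_def)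
    qed
    show "integrable P (\<lambda>\<omega>. l (Suc k) (path (t, \<omega>)))" for k by (rule S1)
  qed (simp_all add: l_def)
  then show ?thesis by eventually_elim (auto simp: l_def split: if_splits)
qed

end

section \<open>The non-atomic part\<close>

definition initial_mass :: "real \<Rightarrow> real" where
  "initial_mass q = measure unit_lebesgue ({0..1} \<inter> {..q})"

text \<open>Its vanishing for all \<open>q\<close> says that the non-atomic part is a multiple of
  Lebesgue measure.\<close>

definition dust_deviation :: "real \<Rightarrow> real measure \<Rightarrow> real" where
  "dust_deviation q \<mu> = measure \<mu> (({0..1} \<inter> {..q}) - atoms \<mu>) - initial_mass q * dustmass \<mu>"

definition centered :: "real \<Rightarrow> real \<Rightarrow> real" where
  "centered q x = indicator {..q} x - initial_mass q"

text \<open>Given \<mu> the two points are independent, so the mean of this function tends to the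
  square of \<open>dust_deviation\<close>. One point would only determine the mean of the deviation,
  two show that it vanishes almost surely.\<close>

definition pair_test :: "real \<Rightarrow> nat \<Rightarrow> (nat \<Rightarrow> real) \<Rightarrow> real" where
  "pair_test q n x = centered q (x 1) * centered q (x 2) * of_bool ({1} \<in> part n x \<and> {2} \<in> part n x)"

lemma initial_mass_bounds: "0 \<le> initial_mass q" "initial_mass q \<le> 1"
  unfolding initial_mass_def
  using M1_D(2)[OF unit_lebesgue_M1] by (simp_all add: prob_space.prob_le_1)

lemma centered_abs_le: "\<bar>centered q x\<bar> \<le> 1"
  using initial_mass_bounds[of q] by (auto simp: centered_def indicator_def)

lemma centered_meas: "centered q \<in> borel_measurable borel"
  unfolding centered_def by measurable

lemma M1_meas: "\<mu> \<in> M1 \<Longrightarrow> f \<in> borel_measurable borel \<Longrightarrow> f \<in> borel_measurable \<mu>"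
  by (auto simp: measurable_cong_sets[OF M1_D(1) refl] unit_borel_def intro: measurable_restrict_space1)

lemma pair_test_abs_le: "\<bar>pair_test q n x\<bar> \<le> 1"
proof -
  have "\<bar>centered q (x 1) * centered q (x 2)\<bar> \<le> 1 * 1"
    unfolding abs_mult by (intro mult_mono centered_abs_le) auto
  then show ?thesis by (simp add: pair_test_def)
qed

lemma pair_test_meas:
  assumes n: "2 \<le> n" shows "pair_test q n \<in> borel_measurable (Cube n)"
  unfolding pair_test_def
  by (intro borel_measurable_times part_fun_meas[of "\<lambda>\<pi>. of_bool ({1} \<in> \<pi> \<and> {2} \<in> \<pi>)"]
      measurable_compose[OF coord_measurable centered_meas]) (use n in auto)

lemma bm_pair_test: "2 \<le> n \<Longrightarrow> bm n (pair_test q n)"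
  by (rule bmI[where B=1, OF pair_test_meas]) (auto simp: pair_test_abs_le)

text \<open>Makes \<open>FVeq_finite_range\<close> applicable although the function also depends on
  positions.\<close>

lemma pair_test_finite: "finite (pair_test q n ` S)"
proof -
  let ?C = "{1 - initial_mass q, - initial_mass q}"
  have "pair_test q n ` S \<subseteq> (\<lambda>(a, b, c). a * b * c) ` (?C \<times> ?C \<times> {0, 1})"
    by (auto simp: pair_test_def centered_def indicator_def image_iff Bex_def)
  then show ?thesis by (rule finite_subset) auto
qed

lemma centered_lebesgue: "(\<integral>x. centered q x \<partial>unit_lebesgue) = 0"
proof -
  interpret prob_space unit_lebesgue by (rule M1_D[OF unit_lebesgue_M1])
  have "(\<integral>x. centered q x \<partial>unit_lebesgue) = (\<integral>x. indicator ({0..1} \<inter> {..q}) x - initial_mass q \<partial>unit_lebesgue)"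
    by (intro Bochner_Integration.integral_cong refl) (auto simp: centered_def indicator_def M1_D[OF unit_lebesgue_M1])
  also have "\<dots> = 0"
  proof -
    have s: "{0..1} \<inter> {..q} \<in> sets unit_lebesgue" by (auto simp: M1_D[OF unit_lebesgue_M1] unit_borel_in)
    then show ?thesis using prob_space by (subst Bochner_Integration.integral_diff) (auto simp: initial_mass_def emeasure_eq_measure)
  qed
  finally show ?thesis .
qed

lemma product_integral_pair:
  fixes g :: "real \<Rightarrow> real"
  assumes mu: "\<mu> \<in> M1" and g: "integrable \<mu> g" and n: "2 \<le> n"
  shows "G_fun n (\<lambda>x. g (x 1) * g (x 2)) \<mu> = (\<integral>x. g x \<partial>\<mu>)\<^sup>2"
proof -
  interpret prob_space \<mu> by (rule M1_D[OF mu])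
  interpret product_sigma_finite "\<lambda>_. \<mu>" ..
  let ?f = "\<lambda>i. if i \<in> {1, 2} then g else (\<lambda>_. 1)"
  have two: "{1..n} = {1, 2} \<union> {3..n}" using n by auto
  have split: "(\<Prod>i\<in>{1..n}. h i) = h 1 * h 2" if "\<And>i. i \<notin> {1, 2} \<Longrightarrow> h i = 1" for h :: "nat \<Rightarrow> real"
  proof -
    have "(\<Prod>i\<in>{1..n}. h i) = (\<Prod>i\<in>{1, 2}. h i)"
      using n that by (intro prod.mono_neutral_right) auto
    then show ?thesis by simp
  qed
  have "G_fun n (\<lambda>x. g (x 1) * g (x 2)) \<mu> = (\<integral>x. (\<Prod>i\<in>{1..n}. ?f i (x i)) \<partial>(\<Pi>\<^sub>M i\<in>{1..n}. \<mu>))"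
    unfolding G_fun_def by (intro Bochner_Integration.integral_cong refl, subst split) auto
  also have "\<dots> = (\<Prod>i\<in>{1..n}. \<integral>x. ?f i x \<partial>\<mu>)"
    by (rule product_integral_prod) (use g in auto)
  also have "\<dots> = (\<integral>x. g x \<partial>\<mu>)\<^sup>2"
    by (subst split) (auto simp: prob_space power2_eq_square)
  finally show ?thesis .
qed

lemma pair_test_lebesgue:
  assumes n: "2 \<le> n" shows "G_fun n (pair_test q n) unit_lebesgue = 0"
proof -
  interpret prob_space unit_lebesgue by (rule M1_D[OF unit_lebesgue_M1])
  have bm2: "bm n (\<lambda>x. centered q (x 1) * centered q (x 2))"
  proof (rule bmI[where B=1])
    show "(\<lambda>x. centered q (x 1) * centered q (x 2)) \<in> borel_measurable (Cube n)"
      by (intro borel_measurable_times measurable_compose[OF coord_measurable centered_meas]) (use n in auto)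
    show "\<bar>centered q (x 1) * centered q (x 2)\<bar> \<le> 1" for x :: "nat \<Rightarrow> real"
      unfolding abs_mult using mult_mono[OF centered_abs_le[of q "x 1"] centered_abs_le[of q "x 2"]] by simp
  qed
  have "G_fun n (pair_test q n) unit_lebesgue = G_fun n (\<lambda>x. centered q (x 1) * centered q (x 2)) unit_lebesgue"
    unfolding G_fun_def
  proof (rule integral_cong_AE)
    show "AE x in \<Pi>\<^sub>M i\<in>{1..n}. unit_lebesgue. pair_test q n x = centered q (x 1) * centered q (x 2)"
      using unit_lebesgue_distinct[of n]
    proof eventually_elim
      case (elim x)
      then show ?case using n by (simp add: pair_test_def part_distinct) (auto simp: singles_def)
    qed
  qed (use bm_integrable[OF unit_lebesgue_M1 bm_pair_test[OF n]] bm_integrable[OF unit_lebesgue_M1 bm2] in auto)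
  also have "\<dots> = (\<integral>x. centered q x \<partial>unit_lebesgue)\<^sup>2"
    by (rule product_integral_pair[OF unit_lebesgue_M1 _ n])
      (auto intro!: integrable_const_bound[where B=1] M1_meas[OF unit_lebesgue_M1] centered_meas simp: centered_abs_le)
  finally show ?thesis by (simp add: centered_lebesgue)
qed

text \<open>A coordinate in \<open>K\<close> has a copy, so its label is not a singleton.\<close>

lemma pair_test_R_map_zero:
  assumes K: "K \<in> Ks n" and i: "i \<in> K" "i \<in> {1, 2}"
  shows "pair_test q n (R_map n K x) = 0"
proof -
  have "\<not> K \<subseteq> {i}" using KsD(2)[OF K] card_mono[of "{i}" K] by auto
  then obtain j where j: "j \<in> K" "j \<noteq> i" by auto
  have "R_map n K x i = R_map n K x j"
    using i j KsD(1)[OF K] by (auto simp: R_map_rK rK_def)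
  then have "{i} \<notin> part n (R_map n K x)"
    using j KsD(1)[OF K] by (auto simp: singleton_in_part)
  then show ?thesis using i(2) by (auto simp: pair_test_def)
qed

text \<open>Here \<open>K\<close> lies in \<open>{3..n}\<close>, so \<open>rK K\<close> fixes 1 and
  2 and sends no other label to them.\<close>

lemma pair_test_R_map_reduce:
  assumes K: "K \<in> Ks n" and d: "1 \<notin> K" "2 \<notin> K"
  shows "pair_test q n (R_map n K x) = pair_test q (n - card K + 1) x" "2 \<le> n - card K + 1"
proof -
  let ?m = "n - card K + 1"
  have sub: "K \<subseteq> {3..n}"
  proof
    fix k assume k: "k \<in> K"
    then have "k \<noteq> 1" "k \<noteq> 2" "1 \<le> k" "k \<le> n" using d KsD(1)[OF K] by auto
    then show "k \<in> {3..n}" by simp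
  qed
  then have "card K \<le> n - 2" using card_mono[OF _ sub] by simp
  then show m: "2 \<le> ?m" using KsD(2,6)[OF K] by linarith
  have n: "2 \<le> n" using KsD(2,6)[OF K] by linarith
  have min: "3 \<le> Min K" using sub KsD(4)[OF K] by auto
  have r: "rK K i = i" if "i \<in> {1, 2}" for i
  proof -
    have "{1..i} - K = {1..i}" using sub that by auto
    then show ?thesis using that d min by (auto simp: rK_def)
  qed
  have co: "R_map n K x i = x i" if "i \<in> {1, 2}" for i
    using r[OF that] that n by (auto simp: R_map_rK)
  have si: "{i} \<in> part n (R_map n K x) \<longleftrightarrow> {i} \<in> part ?m x" if i: "i \<in> {1, 2}" for i
  proof -
    have iK: "i \<notin> K" "i \<in> {1..n}" "i \<in> {1..?m}" using i d n m by auto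
    have "{i} \<in> part n (R_map n K x) \<longleftrightarrow> (\<forall>j\<in>{1..n}. x (rK K j) = x i \<longrightarrow> j = i)"
      unfolding singleton_in_part using co[OF i] iK by (simp add: R_map_rK)
    also have "\<dots> \<longleftrightarrow> (\<forall>j\<in>{1..n}. x (rK K j) = x i \<longrightarrow> rK K j = i)"
    proof (intro ball_cong refl)
      fix j assume "j \<in> {1..n}"
      then have "rK K j = rK K i \<longleftrightarrow> j = i" using rK_eq_iff[OF K, of j i] iK by auto
      then show "(x (rK K j) = x i \<longrightarrow> j = i) = (x (rK K j) = x i \<longrightarrow> rK K j = i)" using r[OF i] by simp
    qed
    also have "\<dots> \<longleftrightarrow> (\<forall>j\<in>rK K ` {1..n}. x j = x i \<longrightarrow> j = i)" by simp
    also have "\<dots> \<longleftrightarrow> {i} \<in> part ?m x" unfolding rK_surj[OF K] singleton_in_part using iK by simp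
    finally show ?thesis .
  qed
  show "pair_test q n (R_map n K x) = pair_test q ?m x"
    unfolding pair_test_def using co si by simp
qed

text \<open>Whether 1 and 2 are singletons is eventually decided by membership of their points in
  the atoms; the shift \<open>n + 2\<close> guarantees that both labels exist.\<close>

lemma pair_test_limit:
  assumes mu: "\<mu> \<in> M1"
  shows "(\<lambda>n. G_fun (n + 2) (pair_test q (n + 2)) \<mu>) \<longlonglongrightarrow> (dust_deviation q \<mu>)\<^sup>2"
proof -
  interpret prob_space \<mu> by (rule M1_D[OF mu])
  interpret S: prob_space "seqs \<mu>" by (rule prob_seqs[OF mu])
  let ?D = "{0..1} - atoms \<mu>"
  let ?g = "\<lambda>x. indicator ?D x * centered q x"
  have Dm: "?D \<in> sets \<mu>" by (rule sets_nonatoms[OF mu])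
  have gm: "?g \<in> borel_measurable \<mu>" using Dm M1_meas[OF mu centered_meas] by simp
  have gb: "\<bar>?g x\<bar> \<le> 1" for x using centered_abs_le[of q x] by (auto simp: indicator_def)
  have gi: "integrable \<mu> ?g" by (rule integrable_const_bound[where B=1]) (use gm gb in auto)
  have gint: "(\<integral>x. ?g x \<partial>\<mu>) = dust_deviation q \<mu>"
  proof -
    have B: "({0..1} \<inter> {..q}) - atoms \<mu> \<in> sets \<mu>"
    proof -
      have "({0..1} \<inter> {..q}) - atoms \<mu> = ({0..1} \<inter> {..q}) \<inter> ?D" by auto
      moreover have "{0..1} \<inter> {..q} \<in> sets \<mu>" by (auto simp: M1_D[OF mu] unit_borel_in)
      ultimately show ?thesis using Dm by auto
    qed
    have "(\<integral>x. ?g x \<partial>\<mu>) = (\<integral>x. indicator (({0..1} \<inter> {..q}) - atoms \<mu>) x - initial_mass q * indicator ?D x \<partial>\<mu>)"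
      by (intro Bochner_Integration.integral_cong refl) (auto simp: centered_def indicator_def)
    also have "\<dots> = measure \<mu> (({0..1} \<inter> {..q}) - atoms \<mu>) - initial_mass q * measure \<mu> ?D"
      using B Dm by (subst Bochner_Integration.integral_diff) (auto simp: emeasure_eq_measure)
    finally show ?thesis by (simp add: dust_deviation_def dustmass_def)
  qed
  have G: "G_fun (n + 2) (pair_test q (n + 2)) \<mu> = (\<integral>X. pair_test q (n + 2) X \<partial>seqs \<mu>)" for n
  proof -
    have "G_fun (n + 2) (pair_test q (n + 2)) \<mu> = (\<integral>X. pair_test q (n + 2) (\<lambda>i\<in>{1..n + 2}. X i) \<partial>seqs \<mu>)"
      unfolding seqs_def by (rule PM_reindex[OF mu, symmetric]) (auto intro: pair_test_meas)
    also have "\<dots> = (\<integral>X. pair_test q (n + 2) X \<partial>seqs \<mu>)"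
    proof (intro Bochner_Integration.integral_cong refl)
      fix X :: "nat \<Rightarrow> real"
      have "part (n + 2) (\<lambda>i\<in>{1..n + 2}. X i) = part (n + 2) X" by (intro part_cong) auto
      then show "pair_test q (n + 2) (\<lambda>i\<in>{1..n + 2}. X i) = pair_test q (n + 2) X"
        by (simp add: pair_test_def)
    qed
    finally show ?thesis .
  qed
  have L: "(\<integral>X. ?g (X 1) * ?g (X 2) \<partial>seqs \<mu>) = (dust_deviation q \<mu>)\<^sup>2"
  proof -
    have m2: "(\<lambda>x. ?g (x 1) * ?g (x 2)) \<in> borel_measurable (Cube 2)"
    proof -
      have c: "(\<lambda>x. x i) \<in> Cube 2 \<rightarrow>\<^sub>M \<mu>" if "i \<in> {1..2}" for i
      proof -
        have "(\<lambda>x. x i) \<in> Cube 2 \<rightarrow>\<^sub>M unit_borel" unfolding Cube_def using that by (rule measurable_component_singleton)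
        then show ?thesis using measurable_cong_sets[OF refl M1_D(1)[OF mu]] by blast
      qed
      show ?thesis
        by (intro borel_measurable_times[of "\<lambda>x. ?g (x 1)" _ "\<lambda>x. ?g (x 2)"]
            measurable_compose[OF c gm]) auto
    qed
    have "(\<integral>X. ?g ((\<lambda>i\<in>{1..2}. X i) 1) * ?g ((\<lambda>i\<in>{1..2}. X i) 2) \<partial>seqs \<mu>) = G_fun 2 (\<lambda>x. ?g (x 1) * ?g (x 2)) \<mu>"
      unfolding seqs_def by (rule PM_reindex[OF mu _ _ m2]) auto
    then show ?thesis using product_integral_pair[OF mu gi, of 2] gint by simp
  qed
  show ?thesis unfolding G L[symmetric]
  proof (rule integral_dominated_convergence[where w="\<lambda>_. 1"])
    show "(\<lambda>X. ?g (X 1) * ?g (X 2)) \<in> borel_measurable (seqs \<mu>)"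
      by (intro borel_measurable_times[of "\<lambda>X. ?g (X 1)" _ "\<lambda>X. ?g (X 2)"] measurable_compose[OF seqs_component gm])
    show "(\<lambda>X. pair_test q (n + 2) X) \<in> borel_measurable (seqs \<mu>)" for n
    proof -
      have c: "(\<lambda>X. centered q (X i)) \<in> borel_measurable (seqs \<mu>)" for i
        by (rule measurable_compose[OF seqs_component M1_meas[OF mu centered_meas]])
      show ?thesis unfolding pair_test_def
        by (intro borel_measurable_times c part_seqs_meas[OF mu, of "\<lambda>\<pi>. of_bool ({1} \<in> \<pi> \<and> {2} \<in> \<pi>)"])
    qed
    show "AE X in seqs \<mu>. (\<lambda>n. pair_test q (n + 2) X) \<longlonglongrightarrow> ?g (X 1) * ?g (X 2)"
    proof -
      have "AE X in seqs \<mu>. \<forall>i. X i \<in> {0..1}" using space_seqs[OF mu] by (intro AE_I2) auto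
      with AE_typical[OF mu] show ?thesis
      proof eventually_elim
        case (elim X)
        have ev: "eventually (\<lambda>n. ({i} \<in> part n X) = (X i \<notin> atoms \<mu>)) sequentially" if i: "1 \<le> i" for i
        proof (cases "X i \<in> atoms \<mu>")
          case True
          from singleton_atom[OF elim(1) True] show ?thesis by eventually_elim (simp add: True)
        next
          case False
          then show ?thesis using i by (intro eventually_sequentiallyI[of i]) (simp add: singleton_dust[OF elim(1)])
        qed
        have "eventually (\<lambda>n. pair_test q n X = ?g (X 1) * ?g (X 2)) sequentially"
          using ev[of 1, OF order_refl] ev[of 2, simplified]
          by eventually_elim (use elim(2) in \<open>auto simp: pair_test_def indicator_def\<close>)
        then have "(\<lambda>n. pair_test q n X) \<longlonglongrightarrow> ?g (X 1) * ?g (X 2)" by (rule tendsto_eventually)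
        then show ?case by (rule LIMSEQ_ignore_initial_segment)
      qed
    qed
  qed (auto simp: pair_test_abs_le)
qed

text \<open>Countably many almost sure statements reach only rational \<open>q\<close>; right limits
  give every \<open>a\<close>, and the sets \<open>{0..1} \<inter> {..a}\<close> determine the
  measure.\<close>

lemma dust_part_uniform:
  assumes mu: "\<mu> \<in> M1" and dev: "\<And>q. q \<in> \<rat> \<Longrightarrow> dust_deviation q \<mu> = 0"
  shows "density \<mu> (indicator ({0..1} - atoms \<mu>)) = density unit_lebesgue (\<lambda>_. ennreal (dustmass \<mu>))"
proof -
  interpret prob_space \<mu> by (rule M1_D[OF mu])
  interpret U: prob_space unit_lebesgue by (rule M1_D[OF unit_lebesgue_M1])
  let ?D = "{0..1} - atoms \<mu>"
  let ?q = "\<lambda>a n. (of_int \<lfloor>real (Suc n) * a\<rfloor> + 1) / real (Suc n) :: real"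
  have Dm: "?D \<in> sets \<mu>" by (rule sets_nonatoms[OF mu])
  have qlim: "(\<lambda>n. indicator {..?q a n} x :: real) \<longlonglongrightarrow> indicator {..a} x" for a x :: real
  proof -
    have f: "filterlim (?q a) (at_right a) sequentially" by (rule dyadic_right_approx)
    have "eventually (\<lambda>y. (indicator {..y} x :: real) = indicator {..a} x) (at_right a)"
    proof (cases "x \<le> a")
      case True
      have "eventually (\<lambda>y. a < y) (at_right a)" by (simp add: eventually_at_filter)
      then show ?thesis by eventually_elim (use True in \<open>auto simp: indicator_def\<close>)
    next
      case False
      then have "eventually (\<lambda>y. y \<in> {a<..<x}) (at_right a)" by (intro eventually_at_right_real) simp
      then show ?thesis by eventually_elim (use False in \<open>auto simp: indicator_def\<close>)
    qed
    from eventually_compose_filterlim[OF this f] show ?thesis by (rule tendsto_eventually)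
  qed
  have meas_lim: "(\<lambda>n. measure M (({0..1} \<inter> {..?q a n}) \<inter> A)) \<longlonglongrightarrow> measure M (({0..1} \<inter> {..a}) \<inter> A)"
    if M: "M \<in> M1" and A: "A \<in> sets M" for M A and a :: real
  proof -
    interpret N: prob_space M by (rule M1_D[OF M])
    have s: "({0..1} \<inter> {..b}) \<inter> A \<in> sets M" for b
    proof (rule sets.Int[OF _ A])
      show "{0..1} \<inter> {..b} \<in> sets M" by (auto simp: M1_D[OF M] unit_borel_in)
    qed
    have "(\<lambda>n. \<integral>x. indicator (({0..1} \<inter> {..?q a n}) \<inter> A) x \<partial>M) \<longlonglongrightarrow> (\<integral>x. (indicator (({0..1} \<inter> {..a}) \<inter> A) x :: real) \<partial>M)"
    proof (rule integral_dominated_convergence[where w="\<lambda>_. 1"])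
      show "AE x in M. (\<lambda>n. indicator (({0..1} \<inter> {..?q a n}) \<inter> A) x :: real) \<longlonglongrightarrow> indicator (({0..1} \<inter> {..a}) \<inter> A) x"
      proof (intro AE_I2)
        fix x
        have "indicator (({0..1} \<inter> {..b}) \<inter> A) x = (indicator ({0..1} \<inter> A) x * indicator {..b} x :: real)" for b
          by (auto simp: indicator_def)
        then show "(\<lambda>n. indicator (({0..1} \<inter> {..?q a n}) \<inter> A) x :: real) \<longlonglongrightarrow> indicator (({0..1} \<inter> {..a}) \<inter> A) x"
          by (simp only:) (intro tendsto_mult tendsto_const qlim)
      qed
      show "(\<lambda>x. indicator (({0..1} \<inter> {..a}) \<inter> A) x :: real) \<in> borel_measurable M"
        by (intro borel_measurable_indicator s)
      show "(\<lambda>x. indicator (({0..1} \<inter> {..?q a n}) \<inter> A) x :: real) \<in> borel_measurable M" for n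
        by (intro borel_measurable_indicator s)
      show "AE x in M. norm (indicator (({0..1} \<inter> {..?q a n}) \<inter> A) x :: real) \<le> 1" for n
        by (intro AE_I2) (simp add: indicator_def)
    qed simp
    moreover have "(\<integral>x. (indicator B x :: real) \<partial>M) = measure M B" if "B \<in> sets M" for B
      using that by simp
    ultimately show ?thesis by (simp only: s)
  qed
  have eq: "measure \<mu> (({0..1} \<inter> {..a}) \<inter> ?D) = initial_mass a * dustmass \<mu>" for a
  proof (rule LIMSEQ_unique[OF meas_lim[OF mu Dm]])
    have "?q a n \<in> \<rat>" for n by auto
    then have "measure \<mu> (({0..1} \<inter> {..?q a n}) \<inter> ?D) = initial_mass (?q a n) * dustmass \<mu>" for n
    proof -
      have "({0..1} \<inter> {..?q a n}) \<inter> ?D = ({0..1} \<inter> {..?q a n}) - atoms \<mu>" by auto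
      then show ?thesis using dev[OF \<open>?q a n \<in> \<rat>\<close>] by (simp add: dust_deviation_def)
    qed
    moreover have "(\<lambda>n. initial_mass (?q a n)) \<longlonglongrightarrow> initial_mass a"
    proof -
      have "({0..1} \<inter> {..b}) \<inter> {0..1} = {0..1} \<inter> {..b}" for b :: real by auto
      then show ?thesis using meas_lim[OF unit_lebesgue_M1, of "{0..1}" a]
        by (simp add: initial_mass_def M1_D[OF unit_lebesgue_M1] unit_borel_in)
    qed
    ultimately show "(\<lambda>n. measure \<mu> (({0..1} \<inter> {..?q a n}) \<inter> ?D)) \<longlonglongrightarrow> initial_mass a * dustmass \<mu>"
      by (simp only:) (intro tendsto_mult tendsto_const)
  qed
  show ?thesis
  proof (rule measure_eqI_generator_eq[where E="range (\<lambda>a. {0..1} \<inter> {..a})" and \<Omega>="{0..1}" and A="\<lambda>_. {0..1} \<inter> {..1}"])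
    show "Int_stable (range (\<lambda>a. {0..1} \<inter> {..a::real}))" by (rule Int_stable_initial)
    show "sets (density \<mu> (indicator ?D)) = sigma_sets {0..1} (range (\<lambda>a. {0..1} \<inter> {..a}))"
      by (simp only: sets_density M1_D(1)[OF mu] sets_unit_borel_sigma)
    show "sets (density unit_lebesgue (\<lambda>_. ennreal (dustmass \<mu>))) = sigma_sets {0..1} (range (\<lambda>a. {0..1} \<inter> {..a}))"
      by (simp only: sets_density M1_D(1)[OF unit_lebesgue_M1] sets_unit_borel_sigma)
    have em: "emeasure (density \<mu> (indicator ?D)) B = emeasure \<mu> (B \<inter> ?D)" if "B \<in> sets \<mu>" for B
    proof -
      have "emeasure (density \<mu> (indicator ?D)) B = (\<integral>\<^sup>+x. indicator ?D x * indicator B x \<partial>\<mu>)"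
        using that Dm by (intro emeasure_density) auto
      also have "\<dots> = (\<integral>\<^sup>+x. indicator (B \<inter> ?D) x \<partial>\<mu>)"
        by (intro nn_integral_cong) (auto simp: indicator_def)
      also have "\<dots> = emeasure \<mu> (B \<inter> ?D)" using that Dm by simp
      finally show ?thesis .
    qed
    have s: "{0..1} \<inter> {..a} \<in> sets \<mu>" "{0..1} \<inter> {..a} \<in> sets unit_lebesgue" for a
      by (auto simp: M1_D[OF mu] M1_D[OF unit_lebesgue_M1] unit_borel_in)
    show "emeasure (density \<mu> (indicator ?D)) ({0..1} \<inter> {..1}) \<noteq> \<infinity>"
      unfolding em[OF s(1)] by simp
    fix X assume "X \<in> range (\<lambda>a. {0..1} \<inter> {..a::real})"
    then obtain a where X: "X = {0..1} \<inter> {..a}" by blast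
    have "emeasure (density \<mu> (indicator ?D)) X = ennreal (initial_mass a * dustmass \<mu>)"
      unfolding X em[OF s(1)] by (simp only: emeasure_eq_measure eq)
    also have "\<dots> = ennreal (dustmass \<mu>) * emeasure unit_lebesgue X"
      unfolding X initial_mass_def U.emeasure_eq_measure
      using dustmass_nonneg[of \<mu>] by (simp add: ennreal_mult' mult.commute)
    also have "\<dots> = emeasure (density unit_lebesgue (\<lambda>_. ennreal (dustmass \<mu>))) X"
      using s unfolding X by (simp add: emeasure_density_const)
    finally show "emeasure (density \<mu> (indicator ?D)) X = emeasure (density unit_lebesgue (\<lambda>_. ennreal (dustmass \<mu>))) X" .
  qed auto
qed

lemma dust_decomposition_atoms:
  assumes mu: "\<mu> \<in> M1" and dev: "\<And>q. q \<in> \<rat> \<Longrightarrow> dust_deviation q \<mu> = 0"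
  shows "dust_decomposition \<mu> (density \<mu> (indicator (atoms \<mu>))) (density \<mu> (indicator ({0..1} - atoms \<mu>)))"
  unfolding dust_decomposition_def
proof (intro conjI ballI)
  let ?D = "{0..1} - atoms \<mu>"
  have Dm: "?D \<in> sets \<mu>" and Am: "atoms \<mu> \<in> sets \<mu>"
    using sets_nonatoms[OF mu] sets_atoms[OF mu order_refl] by (auto simp: M1_D[OF mu])
  show "sets (density \<mu> (indicator (atoms \<mu>))) = sets unit_borel" "sets (density \<mu> (indicator ?D)) = sets unit_borel"
    by (simp_all add: M1_D[OF mu])
  show "emeasure \<mu> B = emeasure (density \<mu> (indicator (atoms \<mu>))) B + emeasure (density \<mu> (indicator ?D)) B"
    if "B \<in> sets unit_borel" for B
  proof -
    have B: "B \<in> sets \<mu>" "B \<subseteq> {0..1}" using that by (auto simp: M1_D[OF mu] unit_borel_in)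
    have "emeasure (density \<mu> (indicator (atoms \<mu>))) B + emeasure (density \<mu> (indicator ?D)) B
        = (\<integral>\<^sup>+x. indicator (atoms \<mu>) x * indicator B x \<partial>\<mu>) + (\<integral>\<^sup>+x. indicator ?D x * indicator B x \<partial>\<mu>)"
      using B Dm Am by (simp add: emeasure_density)
    also have "\<dots> = (\<integral>\<^sup>+x. indicator (atoms \<mu>) x * indicator B x + indicator ?D x * indicator B x \<partial>\<mu>)"
      using B Dm Am by (intro nn_integral_add[symmetric]) auto
    also have "\<dots> = (\<integral>\<^sup>+x. indicator B x \<partial>\<mu>)"
      using B by (intro nn_integral_cong) (auto simp: indicator_def)
    finally show ?thesis using B by simp
  qed
  show "\<exists>A. countable A \<and> (AE x in density \<mu> (indicator (atoms \<mu>)). x \<in> A)"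
    using countable_atoms[OF mu] Am
    by (intro exI[of _ "atoms \<mu>"] conjI) (auto simp: AE_density indicator_def)
  show "absolutely_continuous unit_lebesgue (density \<mu> (indicator ?D))"
  proof -
    have e: "density \<mu> (indicator ?D) = density unit_lebesgue (\<lambda>_. ennreal (dustmass \<mu>))"
      by (rule dust_part_uniform[OF mu dev])
    show ?thesis unfolding e by (rule absolutely_continuousI_density) simp
  qed
qed

text \<open>Absence of dust concerns every decomposition: \<open>\<kappa>\<close> is dominated by
  \<mu>, hence vanishes off the atoms, and it vanishes on them because a countable set is Lebesgue
  null.\<close>

lemma has_dust_dustmass:
  assumes mu: "\<mu> \<in> M1" and dev: "\<And>q. q \<in> \<rat> \<Longrightarrow> dust_deviation q \<mu> = 0"
  shows "dustmass \<mu> > 0 \<Longrightarrow> has_dust \<mu>" "\<not> dustmass \<mu> > 0 \<Longrightarrow> has_no_dust \<mu>"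
proof -
  interpret prob_space \<mu> by (rule M1_D[OF mu])
  let ?D = "{0..1} - atoms \<mu>"
  have dec: "dust_decomposition \<mu> (density \<mu> (indicator (atoms \<mu>))) (density \<mu> (indicator ?D))"
    by (rule dust_decomposition_atoms[OF mu dev])
  have Dm: "?D \<in> sets \<mu>" by (rule sets_nonatoms[OF mu])
  have mass: "emeasure \<mu> ?D = ennreal (dustmass \<mu>)" by (simp add: dustmass_def emeasure_eq_measure)
  show "has_dust \<mu>" if "dustmass \<mu> > 0"
  proof -
    have "emeasure (density \<mu> (indicator ?D)) (space \<mu>) = (\<integral>\<^sup>+x. indicator ?D x * indicator (space \<mu>) x \<partial>\<mu>)"
      using Dm by (intro emeasure_density) auto
    also have "\<dots> = (\<integral>\<^sup>+x. indicator ?D x \<partial>\<mu>)" by (intro nn_integral_cong) simp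
    also have "\<dots> = ennreal (dustmass \<mu>)" using Dm mass by simp
    finally have "emeasure (density \<mu> (indicator ?D)) (space (density \<mu> (indicator ?D))) \<noteq> 0" using that by simp
    then show ?thesis unfolding has_dust_def using dec by blast
  qed
  show "has_no_dust \<mu>" if d: "\<not> dustmass \<mu> > 0"
    unfolding has_no_dust_def
  proof (intro conjI)
    show "\<exists>\<alpha> \<kappa>. dust_decomposition \<mu> \<alpha> \<kappa>" using dec by blast
    show "\<not> has_dust \<mu>"
    proof
      assume "has_dust \<mu>"
      then obtain \<alpha> \<kappa> where dd: "dust_decomposition \<mu> \<alpha> \<kappa>" and ne: "emeasure \<kappa> (space \<kappa>) \<noteq> 0"
        by (auto simp: has_dust_def)
      have sk: "sets \<kappa> = sets unit_borel" using dd by (simp add: dust_decomposition_def)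
      have "emeasure \<mu> ?D = 0" using d mass dustmass_nonneg[of \<mu>] by simp
      moreover have "?D \<in> sets unit_borel" using Dm by (simp add: M1_D[OF mu])
      ultimately have D0: "emeasure \<kappa> ?D = 0"
        using dd by (auto simp: dust_decomposition_def)
      have "atoms \<mu> \<in> null_sets unit_lebesgue"
      proof -
        have "(\<Union>x\<in>atoms \<mu>. {x}) \<in> null_sets unit_lebesgue"
        proof (rule null_sets_UN'[OF countable_atoms[OF mu]])
          fix x assume "x \<in> atoms \<mu>"
          then have "{x} \<in> sets unit_lebesgue" using sets_atoms[OF mu, of "{x}"] by (simp add: M1_D[OF unit_lebesgue_M1])
          then show "{x} \<in> null_sets unit_lebesgue" by (simp add: null_sets_def unit_lebesgue_atomless)
        qed
        then show ?thesis by simp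
      qed
      then have A0: "atoms \<mu> \<in> null_sets \<kappa>"
        using dd by (auto simp: dust_decomposition_def absolutely_continuous_def)
      have "atoms \<mu> \<subseteq> {0..1}" unfolding atoms_unit[OF mu] by (rule Collect_subset)
      moreover have "space \<kappa> = {0..1}" using sets_eq_imp_space_eq[OF sk] by simp
      ultimately have sp: "space \<kappa> = ?D \<union> atoms \<mu>" by blast
      have "?D \<in> null_sets \<kappa>"
        using D0 Dm M1_D(1)[OF mu] sk by (intro null_setsI) simp_all
      then have "space \<kappa> \<in> null_sets \<kappa>" unfolding sp using A0 by (rule null_sets.Un)
      then show False using ne null_setsD1 by blast
    qed
  qed
qed

context fleming_viot
begin

text \<open>Since \<open>x < 1\<close> almost everywhere, the mean of \<nu> is at most its mass;
  \<open>dust_positive\<close> therefore covers regime Discrete too.\<close>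

lemma discrete_mean_finite:
  assumes "regime_discrete \<Lambda>" shows "nu_mean \<Lambda> < \<infinity>"
proof -
  note L0 = discreteD[OF assms]
  have "(\<integral>\<^sup>+x. inverse (ennreal (x\<^sup>2)) * ennreal x \<partial>\<Lambda>) \<le> (\<integral>\<^sup>+x. inverse (ennreal (x\<^sup>2)) \<partial>\<Lambda>)"
  proof (rule nn_integral_mono_AE)
    show "AE x in \<Lambda>. inverse (ennreal (x\<^sup>2)) * ennreal x \<le> inverse (ennreal (x\<^sup>2))"
      using L_AE_unit
    proof eventually_elim
      case (elim x)
      then have "ennreal x \<le> 1" by (simp add: ennreal_le_1)
      then show ?case using mult_left_mono[of "ennreal x" 1 "inverse (ennreal (x\<^sup>2))"] by simp
    qed
  qed
  then show ?thesis using assms L0(1) by (simp add: nu_mean_def nn_mean_nu regime_discrete_def emeasure_nu order_le_less_trans)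
qed

text \<open>A merger involving \<open>1\<close> or \<open>2\<close> kills the test function, any other one reduces it to fewer points.\<close>

lemma V_pair_test_zero:
  assumes "2 \<le> n" "0 \<le> t"
  shows "V n (pair_test q n) t = 0"
  using assms
proof (induction n arbitrary: t rule: less_induct)
  case (less n)
  let ?f = "pair_test q n"
  note n = less.prems(1)
  have f: "bm n ?f" by (rule bm_pair_test[OF n])
  have fv: "FVeq n ?f"
    using n by (intro FVeq_finite_range pair_test_meas pair_test_finite) auto
  define c where "c = (\<Sum>K\<in>Ks n. lam n (card K))"
  have R: "VI n (\<lambda>x. ?f (R_map n K x)) s = 0" if K: "K \<in> Ks n" for K s
  proof (cases "1 \<in> K \<or> 2 \<in> K")
    case True
    then have "?f (R_map n K x) = 0" for x using pair_test_R_map_zero[OF K] by auto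
    then show ?thesis by (simp add: VI_def V_def G_fun_def set_lebesgue_integral_def)
  next
    case False
    then have K12: "1 \<notin> K" "2 \<notin> K" by auto
    let ?m = "n - card K + 1"
    note red = pair_test_R_map_reduce[OF K K12]
    have "V n (\<lambda>x. ?f (R_map n K x)) = V ?m (pair_test q ?m)"
    proof -
      have "G_fun n (\<lambda>x. ?f (R_map n K x)) \<mu> = G_fun ?m (pair_test q ?m) \<mu>" if "\<mu> \<in> M1" for \<mu>
        using G_R_map_reduce[OF that K f] by (simp only: red(1))
      then show ?thesis unfolding V_def
        by (intro ext Bochner_Integration.integral_cong refl) (simp add: path_M1)
    qed
    moreover have "?m < n" using KsD(2,6)[OF K] by linarith
    ultimately have "V n (\<lambda>x. ?f (R_map n K x)) r = 0" if "0 \<le> r" for r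
      using less.IH[of ?m r] red(2) that by simp
    then have "VI n (\<lambda>x. ?f (R_map n K x)) s = (LINT r:{0..s}|lborel. 0)"
      unfolding VI_def by (intro set_lebesgue_integral_cong) auto
    then show ?thesis by (simp add: set_lebesgue_integral_def)
  qed
  \<comment> \<open>The initial value and all terms for smaller samples vanish, leaving a
    homogeneous Volterra equation.\<close>
  have eq: "V n ?f s = - c * (LINT r:{0..s}|lborel. V n ?f r)" if s: "0 \<le> s" for s
  proof -
    have "V n ?f s = VI n (A_fun n ?f) s"
      using fv s pair_test_lebesgue[OF n] by (simp add: FVeq_def)
    also have "\<dots> = (\<Sum>K\<in>Ks n. lam n (card K) * (0 - VI n ?f s))"
      unfolding VI_A[OF f] by (intro sum.cong refl) (simp add: R)
    also have "\<dots> = - c * VI n ?f s" by (simp add: c_def sum_distrib_right sum_negf)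
    finally show ?thesis by (simp add: VI_def)
  qed
  show ?case
    by (rule volterra_zero[OF V_meas[OF f] V_abs_le[OF f pair_test_abs_le] eq less.prems(2)])
qed

text \<open>The mean of the squared deviation is a limit of means that are all 0.\<close>

lemma dust_deviation_zero:
  assumes t: "0 \<le> t"
  shows "AE \<omega> in P. dust_deviation q (path (t, \<omega>)) = 0"
proof -
  let ?X = "\<lambda>n \<omega>. G_fun (n + 2) (pair_test q (n + 2)) (path (t, \<omega>))"
  let ?d = "\<lambda>\<omega>. (dust_deviation q (path (t, \<omega>)))\<^sup>2"
  have b: "bm (n + 2) (pair_test q (n + 2))" for n by (rule bm_pair_test) simp
  have bX: "\<bar>?X n \<omega>\<bar> \<le> 1" if "\<omega> \<in> space P" for n \<omega>
    by (rule G_abs_le[OF path_M1[OF that] b]) (rule pair_test_abs_le)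
  have lim: "(\<lambda>n. ?X n \<omega>) \<longlonglongrightarrow> ?d \<omega>" if "\<omega> \<in> space P" for \<omega>
    by (rule pair_test_limit[OF path_M1[OF that]])
  have m: "?d \<in> borel_measurable P"
    by (rule borel_measurable_LIMSEQ_real[OF lim G_path_meas1[OF b]])
  have bd: "\<bar>?d \<omega>\<bar> \<le> 1" if "\<omega> \<in> space P" for \<omega>
    by (rule LIMSEQ_le_const2[OF tendsto_rabs[OF lim[OF that]]]) (use bX[OF that] in blast)
  have i: "integrable P ?d" by (rule P.integrable_const_bound[where B=1]) (use bd m in auto)
  have "(\<lambda>n. \<integral>\<omega>. ?X n \<omega> \<partial>P) \<longlonglongrightarrow> (\<integral>\<omega>. ?d \<omega> \<partial>P)"
  proof (rule integral_dominated_convergence[where w="\<lambda>_. 1"])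
    show "AE \<omega> in P. (\<lambda>n. ?X n \<omega>) \<longlonglongrightarrow> ?d \<omega>" by (intro AE_I2 lim)
    show "AE \<omega> in P. norm (?X n \<omega>) \<le> 1" for n unfolding real_norm_def by (intro AE_I2 bX)
    show "?d \<in> borel_measurable P" by (rule m)
    show "(\<lambda>\<omega>. ?X n \<omega>) \<in> borel_measurable P" for n by (rule G_path_meas1[OF b])
  qed simp
  moreover have "(\<integral>\<omega>. ?X n \<omega> \<partial>P) = 0" for n
    using V_pair_test_zero[of "n + 2" t q] t by (simp add: V_def)
  ultimately have "(\<integral>\<omega>. ?d \<omega> \<partial>P) = 0" by (simp add: LIMSEQ_const_iff)
  then have "AE \<omega> in P. ?d \<omega> = 0"
    using i by (subst (asm) integral_nonneg_eq_0_iff_AE) auto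
  then show ?thesis by eventually_elim simp
qed

lemma dust_dichotomy:
  assumes t: "0 \<le> t"
  shows "AE \<omega> in P. (dustmass (path (t, \<omega>)) > 0 \<longrightarrow> has_dust (path (t, \<omega>))) \<and>
    (\<not> dustmass (path (t, \<omega>)) > 0 \<longrightarrow> has_no_dust (path (t, \<omega>)))"
proof -
  have "AE \<omega> in P. \<forall>q\<in>\<rat>. dust_deviation q (path (t, \<omega>)) = 0"
    by (subst AE_ball_countable[OF countable_rat]) (intro ballI dust_deviation_zero t)
  moreover have "AE \<omega> in P. path (t, \<omega>) \<in> M1" by (intro AE_I2 path_M1)
  ultimately show ?thesis
  proof eventually_elim
    case (elim \<omega>)
    show ?case using has_dust_dustmass[OF elim(2)] elim(1) by blast
  qed
qed

end

theorem proposition1p3: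
  fixes \<Lambda> :: "real measure" and P :: "'a measure" and \<rho> :: "real \<Rightarrow> 'a \<Rightarrow> real measure"
  assumes "finite_measure \<Lambda>" and "sets \<Lambda> = sets unit_borel" and "emeasure \<Lambda> {1} = 0"
    and "Lambda_Fleming_Viot \<Lambda> P \<rho>" and "cadlag P \<rho>"
  shows "(regime_discrete \<Lambda> \<longrightarrow>
            (\<forall>t>0. AE \<omega> in P. has_dust (\<rho> t \<omega>) \<and> finite (atoms (\<rho> t \<omega>)))) \<and>
         (regime_infinite_dust \<Lambda> \<longrightarrow>
            (\<forall>t>0. AE \<omega> in P. has_dust (\<rho> t \<omega>) \<and> infinite (atoms (\<rho> t \<omega>)))) \<and>
         (regime_infinite_no_dust \<Lambda> \<longrightarrow>
            (\<forall>t>0. AE \<omega> in P. has_no_dust (\<rho> t \<omega>) \<and> infinite (atoms (\<rho> t \<omega>)))) \<and>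
         (regime_CDI \<Lambda> \<longrightarrow>
            (\<forall>t>0. AE \<omega> in P. has_no_dust (\<rho> t \<omega>) \<and> finite (atoms (\<rho> t \<omega>))))"
proof -
  interpret fleming_viot \<Lambda> P \<rho> by (rule fleming_viot.intro[OF assms])
  have path: "path (t, \<omega>) = \<rho> t \<omega>" if "t > 0" for t \<omega> using that by (simp add: path_def)
  show ?thesis
  proof (intro conjI impI allI)
    fix t :: real assume reg: "regime_discrete \<Lambda>" and t: "t > 0"
    have "nu_mean \<Lambda> < \<infinity>" by (rule discrete_mean_finite[OF reg])
    from dust_dichotomy[OF less_imp_le[OF t]] dust_positive[OF this less_imp_le[OF t]]
      discrete_finite_atoms[OF reg less_imp_le[OF t]]
    show "AE \<omega> in P. has_dust (\<rho> t \<omega>) \<and> finite (atoms (\<rho> t \<omega>))"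
      by eventually_elim (simp add: path[OF t])
  next
    fix t :: real assume reg: "regime_infinite_dust \<Lambda>" and t: "t > 0"
    then have "nu_mean \<Lambda> < \<infinity>" by (simp add: regime_infinite_dust_def)
    from dust_dichotomy[OF less_imp_le[OF t]] dust_positive[OF this less_imp_le[OF t]]
      infinite_atoms_dust[OF reg t]
    show "AE \<omega> in P. has_dust (\<rho> t \<omega>) \<and> infinite (atoms (\<rho> t \<omega>))"
      by eventually_elim (simp add: path[OF t])
  next
    fix t :: real assume reg: "regime_infinite_no_dust \<Lambda>" and t: "t > 0"
    then have r: "nu_mean \<Lambda> = \<infinity>" "\<not> Psi_integral_finite \<Lambda>" by (auto simp: regime_infinite_no_dust_def)
    from dust_dichotomy[OF less_imp_le[OF t]] no_dust[OF r(1) t] infinite_support_no_dust[OF r less_imp_le[OF t]]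
    show "AE \<omega> in P. has_no_dust (\<rho> t \<omega>) \<and> infinite (atoms (\<rho> t \<omega>))"
      by eventually_elim (simp add: path[OF t])
  next
    fix t :: real assume reg: "regime_CDI \<Lambda>" and t: "t > 0"
    from dust_dichotomy[OF less_imp_le[OF t]] CDI_finite_support[OF reg[unfolded regime_CDI_def] t]
    show "AE \<omega> in P. has_no_dust (\<rho> t \<omega>) \<and> finite (atoms (\<rho> t \<omega>))"
      by eventually_elim (simp add: path[OF t])
  qed
qed

end
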